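(* Let $T>0$ and $X_T=(0,1)\times(0,T)$. Let $b\in\mathcal{G}_{H^\infty(X_T)}$ be of $L^\infty$-log-type, and let $c\in\mathcal{G}_{H^\infty((0,1))}$ possess a representative $(c_\varepsilon)_\varepsilon$ with $0<c_0\le c_\varepsilon(x)\le c_1$ for all $x\in(0,1)$, $\varepsilon\in(0,1]$, for some real constants $c_1>c_0>0$. Let $f_1,f_2\in\mathcal{G}_{H^\infty((0,1))}$ with $f_1(0)=f_1(1)=0$ (as generalized numbers), and let $g\in\mathcal{G}_{H^\infty(X_T)}$. Assume in addition that the coefficients $b$ and $c$ are (Colombeau classes of) $C^\infty$ functions. Let $u\in\mathcal{G}_{H^\infty(X_T)}$ denote the unique generalized solution to the initial-boundary value problem $$\partial_t^2u+\partial_x^2\big(c\,\partial_x^2u\big)+b\,\partial_x^2u=g,\qquad u|_{t=0}=f_1,\quad\partial_tu|_{t=0}=f_2,$$ $$u|_{x=0}=u|_{x=1}=0,\qquad\partial_xu|_{x=0}=\partial_xu|_{x=1}=0. \tag{P}$$ (i) If the data $f_1$, $f_2$ and $g$ are (the Colombeau classes of) smooth functions as well, then $u$ equals the (embedding of the) unique smooth solution in $H^\infty(X_T)$ of (P). (ii) Let $f_1=[(f_{1,\varepsilon})_\varepsilon]$, $f_2=[(f_{2,\varepsilon})_\varepsilon]$, $g=[(g_\varepsilon)_\varepsilon]$ and assume that, as $\varepsilon\to0$, $f_{1,\varepsilon}\to\tilde f_1$ in $H^2_0((0,1))$, $f_{2,\varepsilon}\to\tilde f_2$ in $L^2((0,1))$,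 and $g_\varepsilon\to\tilde g$ in $L^2(X_T)$. Then $u$ is associated with the unique weak solution $w\in L^2((0,T),H^2_0((0,1)))$ with initial values $\tilde f_1$, $\tilde f_2$ and right-hand side $\tilde g$.
   Context: For $\Omega=X_T$ or $\Omega=(0,1)$, $H^\infty(\Omega)$ denotes the space of smooth functions on $\Omega$ all of whose derivatives belong to $L^2(\Omega)$ (such functions are smooth up to the boundary). All nets are indexed by $\varepsilon\in(0,1]$. Moderate families: $\mathcal{E}_{M,H^\infty(\Omega)}$ is the set of families $(u_\varepsilon)_\varepsilon$ in $H^\infty(\Omega)$ such that for every multi-index $\alpha$ there is $p\ge0$ with $\|\partial^\alpha u_\varepsilon\|_{L^2(\Omega)}=O(\varepsilon^{-p})$ as $\varepsilon\to0$. Null families: $\mathcal{N}_{H^\infty(\Omega)}$ is the set of moderate families with $\|u_\varepsilon\|_{L^2(\Omega)}=O(\varepsilon^q)$ for every $q\ge0$ (equivalently, the same holds for all derivatives). The Colombeau algebra is $\mathcal{G}_{H^\infty(\Omega)}=\mathcal{E}_{M,H^\infty(\Omega)}/\mathcal{N}_{H^\infty(\Omega)}$; $[(u_\varepsilon)_\varepsilon]$ denotes the class of $(u_\varepsilon)_\varepsilon$. Products and derivatives are defined $\varepsilon$-wise on representatives; elements of $\mathcal{G}_{H^\infty((0,1))}$ are regarded as elements of $\mathcal{G}_{H^\infty(X_T)}$ (independent of $t$). A smooth function $h\in H^\infty(\Omega)$ is embedded as its Colombeau class, the class $[(h)_\varepsilon]$ of the constant family. Restrictions: for $u=[(u_\varepsilon)_\varepsilon]\in\mathcal{G}_{H^\infty(X_T)}$,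 $u|_{t=0}\in\mathcal{G}_{H^\infty((0,1))}$ is the class of $(u_\varepsilon(\cdot,0))_\varepsilon$; restrictions to $x=0$ and $x=1$ are likewise defined by restricting representatives. For $v=[(v_\varepsilon)_\varepsilon]\in\mathcal{G}_{H^\infty((0,1))}$, "$v(0)=0$ as generalized numbers" means $|v_\varepsilon(0)|=O(\varepsilon^q)$ as $\varepsilon\to0$ for all $q\ge0$; similarly for $v(1)$. $L^\infty$-log-type: $b$ is of $L^\infty$-log-type if for some (hence any) representative $(b_\varepsilon)_\varepsilon$ there exist $N\in\mathbb{N}$ and $\varepsilon_0\in(0,1]$ such that $\|b_\varepsilon\|_{L^\infty(X_T)}\le N\log(1/\varepsilon)$ for $0<\varepsilon\le\varepsilon_0$. Under the hypotheses on $b,c,f_1,f_2,g$ in the first three sentences of the claim, the paper asserts that (P) has a unique solution in $\mathcal{G}_{H^\infty(X_T)}$; this is the solution referred to. Association: $u=[(u_\varepsilon)_\varepsilon]$ is associated with the distribution $w\in\mathcal{D}'$ if for some (hence any) representative $u_\varepsilon\to w$ in $\mathcal{D}'$ as $\varepsilon\to0$. Weak solution: for the smooth coefficients $b,c$, the weak solution with initial values $\tilde f_1\in H^2_0((0,1))$, $\tilde f_2\in L^2((0,1))$ and right-hand side $\tilde g\in L^2((0,T),L^2((0,1)))$ is the (asserted by the paper to be unique) $w\in L^2((0,T),H^2_0((0,1)))$ with $w'\in L^2((0,T),H^2_0((0,1)))$, $w''\in L^2((0,T),H^{-2}((0,1)))$ such that $$\langle w''(t),v\rangle+\langle c\,\partial_x^2w(t),\partial_x^2v\rangle+\langle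 b(t)\partial_x^2w(t),v\rangle=\langle\tilde g(t),v\rangle\quad\text{for all } v\in H^2_0((0,1)),\ t\in(0,T)\ \text{(a.e.)},$$ $w(0)=\tilde f_1$, $w'(0)=\tilde f_2$. Here $\langle\cdot,\cdot\rangle$ is the $L^2((0,1))$ inner product extended to the antiduality pairing of $H^{-2}((0,1))$ with $H^2_0((0,1))$.
   Formalization: In (ii) the weak solution w is assumed to exist (it may not when f̃2 is only in L², since w' is required to lie in L²((0,T),H²_0)); its uniqueness and the association of u with it are proved. The generalized solution u is taken as given. *)

theory Defs
  imports "HOL-Analysis.Analysis" "HOL-Library.Landau_Symbols"
begin

text \<open>
  All functions are complex-valued and total; only their values on the domain under consideration
  matter. Points of the space-time domain are pairs \<open>(x, t)\<close>.
\<close>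

abbreviation U01 :: "real set" where
  "U01 \<equiv> {0<..<1}"

definition XT :: "real \<Rightarrow> (real \<times> real) set" where
  "XT T = {0<..<1} \<times> {0<..<T}"

abbreviation dirX :: "real \<times> real" where "dirX \<equiv> (1, 0)"
abbreviation dirT :: "real \<times> real" where "dirT \<equiv> (0, 1)"


section \<open>Smooth functions and \<open>L\<^sup>2\<close>\<close>

definition pdiff :: "'a::euclidean_space \<Rightarrow> ('a \<Rightarrow> complex) \<Rightarrow> 'a \<Rightarrow> complex" where
  "pdiff e f = (\<lambda>z. frechet_derivative f (at z) e)"

text \<open>
  Iterated partial derivatives; a multi-index is given as a list of basis vectors. In dimension one
  the only basis vector is \<open>1\<close>.
\<close>

definition pdiffs :: "'a::euclidean_space list \<Rightarrow> ('a \<Rightarrow> complex) \<Rightarrow> 'a \<Rightarrow> complex" where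
  "pdiffs es f = foldr pdiff es f"

text \<open>
  For open \<open>\<Omega>\<close> this is \<open>C\<^sup>\<infinity>\<close>: all iterated partial derivatives exist and are Frechet
  differentiable, hence continuous.
\<close>

definition smooth_on :: "'a::euclidean_space set \<Rightarrow> ('a \<Rightarrow> complex) \<Rightarrow> bool" where
  "smooth_on \<Omega> f \<longleftrightarrow> (\<forall>es\<in>lists Basis. pdiffs es f differentiable_on \<Omega>)"

definition test_fun :: "'a::euclidean_space set \<Rightarrow> ('a \<Rightarrow> complex) set" where
  "test_fun \<Omega> = {\<phi>. smooth_on UNIV \<phi> \<and> (\<exists>K. compact K \<and> K \<subseteq> \<Omega> \<and> (\<forall>z. z \<notin> K \<longrightarrow> \<phi> z = 0))}"

definition L2 :: "'a::euclidean_space set \<Rightarrow> ('a \<Rightarrow> complex) set" where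
  "L2 \<Omega> = {f. f \<in> borel_measurable (lebesgue_on \<Omega>) \<and>
              integrable (lebesgue_on \<Omega>) (\<lambda>z. (cmod (f z))\<^sup>2)}"

definition L2norm :: "'a::euclidean_space set \<Rightarrow> ('a \<Rightarrow> complex) \<Rightarrow> real" where
  "L2norm \<Omega> f = sqrt (LINT z|lebesgue_on \<Omega>. (cmod (f z))\<^sup>2)"

definition L2ip :: "(real \<Rightarrow> complex) \<Rightarrow> (real \<Rightarrow> complex) \<Rightarrow> complex" where
  "L2ip f h = (LINT x|lebesgue_on U01. f x * cnj (h x))"

definition Hinf :: "'a::euclidean_space set \<Rightarrow> ('a \<Rightarrow> complex) set" where
  "Hinf \<Omega> = {f. smooth_on \<Omega> f \<and> (\<forall>es\<in>lists Basis. pdiffs es f \<in> L2 \<Omega>)}"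

text \<open>
  Value at a boundary point of a function that is smooth up to the boundary, i.e. the value of its
  continuous extension.
\<close>

definition bdval :: "'a::euclidean_space set \<Rightarrow> ('a \<Rightarrow> complex) \<Rightarrow> 'a \<Rightarrow> complex" where
  "bdval \<Omega> f z = Lim (at z within \<Omega>) f"

definition trace_t :: "real \<Rightarrow> real \<Rightarrow> (real \<times> real \<Rightarrow> complex) \<Rightarrow> real \<Rightarrow> complex" where
  "trace_t T s f = (\<lambda>x. bdval (XT T) f (x, s))"

definition trace_x :: "real \<Rightarrow> real \<Rightarrow> (real \<times> real \<Rightarrow> complex) \<Rightarrow> real \<Rightarrow> complex" where
  "trace_x T a f = (\<lambda>t. bdval (XT T) f (a, t))"


section \<open>Colombeau algebras\<close>

text \<open>
  A net is a function of \<open>\<epsilon>\<close>, of which only the restriction to \<open>{0<..1}\<close> is meaningful. Since null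
  families are characterized by their behaviour as \<open>\<epsilon> \<rightarrow> 0\<close>, the irrelevant values (for other
  \<open>\<epsilon>\<close>, and outside \<open>\<Omega>\<close>) disappear in the quotient.
\<close>

type_synonym 'a net = "real \<Rightarrow> 'a \<Rightarrow> complex"

definition moderate :: "'a::euclidean_space set \<Rightarrow> 'a net set" where
  "moderate \<Omega> = {u. (\<forall>\<epsilon>\<in>{0<..1}. u \<epsilon> \<in> Hinf \<Omega>) \<and>
     (\<forall>es\<in>lists Basis. \<exists>p\<ge>0. (\<lambda>\<epsilon>. L2norm \<Omega> (pdiffs es (u \<epsilon>))) \<in> O[at_right 0](\<lambda>\<epsilon>. \<epsilon> powr (- p)))}"

definition null_nets :: "'a::euclidean_space set \<Rightarrow> 'a net set" where
  "null_nets \<Omega> = {u \<in> moderate \<Omega>. \<forall>q\<ge>0. (\<lambda>\<epsilon>. L2norm \<Omega> (u \<epsilon>)) \<in> O[at_right 0](\<lambda>\<epsilon>. \<epsilon> powr q)}"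

definition colrel :: "'a::euclidean_space set \<Rightarrow> ('a net \<times> 'a net) set" where
  "colrel \<Omega> = {(u, v). u \<in> moderate \<Omega> \<and> v \<in> moderate \<Omega> \<and> (\<lambda>\<epsilon> z. u \<epsilon> z - v \<epsilon> z) \<in> null_nets \<Omega>}"

definition Col :: "'a::euclidean_space set \<Rightarrow> 'a net set set" where
  "Col \<Omega> = moderate \<Omega> // colrel \<Omega>"

definition cls :: "'a::euclidean_space set \<Rightarrow> 'a net \<Rightarrow> 'a net set" where
  "cls \<Omega> u = colrel \<Omega> `` {u}"

definition col_embed :: "'a::euclidean_space set \<Rightarrow> ('a \<Rightarrow> complex) \<Rightarrow> 'a net set" where
  "col_embed \<Omega> h = cls \<Omega> (\<lambda>\<epsilon>. h)"

text \<open>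
  Operations performed \<open>\<epsilon>\<close>-wise on representatives, in the union style for functions on quotients
  (cf. \<open>HOL.Equiv_Relations\<close>). \<open>\<Omega>\<close> is the domain of the result.
\<close>

definition col_map ::
  "'b::euclidean_space set \<Rightarrow> (('a \<Rightarrow> complex) \<Rightarrow> 'b \<Rightarrow> complex) \<Rightarrow> 'a net set \<Rightarrow> 'b net set" where
  "col_map \<Omega> \<Phi> U = (\<Union>u\<in>U. cls \<Omega> (\<lambda>\<epsilon>. \<Phi> (u \<epsilon>)))"

definition col_add :: "'a::euclidean_space set \<Rightarrow> 'a net set \<Rightarrow> 'a net set \<Rightarrow> 'a net set" where
  "col_add \<Omega> U V = (\<Union>u\<in>U. \<Union>v\<in>V. cls \<Omega> (\<lambda>\<epsilon> z. u \<epsilon> z + v \<epsilon> z))"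

definition col_mult :: "'a::euclidean_space set \<Rightarrow> 'a net set \<Rightarrow> 'a net set \<Rightarrow> 'a net set" where
  "col_mult \<Omega> U V = (\<Union>u\<in>U. \<Union>v\<in>V. cls \<Omega> (\<lambda>\<epsilon> z. u \<epsilon> z * v \<epsilon> z))"

abbreviation col_diff ::
  "'a::euclidean_space set \<Rightarrow> 'a \<Rightarrow> 'a net set \<Rightarrow> 'a net set" where
  "col_diff \<Omega> e \<equiv> col_map \<Omega> (pdiff e)"

abbreviation col_lift_x :: "real \<Rightarrow> real net set \<Rightarrow> (real \<times> real) net set" where
  "col_lift_x T \<equiv> col_map (XT T) (\<lambda>f (x, t). f x)"

abbreviation col_zero :: "'a::euclidean_space set \<Rightarrow> 'a net set" where
  "col_zero \<Omega> \<equiv> col_embed \<Omega> (\<lambda>z. 0)"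

definition vanishes_at :: "real \<Rightarrow> real net set \<Rightarrow> bool" where
  "vanishes_at a V \<longleftrightarrow>
     (\<exists>v\<in>V. \<forall>q\<ge>0. (\<lambda>\<epsilon>. cmod (bdval U01 (v \<epsilon>) a)) \<in> O[at_right 0](\<lambda>\<epsilon>. \<epsilon> powr q))"

definition Linf_log_type :: "real \<Rightarrow> (real \<times> real) net set \<Rightarrow> bool" where
  "Linf_log_type T B \<longleftrightarrow>
     (\<exists>b\<in>B. \<exists>N::nat. \<exists>\<epsilon>\<^sub>0\<in>{0<..1}. \<forall>\<epsilon>\<in>{0<..\<epsilon>\<^sub>0}.
        AE z in lebesgue_on (XT T). cmod (b \<epsilon> z) \<le> real N * ln (1 / \<epsilon>))"

definition associated ::
  "real \<Rightarrow> (real \<times> real) net set \<Rightarrow> ((real \<times> real \<Rightarrow> complex) \<Rightarrow> complex) \<Rightarrow> bool" where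
  "associated T U \<Lambda> \<longleftrightarrow>
     (\<exists>u\<in>U. \<forall>\<psi>\<in>test_fun (XT T).
        ((\<lambda>\<epsilon>. LINT z|lebesgue_on (XT T). u \<epsilon> z * \<psi> z) \<longlongrightarrow> \<Lambda> \<psi>) (at_right 0))"


section \<open>The initial-boundary value problem\<close>

definition generalized_solution ::
  "real \<Rightarrow> (real \<times> real) net set \<Rightarrow> real net set \<Rightarrow> real net set \<Rightarrow> real net set \<Rightarrow>
   (real \<times> real) net set \<Rightarrow> (real \<times> real) net set \<Rightarrow> bool" where
  "generalized_solution T b c f1 f2 g u \<longleftrightarrow>
     (let \<Omega> = XT T; I = {0<..<T}; dx = col_diff \<Omega> dirX; dt = col_diff \<Omega> dirT in
      u \<in> Col \<Omega> \<and>
      col_add \<Omega> (col_add \<Omega> (dt (dt u)) (dx (dx (col_mult \<Omega> (col_lift_x T c) (dx (dx u))))))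
        (col_mult \<Omega> b (dx (dx u))) = g \<and>
      col_map U01 (trace_t T 0) u = f1 \<and>
      col_map U01 (trace_t T 0) (dt u) = f2 \<and>
      col_map I (trace_x T 0) u = col_zero I \<and>
      col_map I (trace_x T 1) u = col_zero I \<and>
      col_map I (trace_x T 0) (dx u) = col_zero I \<and>
      col_map I (trace_x T 1) (dx u) = col_zero I)"

definition smooth_solution ::
  "real \<Rightarrow> (real \<times> real \<Rightarrow> complex) \<Rightarrow> (real \<Rightarrow> complex) \<Rightarrow> (real \<Rightarrow> complex) \<Rightarrow> (real \<Rightarrow> complex) \<Rightarrow>
   (real \<times> real \<Rightarrow> complex) \<Rightarrow> (real \<times> real \<Rightarrow> complex) \<Rightarrow> bool" where
  "smooth_solution T b c f1 f2 g h \<longleftrightarrow>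
     (let dx = pdiff dirX; dt = pdiff dirT in
      h \<in> Hinf (XT T) \<and>
      (\<forall>z\<in>XT T. dt (dt h) z + dx (dx (\<lambda>y. c (fst y) * dx (dx h) y)) z + b z * dx (dx h) z = g z) \<and>
      (\<forall>x\<in>U01. trace_t T 0 h x = f1 x \<and> trace_t T 0 (dt h) x = f2 x) \<and>
      (\<forall>t\<in>{0<..<T}. trace_x T 0 h t = 0 \<and> trace_x T 1 h t = 0 \<and>
                     trace_x T 0 (dx h) t = 0 \<and> trace_x T 1 (dx h) t = 0))"


section \<open>Sobolev spaces on \<open>(0, 1)\<close>\<close>

definition weak_deriv :: "nat \<Rightarrow> (real \<Rightarrow> complex) \<Rightarrow> (real \<Rightarrow> complex) \<Rightarrow> bool" where
  "weak_deriv k v z \<longleftrightarrow>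
     (\<forall>\<phi>\<in>test_fun U01. (LINT x|lebesgue_on U01. v x * (pdiff 1 ^^ k) \<phi> x)
                         = (- 1) ^ k * (LINT x|lebesgue_on U01. z x * \<phi> x))"

definition H2 :: "(real \<Rightarrow> complex) set" where
  "H2 = {v \<in> L2 U01. \<forall>k\<le>2. \<exists>z\<in>L2 U01. weak_deriv k v z}"

text \<open>The weak derivative of order \<open>k\<close>; it is determined up to a null set.\<close>

definition wd :: "nat \<Rightarrow> (real \<Rightarrow> complex) \<Rightarrow> real \<Rightarrow> complex" where
  "wd k v = (SOME z. z \<in> L2 U01 \<and> weak_deriv k v z)"

definition H2norm :: "(real \<Rightarrow> complex) \<Rightarrow> real" where
  "H2norm v = sqrt (\<Sum>k\<le>2. (L2norm U01 (wd k v))\<^sup>2)"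

definition H20 :: "(real \<Rightarrow> complex) set" where
  "H20 = {v \<in> H2. \<exists>\<phi>::nat \<Rightarrow> real \<Rightarrow> complex.
            (\<forall>n. \<phi> n \<in> test_fun U01) \<and> (\<lambda>n. H2norm (\<lambda>x. \<phi> n x - v x)) \<longlonglongrightarrow> 0}"

text \<open>
  The antidual of \<open>H20\<close>. Boundedness together with additivity makes such functionals insensitive
  to changes of the argument on null sets.
\<close>

definition Hm2 :: "((real \<Rightarrow> complex) \<Rightarrow> complex) set" where
  "Hm2 = {Z. (\<forall>v\<in>H20. \<forall>v'\<in>H20. Z (\<lambda>x. v x + v' x) = Z v + Z v') \<and>
             (\<forall>v\<in>H20. \<forall>a. Z (\<lambda>x. a * v x) = cnj a * Z v) \<and>
             (\<exists>K. \<forall>v\<in>H20. cmod (Z v) \<le> K * H2norm v)}"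

definition Hm2norm :: "((real \<Rightarrow> complex) \<Rightarrow> complex) \<Rightarrow> real" where
  "Hm2norm Z = Sup {cmod (Z v) | v. v \<in> H20 \<and> H2norm v \<le> 1}"


section \<open>Vector-valued functions of time\<close>

text \<open>
  The spaces above are sets \<open>S\<close> of complex-valued functions with a seminorm \<open>N\<close>, whose kernel
  consists of the representatives of zero. The following is Bochner measurability and square
  integrability with respect to \<open>N\<close>, i.e. the space \<open>L\<^sup>2((0,T), S)\<close>.
\<close>

definition bochner_L2 ::
  "real \<Rightarrow> ('v \<Rightarrow> complex) set \<Rightarrow> (('v \<Rightarrow> complex) \<Rightarrow> real) \<Rightarrow> (real \<Rightarrow> 'v \<Rightarrow> complex) set" where
  "bochner_L2 T S N = {w.
     (AE t in lebesgue_on {0<..<T}. w t \<in> S) \<and>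
     (\<exists>s::nat \<Rightarrow> real \<Rightarrow> 'v \<Rightarrow> complex.
        (\<forall>n. simple_function (lebesgue_on {0<..<T}) (s n) \<and> (\<forall>t\<in>{0<..<T}. s n t \<in> S)) \<and>
        (AE t in lebesgue_on {0<..<T}. (\<lambda>n. N (\<lambda>y. s n t y - w t y)) \<longlonglongrightarrow> 0)) \<and>
     integrable (lebesgue_on {0<..<T}) (\<lambda>t. (N (w t))\<^sup>2)}"

text \<open>
  Derivative in the sense of \<open>Hm2\<close>-valued distributions on \<open>(0,T)\<close>. Functions with values in
  \<open>L2 U01\<close> enter through the embedding \<open>L2ip\<close> of \<open>L2 U01\<close> into \<open>Hm2\<close>.
\<close>

definition time_deriv ::
  "real \<Rightarrow> (real \<Rightarrow> (real \<Rightarrow> complex) \<Rightarrow> complex) \<Rightarrow> (real \<Rightarrow> (real \<Rightarrow> complex) \<Rightarrow> complex) \<Rightarrow> bool" where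
  "time_deriv T W Z \<longleftrightarrow>
     (\<forall>v\<in>H20. \<forall>\<phi>\<in>test_fun {0<..<T}.
        (LINT t|lebesgue_on {0<..<T}. pdiff 1 \<phi> t * W t v)
          = - (LINT t|lebesgue_on {0<..<T}. \<phi> t * Z t v))"

text \<open>The representative of \<open>w\<close> that is continuous on \<open>[0,T]\<close> takes the value \<open>f\<close> at time 0.\<close>

definition initial_value ::
  "real \<Rightarrow> ('v \<Rightarrow> complex) set \<Rightarrow> (('v \<Rightarrow> complex) \<Rightarrow> real) \<Rightarrow> (real \<Rightarrow> 'v \<Rightarrow> complex) \<Rightarrow>
   ('v \<Rightarrow> complex) \<Rightarrow> bool" where
  "initial_value T S N w f \<longleftrightarrow>
     (\<exists>W. (AE t in lebesgue_on {0<..<T}. N (\<lambda>y. W t y - w t y) = 0) \<and>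
          (\<forall>t\<in>{0..T}. W t \<in> S \<and> ((\<lambda>s. N (\<lambda>y. W s y - W t y)) \<longlongrightarrow> 0) (at t within {0..T})) \<and>
          N (\<lambda>y. W 0 y - f y) = 0)"

definition weak_solution ::
  "real \<Rightarrow> (real \<times> real \<Rightarrow> complex) \<Rightarrow> (real \<Rightarrow> complex) \<Rightarrow> (real \<Rightarrow> complex) \<Rightarrow> (real \<Rightarrow> complex) \<Rightarrow>
   (real \<times> real \<Rightarrow> complex) \<Rightarrow> (real \<Rightarrow> real \<Rightarrow> complex) \<Rightarrow> bool" where
  "weak_solution T b c f1 f2 g w \<longleftrightarrow>
     w \<in> bochner_L2 T H20 H2norm \<and>
     (\<exists>w1 w2. w1 \<in> bochner_L2 T H20 H2norm \<and> w2 \<in> bochner_L2 T Hm2 Hm2norm \<and>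
        time_deriv T (\<lambda>t. L2ip (w t)) (\<lambda>t. L2ip (w1 t)) \<and>
        time_deriv T (\<lambda>t. L2ip (w1 t)) w2 \<and>
        (\<forall>v\<in>H20. AE t in lebesgue_on {0<..<T}.
           w2 t v + L2ip (\<lambda>x. c x * wd 2 (w t) x) (wd 2 v) + L2ip (\<lambda>x. b (x, t) * wd 2 (w t) x) v
             = L2ip (\<lambda>x. g (x, t)) v) \<and>
        initial_value T H20 H2norm w f1 \<and>
        initial_value T (L2 U01) (L2norm U01) w1 f2)"

text \<open>
  The distribution on \<open>XT T\<close> defined by a function with values in \<open>L2 U01\<close>. The integral is
  iterated because \<open>(x, t) \<mapsto> w t x\<close> need not be jointly measurable for arbitrary
  representatives \<open>w t\<close>.
\<close>

definition distr_of :: "real \<Rightarrow> (real \<Rightarrow> real \<Rightarrow> complex) \<Rightarrow> (real \<times> real \<Rightarrow> complex) \<Rightarrow> complex" where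
  "distr_of T w \<psi> = (LINT t|lebesgue_on {0<..<T}. LINT x|lebesgue_on U01. w t x * \<psi> (x, t))"

end

theory Submission
 imports Defs "HOL-Real_Asymp.Real_Asymp"
begin

text \<open>
  No existence theory is needed, since a generalized solution is given. Subtracting a Hermite interpolation
  of its lateral traces, which are null, gives representatives \<open>v\<close> satisfying the boundary conditions exactly,
  so that differences are controlled, uniformly in time, by an energy estimate in terms of the initial
  values and the right-hand side. It is proved for functions that are merely weakly differentiable in
  time (via Steklov averages) and therefore covers weak solutions as well. For smooth data, the
  difference of \<open>v\<close> at \<open>\<epsilon>\<close> and \<open>\<epsilon>/2\<close> is thus \<open>L\<^sup>2\<close>-null, hence null together with all derivatives by interpolation, and the limit
  along \<open>\<epsilon> = 2\<^sup>-\<^sup>k\<close> is the smooth solution. In (ii) the same estimate compares \<open>v\<close> with \<open>w\<close>.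
\<close>

text \<open>The obstacle in the energy estimate is the test function. The natural multiplier is the
  velocity, but for a weak solution it is continuous in time only with values in \<open>L2\<close>,
  and it lies in \<open>H20\<close> merely for almost every time. The increments
  \<open>z (t + h) - z t\<close> always lie in \<open>H20\<close>; testing with them turns both
  quadratic terms into boundary terms after one integration in time, and \<open>h\<close> tending to
  0 gives the energy inequality. The estimate is stated in an abstract real inner product space, so
  a quotient type is built from \<open>L2 U01\<close> and only real parts of pairings are used. On
  the Colombeau side all derivatives are measured in sup norms, because these behave well under
  products. Passing from \<open>L2norm\<close> to sup norms costs a negative power of \<epsilon>,
  since Lipschitz constants and second derivatives are moderate; null families beat every such
  power. Halving \<epsilon> keeps the difference of two members a net in one parameter, to which
  this interpolation applies, and null bounds are summable along \<open>2^-k\<close>.\<close>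

abbreviation dX :: "(real \<times> real => complex) => real \<times> real => complex" where "dX \<equiv> pdiff dirX"
abbreviation dT :: "(real \<times> real => complex) => real \<times> real => complex" where "dT \<equiv> pdiff dirT"
abbreviation lebU :: "real measure" where "lebU \<equiv> lebesgue_on U01"
abbreviation lebT :: "real => real measure" where "lebT T \<equiv> lebesgue_on {0<..<T}"
abbreviation bmeas :: "'a measure => ('a => 'b::topological_space) set" where "bmeas M \<equiv> borel_measurable M"
lemmas bochner_cong = Bochner_Integration.integral_cong
 and hk_combine = Henstock_Kurzweil_Integration.integral_combine

section \<open>Partial derivatives on open sets\<close>

lemma pdiffs_Nil [simp]: "pdiffs [] f = f"
 and pdiffs_Cons: "pdiffs (e # es) f = pdiff e (pdiffs es f)"
 and pdiffs_append: "pdiffs (es @ fs) f = pdiffs es (pdiffs fs f)"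
 by (simp_all add: pdiffs_def)

lemma pdiff_eq: "(f has_derivative f') (at z) ==> pdiff e f z = f' e"
 by (simp add: pdiff_def frechet_derivative_at[symmetric])

lemma pdiff_has_derivative:
 fixes f :: "'a::euclidean_space => complex"
 assumes "f differentiable (at z)"
 shows "(f has_derivative (%v. \<Sum>e\<in>Basis. (v \<bullet> e) *\<^sub>R pdiff e f z)) (at z)"
proof -
 have d: "(f has_derivative frechet_derivative f (at z)) (at z)"
  using assms frechet_derivative_works by blast
 then interpret linear "frechet_derivative f (at z)"
  by (rule has_derivative_linear)
 have "frechet_derivative f (at z) v = (\<Sum>e\<in>Basis. (v \<bullet> e) *\<^sub>R pdiff e f z)" for v
 proof -
  have "frechet_derivative f (at z) (\<Sum>e\<in>Basis. (v \<bullet> e) *\<^sub>R e)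
    = (\<Sum>e\<in>Basis. (v \<bullet> e) *\<^sub>R pdiff e f z)"
   by (simp add: sum scale pdiff_def)
  then show ?thesis by (simp add: euclidean_representation)
 qed
 then have "frechet_derivative f (at z) = (%v. \<Sum>e\<in>Basis. (v \<bullet> e) *\<^sub>R pdiff e f z)" by blast
 with d show ?thesis by simp
qed

lemma pdiff_cong:
 assumes "open S" "z : S" "!!y. y : S ==> f y = g y"
 shows "pdiff e f z = pdiff e g z"
proof -
 have "(f has_derivative D) (at z) \<longleftrightarrow> (g has_derivative D) (at z)" for D
  using has_derivative_transform_within_open[OF _ assms(1,2)] assms(3) by metis
 then show ?thesis by (simp add: pdiff_def frechet_derivative_def)
qed

lemma pdiffs_cong:
 assumes "open S" "z : S" "!!y. y : S ==> f y = g y"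
 shows "pdiffs es f z = pdiffs es g z"
 using assms(2)
proof (induction es arbitrary: z)
 case Nil then show ?case using assms(3) by simp
next
 case (Cons e es)
 show ?case unfolding pdiffs_Cons
  by (rule pdiff_cong[OF assms(1) Cons.prems]) (rule Cons.IH)
qed

lemma differentiable_cong_open:
 assumes "open S" "z : S" "!!y. y : S ==> f y = g y" "g differentiable (at z)"
 shows "f differentiable (at z)"
 using assms unfolding differentiable_def
 by (metis has_derivative_transform_within_open)

lemma smooth_on_at:
 "open Om ==> smooth_on Om f \<longleftrightarrow> (\<forall>es\<in>lists Basis. \<forall>z\<in>Om. pdiffs es f differentiable (at z))"
 by (simp add: smooth_on_def differentiable_on_def at_within_open[of _ Om])

section \<open>Nets with uniformly bounded derivatives and their growth classes\<close>

text \<open>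
 Nets all of whose derivatives are bounded on \<open>Om\<close> by functions of \<open>ep\<close> from the class \<open>A\<close>. With
 \<open>A = UNIV\<close> and constant nets, this also covers single functions with bounded derivatives.
\<close>

definition snet :: "(real => real) set => 'a::euclidean_space set => 'a net => bool" where
 "snet A Om u \<longleftrightarrow> (\<forall>ep\<in>{0<..1}. smooth_on Om (u ep)) \<and>
   (\<forall>es\<in>lists Basis. \<exists>K\<in>A. \<forall>ep\<in>{0<..1}. \<forall>z\<in>Om. cmod (pdiffs es (u ep) z) <= K ep)"

abbreviation bsm :: "'a::euclidean_space set => ('a => complex) => bool" where
 "bsm Om f \<equiv> snet UNIV Om (%ep. f)"

definition A_mod :: "(real => real) set" where
 "A_mod = {K. \<exists>p\<ge>0. K : O[at_right 0](%ep. ep powr (- p))}"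

definition A_null :: "(real => real) set" where
 "A_null = {K. \<forall>q\<ge>0. K : O[at_right 0](%ep. ep powr q)}"

lemma snet_bound:
 assumes "snet A Om u" "es : lists Basis"
 obtains K where "K : A" "!!ep z. 0 < ep ==> ep <= 1 ==> z : Om ==> cmod (pdiffs es (u ep) z) <= K ep"
proof -
 have "\<forall>es\<in>lists Basis. \<exists>K\<in>A. \<forall>ep\<in>{0<..1}. \<forall>z\<in>Om. cmod (pdiffs es (u ep) z) <= K ep"
  using assms(1) by (simp add: snet_def)
 from bspec[OF this assms(2)] obtain K
  where "K : A" "\<forall>ep\<in>{0<..1}. \<forall>z\<in>Om. cmod (pdiffs es (u ep) z) <= K ep" by (elim bexE)
 then show thesis by (intro that[of K]) simp_all
qed

lemma snet_bound0:
 assumes "snet A Om u"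
 obtains K where "K : A" "!!ep z. 0 < ep ==> ep <= 1 ==> z : Om ==> cmod (u ep z) <= K ep"
 by (rule snet_bound[OF assms lists.Nil, unfolded pdiffs_Nil]) (rule that)

lemma snet_mono: "snet A Om u ==> A \<subseteq> B ==> snet B Om u"
 unfolding snet_def by (meson subsetD)

lemma snet_bsm:
 assumes "snet A Om u" "0 < ep" "ep <= 1"
 shows "bsm Om (u ep)"
 unfolding snet_def
proof (intro conjI ballI)
 show "smooth_on Om (u ep)" using assms by (simp add: snet_def)
next
 fix es :: "'a list" assume *: "es : lists Basis"
 obtain K where "!!ep z. 0 < ep ==> ep <= 1 ==> z : Om ==> cmod (pdiffs es (u ep) z) <= K ep"
  by (rule snet_bound[OF assms(1) *]) blast
 then show "\<exists>K\<in>UNIV. \<forall>ep'\<in>{0<..1::real}. \<forall>z\<in>Om. cmod (pdiffs es (u ep) z) <= K ep'"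
  using assms by (intro bexI[of _ "%_. K ep"]) simp_all
qed

text \<open>Coinduction principle: when the partial derivatives of nets in \<open>P\<close> agree on
  \<open>Om\<close> with nets again in \<open>P\<close>, every iterated derivative of
  \<open>u\<close> agrees with some member of \<open>P\<close> and inherits its differentiability
  and its bound. This replaces formulas for higher derivatives. Agreement is asked on
  \<open>Om\<close> and for parameters in \<open>(0, 1]\<close> only, because all other values are
  arbitrary.\<close>

lemma snet_coinduct:
 assumes "open Om" "P u"
  and diff: "!!v ep z. P v ==> 0 < ep ==> ep <= 1 ==> z : Om ==> v ep differentiable (at z)"
  and bound: "!!v. P v ==> \<exists>K\<in>A. \<forall>ep\<in>{0<..1}. \<forall>z\<in>Om. cmod (v ep z) <= K ep"
  and step: "!!v e. P v ==> e : Basis ==> \<exists>w. P w \<and> (\<forall>ep\<in>{0<..1}. \<forall>z\<in>Om. pdiff e (v ep) z = w ep z)"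
 shows "snet A Om u"
proof -
 define agree :: "'a net => 'a net => bool"
  where "agree v w \<longleftrightarrow> (\<forall>ep\<in>{0<..1}. \<forall>z\<in>Om. v ep z = w ep z)" for v w
 have agreeD: "v ep z = w ep z" if "agree v w" "ep : {0<..1}" "z : Om" for v w ep z
  using that unfolding agree_def by (elim ballE) auto
 have step': "\<exists>w. P w \<and> agree (%ep. pdiff e (v ep)) w" if "P v" "e : Basis" for v e
  unfolding agree_def by (rule step[OF that])
 have *: "\<exists>w. P w \<and> agree (%ep. pdiffs es (u ep)) w" if "es : lists Basis" for es
  using that
 proof (induction es)
  case Nil
  have "agree (%ep. pdiffs [] (u ep)) u" by (simp add: agree_def)
  with \<open>P u\<close> show ?case by (intro exI[of _ u] conjI)
 next
  case (Cons e es)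
  have "e : Basis" "es : lists Basis" using Cons.hyps Cons.prems by simp_all
  obtain w where w: "P w" "agree (%ep. pdiffs es (u ep)) w" using Cons.IH by (elim exE conjE)
  obtain w' where w': "P w'" "agree (%ep. pdiff e (w ep)) w'"
   using step'[OF w(1) \<open>e : Basis\<close>] by (elim exE conjE)
  have "agree (%ep. pdiffs (e # es) (u ep)) w'"
   unfolding agree_def
  proof (intro ballI)
   fix ep :: real and z assume e: "ep : {0<..1}" "z : Om"
   have "pdiff e (pdiffs es (u ep)) z = pdiff e (w ep) z"
    by (rule pdiff_cong[OF \<open>open Om\<close> e(2)]) (rule agreeD[OF w(2) e(1)])
   then show "pdiffs (e # es) (u ep) z = w' ep z"
    using agreeD[OF w'(2) e] by (simp add: pdiffs_Cons)
  qed
  with w'(1) show ?case by (intro exI[of _ w'] conjI)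
 qed
 show ?thesis unfolding snet_def
 proof (intro conjI ballI)
  fix ep :: real assume e: "ep : {0<..1}"
  show "smooth_on Om (u ep)" unfolding smooth_on_at[OF \<open>open Om\<close>]
  proof (intro ballI)
   fix es :: "'a list" and z assume "es : lists Basis" and z: "z : Om"
   obtain w where w: "P w" "agree (%ep. pdiffs es (u ep)) w"
    using *[OF \<open>es : _\<close>] by (elim exE conjE)
   have "w ep differentiable (at z)" using diff[OF w(1)] e z by simp
   with agreeD[OF w(2) e] show "pdiffs es (u ep) differentiable (at z)"
    by (rule differentiable_cong_open[OF \<open>open Om\<close> z])
  qed
 next
  fix es :: "'a list" assume es: "es : lists Basis"
  obtain w where w: "P w" "agree (%ep. pdiffs es (u ep)) w"
   using *[OF es] by (elim exE conjE)
  obtain K where "K : A" and K: "\<forall>ep\<in>{0<..1}. \<forall>z\<in>Om. cmod (w ep z) <= K ep"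
   using bound[OF w(1)] by (elim bexE)
  show "\<exists>K\<in>A. \<forall>ep\<in>{0<..1}. \<forall>z\<in>Om. cmod (pdiffs es (u ep) z) <= K ep"
  proof (rule bexI[OF _ \<open>K : A\<close>], intro ballI)
   fix ep :: real and z assume e: "ep : {0<..1}" "z : Om"
   have "cmod (w ep z) <= K ep" using K e by (elim ballE) auto
   then show "cmod (pdiffs es (u ep) z) <= K ep" by (simp only: agreeD[OF w(2) e])
  qed
 qed
qed

lemma snet_smooth: "snet A Om u ==> 0 < ep ==> ep <= 1 ==> smooth_on Om (u ep)"
 by (simp add: snet_def)

lemma snet_differentiable:
 assumes "snet A Om u" "open Om" "0 < ep" "ep <= 1" "z : Om"
 shows "u ep differentiable (at z)"
proof -
 have "\<forall>es\<in>lists Basis. \<forall>z\<in>Om. pdiffs es (u ep) differentiable (at z)"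
  using snet_smooth[OF assms(1,3,4)] by (simp only: smooth_on_at[OF assms(2)])
 from bspec[OF this lists.Nil] have "\<forall>z\<in>Om. u ep differentiable (at z)" by simp
 from bspec[OF this assms(5)] show ?thesis .
qed

lemma snet_pdiffs:
 assumes "snet A Om u" "es : lists Basis"
 shows "snet A Om (%ep. pdiffs es (u ep))"
proof -
 have app: "fs @ es : lists Basis" if "fs : lists Basis" for fs :: "'a list"
  using that assms(2) by simp
 show ?thesis unfolding snet_def smooth_on_def
 proof (intro conjI ballI)
  fix ep :: real and fs :: "'a list" assume *: "fs : lists Basis" and e: "ep : {0<..1}"
  have "smooth_on Om (u ep)" using snet_smooth[OF assms(1)] e by simp
  from bspec[OF this[unfolded smooth_on_def] app[OF *]]
  show "pdiffs fs (pdiffs es (u ep)) differentiable_on Om" by (simp only: pdiffs_append)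
 next
  fix fs :: "'a list" assume *: "fs : lists Basis"
  obtain K where K: "K : A"
   "!!ep z. 0 < ep ==> ep <= 1 ==> z : Om ==> cmod (pdiffs (fs @ es) (u ep) z) <= K ep"
   using snet_bound[OF assms(1) app[OF *]] by blast
  show "\<exists>K\<in>A. \<forall>ep\<in>{0<..1}. \<forall>z\<in>Om. cmod (pdiffs fs (pdiffs es (u ep)) z) <= K ep"
   by (rule bexI[OF _ K(1)]) (simp add: K(2) pdiffs_append[symmetric])
 qed
qed

lemma snet_pdiff: "snet A Om u ==> e : Basis ==> snet A Om (%ep. pdiff e (u ep))"
 using snet_pdiffs[of A Om u "[e]"] by (simp add: pdiffs_Cons)

lemma snet_cong:
 assumes "open Om" "snet A Om u" "!!ep z. 0 < ep ==> ep <= 1 ==> z : Om ==> u ep z = v ep z"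
 shows "snet A Om v"
proof -
 have eq: "pdiffs es (v ep) z = pdiffs es (u ep) z" if "ep : {0<..1}" "z : Om" for es ep z
  using that assms(3)[of ep] by (intro pdiffs_cong[OF assms(1)]) auto
 show ?thesis unfolding snet_def
 proof (intro conjI ballI)
  fix ep :: real assume e: "ep : {0<..1}"
  show "smooth_on Om (v ep)" unfolding smooth_on_at[OF assms(1)]
  proof (intro ballI)
   fix es :: "'a list" and z assume es: "es : lists Basis" and z: "z : Om"
   have "pdiffs es (u ep) differentiable (at z)"
    using snet_differentiable[OF snet_pdiffs[OF assms(2) es] assms(1) _ _ z] e by simp
   with eq[OF e] show "pdiffs es (v ep) differentiable (at z)"
    by (rule differentiable_cong_open[OF assms(1) z])
  qed
 next
  fix es :: "'a list" assume *: "es : lists Basis"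
  obtain K where K: "K : A" "!!ep z. 0 < ep ==> ep <= 1 ==> z : Om ==> cmod (pdiffs es (u ep) z) <= K ep"
   using snet_bound[OF assms(2) *] by blast
  show "\<exists>K\<in>A. \<forall>ep\<in>{0<..1}. \<forall>z\<in>Om. cmod (pdiffs es (v ep) z) <= K ep"
   by (rule bexI[OF _ K(1)]) (simp add: K(2) eq)
 qed
qed

lemma pdiff_add:
 "f differentiable (at z) ==> g differentiable (at z) ==>
  pdiff e (%y. f y + g y) z = pdiff e f z + pdiff e g z"
 unfolding frechet_derivative_works
 by (drule (1) has_derivative_add, drule pdiff_eq, simp add: pdiff_def)

lemma pdiff_diff:
 "f differentiable (at z) ==> g differentiable (at z) ==>
  pdiff e (%y. f y - g y) z = pdiff e f z - pdiff e g z"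
 unfolding frechet_derivative_works
 by (drule (1) has_derivative_diff, drule pdiff_eq, simp add: pdiff_def)

lemma pdiff_mult:
 "f differentiable (at z) ==> g differentiable (at z) ==>
  pdiff e (%y. f y * g y) z = f z * pdiff e g z + pdiff e f z * g z"
 unfolding frechet_derivative_works
 by (drule (1) has_derivative_mult, drule pdiff_eq, simp add: pdiff_def)

lemma pdiff_const [simp]: "pdiff e (%y. k) = (%y. 0)"
 by (rule ext, rule pdiff_eq) simp

lemma snet_add:
 assumes "open Om" "snet A Om u" "snet B Om v" "!!a b. a : A ==> b : B ==> (%ep. a ep + b ep) : C"
 shows "snet C Om (%ep z. u ep z + v ep z)"
 using assms(1)
proof (rule snet_coinduct[where P = "%w. \<exists>u v. snet A Om u \<and> snet B Om v \<and> w = (%ep z. u ep z + v ep z)"])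
 fix w :: "'a net"
 assume "\<exists>u v. snet A Om u \<and> snet B Om v \<and> w = (%ep z. u ep z + v ep z)"
 then obtain u v where w: "snet A Om u" "snet B Om v" "w = (%ep z. u ep z + v ep z)" by blast
 obtain K1 where K1: "K1 : A" "!!ep z. 0 < ep ==> ep <= 1 ==> z : Om ==> cmod (u ep z) <= K1 ep"
  using snet_bound0[OF w(1)] by blast
 obtain K2 where K2: "K2 : B" "!!ep z. 0 < ep ==> ep <= 1 ==> z : Om ==> cmod (v ep z) <= K2 ep"
  using snet_bound0[OF w(2)] by blast
 show "\<exists>K\<in>C. \<forall>ep\<in>{0<..1}. \<forall>z\<in>Om. cmod (w ep z) <= K ep"
  unfolding w(3)
  by (rule bexI[OF _ assms(4)[OF K1(1) K2(1)]]) (simp add: K1(2) K2(2) norm_triangle_mono)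
 show "w ep differentiable at z" if "0 < ep" "ep <= 1" "z : Om" for ep z
  using snet_differentiable[OF w(1) assms(1) that] snet_differentiable[OF w(2) assms(1) that] w(3)
  by simp
 show "\<exists>wa. (\<exists>u v. snet A Om u \<and> snet B Om v \<and> wa = (%ep z. u ep z + v ep z)) \<and>
     (\<forall>ep\<in>{0<..1}. \<forall>z\<in>Om. pdiff e (w ep) z = wa ep z)" if "e : Basis" for e
 proof (intro exI conjI)
  show "snet A Om (%ep. pdiff e (u ep))" "snet B Om (%ep. pdiff e (v ep))"
   using snet_pdiff w that by blast+
  show "\<forall>ep\<in>{0<..1}. \<forall>z\<in>Om. pdiff e (w ep) z = pdiff e (u ep) z + pdiff e (v ep) z"
   unfolding w(3)
   by (simp add: pdiff_add snet_differentiable[OF w(1) assms(1)] snet_differentiable[OF w(2) assms(1)])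
 qed simp
next
 show "\<exists>u' v'. snet A Om u' \<and> snet B Om v' \<and> (%ep z. u ep z + v ep z) = (%ep z. u' ep z + v' ep z)"
  using assms(2,3) by (intro exI conjI) auto
qed

text \<open>The Leibniz rule turns a product into a sum of two products, so single products are not
  closed under differentiation. This closure under sums is the invariant for
  \<open>snet_coinduct\<close>.\<close>

inductive sum_of_products ::
 "(real => real) set => (real => real) set => 'a::euclidean_space set => 'a net => bool" for A B Om where
 prod: "snet A Om u ==> snet B Om v ==> sum_of_products A B Om (%ep z. u ep z * v ep z)"
| sum: "sum_of_products A B Om u ==> sum_of_products A B Om v ==> sum_of_products A B Om (%ep z. u ep z + v ep z)"

text \<open>Three growth classes, so that one proof serves bounded times bounded, moderate times
  moderate and moderate times null. \<open>C\<close> has to absorb products of bounds and, because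
  of the Leibniz sums, be closed under addition.\<close>

lemma snet_mult:
 assumes "open Om" "snet A Om u" "snet B Om v"
  and AB: "!!a b. a : A ==> b : B ==> (%ep. a ep * b ep) : C"
  and CC: "!!a b. a : C ==> b : C ==> (%ep. a ep + b ep) : C"
 shows "snet C Om (%ep z. u ep z * v ep z)"
 using assms(1)
proof (rule snet_coinduct[where P = "sum_of_products A B Om"])
 have d: "\<forall>ep z. 0 < ep --> ep <= 1 --> z : Om --> w ep differentiable at z" 
  if "sum_of_products A B Om w" for w
  using that by induction (auto intro!: differentiable_mult differentiable_add snet_differentiable[OF _ assms(1)])
 then show "w ep differentiable at z" if "sum_of_products A B Om w" "0 < ep" "ep <= 1" "z : Om" for w ep z
  using that by blast
 show "\<exists>K\<in>C. \<forall>ep\<in>{0<..1}. \<forall>z\<in>Om. cmod (w ep z) <= K ep" if "sum_of_products A B Om w" for w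
  using that
 proof induction
  case (prod u v)
  obtain K1 where K1: "K1 : A" "!!ep z. 0 < ep ==> ep <= 1 ==> z : Om ==> cmod (u ep z) <= K1 ep"
   using snet_bound0[OF prod(1)] by blast
  obtain K2 where K2: "K2 : B" "!!ep z. 0 < ep ==> ep <= 1 ==> z : Om ==> cmod (v ep z) <= K2 ep"
   using snet_bound0[OF prod(2)] by blast
  have "cmod (u ep z * v ep z) <= K1 ep * K2 ep" if "0 < ep" "ep <= 1" "z : Om" for ep z
   unfolding norm_mult using K1(2)[OF that] K2(2)[OF that]
   by (intro mult_mono) (auto intro: order_trans[OF norm_ge_zero])
  then show ?case by (intro bexI[OF _ AB[OF K1(1) K2(1)]]) simp
 next
  case (sum u v)
  obtain K1 where K1: "K1 : C" "\<forall>ep\<in>{0<..1}. \<forall>z\<in>Om. cmod (u ep z) <= K1 ep" using sum by metis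
  obtain K2 where K2: "K2 : C" "\<forall>ep\<in>{0<..1}. \<forall>z\<in>Om. cmod (v ep z) <= K2 ep" using sum by metis
  show ?case
   by (rule bexI[OF _ CC[OF K1(1) K2(1)]]) (use K1(2) K2(2) in \<open>simp add: norm_triangle_mono\<close>)
 qed
 show "\<exists>wa. sum_of_products A B Om wa \<and> (\<forall>ep\<in>{0<..1}. \<forall>z\<in>Om. pdiff e (w ep) z = wa ep z)"
  if "sum_of_products A B Om w" "e : Basis" for w e
  using that
 proof induction
  case (prod u v)
  have "sum_of_products A B Om (%ep z. u ep z * pdiff e (v ep) z + pdiff e (u ep) z * v ep z)"
   using prod by (intro sum_of_products.intros snet_pdiff)
  moreover have "pdiff e (%y. u ep y * v ep y) z = u ep z * pdiff e (v ep) z + pdiff e (u ep) z * v ep z"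
   if "0 < ep" "ep <= 1" "z : Om" for ep z
   using snet_differentiable[OF prod(1) assms(1) that] snet_differentiable[OF prod(2) assms(1) that]
   by (simp add: pdiff_mult)
  ultimately show ?case
   by (intro exI[of _ "%ep z. u ep z * pdiff e (v ep) z + pdiff e (u ep) z * v ep z"]) simp
 next
  case (sum u v)
  obtain u' where u': "sum_of_products A B Om u'" "\<forall>ep\<in>{0<..1}. \<forall>z\<in>Om. pdiff e (u ep) z = u' ep z"
   using sum by metis
  obtain v' where v': "sum_of_products A B Om v'" "\<forall>ep\<in>{0<..1}. \<forall>z\<in>Om. pdiff e (v ep) z = v' ep z"
   using sum by metis
  show ?case
   by (rule exI[of _ "%ep z. u' ep z + v' ep z"])
    (use u' v' d[OF sum(1)] d[OF sum(2)] in \<open>simp add: sum_of_products.sum pdiff_add\<close>)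
 qed
next
 show "sum_of_products A B Om (%ep z. u ep z * v ep z)"
  using assms by (intro sum_of_products.prod)
qed

lemma A_null_mod: "A_null \<subseteq> A_mod"
 unfolding A_null_def A_mod_def by (auto intro!: exI[of _ 0])

lemma A_mod_const: "(%_. k) : A_mod"
proof -
 have "(%_. k) : O[at_right 0](%ep::real. ep powr (- 0))"
  by (rule bigoI[of _ "\<bar>k\<bar>"], rule eventually_mono[OF eventually_at_right_less]) auto
 then show ?thesis unfolding A_mod_def by blast
qed

lemma powr_bigo_mono:
 assumes "p <= q"
 shows "(%ep::real. ep powr q) : O[at_right 0](%ep. ep powr p)"
proof (rule bigoI[of _ 1])
 have "eventually (%ep::real. ep : {0<..<1}) (at_right 0)"
  by (rule eventually_at_right_real) simp
 then show "\<forall>\<^sub>F x in at_right 0. norm (x powr q) <= 1 * norm (x powr p)"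
  by eventually_elim (use assms in \<open>auto intro!: powr_mono'\<close>)
qed

lemma A_mod_add: "a : A_mod ==> b : A_mod ==> (%ep. a ep + b ep) : A_mod"
proof -
 assume "a : A_mod" "b : A_mod"
 then obtain p q where p: "p >= 0" "a : O[at_right 0](%ep. ep powr (- p))"
  and q: "q >= 0" "b : O[at_right 0](%ep. ep powr (- q))"
  unfolding A_mod_def by blast
 have "a : O[at_right 0](%ep. ep powr (- (p + q)))"
  using p(2) powr_bigo_mono[of "-(p + q)" "-p"] q(1) landau_o.big_trans by fastforce
 moreover have "b : O[at_right 0](%ep. ep powr (- (p + q)))"
  using q(2) powr_bigo_mono[of "-(p + q)" "-q"] p(1) landau_o.big_trans by fastforce
 ultimately show ?thesis unfolding A_mod_def using p q
  by (auto intro!: exI[of _ "p + q"] intro: sum_in_bigo)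
qed

lemma A_mod_mult: "a : A_mod ==> b : A_mod ==> (%ep. a ep * b ep) : A_mod"
proof -
 assume "a : A_mod" "b : A_mod"
 then obtain p q where p: "p >= 0" "a : O[at_right 0](%ep. ep powr (- p))"
  and q: "q >= 0" "b : O[at_right 0](%ep. ep powr (- q))"
  unfolding A_mod_def by blast
 have "(%ep. a ep * b ep) : O[at_right 0](%ep. ep powr (- p) * ep powr (- q))"
  using p q by (intro landau_o.big.mult)
 then have "(%ep. a ep * b ep) : O[at_right 0](%ep. ep powr (- (p + q)))"
  by (simp add: powr_add[symmetric])
 then show ?thesis unfolding A_mod_def using p q
  by (intro CollectI exI[of _ "p + q"]) auto
qed

lemma A_null_add: "a : A_null ==> b : A_null ==> (%ep. a ep + b ep) : A_null"
 unfolding A_null_def by (auto intro: sum_in_bigo)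

text \<open>The ideal property: for the target exponent \<open>q\<close> the null factor is used
  with exponent \<open>p + q\<close>, which pays for the growth \<open>- p\<close> of the moderate
  factor.\<close>

lemma A_mod_null_mult: "a : A_mod ==> b : A_null ==> (%ep. a ep * b ep) : A_null"
proof -
 assume "a : A_mod" and b: "b : A_null"
 then obtain p where p: "p >= 0" "a : O[at_right 0](%ep. ep powr (- p))"
  unfolding A_mod_def by blast
 have "(%ep. a ep * b ep) : O[at_right 0](%ep. ep powr q)" if "q >= 0" for q
 proof -
  have "b : O[at_right 0](%ep. ep powr (p + q))" using b that p unfolding A_null_def by simp
  then have "(%ep. a ep * b ep) : O[at_right 0](%ep. ep powr (- p) * ep powr (p + q))"
   using p by (intro landau_o.big.mult)
  then show ?thesis by (simp add: powr_add[symmetric])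
 qed
 then show ?thesis unfolding A_null_def by blast
qed

lemma A_null_cmult: "b : A_null ==> (%ep. k * b ep) : A_null"
 using A_mod_null_mult[OF A_mod_const] .

lemma A_null_le:
 assumes "b : A_null" "\<forall>\<^sub>F ep in at_right 0. \<bar>a ep\<bar> <= b ep"
 shows "a : A_null"
proof -
 have "a : O[at_right 0](b)"
  by (rule bigoI[of _ 1], rule eventually_mono[OF assms(2)]) auto
 with assms(1) show ?thesis unfolding A_null_def using landau_o.big_trans by blast
qed

lemma A_mod_le:
 assumes "b : A_mod" "\<forall>\<^sub>F ep in at_right 0. \<bar>a ep\<bar> <= b ep"
 shows "a : A_mod"
proof -
 have "a : O[at_right 0](b)"
  by (rule bigoI[of _ 1], rule eventually_mono[OF assms(2)]) auto
 with assms(1) show ?thesis unfolding A_mod_def using landau_o.big_trans by blast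
qed

lemma A_null_tendsto: "b : A_null ==> (b \<longlongrightarrow> 0) (at_right 0)"
proof -
 assume "b : A_null"
 then have "b : O[at_right 0](%ep. ep powr 1)"
  unfolding A_null_def mem_Collect_eq by (rule allE[of _ 1]) simp
 then obtain c where c: "c > 0" "\<forall>\<^sub>F ep in at_right 0. norm (b ep) <= c * norm (ep powr 1)"
  by (elim landau_o.bigE)
 have "((%ep::real. c * \<bar>ep\<bar>) \<longlongrightarrow> 0) (at_right 0)" by (auto intro!: tendsto_eq_intros)
 then have "((%ep::real. c * norm (ep powr 1)) \<longlongrightarrow> 0) (at_right 0)"
  by (rule Lim_transform_eventually)
   (rule eventually_mono[OF eventually_at_right_less], simp)
 with c(2) show ?thesis by (rule Lim_null_comparison)
qed

section \<open>An abstract energy estimate by Steklov averages\<close>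

lemma integral_corner_continuous:
 fixes k :: "real => real => real"
 assumes k: "continuous_on UNIV (%(r, t). k r t)"
 shows "continuous_on {0..h} (%r. integral {c..c + h - r} (k r))"
proof -
 have kc: "continuous_on S (k r)" for S r
  by (rule continuous_on_subset[of UNIV])
   (auto intro!: continuous_on_compose2[OF k, of _ "%t. (r, t)", simplified] continuous_intros)
 define L where "L r = integral {c..c + h - r} (k r)" for r
 \<comment> \<open>Rescaling the inner variable to \<open>[0, 1]\<close> freezes the domain of
   integration, so that continuity of parameter integrals applies; at \<open>r = h\<close> both
   sides are 0.\<close>
 have Leq: "L r = integral (cbox 0 1) (%s. (h - r) * k r (c + s * (h - r)))" if "r : {0..h}" for r
 proof (cases "r = h")
  case False
  then have hr: "h - r > 0" using that by auto
  have "((%s. (h - r) *\<^sub>R k r (c + s * (h - r))) has_integral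
    (integral {c..c + 1 * (h - r)} (k r) - 0)) {0..1}"
  proof -
   have "((%s. (h - r) *\<^sub>R k r (c + s * (h - r))) has_integral
    (integral {(%s. c + s * (h - r)) 0..(%s. c + s * (h - r)) 1} (k r))) {0..1}"
    by (rule has_integral_substitution[of 0 1 "%s. c + s * (h - r)" "c" "c + (h - r)" "k r" "%_. h - r"])
     (use hr kc in \<open>auto intro!: derivative_eq_intros simp: mult_le_cancel_right1\<close>)
   then show ?thesis by simp
  qed
  then have "integral {0..1} (%s. (h - r) * k r (c + s * (h - r))) = L r"
   by (subst L_def) (auto dest!: integral_unique simp: algebra_simps)
  then show ?thesis by (simp add: box_real)
 qed (simp add: L_def)
 have "continuous_on {0..h} (%r. integral (cbox 0 1) (%s. (h - r) * k r (c + s * (h - r))))"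
  by (intro integral_continuous_on_param)
   (auto intro!: continuous_intros continuous_on_compose2[OF k, of _ "%(r, s). (r, c + s * (h - r))", simplified case_prod_unfold fst_conv snd_conv] simp: case_prod_unfold)
 then have "continuous_on {0..h} L" by (rule continuous_on_eq) (simp only: Leq)
 then show ?thesis by (simp add: L_def)
qed

text \<open>The triangle \<open>0 <= r\<close>, \<open>c <= t <= c + h - r\<close> has area
  \<open>h^2 / 2\<close>, so the factor makes the integral an average of \<open>k\<close> over a set
  that shrinks to the point \<open>(0, c)\<close>.\<close>

lemma integral_corner_tendsto:
 fixes k :: "real => real => real"
 assumes k: "continuous_on UNIV (%(r, t). k r t)"
 shows "((%h. 2 / h\<^sup>2 * integral {0..h} (%r. integral {c..c + h - r} (k r))) \<longlongrightarrow> k 0 c) (at_right 0)"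
proof (rule tendstoI)
 fix e :: real assume "e > 0"
 define et where "et = e / 3"
 have "et > 0" using \<open>e > 0\<close> by (simp add: et_def)
 have "isCont (%(r, t). k r t) (0, c)" using k by (simp add: continuous_on_eq_continuous_at)
 then obtain d where d: "d > 0" "!!q. dist q (0, c) < d ==> dist ((%(r, t). k r t) q) (k 0 c) < et"
  using \<open>et > 0\<close> unfolding continuous_at_eps_delta by fastforce
 have "\<forall>\<^sub>F h in at_right 0. h : {0<..<d / 2}"
  by (rule eventually_at_right_real) (use d in auto)
 then show "\<forall>\<^sub>F h in at_right 0.
   dist (2 / h\<^sup>2 * integral {0..h} (%r. integral {c..c + h - r} (k r))) (k 0 c) < e"
 proof eventually_elim
  case (elim h)
  then have h: "0 < h" "2 * h < d" by auto
  have kc: "continuous_on S (k r)" for S r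
   by (rule continuous_on_subset[of UNIV])
    (auto intro!: continuous_on_compose2[OF k, of _ "%t. (r, t)", simplified] continuous_intros)
  have near: "\<bar>k r t - k 0 c\<bar> <= et" if "r : {0..h}" "t : {c..c + h}" for r t
  proof -
   have "dist (r, t) (0, c) <= \<bar>r\<bar> + \<bar>t - c\<bar>"
    unfolding dist_Pair_Pair dist_real_def using sqrt_sum_squares_le_sum_abs[of r "t - c"] by simp
   also have "\<dots> < d" using that h by auto
   finally show ?thesis using d(2)[of "(r, t)"] by (simp add: dist_real_def)
  qed
  define L where "L r = integral {c..c + h - r} (k r)" for r
  have Lb: "\<bar>L r - k 0 c * (h - r)\<bar> <= et * h" if r: "r : {0..h}" for r
  proof -
   have "L r - k 0 c * (h - r) = integral {c..c + h - r} (%t. k r t - k 0 c)"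
    unfolding L_def using r kc by (subst integral_diff) (auto intro!: integrable_continuous_real)
   also have "\<bar>\<dots>\<bar> <= et * (c + h - r - c)"
    unfolding real_norm_def[symmetric] using r near[OF r] kc
    by (intro integral_bound continuous_intros) auto
   also have "\<dots> <= et * h" using r \<open>et > 0\<close> by simp
   finally show ?thesis .
  qed
  have "continuous_on {0..h} L" unfolding L_def by (rule integral_corner_continuous[OF k])
  then have Li: "L integrable_on {0..h}" by (rule integrable_continuous_real)
  have lin: "((%r. k 0 c * (h - r)) has_integral (k 0 c * h\<^sup>2 / 2)) {0..h}"
  proof -
   have "((%r. k 0 c * (h - r)) has_integral
     ((%r. k 0 c * (h * r - r\<^sup>2 / 2)) h - (%r. k 0 c * (h * r - r\<^sup>2 / 2)) 0)) {0..h}"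
    by (rule fundamental_theorem_of_calculus)
     (use h in \<open>auto intro!: derivative_eq_intros simp: has_real_derivative_iff_has_vector_derivative[symmetric]\<close>)
   then show ?thesis by (simp add: power2_eq_square algebra_simps)
  qed
  have "\<bar>integral {0..h} L - k 0 c * h\<^sup>2 / 2\<bar> = \<bar>integral {0..h} (%r. L r - k 0 c * (h - r))\<bar>"
   using integral_diff[OF Li has_integral_integrable[OF lin]] integral_unique[OF lin] by (simp only:)
  also have "\<dots> <= et * h * (h - 0)"
   unfolding real_norm_def[symmetric]
   using h Lb \<open>continuous_on {0..h} L\<close> by (intro integral_bound continuous_intros) auto
  finally have "\<bar>integral {0..h} L - k 0 c * h\<^sup>2 / 2\<bar> <= et * h\<^sup>2" by (simp add: power2_eq_square)
  then have "2 / h\<^sup>2 * \<bar>integral {0..h} L - k 0 c * h\<^sup>2 / 2\<bar> <= 2 / h\<^sup>2 * (et * h\<^sup>2)"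
   by (rule mult_left_mono) simp
  moreover have "2 / h\<^sup>2 * \<bar>integral {0..h} L - k 0 c * h\<^sup>2 / 2\<bar> = \<bar>2 / h\<^sup>2 * integral {0..h} L - k 0 c\<bar>"
  proof -
   have "2 / h\<^sup>2 * (integral {0..h} L - k 0 c * h\<^sup>2 / 2) = 2 / h\<^sup>2 * integral {0..h} L - k 0 c"
    using h by (simp add: field_simps)
   moreover have "2 / h\<^sup>2 * \<bar>integral {0..h} L - k 0 c * h\<^sup>2 / 2\<bar> = \<bar>2 / h\<^sup>2 * (integral {0..h} L - k 0 c * h\<^sup>2 / 2)\<bar>"
    unfolding abs_mult by simp
   ultimately show ?thesis by simp
  qed
  ultimately have "\<bar>2 / h\<^sup>2 * integral {0..h} L - k 0 c\<bar> <= 2 * et" using h by simp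
  also have "\<dots> < e" using \<open>e > 0\<close> by (simp add: et_def)
  finally show ?case by (simp add: dist_real_def L_def[abs_def])
 qed
qed

text \<open>A discrete form of integrating the derivative of \<open>|Z|^2\<close>. Substituting
  \<open>s = t + h - r\<close> in the term with \<open>Z (t + h)\<close> and
  \<open>s = t + r\<close> in the term with \<open>Z t\<close> turns the integrand into
  \<open>k r (t + h - r) - k r t\<close>. For fixed \<open>r\<close> this is a shift of
  \<open>k r\<close> minus \<open>k r\<close>, so after exchanging the integrals the
  \<open>t\<close>-integral leaves only the two corner pieces at \<open>b\<close> and at 0.\<close>

lemma steklov_swap:
 fixes Z :: "real => 'h::real_inner"
 assumes Z: "continuous_on UNIV Z" and h: "h > 0" and b: "b >= 0"
 defines "k \<equiv> %r t. Z t \<bullet> Z (t + r)"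
 shows "integral {0..b} (%t. integral {t..t + h} (%s. Z s \<bullet> (Z (t + h) - Z t)))
  = integral {0..h} (%r. integral {b..b + h - r} (k r)) - integral {0..h} (%r. integral {0..0 + h - r} (k r))"
  (is "?lhs = ?rhs")
  and "continuous_on {0..b} (%t. integral {t..t + h} (%s. Z s \<bullet> (Z (t + h) - Z t)))"
proof -
 note Zc = continuous_on_compose2[OF Z _ subset_UNIV]
 have shift: "integral {c..d} (%t. f (t + a)) = integral {c + a..d + a} f"
  if "continuous_on UNIV f" for f :: "real => real" and a c d
  using integral_shift[of c a d f] that continuous_on_subset[OF that subset_UNIV] by (simp add: o_def)
 have q: "integral {t..t + h} (%s. Z s \<bullet> (Z (t + h) - Z t))
   = integral {0..h} (%r. k r (t + h - r) - k r t)" for t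
 proof -
  have "integral {t..t + h} (%s. Z s \<bullet> (Z (t + h) - Z t))
    = integral {t..t + h} (%s. Z s \<bullet> Z (t + h)) - integral {t..t + h} (%s. Z s \<bullet> Z t)"
   unfolding inner_diff_right
   by (intro integral_diff integrable_continuous_real continuous_intros Zc)
  moreover have "integral {t..t + h} (%s. Z s \<bullet> Z t) = integral {0..h} (%r. k r t)"
   using shift[of "%s. Z s \<bullet> Z t" 0 h t]
   by (simp add: k_def inner_commute add.commute continuous_intros Zc)
  moreover have "integral {t..t + h} (%s. Z s \<bullet> Z (t + h)) = integral {0..h} (%r. k r (t + h - r))"
  proof -
   have "integral {0..h} (%r. k r (t + h - r)) = integral {-h..-0} (%r. k (-r) (t + h + r))"
    using Henstock_Kurzweil_Integration.integral_reflect_real[of h 0 "%r. k r (t + h - r)"] by (simp add: algebra_simps)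
   also have "\<dots> = integral {-h..0} (%r. (%s. Z s \<bullet> Z (t + h)) (r + (t + h)))"
    by (simp add: k_def algebra_simps)
   also have "\<dots> = integral {t..t + h} (%s. Z s \<bullet> Z (t + h))"
    by (subst shift) (auto intro!: continuous_intros Zc)
   finally show ?thesis by simp
  qed
  ultimately show ?thesis
   by (simp add: integral_diff[symmetric] k_def integrable_continuous_real continuous_intros Zc)
 qed
 have kc: "continuous_on S (k r)" for S r unfolding k_def by (intro continuous_intros Zc)
 have k2: "continuous_on S (%(r, t). k r t)" for S
  unfolding k_def case_prod_unfold by (intro continuous_intros Zc)
 have c2: "continuous_on S (%(t, r). k r (t + h - r) - k r t)" for S
  unfolding k_def case_prod_unfold by (intro continuous_intros Zc)
 have q': "(%t. integral {t..t + h} (%s. Z s \<bullet> (Z (t + h) - Z t)))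
   = (%t. integral (cbox 0 h) (%r. k r (t + h - r) - k r t))"
  by (simp add: q box_real)
 show "continuous_on {0..b} (%t. integral {t..t + h} (%s. Z s \<bullet> (Z (t + h) - Z t)))"
  unfolding q' by (intro integral_continuous_on_param c2)
 have "?lhs = integral {0..b} (%t. integral {0..h} (%r. k r (t + h - r) - k r t))"
  by (simp add: q)
 also have "\<dots> = integral {0..h} (%r. integral {0..b} (%t. k r (t + h - r) - k r t))"
  using integral_swap_continuous[OF c2, of 0 b 0 h] by (simp add: box_real)
 also have "\<dots> = integral {0..h} (%r. integral {b..b + h - r} (k r) - integral {0..0 + h - r} (k r))"
 proof (rule integral_cong)
  fix r assume r: "r : {0..h}"
  have "integral {0..b} (%t. k r (t + h - r) - k r t)
   = integral {0..b} (%t. k r (t + (h - r))) - integral {0..b} (k r)"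
   using kc by (simp add: add_diff_eq)
    (intro integral_diff integrable_continuous_real continuous_on_compose2[OF kc[of UNIV]] continuous_intros, auto)
  also have "integral {0..b} (%t. k r (t + (h - r))) = integral {h - r..b + h - r} (k r)"
   using shift[OF kc, of 0 b r "h - r"] by (simp add: algebra_simps)
  also have "integral {h - r..b + h - r} (k r) - integral {0..b} (k r)
    = integral {b..b + h - r} (k r) - integral {0..0 + h - r} (k r)"
  proof -
   have ki: "k r integrable_on {p..p'}" for p p' by (intro integrable_continuous_real kc)
   have "integral {0..h - r} (k r) + integral {h - r..b + h - r} (k r) = integral {0..b + h - r} (k r)"
    by (rule hk_combine) (use r b ki in auto)
   moreover have "integral {0..b} (k r) + integral {b..b + h - r} (k r) = integral {0..b + h - r} (k r)"
    by (rule hk_combine) (use r b ki in auto)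
   ultimately show ?thesis by simp
  qed
  finally show "integral {0..b} (%t. k r (t + h - r) - k r t)
   = integral {b..b + h - r} (k r) - integral {0..0 + h - r} (k r)" .
 qed
 also have "\<dots> = ?rhs"
 proof (rule integral_diff)
  have "(%r. integral {c..c + h - r} (k r)) integrable_on {0..h}" for c
   by (intro integrable_continuous_real integral_corner_continuous k2)
  then show "(%r. integral {b..b + h - r} (k r)) integrable_on {0..h}"
   "(%r. integral {0..0 + h - r} (k r)) integrable_on {0..h}" by blast+
 qed
 finally show "?lhs = ?rhs" .
qed

text \<open>Testing the equation on \<open>[t, t + h]\<close> with the increment of \<open>z\<close>
  gives half the \<open>t\<close>-derivative of \<open>|z (t + h) - z t|^2\<close> plus the term
  treated in \<open>steklov_swap\<close>. Integration over \<open>[0, b]\<close>, division by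
  \<open>h^2\<close> and the limit of \<open>h\<close> to 0 give the inequality. \<open>D\<close>
  stands for the admissible test functions paired with their images in the elliptic form,
  \<open>Ga\<close> for the accumulated force, and \<open>b < T\<close> leaves room for forward
  increments.\<close>

lemma energy_core:
 fixes z y Z :: "real => 'h::real_inner"
 assumes b: "0 <= b" "b < T"
  and Z: "continuous_on UNIV Z" and Ga: "continuous_on UNIV Ga"
  and y: "continuous_on {0..T} y"
  and dz: "!!t. t : {0..T} ==> (z has_vector_derivative y t) (at t within {0..T})"
  and D: "!!s t. s : {0..T} ==> t : {0..T} ==> (z s - z t, Z s - Z t) : D"
  and eq: "!!v V t1 t2. (v, V) : D ==> 0 <= t1 ==> t1 <= t2 ==> t2 <= T ==>
   (y t2 - y t1) \<bullet> v + integral {t1..t2} (%s. Z s \<bullet> V) <= norm v * (Ga t2 - Ga t1)"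
  and mono: "!!s t. 0 <= s ==> s <= t ==> t <= T ==> Ga s <= Ga t"
  and M: "!!t. t : {0..T} ==> norm (y t) <= M"
 shows "(norm (y b))\<^sup>2 + (norm (Z b))\<^sup>2 <= (norm (y 0))\<^sup>2 + (norm (Z 0))\<^sup>2 + 2 * M * (Ga b - Ga 0)"
proof -
 define k where "k r t = Z t \<bullet> Z (t + r)" for r t
 define P where "P h c = integral {0..h} (%r. integral {c..c + h - r} (k r))" for h c
 define f where "f h t = (norm (z (t + h) - z t))\<^sup>2" for h t
 have k2: "continuous_on S (%(r, t). k r t)" for S
  unfolding k_def case_prod_unfold by (intro continuous_intros continuous_on_compose2[OF Z _ subset_UNIV])
 have k0: "k 0 c = (norm (Z c))\<^sup>2" for c by (simp add: k_def power2_norm_eq_inner)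
 have lim_P: "((%h. 2 / h\<^sup>2 * P h c) \<longlongrightarrow> (norm (Z c))\<^sup>2) (at_right 0)" for c
  unfolding P_def k0[symmetric] by (rule integral_corner_tendsto[OF k2])
 have lim_f: "((%h. f h c / h\<^sup>2) \<longlongrightarrow> (norm (y c))\<^sup>2) (at_right 0)" if c: "0 <= c" "c < T" for c
 proof -
  have "(z has_vector_derivative y c) (at c within {c..T})"
   by (rule has_vector_derivative_within_subset[OF dz]) (use c in auto)
  then have "((%t. (1 / norm (t - c)) *\<^sub>R (z t - (z c + (t - c) *\<^sub>R y c))) \<longlongrightarrow> 0) (at_right c)"
   using c by (simp add: has_vector_derivative_def has_derivative_within at_within_Icc_at_right)
  then have "((%t. (1 / norm (t - c)) *\<^sub>R (z t - (z c + (t - c) *\<^sub>R y c)) + y c) \<longlongrightarrow> 0 + y c) (at_right c)"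
   by (intro tendsto_intros)
  then have "((%t. (1 / norm (t - c)) *\<^sub>R (z t - (z c + (t - c) *\<^sub>R y c)) + y c) \<longlongrightarrow> y c) (at_right c)"
   by simp
  then have "((%t. (z t - z c) /\<^sub>R (t - c)) \<longlongrightarrow> y c) (at_right c)"
   by (rule Lim_transform_eventually)
    (rule eventually_mono[OF eventually_at_right_less],
     simp add: scaleR_diff_right scaleR_add_right divide_inverse)
  then have "((%h. (z (c + h) - z c) /\<^sub>R h) \<longlongrightarrow> y c) (at_right 0)"
   by (subst (asm) filterlim_at_right_to_0) (simp add: add.commute)
  then have "((%h. (norm ((z (c + h) - z c) /\<^sub>R h))\<^sup>2) \<longlongrightarrow> (norm (y c))\<^sup>2) (at_right 0)"
   by (intro tendsto_intros)
  then show ?thesis by (simp add: f_def power_mult_distrib power_divide divide_inverse mult.commute power_inverse)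
 qed
 have lim_Ga: "((%h. integral {c..c + h} Ga / h) \<longlongrightarrow> Ga c) (at_right 0)" for c
 proof -
  have "((%x. integral {c..x} Ga) has_vector_derivative Ga c) (at c within {c..c + 1})"
   by (rule integral_has_vector_derivative[OF continuous_on_subset[OF Ga]]) auto
  then have "((%x. integral {c..x} Ga) has_field_derivative Ga c) (at c within {c..c + 1})"
   by (simp add: has_real_derivative_iff_has_vector_derivative)
  then have "((%x. integral {c..x} Ga / (x - c)) \<longlongrightarrow> Ga c) (at_right c)"
   by (simp add: has_field_derivative_iff at_within_Icc_at_right)
  then show ?thesis by (subst (asm) filterlim_at_right_to_0) (simp add: add.commute)
 qed
 have step: "(f h b / h\<^sup>2 - f h 0 / h\<^sup>2) + (2 / h\<^sup>2 * P h b - 2 / h\<^sup>2 * P h 0)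
   <= 2 * M * (integral {b..b + h} Ga / h - integral {0..0 + h} Ga / h)"
  if h: "0 < h" "h < T - b" for h
 proof -
  define q where "q t = integral {t..t + h} (%s. Z s \<bullet> (Z (t + h) - Z t))" for t
  have qP: "integral {0..b} q = P h b - P h 0" and qc: "continuous_on {0..b} q"
   unfolding P_def k_def[abs_def] q_def[abs_def] using steklov_swap[OF Z h(1) b(1)] by blast+
  define f' where "f' t = 2 * ((y (t + h) - y t) \<bullet> (z (t + h) - z t))" for t
  have df: "(f h has_real_derivative f' t) (at t within {0..b})" if t: "t : {0..b}" for t
  proof -
   have 1: "(z has_vector_derivative y t) (at t within {0..b})"
    by (rule has_vector_derivative_within_subset[OF dz]) (use t b in auto)
   have "((z \<circ> (%t. t + h)) has_vector_derivative (1 *\<^sub>R y (t + h))) (at t within {0..b})"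
   proof (rule vector_diff_chain_within)
    show "((%t. t + h) has_vector_derivative 1) (at t within {0..b})"
     by (auto intro!: derivative_eq_intros)
    show "(z has_vector_derivative y (t + h)) (at (t + h) within (%t. t + h) ` {0..b})"
     by (rule has_vector_derivative_within_subset[OF dz]) (use t b h in auto)
   qed
   then have 2: "((%t. z (t + h)) has_vector_derivative y (t + h)) (at t within {0..b})"
    by (simp add: o_def)
   have "((%t. (z (t + h) - z t) \<bullet> (z (t + h) - z t)) has_vector_derivative
     ((z (t + h) - z t) \<bullet> (y (t + h) - y t) + (y (t + h) - y t) \<bullet> (z (t + h) - z t))) (at t within {0..b})"
    using has_vector_derivative_diff[OF 2 1] bounded_bilinear.has_vector_derivative[OF bounded_bilinear_inner] by blast
   then show ?thesis
    by (simp add: f_def[abs_def] f'_def power2_norm_eq_inner has_real_derivative_iff_has_vector_derivative inner_commute)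
  qed
  have f'i: "(f' has_integral (f h b - f h 0)) {0..b}"
   by (rule fundamental_theorem_of_calculus[OF b(1)])
    (use df in \<open>simp add: has_real_derivative_iff_has_vector_derivative\<close>)
  have Gai: "Ga integrable_on {p..p'}" for p p'
   by (intro integrable_continuous_real continuous_on_subset[OF Ga]) auto
  have Gac: "continuous_on {0..b} (%t. Ga (t + h) - Ga t)"
   by (intro continuous_intros continuous_on_compose2[OF Ga _ subset_UNIV])
  have bound: "f' t <= 2 * (h * M) * (Ga (t + h) - Ga t) - 2 * q t" if t: "t : {0..b}" for t
  proof -
   let ?v = "z (t + h) - z t" and ?V = "Z (t + h) - Z t"
   have "(y (t + h) - y t) \<bullet> ?v + integral {t..t + h} (%s. Z s \<bullet> ?V) <= norm ?v * (Ga (t + h) - Ga t)"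
    by (rule eq[OF D]) (use t h b in auto)
   \<comment> \<open>This is where the bound on the velocity enters. Its factor \<open>h\<close>,
     together with the factor \<open>h\<close> gained by averaging \<open>Ga\<close> over an
     interval of length \<open>h\<close>, matches the later division by \<open>h^2\<close>.\<close>
   moreover have "norm ?v <= h * M"
   proof -
    have "norm (z (t + h) - z t) <= M * norm (t + h - t)"
     by (rule differentiable_bound[of "{0..T}" z "%t s. s *\<^sub>R y t"])
     (use M dz t h b in \<open>auto simp: has_vector_derivative_def onorm_scaleR_left onorm_id bounded_linear_ident\<close>)
    then show ?thesis using h by (simp add: mult.commute)
   qed
   moreover have "Ga (t + h) - Ga t >= 0" using mono[of t "t + h"] t h b by auto
   ultimately have "(y (t + h) - y t) \<bullet> ?v + q t <= (h * M) * (Ga (t + h) - Ga t)"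
    unfolding q_def by (meson mult_right_mono order_trans)
   then show ?thesis by (simp add: f'_def)
  qed
  have gi: "((%t. Ga (t + h) - Ga t) has_integral (integral {b..b + h} Ga - integral {0..0 + h} Ga)) {0..b}"
  proof -
   have "integral {0..b} (%t. Ga (t + h) - Ga t) = integral {0..b} (%t. Ga (t + h)) - integral {0..b} Ga"
    by (intro integral_diff integrable_continuous_real continuous_intros continuous_on_compose2[OF Ga _ subset_UNIV])
   also have "integral {0..b} (%t. Ga (t + h)) = integral {h..b + h} Ga"
    using integral_shift[of 0 h b Ga] continuous_on_subset[OF Ga subset_UNIV] by (simp add: o_def)
   also have "integral {h..b + h} Ga - integral {0..b} Ga = integral {b..b + h} Ga - integral {0..0 + h} Ga"
   proof -
    have "integral {0..h} Ga + integral {h..b + h} Ga = integral {0..b + h} Ga"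
     by (rule hk_combine) (use h b Gai in auto)
    moreover have "integral {0..b} Ga + integral {b..b + h} Ga = integral {0..b + h} Ga"
     by (rule hk_combine) (use h b Gai in auto)
    ultimately show ?thesis by simp
   qed
   finally show ?thesis using integrable_continuous_real[OF Gac] by (simp add: has_integral_integral)
  qed
  have "f h b - f h 0 <= 2 * (h * M) * (integral {b..b + h} Ga - integral {0..0 + h} Ga) - 2 * integral {0..b} q"
  proof (rule has_integral_le[OF f'i])
   show "((%t. 2 * (h * M) * (Ga (t + h) - Ga t) - 2 * q t) has_integral
    2 * (h * M) * (integral {b..b + h} Ga - integral {0..0 + h} Ga) - 2 * integral {0..b} q) {0..b}"
    using qc by (intro has_integral_diff has_integral_mult_right gi integrable_integral integrable_continuous_real)
  qed (use bound in auto)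
  then have "((f h b - f h 0) + 2 * (P h b - P h 0)) / h\<^sup>2
    <= (2 * (h * M) * (integral {b..b + h} Ga - integral {0..0 + h} Ga)) / h\<^sup>2"
   by (intro divide_right_mono) (auto simp: qP)
  also have "\<dots> = 2 * M * (integral {b..b + h} Ga / h - integral {0..0 + h} Ga / h)"
   using h by (simp add: field_simps power2_eq_square)
  finally show ?thesis by (simp add: add_divide_distrib diff_divide_distrib algebra_simps)
 qed
 have "((norm (y b))\<^sup>2 - (norm (y 0))\<^sup>2) + ((norm (Z b))\<^sup>2 - (norm (Z 0))\<^sup>2) <= 2 * M * (Ga b - Ga 0)"
 proof (rule tendsto_le[OF trivial_limit_at_right_real])
  show "((%h. 2 * M * (integral {b..b + h} Ga / h - integral {0..0 + h} Ga / h))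
    \<longlongrightarrow> 2 * M * (Ga b - Ga 0)) (at_right 0)"
   by (intro tendsto_intros lim_Ga)
  show "((%h. (f h b / h\<^sup>2 - f h 0 / h\<^sup>2) + (2 / h\<^sup>2 * P h b - 2 / h\<^sup>2 * P h 0)) \<longlongrightarrow>
   ((norm (y b))\<^sup>2 - (norm (y 0))\<^sup>2) + ((norm (Z b))\<^sup>2 - (norm (Z 0))\<^sup>2)) (at_right 0)"
   using b by (intro tendsto_intros lim_f lim_P) auto
  have "\<forall>\<^sub>F h in at_right 0. h : {0<..<T - b}"
   by (rule eventually_at_right_real) (use b in auto)
  then show "\<forall>\<^sub>F h in at_right 0. (f h b / h\<^sup>2 - f h 0 / h\<^sup>2) + (2 / h\<^sup>2 * P h b - 2 / h\<^sup>2 * P h 0)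
   <= 2 * M * (integral {b..b + h} Ga / h - integral {0..0 + h} Ga / h)"
   by eventually_elim (use step in auto)
 qed
 then show ?thesis by simp
qed

text \<open>Removes the a priori bound \<open>M\<close> of \<open>energy_core\<close> and the memory
  term in one stroke, by a weighted maximum norm in the role of Gronwall's lemma. With
  \<open>N^2\<close> the maximum of \<open>exp (- (2 * l * t)) * E t\<close>, both \<open>y\<close>
  and \<open>Z\<close> are at most \<open>exp (l * t) * N\<close>; at the maximising time
  \<open>ta\<close> the memory term then contributes at most \<open>2 * C / l * N^2\<close>, and
  \<open>l\<close> is chosen so that this is at most half of \<open>N^2\<close>.\<close>

lemma energy_estimate:
 fixes z y Z :: "real => 'h::real_inner"
 assumes T: "0 < T"
  and Z: "continuous_on {0..T} Z" and y: "continuous_on {0..T} y" and B: "continuous_on {0..T} B"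
  and C: "C >= 0"
  and dz: "!!t. t : {0..T} ==> (z has_vector_derivative y t) (at t within {0..T})"
  and D: "!!s t. s : {0..T} ==> t : {0..T} ==> (z s - z t, Z s - Z t) : D"
  and eq: "!!v V t1 t2. (v, V) : D ==> 0 <= t1 ==> t1 <= t2 ==> t2 <= T ==>
   (y t2 - y t1) \<bullet> v + integral {t1..t2} (%s. Z s \<bullet> V)
    <= norm v * (B t2 - B t1 + C * integral {t1..t2} (%s. norm (Z s)))"
  and mono: "!!s t. 0 <= s ==> s <= t ==> t <= T ==> B s <= B t"
  and t: "t : {0..T}"
 shows "(norm (y t))\<^sup>2 + (norm (Z t))\<^sup>2
  <= exp (2 * (4 * C + 1) * T) * (4 * ((norm (y 0))\<^sup>2 + (norm (Z 0))\<^sup>2) + 16 * (B T - B 0)\<^sup>2)"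
proof -
 define E where "E t = (norm (y t))\<^sup>2 + (norm (Z t))\<^sup>2" for t
 \<comment> \<open>\<open>energy_core\<close> takes \<open>Z\<close> and \<open>Ga\<close> on the
   whole line; composing with this clamp onto \<open>[0, T]\<close> extends them continuously by
   their end values.\<close>
 define cl where "cl t = max 0 (min t T)" for t
 have cl: "cl t : {0..T}" "t : {0..T} ==> cl t = t" for t using T by (auto simp: cl_def)
 have clc: "continuous_on S cl" for S unfolding cl_def[abs_def] by (intro continuous_intros)
 define G where "G t = B (cl t) + C * integral {0..cl t} (%s. norm (Z s))" for t
 define Z' where "Z' t = Z (cl t)" for t
 have nZ: "continuous_on {0..T} (%s. norm (Z s))" by (intro continuous_intros Z)
 have Gc: "continuous_on UNIV G"
 proof -
  have "continuous_on {0..T} (%t. integral {0..t} (%s. norm (Z s)))"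
   by (intro indefinite_integral_continuous_1 integrable_continuous_real nZ)
  then have "continuous_on UNIV (%t. integral {0..cl t} (%s. norm (Z s)))"
   by (rule continuous_on_compose2[OF _ clc]) (use cl in auto)
  moreover have "continuous_on UNIV (%t. B (cl t))"
   by (rule continuous_on_compose2[OF B clc]) (use cl in auto)
  ultimately show ?thesis unfolding G_def[abs_def] by (intro continuous_intros)
 qed
 have Zc: "continuous_on UNIV Z'"
  unfolding Z'_def[abs_def] by (rule continuous_on_compose2[OF Z clc]) (use cl in auto)
 have Gdiff: "G t2 - G t1 = B t2 - B t1 + C * integral {t1..t2} (%s. norm (Z s))"
  if "0 <= t1" "t1 <= t2" "t2 <= T" for t1 t2
 proof -
  have "integral {0..t1} (%s. norm (Z s)) + integral {t1..t2} (%s. norm (Z s)) = integral {0..t2} (%s. norm (Z s))"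
   by (rule hk_combine)
    (use that in \<open>auto intro!: integrable_continuous_real continuous_on_subset[OF nZ]\<close>)
  from this[symmetric] show ?thesis using that cl(2) by (simp add: G_def algebra_simps)
 qed
 \<comment> \<open>Forward increments need room, so \<open>energy_core\<close> is applied on
   \<open>[0, b]\<close> up to times \<open>a < b\<close>, and then \<open>a\<close> tends to
   \<open>b\<close>. In this way \<open>M\<close> has to bound \<open>y\<close> only up to time
   \<open>b\<close>, which is essential for the choice \<open>b = ta\<close>.\<close>
 have core: "E b <= E 0 + 2 * M * (G b - G 0)"
  if b: "0 <= b" "b <= T" and M: "!!t. t : {0..b} ==> norm (y t) <= M" for b M
 proof (cases "b = 0")
  case False
  then have b0: "0 < b" using b by simp
  have *: "E a <= E 0 + 2 * M * (G a - G 0)" if a: "0 <= a" "a < b" for a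
  proof -
   have "(norm (y a))\<^sup>2 + (norm (Z' a))\<^sup>2 <= (norm (y 0))\<^sup>2 + (norm (Z' 0))\<^sup>2 + 2 * M * (G a - G 0)"
   proof (rule energy_core[OF a Zc Gc _ _ _ _ _ M])
    show "continuous_on {0..b} y" by (rule continuous_on_subset[OF y]) (use b in auto)
    show "(z has_vector_derivative y t) (at t within {0..b})" if "t : {0..b}" for t
     by (rule has_vector_derivative_within_subset[OF dz]) (use that b in auto)
    show "(z s - z t, Z' s - Z' t) : D" if "s : {0..b}" "t : {0..b}" for s t
     using D[of s t] that b cl(2) by (auto simp: Z'_def)
    show "(y t2 - y t1) \<bullet> v + integral {t1..t2} (%s. Z' s \<bullet> V) <= norm v * (G t2 - G t1)"
     if "(v, V) : D" "0 <= t1" "t1 <= t2" "t2 <= b" for v V t1 t2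
    proof -
     have "integral {t1..t2} (%s. Z' s \<bullet> V) = integral {t1..t2} (%s. Z s \<bullet> V)"
     by (rule integral_cong) (use that b cl(2) in \<open>auto simp: Z'_def\<close>)
     then show ?thesis using eq[OF that(1-3)] that b by (simp add: Gdiff)
    qed
    show "G s <= G t" if "0 <= s" "s <= t" "t <= b" for s t
    proof -
     have "G t - G s = B t - B s + C * integral {s..t} (%s. norm (Z s))"
     using Gdiff that b by auto
     moreover have "integral {s..t} (%s. norm (Z s)) >= 0"
     by (rule integral_nonneg)
     (use that b in \<open>auto intro!: integrable_continuous_real continuous_on_subset[OF nZ]\<close>)
     ultimately show ?thesis using mono[of s t] that b C by (smt (verit) mult_nonneg_nonneg)
    qed
   qed auto
   then show ?thesis using a b cl(2) by (simp add: E_def Z'_def)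
  qed
  show ?thesis
  proof (rule tendsto_le[of "at_left b"])
   show "(E \<longlongrightarrow> E b) (at_left b)"
    by (rule continuous_on_Icc_at_leftD[OF _ b0], unfold E_def[abs_def])
     (use b in \<open>auto intro!: continuous_intros continuous_on_subset[OF y] continuous_on_subset[OF Z]\<close>)
   show "((%b. E 0 + 2 * M * (G b - G 0)) \<longlongrightarrow> E 0 + 2 * M * (G b - G 0)) (at_left b)"
    by (rule continuous_on_Icc_at_leftD[OF _ b0])
     (auto intro!: continuous_intros continuous_on_subset[OF Gc])
   have "\<forall>\<^sub>F a in at_left b. a : {0<..<b}" by (rule eventually_at_left_real[OF b0])
   then show "\<forall>\<^sub>F a in at_left b. E a <= E 0 + 2 * M * (G a - G 0)"
    by eventually_elim (use * in auto)
  qed (use b0 in simp)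
 qed simp
 \<comment> \<open>\<open>4 * C\<close> makes \<open>2 * C / l\<close> at most one half; the summand
   1 keeps \<open>l\<close> positive for \<open>C = 0\<close>.\<close>
 define l where "l = 4 * C + 1"
 have l: "l > 0" "2 * C / l <= 1 / 2" using C by (auto simp: l_def field_simps)
 have "continuous_on {0..T} (%t. exp (- (2 * l * t)) * E t)"
  unfolding E_def[abs_def] by (intro continuous_intros y Z)
 then obtain ta where ta: "ta : {0..T}" "!!t. t : {0..T} ==> exp (- (2 * l * t)) * E t <= exp (- (2 * l * ta)) * E ta"
  using continuous_attains_sup[of "{0..T}" "%t. exp (- (2 * l * t)) * E t"] T by fastforce
 define N where "N = sqrt (exp (- (2 * l * ta)) * E ta)"
 have E0: "E t >= 0" for t by (simp add: E_def)
 have N: "N >= 0" "N\<^sup>2 = exp (- (2 * l * ta)) * E ta" using E0[of ta] by (auto simp: N_def)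
 have Eb: "E t <= (exp (l * t) * N)\<^sup>2" if "t : {0..T}" for t
 proof -
  have "exp (2 * l * t) * (exp (- (2 * l * t)) * E t) <= exp (2 * l * t) * N\<^sup>2"
   using ta(2)[OF that] N by (intro mult_left_mono) auto
  then show ?thesis
   by (simp add: power_mult_distrib exp_double[symmetric] mult.assoc[symmetric] exp_add[symmetric])
 qed
 have nb: "norm (y t) <= exp (l * t) * N" "norm (Z t) <= exp (l * t) * N" if "t : {0..T}" for t
 proof -
  have a: "(norm (y t))\<^sup>2 <= (exp (l * t) * N)\<^sup>2" and b: "(norm (Z t))\<^sup>2 <= (exp (l * t) * N)\<^sup>2"
   using Eb[OF that] zero_le_power2[of "norm (y t)"] zero_le_power2[of "norm (Z t)"]
   unfolding E_def by linarith+
  have c: "0 <= exp (l * t) * N" using N by simp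
  show "norm (y t) <= exp (l * t) * N" by (rule power2_le_imp_le[OF a c])
  show "norm (Z t) <= exp (l * t) * N" by (rule power2_le_imp_le[OF b c])
 qed
 have "E ta <= E 0 + 2 * (exp (l * ta) * N) * (G ta - G 0)"
 proof (rule core)
  show "norm (y t) <= exp (l * ta) * N" if "t : {0..ta}" for t
   using that ta l by (intro order_trans[OF nb(1)] mult_right_mono N) auto
 qed (use ta in auto)
 also have "G ta - G 0 <= (B T - B 0) + C * (exp (l * ta) * N / l)"
 proof -
  have "((%s. exp (l * s) * N) has_integral ((%s. exp (l * s) * N / l) ta - (%s. exp (l * s) * N / l) 0)) {0..ta}"
   by (rule fundamental_theorem_of_calculus)
    (use ta l in \<open>auto intro!: derivative_eq_intros simp: has_real_derivative_iff_has_vector_derivative[symmetric]\<close>)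
  moreover have "((%s. norm (Z s)) has_integral integral {0..ta} (%s. norm (Z s))) {0..ta}"
   using ta by (auto intro!: integrable_integral integrable_continuous_real continuous_on_subset[OF nZ])
  ultimately have "integral {0..ta} (%s. norm (Z s)) <= exp (l * ta) * N / l - N / l"
   using nb(2) ta by (intro has_integral_le[where i = "integral {0..ta} (%s. norm (Z s))"]) auto
  also have "\<dots> <= exp (l * ta) * N / l" using N l by simp
  finally have "C * integral {0..ta} (%s. norm (Z s)) <= C * (exp (l * ta) * N / l)"
   using C by (rule mult_left_mono)
  moreover have "B ta <= B T" using mono ta by auto
  moreover have "G ta - G 0 = B ta - B 0 + C * integral {0..ta} (%s. norm (Z s))"
   using Gdiff[of 0 ta] ta by auto
  ultimately show ?thesis by linarith
 qed
 finally have 1: "E ta <= E 0 + 2 * (exp (l * ta) * N) * ((B T - B 0) + C * (exp (l * ta) * N / l))"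
  using N by (simp add: mult_left_mono)
 have "N\<^sup>2 <= E 0 + 2 * N * (B T - B 0) + N\<^sup>2 / 2"
 proof -
  have e: "exp (- (2 * l * ta)) <= 1" "exp (- (l * ta)) <= 1" using ta l by auto
  have ee: "exp (- (2 * l * ta)) * exp (l * ta) = exp (- (l * ta))" "exp (- (2 * l * ta)) * (exp (l * ta) * exp (l * ta)) = 1"
   by (simp_all add: exp_add[symmetric])
  have BT: "B T - B 0 >= 0" using mono[of 0 T] T by simp
  have "N\<^sup>2 <= exp (- (2 * l * ta)) * (E 0 + 2 * (exp (l * ta) * N) * ((B T - B 0) + C * (exp (l * ta) * N / l)))"
   using N(2) 1 by (simp add: mult_left_mono)
  also have "\<dots> = exp (- (2 * l * ta)) * E 0 + exp (- (2 * l * ta)) * exp (l * ta) * (2 * N * (B T - B 0))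
    + exp (- (2 * l * ta)) * (exp (l * ta) * exp (l * ta)) * ((2 * C / l) * N\<^sup>2)"
   by (simp add: algebra_simps power2_eq_square)
  also have "\<dots> = exp (- (2 * l * ta)) * E 0 + exp (- (l * ta)) * (2 * N * (B T - B 0)) + (2 * C / l) * N\<^sup>2"
   unfolding ee by simp
  also have "\<dots> <= 1 * E 0 + 1 * (2 * N * (B T - B 0)) + (1 / 2) * N\<^sup>2"
   using e l(2) N BT E0 by (intro add_mono mult_right_mono) auto
  finally show ?thesis by simp
 qed
 \<comment> \<open>Young's inequality, weighted so that a quarter of \<open>N^2\<close> survives on
   the left; multiplying by 4 produces the constants 4 and 16 of the statement.\<close>
 moreover have "2 * N * (B T - B 0) <= N\<^sup>2 / 4 + 4 * (B T - B 0)\<^sup>2"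
  using zero_le_power2[of "N / 2 - 2 * (B T - B 0)"] by (simp add: power2_eq_square algebra_simps)
 ultimately have "N\<^sup>2 <= 4 * E 0 + 16 * (B T - B 0)\<^sup>2" by linarith
 moreover have "E t <= exp (2 * l * T) * N\<^sup>2"
 proof -
  have "E t <= exp (2 * l * t) * N\<^sup>2"
   using Eb[OF t] by (simp add: power_mult_distrib exp_double[symmetric] mult.assoc)
  also have "\<dots> <= exp (2 * l * T) * N\<^sup>2" using t l by (intro mult_right_mono) auto
  finally show ?thesis .
 qed
 ultimately have "E t <= exp (2 * l * T) * (4 * E 0 + 16 * (B T - B 0)\<^sup>2)"
  by (meson exp_ge_zero mult_left_mono order_trans)
 then show ?thesis by (simp add: E_def l_def)
qed

section \<open>Sobolev and interpolation estimates on nice domains\<close>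

text \<open>
 What the Sobolev-type estimates below need of the domain: a bound of the supremum by finitely many
 \<open>L\<^sup>2\<close> norms of derivatives, a cone condition in measure, and room to move along coordinate axes.
\<close>

definition nice_dom :: "'a::euclidean_space set => bool" where
 "nice_dom Om \<longleftrightarrow> open Om \<and> convex Om \<and> bounded Om \<and>
   (\<exists>C\<ge>0. \<exists>ES. set ES \<subseteq> lists Basis \<and>
    (\<forall>f\<in>Hinf Om. \<forall>z\<in>Om. cmod (f z) <= C * (1 + (\<Sum>es\<leftarrow>ES. (L2norm Om (pdiffs es f))\<^sup>2)))) \<and>
   (\<exists>ka>0. \<exists>r0>0. \<forall>z\<in>Om. \<forall>r\<in>{0<..r0}. \<exists>S\<in>sets borel. S \<subseteq> Om \<inter> cball z r \<and>
    ka * r ^ DIM('a) <= measure lebesgue S) \<and>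
   (\<exists>et>0. \<forall>z\<in>Om. \<forall>e\<in>Basis. \<exists>\<sigma>\<in>{-1, 1}. \<forall>s\<in>{0..et}. z + (s * \<sigma>) *\<^sub>R e : Om)"

lemma nice_open: "nice_dom Om ==> open Om" and nice_convex: "nice_dom Om ==> convex Om"
 and nice_bounded: "nice_dom Om ==> bounded Om"
 by (simp_all add: nice_dom_def)

lemma nice_lmeasurable: "nice_dom Om ==> Om : lmeasurable"
 by (simp add: nice_dom_def bounded_set_imp_lmeasurable borel_open)

lemma nice_finite: "nice_dom Om ==> finite_measure (lebesgue_on Om)"
 by (rule finite_measure_lebesgue_on[OF nice_lmeasurable])

lemma bounded_L2:
 assumes "Om : lmeasurable" "f : bmeas (lebesgue_on Om)" "!!z. z : Om ==> cmod (f z) <= K"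
 shows "f : L2 Om" "L2norm Om f <= sqrt (measure lebesgue Om) * \<bar>K\<bar>"
proof -
 interpret finite_measure "lebesgue_on Om" by (rule finite_measure_lebesgue_on[OF assms(1)])
 have K: "(cmod (f z))\<^sup>2 <= K\<^sup>2" if "z : Om" for z
  using assms(3)[OF that] by (simp add: power_mono)
 have sp: "space (lebesgue_on Om) = Om" by simp
 have i: "integrable (lebesgue_on Om) (%z. (cmod (f z))\<^sup>2)"
 proof (rule integrable_const_bound[of _ "K\<^sup>2"])
  show "AE x in lebesgue_on Om. norm ((cmod (f x))\<^sup>2) <= K\<^sup>2"
   by (rule AE_I2) (use K in \<open>simp add: sp\<close>)
 qed (use assms(2) in measurable)
 then show "f : L2 Om" using assms(2) by (simp add: L2_def)
 have "(LINT z|lebesgue_on Om. (cmod (f z))\<^sup>2) <= (LINT z|lebesgue_on Om. K\<^sup>2)"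
  by (rule integral_mono[OF i]) (use K in \<open>auto simp: sp\<close>)
 also have "\<dots> = measure lebesgue Om * K\<^sup>2"
  using assms(1) by (simp add: measure_restrict_space fmeasurable_def)
 finally have "L2norm Om f <= sqrt (measure lebesgue Om * K\<^sup>2)"
  unfolding L2norm_def by (rule real_sqrt_le_mono)
 then show "L2norm Om f <= sqrt (measure lebesgue Om) * \<bar>K\<bar>" by (simp add: real_sqrt_mult)
qed

lemma L2norm_nonneg [simp]: "L2norm Om f >= 0"
 by (simp add: L2norm_def)

lemma snet_continuous_on:
 assumes "snet A Om u" "open Om" "0 < ep" "ep <= 1" shows "continuous_on Om (u ep)"
 by (intro differentiable_imp_continuous_on)
  (auto simp: differentiable_on_def intro!: differentiable_at_withinI snet_differentiable[OF assms])

lemma snet_measurable: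
 assumes "snet A Om u" "nice_dom Om" "0 < ep" "ep <= 1"
 shows "u ep : bmeas (lebesgue_on Om)"
 by (rule continuous_imp_measurable_on_sets_lebesgue[OF snet_continuous_on[OF assms(1) nice_open[OF assms(2)] assms(3,4)]])
  (use nice_open[OF assms(2)] in simp)

text \<open>One direction applies the Sobolev bound of \<open>nice_dom\<close> to every derivative,
  the other uses that \<open>Om\<close> has finite measure. It allows \<open>Hinf\<close> to be
  handled through sup norms throughout.\<close>

lemma Hinf_iff_bsm:
 fixes Om :: "'a::euclidean_space set"
 assumes "nice_dom Om" shows "f : Hinf Om \<longleftrightarrow> bsm Om f"
proof
 assume f: "f : Hinf Om"
 obtain C ES where "!!f z. f : Hinf Om ==> z : Om ==> cmod (f z) <= C * (1 + (\<Sum>es\<leftarrow>ES. (L2norm Om (pdiffs es f))\<^sup>2))"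
  using assms unfolding nice_dom_def by (elim conjE exE) blast
 note bd = this
 have H: "pdiffs es f : Hinf Om" if "es : lists Basis" for es
 proof -
  have app: "fs @ es : lists Basis" if "fs : lists Basis" for fs using that \<open>es : _\<close> by simp
  have 1: "\<forall>es\<in>lists Basis. pdiffs es f differentiable_on Om" "\<forall>es\<in>lists Basis. pdiffs es f : L2 Om"
   using f by (simp_all add: Hinf_def smooth_on_def)
  show ?thesis unfolding Hinf_def smooth_on_def pdiffs_append[symmetric] mem_Collect_eq
   by (intro conjI ballI bspec[OF 1(1) app] bspec[OF 1(2) app])
 qed
 show "bsm Om f" unfolding snet_def
 proof (intro conjI ballI)
  show "smooth_on Om f" using f by (simp add: Hinf_def)
  fix es :: "'a list" assume "es : lists Basis"
  from bd[OF H[OF this]]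
  show "\<exists>K\<in>UNIV. \<forall>ep\<in>{0<..1::real}. \<forall>z\<in>Om. cmod (pdiffs es f z) <= K ep"
   by (intro bexI[of _ "%_. C * (1 + (\<Sum>es'\<leftarrow>ES. (L2norm Om (pdiffs es' (pdiffs es f)))\<^sup>2))"]) simp_all
 qed
next
 assume f: "bsm Om f"
 have "pdiffs es f : L2 Om" if es: "es : lists Basis" for es
 proof -
  obtain K where K: "!!z. z : Om ==> cmod (pdiffs es f z) <= K"
   using snet_bound[OF f es] by (metis zero_less_one order_refl)
  show ?thesis
   using bounded_L2(1)[OF nice_lmeasurable[OF assms] _ K] snet_measurable[OF snet_pdiffs[OF f es] assms, of 1] by simp
 qed
 then show "f : Hinf Om" using snet_smooth[OF f, of 1] by (simp add: Hinf_def)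
qed

lemma snet_L2norm_le:
 assumes u: "snet A Om u" and nice: "nice_dom Om" and es: "es : lists Basis"
 obtains K where "K : A"
  "!!ep. 0 < ep ==> ep <= 1 ==> L2norm Om (pdiffs es (u ep)) <= sqrt (measure lebesgue Om) * \<bar>K ep\<bar>"
proof -
 obtain K where K: "K : A" "!!ep z. 0 < ep ==> ep <= 1 ==> z : Om ==> cmod (pdiffs es (u ep) z) <= K ep"
  using snet_bound[OF u es] by blast
 show thesis
  using bounded_L2(2)[OF nice_lmeasurable[OF nice] snet_measurable[OF snet_pdiffs[OF u es] nice] K(2)] K(1)
  by (intro that) auto
qed

lemma eventually_at_right_01: "\<forall>\<^sub>F ep::real in at_right 0. 0 < ep \<and> ep <= 1"
 by (rule eventually_mono[OF eventually_at_right_real[of 0 1]]) auto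

lemma A_mod_abs: "K : A_mod ==> (%ep. \<bar>K ep\<bar>) : A_mod"
 and A_null_abs: "K : A_null ==> (%ep. \<bar>K ep\<bar>) : A_null"
 by (simp_all add: A_mod_def A_null_def)

lemma snet_L2norm_mod:
 assumes "snet A_mod Om u" "nice_dom Om" "es : lists Basis"
 shows "(%ep. L2norm Om (pdiffs es (u ep))) : A_mod"
proof -
 obtain K where K: "K : A_mod"
  "!!ep. 0 < ep ==> ep <= 1 ==> L2norm Om (pdiffs es (u ep)) <= sqrt (measure lebesgue Om) * \<bar>K ep\<bar>"
  using snet_L2norm_le[OF assms] by blast
 show ?thesis
  by (rule A_mod_le[OF A_mod_mult[OF A_mod_const[of "sqrt (measure lebesgue Om)"] A_mod_abs[OF K(1)]]], rule eventually_mono[OF eventually_at_right_01])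
   (use K(2) in simp)
qed

lemma snet_L2norm_null:
 assumes "snet A_null Om u" "nice_dom Om" "es : lists Basis"
 shows "(%ep. L2norm Om (pdiffs es (u ep))) : A_null"
proof -
 obtain K where K: "K : A_null"
  "!!ep. 0 < ep ==> ep <= 1 ==> L2norm Om (pdiffs es (u ep)) <= sqrt (measure lebesgue Om) * \<bar>K ep\<bar>"
  using snet_L2norm_le[OF assms] by blast
 show ?thesis
  by (rule A_null_le[OF A_null_cmult[OF A_null_abs[OF K(1)], of "sqrt (measure lebesgue Om)"]], rule eventually_mono[OF eventually_at_right_01])
   (use K(2) in simp)
qed

text \<open>The constant of the Sobolev bound is the same for all \<epsilon>, and 1 plus a finite
  sum of squares of moderate bounds is again moderate.\<close>

lemma moderate_iff_snet:
 fixes Om :: "'a::euclidean_space set"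
 assumes nice: "nice_dom Om" shows "u : moderate Om \<longleftrightarrow> snet A_mod Om u"
proof
 assume u: "u : moderate Om"
 obtain C ES where bd: "!!f z. f : Hinf Om ==> z : Om ==> cmod (f z) <= C * (1 + (\<Sum>es\<leftarrow>ES. (L2norm Om (pdiffs es f))\<^sup>2))"
  and ES: "set ES \<subseteq> lists Basis"
  using nice unfolding nice_dom_def by (elim conjE exE) blast
 have uH: "u ep : Hinf Om" if "ep : {0<..1}" for ep using u that by (simp add: moderate_def)
 have mod: "(%ep. L2norm Om (pdiffs es (u ep))) : A_mod" if "es : lists Basis" for es
  using u that unfolding moderate_def A_mod_def by simp
 show "snet A_mod Om u" unfolding snet_def
 proof (intro conjI ballI)
  fix ep :: real assume "ep : {0<..1}"
  from uH[OF this] show "smooth_on Om (u ep)" by (simp add: Hinf_def)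
 next
  fix es :: "'a list" assume es: "es : lists Basis"
  define K where "K ep = C * (1 + (\<Sum>es'\<leftarrow>ES. (L2norm Om (pdiffs es' (pdiffs es (u ep))))\<^sup>2))" for ep
  have "(%ep. \<Sum>es'\<leftarrow>ES. (L2norm Om (pdiffs es' (pdiffs es (u ep))))\<^sup>2) : A_mod"
   using ES
  proof (induction ES)
   case (Cons es' ES)
   then have "es' @ es : lists Basis" using es by simp
   from A_mod_mult[OF mod[OF this] mod[OF this]] Cons show ?case
    by (simp add: pdiffs_append power2_eq_square A_mod_add)
  qed (simp add: A_mod_const)
  then have "K : A_mod" unfolding K_def[abs_def] by (intro A_mod_mult A_mod_add A_mod_const)
  moreover have "cmod (pdiffs es (u ep) z) <= K ep" if "ep : {0<..1}" "z : Om" for ep z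
  proof -
   have "bsm Om (u ep)" using uH[OF that(1)] Hinf_iff_bsm[OF nice] by simp
   from snet_pdiffs[OF this es] have "pdiffs es (u ep) : Hinf Om" by (simp add: Hinf_iff_bsm[OF nice])
   from bd[OF this that(2)] show ?thesis by (simp add: K_def)
  qed
  ultimately show "\<exists>K\<in>A_mod. \<forall>ep\<in>{0<..1}. \<forall>z\<in>Om. cmod (pdiffs es (u ep) z) <= K ep"
   by (intro bexI[of _ K]) simp_all
 qed
next
 assume u: "snet A_mod Om u"
 show "u : moderate Om" unfolding moderate_def mem_Collect_eq
 proof (intro conjI ballI)
  fix ep :: real assume "ep : {0<..1}"
  then show "u ep : Hinf Om" using snet_bsm[OF u] by (simp add: Hinf_iff_bsm[OF nice])
 next
  fix es :: "'a list" assume es: "es : lists Basis"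
  have "(%ep. L2norm Om (pdiffs es (u ep))) : A_mod" by (rule snet_L2norm_mod[OF u nice es])
  then show "\<exists>p\<ge>0. (%ep. L2norm Om (pdiffs es (u ep))) : O[at_right 0](%ep. ep powr - p)"
   by (simp add: A_mod_def)
 qed
qed

text \<open>With \<open>m = cmod (f z)\<close>, the Lipschitz bound keeps \<open>cmod f\<close>
  above \<open>m / 2\<close> within distance \<open>m / (2 * M)\<close> of \<open>z\<close>, and the
  cone condition supplies a set of measure at least \<open>ka * r ^ DIM('a)\<close> there. Hence
  \<open>(m / 2)^2\<close> times this measure is at most the squared \<open>L2norm\<close>. The two
  alternatives of the conclusion are the two possible values of
  \<open>r = min r0 (m / (2 * M))\<close>.\<close>

lemma L2_Lipschitz_sup:
 fixes Om :: "'a::euclidean_space set"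
 assumes S: "!!r. 0 < r ==> r <= r0 ==> \<exists>S\<in>sets borel. S \<subseteq> Om \<inter> cball z r \<and> ka * r ^ DIM('a) <= measure lebesgue S"
  and ka: "ka > 0" and r0: "r0 > 0" and Om: "Om : lmeasurable" "z : Om"
  and f: "f : L2 Om" and lip: "!!w. w : Om ==> cmod (f w - f z) <= M * dist w z" and M: "M >= 1"
 shows "(cmod (f z))\<^sup>2 <= 4 * (L2norm Om f)\<^sup>2 / (ka * r0 ^ DIM('a)) \<or>
  (cmod (f z)) ^ (DIM('a) + 2) <= 4 * (2 * M) ^ DIM('a) * (L2norm Om f)\<^sup>2 / ka"
proof (cases "f z = 0")
 case False
 define m r where "m = cmod (f z)" and "r = min r0 (m / (2 * M))"
 have m: "m > 0" using False by (simp add: m_def)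
 have r: "0 < r" "r <= r0" "M * r <= m / 2" using m M r0 by (auto simp: r_def min_def field_simps)
 obtain S where S: "S : sets borel" "S \<subseteq> Om" "S \<subseteq> cball z r" "ka * r ^ DIM('a) <= measure lebesgue S"
  using S[OF r(1,2)] by auto
 have big: "m / 2 <= cmod (f w)" if "w : S" for w
 proof -
  have "cmod (f w - f z) <= M * dist w z" using lip S(2) that by auto
  also have "\<dots> <= M * r" using S(3) that M by (intro mult_left_mono) (auto simp: dist_commute)
  finally have "cmod (f w - f z) <= m / 2" using r by simp
  moreover have "m <= cmod (f w) + cmod (f w - f z)"
   unfolding m_def by (metis norm_triangle_sub norm_minus_commute)
  ultimately show ?thesis by simp
 qed
 have Sm: "S : lmeasurable" using fmeasurableI2[OF Om(1) S(2)] S(1) by simp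
 have "(m / 2)\<^sup>2 * measure lebesgue S = (LINT w|lebesgue_on Om. (m / 2)\<^sup>2 * indicator S w)"
  using S(2) Sm Om by (simp add: measure_restrict_space fmeasurable_def Int_absorb2 Int_absorb1)
 also have "\<dots> <= (LINT w|lebesgue_on Om. (cmod (f w))\<^sup>2)"
 proof (rule integral_mono)
  show "integrable (lebesgue_on Om) (%w. (cmod (f w))\<^sup>2)" using f by (simp add: L2_def)
  have "finite_measure (lebesgue_on Om)" by (rule finite_measure_lebesgue_on[OF Om(1)])
  then show "integrable (lebesgue_on Om) (%w. (m / 2)\<^sup>2 * indicator S w)"
   using S(1,2) Om by (intro integrable_mult_right integrable_real_indicator)
    (auto simp: sets_restrict_space_iff fmeasurable_def finite_measure.emeasure_finite less_top[symmetric])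
  show "(m / 2)\<^sup>2 * indicator S w <= (cmod (f w))\<^sup>2" if "w : space (lebesgue_on Om)" for w
  proof (cases "w : S")
   case True
   then show ?thesis using power_mono[OF big[OF True], of 2] m by simp
  qed simp
 qed
 also have "\<dots> = (L2norm Om f)\<^sup>2" by (simp add: L2norm_def)
 finally have *: "(m / 2)\<^sup>2 * measure lebesgue S <= (L2norm Om f)\<^sup>2" .
 have "(m / 2)\<^sup>2 * (ka * r ^ DIM('a)) <= (m / 2)\<^sup>2 * measure lebesgue S"
  using S(4) by (rule mult_left_mono) simp
 with * have **: "(m / 2)\<^sup>2 * (ka * r ^ DIM('a)) <= (L2norm Om f)\<^sup>2" by simp
 show ?thesis
 proof (cases "r = r0")
  case True
  have "m\<^sup>2 * (ka * r0 ^ DIM('a)) <= 4 * (L2norm Om f)\<^sup>2" using ** True by (simp add: power_divide)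
  then show ?thesis using ka r0 by (simp add: m_def pos_le_divide_eq)
 next
  case False
  then have req: "r = m / (2 * M)" by (auto simp: r_def min_def)
  have "m ^ (DIM('a) + 2) * ka <= 4 * (2 * M) ^ DIM('a) * (L2norm Om f)\<^sup>2"
  proof -
   have "(m / 2)\<^sup>2 * (ka * r ^ DIM('a)) * (4 * (2 * M) ^ DIM('a)) <= (L2norm Om f)\<^sup>2 * (4 * (2 * M) ^ DIM('a))"
    using ** M by (intro mult_right_mono) auto
   moreover have "(m / 2)\<^sup>2 * (ka * r ^ DIM('a)) * (4 * (2 * M) ^ DIM('a)) = m ^ (DIM('a) + 2) * ka"
    using M unfolding req by (simp add: power_divide power_add power2_eq_square)
   ultimately have "m ^ (DIM('a) + 2) * ka <= (L2norm Om f)\<^sup>2 * (4 * (2 * M) ^ DIM('a))" by (simp only:)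
   then show ?thesis by (simp only: mult.commute)
  qed
  then show ?thesis using ka by (simp add: m_def pos_le_divide_eq)
 qed
qed (use ka r0 in simp)

text \<open>Exponent \<open>q\<close> for the root follows from exponent \<open>q * k\<close> for
  the power, and a null bound offers all exponents.\<close>

lemma A_null_root:
 assumes K: "K : A_null" and k: "k > 0" and a: "\<forall>\<^sub>F ep in at_right 0. 0 <= a ep \<and> a ep ^ k <= K ep"
 shows "a : A_null"
 unfolding A_null_def mem_Collect_eq
proof (intro allI impI)
 fix q :: real assume q: "q >= 0"
 then have "K : O[at_right 0](%ep. ep powr (q * real k))" using K by (simp add: A_null_def)
 then obtain c where c: "c > 0" "\<forall>\<^sub>F ep in at_right 0. norm (K ep) <= c * norm (ep powr (q * real k))"
  by (elim landau_o.bigE)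
 have "\<forall>\<^sub>F ep in at_right 0. norm (a ep) <= root k c * norm (ep powr q)"
  using a c(2) eventually_at_right_01
 proof eventually_elim
  case (elim ep)
  have "a ep ^ k <= c * ep powr (q * real k)" using elim by (simp, linarith)
  also have "\<dots> = (root k c * ep powr q) ^ k"
   using elim k c by (simp add: power_mult_distrib powr_power mult.commute)
  finally have "a ep <= root k c * ep powr q"
   using k c by (intro power_le_imp_le_base[of "a ep" "k - 1"]) simp_all
  then show ?case using elim by simp
 qed
 then show "a : O[at_right 0](%ep. ep powr q)" by (rule bigoI)
qed

lemma vector_derivative_norm_bound:
 fixes g :: "real => 'b::real_normed_vector"
 assumes "!!s. s : {a..b} ==> (g has_vector_derivative g' s) (at s within {a..b})"
  and "!!s. s : {a..b} ==> norm (g' s) <= B" and "s : {a..b}" "s' : {a..b}"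
 shows "norm (g s - g s') <= B * \<bar>s - s'\<bar>"
 using differentiable_bound[of "{a..b}" g "%s t. t *\<^sub>R g' s" B s s'] assms
 by (simp add: has_vector_derivative_def onorm_scaleR_left onorm_id bounded_linear_ident)

text \<open>Taylor's formula along \<open>e\<close> from two mean value inequalities on the segment,
  hence the constant \<open>K\<close> rather than \<open>K / 2\<close>.\<close>

lemma quadratic_remainder:
 fixes f :: "'a::euclidean_space => complex"
 assumes f: "bsm Om f" and op: "open Om" and cv: "convex Om" and e: "e : Basis"
  and z: "z : Om" "z + h *\<^sub>R e : Om"
  and K: "!!w. w : Om ==> cmod (pdiff e (pdiff e f) w) <= K"
 shows "cmod (f (z + h *\<^sub>R e) - f z - h *\<^sub>R pdiff e f z) <= K * h\<^sup>2"
proof -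
 define p where "p r = z + (r * h) *\<^sub>R e" for r
 have p: "p r : Om" if "r : {0..1}" for r
 proof -
  have "p r = (1 - r) *\<^sub>R z + r *\<^sub>R (z + h *\<^sub>R e)" by (simp add: p_def algebra_simps)
  then show ?thesis using convexD[OF cv z, of "1 - r" r] that by simp
 qed
 have pd: "((%r. g (p r)) has_vector_derivative h *\<^sub>R pdiff e g (p r)) (at r within {0..1})"
  if "bsm Om g" "r : {0..1}" for g r
 proof -
  have "(g has_derivative (%v. \<Sum>e\<in>Basis. (v \<bullet> e) *\<^sub>R pdiff e g (p r))) (at (p r))"
   using snet_differentiable[OF that(1) op, of 1] p[OF that(2)] by (intro pdiff_has_derivative) simp
  moreover have "(p has_derivative (%s. (s * h) *\<^sub>R e)) (at r within {0..1})"
   unfolding p_def[abs_def] by (auto intro!: derivative_eq_intros)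
  ultimately have "((%r. g (p r)) has_derivative
    (%s. \<Sum>e'\<in>Basis. (((s * h) *\<^sub>R e) \<bullet> e') *\<^sub>R pdiff e' g (p r))) (at r within {0..1})"
   by (rule has_derivative_compose[rotated])
  moreover have "(\<Sum>e'\<in>Basis. (((s * h) *\<^sub>R e) \<bullet> e') *\<^sub>R pdiff e' g (p r)) = s *\<^sub>R h *\<^sub>R pdiff e g (p r)" for s
  proof -
   have "(\<Sum>e'\<in>Basis. (((s * h) *\<^sub>R e) \<bullet> e') *\<^sub>R pdiff e' g (p r))
     = (\<Sum>e'\<in>Basis. if e' = e then (s * h) *\<^sub>R pdiff e g (p r) else 0)"
    by (rule sum.cong) (use e in \<open>auto simp: inner_Basis\<close>)
   then show ?thesis using e by simp
  qed
  ultimately show ?thesis by (simp add: has_vector_derivative_def)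
 qed
 have K0: "K >= 0" using K[OF z(1)] norm_ge_zero order_trans by blast
 have d1: "norm (h *\<^sub>R pdiff e f (p r) - h *\<^sub>R pdiff e f (p 0)) <= K * h\<^sup>2" if r: "r : {0..1}" for r
 proof -
  have "cmod (pdiff e f (p r) - pdiff e f (p 0)) <= (\<bar>h\<bar> * K) * \<bar>r - 0\<bar>"
   by (rule vector_derivative_norm_bound[OF pd[OF snet_pdiff[OF f e]]])
    (use p K r in \<open>auto intro!: mult_left_mono\<close>)
  also have "\<dots> <= \<bar>h\<bar> * K" using r K0 by (intro mult_left_le) auto
  finally have "\<bar>h\<bar> * cmod (pdiff e f (p r) - pdiff e f (p 0)) <= \<bar>h\<bar> * (\<bar>h\<bar> * K)"
   by (rule mult_left_mono) simp
  moreover have "\<bar>h\<bar> * (\<bar>h\<bar> * K) = K * h\<^sup>2" by (simp add: power2_eq_square abs_mult_self_eq flip: mult.assoc)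
  ultimately show ?thesis by (simp flip: scaleR_diff_right)
 qed
 have "norm ((f (p 1) - 1 *\<^sub>R h *\<^sub>R pdiff e f (p 0)) - (f (p 0) - 0 *\<^sub>R h *\<^sub>R pdiff e f (p 0))) <= (K * h\<^sup>2) * \<bar>1 - 0\<bar>"
 proof (rule vector_derivative_norm_bound[of 0 1 "%r. f (p r) - r *\<^sub>R h *\<^sub>R pdiff e f (p 0)"
    "%r. h *\<^sub>R pdiff e f (p r) - h *\<^sub>R pdiff e f (p 0)"])
  show "((%r. f (p r) - r *\<^sub>R h *\<^sub>R pdiff e f (p 0)) has_vector_derivative
    (h *\<^sub>R pdiff e f (p r) - h *\<^sub>R pdiff e f (p 0))) (at r within {0..1})" if "r : {0..1}" for r
  proof (rule has_vector_derivative_diff[OF pd[OF f that]])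
   show "((%r. r *\<^sub>R h *\<^sub>R pdiff e f (p 0)) has_vector_derivative h *\<^sub>R pdiff e f (p 0)) (at r within {0..1})"
    unfolding has_vector_derivative_def by (auto intro!: derivative_eq_intros)
  qed
 qed (use d1 in auto)
 then show ?thesis by (simp add: p_def algebra_simps)
qed

lemma bsm_Lipschitz:
 fixes f :: "'a::euclidean_space => complex"
 assumes f: "bsm Om f" and op: "open Om" and cv: "convex Om"
  and L: "!!e z. e : Basis ==> z : Om ==> cmod (pdiff e f z) <= (L::real)"
  and w: "w : Om" "z : Om"
 shows "cmod (f w - f z) <= real DIM('a) * L * dist w z"
proof -
 have "cmod (f w - f z) <= (DIM('a) * L) * norm (w - z)"
 proof (rule differentiable_bound[OF cv _ _ w])
  show "(f has_derivative (%v. \<Sum>e\<in>Basis. (v \<bullet> e) *\<^sub>R pdiff e f y)) (at y within Om)" if "y : Om" for y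
   using snet_differentiable[OF f op, of 1] that
   by (auto intro: has_derivative_at_withinI[OF pdiff_has_derivative])
  show "onorm (%v. \<Sum>e\<in>Basis. (v \<bullet> e) *\<^sub>R pdiff e f y) <= DIM('a) * L" if "y : Om" for y
  proof (rule onorm_le)
   fix v :: 'a
   have "norm (\<Sum>e\<in>Basis. (v \<bullet> e) *\<^sub>R pdiff e f y) <= (\<Sum>e\<in>(Basis::'a set). norm v * L)"
   proof (rule sum_norm_le)
    fix e :: 'a assume e: "e : Basis"
    show "norm ((v \<bullet> e) *\<^sub>R pdiff e f y) <= norm v * L"
     unfolding norm_scaleR by (rule mult_mono[OF Basis_le_norm[OF e] L[OF e that]]) simp_all
   qed
   then show "norm (\<Sum>e\<in>Basis. (v \<bullet> e) *\<^sub>R pdiff e f y) <= DIM('a) * L * norm v"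
    by (simp add: mult.commute mult.left_commute)
  qed
 qed
 then show ?thesis by (simp add: dist_norm)
qed

text \<open>Landau's interpolation inequality: Taylor's formula with step \<open>h\<close> bounds
  the first derivative by \<open>2 * K0 / h + h * K2\<close>. A step of the order of
  \<open>sqrt K0\<close> makes both terms null, since \<open>sqrt K0\<close> is null and
  \<open>K2\<close> is moderate.\<close>

lemma snet_null_deriv:
 fixes Om :: "'a::euclidean_space set"
 assumes nice: "nice_dom Om" and u: "snet A_mod Om u" and e: "e : Basis"
  and K0: "K0 : A_null" "!!ep z. 0 < ep ==> ep <= 1 ==> z : Om ==> cmod (u ep z) <= K0 ep"
 obtains K where "K : A_null" "!!ep z. 0 < ep ==> ep <= 1 ==> z : Om ==> cmod (pdiff e (u ep) z) <= K ep"
proof -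
 obtain et where et: "et > 0" "!!z e. z : Om ==> e : Basis ==> \<exists>\<sigma>\<in>{-1, 1}. \<forall>s\<in>{0..et}. z + (s * \<sigma>) *\<^sub>R e : Om"
  using nice unfolding nice_dom_def by (elim conjE exE) blast
 obtain K2 where K2: "K2 : A_mod"
  "!!ep z. 0 < ep ==> ep <= 1 ==> z : Om ==> cmod (pdiff e (pdiff e (u ep)) z) <= K2 ep"
  using snet_bound0[OF snet_pdiff[OF snet_pdiff[OF u e] e]] by blast
 define s where "s ep = sqrt \<bar>K0 ep\<bar>" for ep
 define K where "K ep = (2 / et) * (s ep + s ep * s ep) + (et * \<bar>K2 ep\<bar>) * s ep" for ep
 have "s : A_null"
  by (rule A_null_root[OF A_null_abs[OF K0(1)], of 2]) (auto simp: s_def)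
 then have "K : A_null"
  unfolding K_def[abs_def]
  by (intro A_null_add A_null_cmult A_mod_null_mult[OF A_mod_mult[OF A_mod_const A_mod_abs[OF K2(1)]]]
    A_mod_null_mult[of s s]) (use A_null_mod in auto)
 moreover have "cmod (pdiff e (u ep) z) <= K ep" if ep: "0 < ep" "ep <= 1" and z: "z : Om" for ep z
 proof -
  obtain \<sigma> where \<sigma>: "\<sigma> : {-1, 1}" "\<forall>s\<in>{0..et}. z + (s * \<sigma>) *\<^sub>R e : Om" using et(2)[OF z e] by blast
  have *: "h * cmod (pdiff e (u ep) z) <= 2 * K0 ep + h\<^sup>2 * K2 ep" if "0 < h" "h <= et" for h
  proof -
   have zh: "z + (h * \<sigma>) *\<^sub>R e : Om" using bspec[OF \<sigma>(2), of h] that by simp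
   have "cmod (u ep (z + (h * \<sigma>) *\<^sub>R e) - u ep z - (h * \<sigma>) *\<^sub>R pdiff e (u ep) z) <= K2 ep * (h * \<sigma>)\<^sup>2"
    by (rule quadratic_remainder[OF snet_bsm[OF u ep] nice_open[OF nice] nice_convex[OF nice] e z zh K2(2)[OF ep]])
   moreover have "K2 ep * (h * \<sigma>)\<^sup>2 = h\<^sup>2 * K2 ep" using \<sigma>(1) by auto
   moreover have "h * cmod (pdiff e (u ep) z) = cmod ((h * \<sigma>) *\<^sub>R pdiff e (u ep) z)"
    using \<sigma>(1) that by auto
   moreover have "cmod ((h * \<sigma>) *\<^sub>R pdiff e (u ep) z) <= cmod (u ep (z + (h * \<sigma>) *\<^sub>R e)) + cmod (u ep z)
     + cmod (u ep (z + (h * \<sigma>) *\<^sub>R e) - u ep z - (h * \<sigma>) *\<^sub>R pdiff e (u ep) z)"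
   proof -
    have "cmod c <= cmod a + cmod b + cmod (a - b - c)" for a b c :: complex
     using norm_triangle_ineq4[of "a - b" "a - b - c"] norm_triangle_ineq4[of a b] by simp
    then show ?thesis by blast
   qed
   ultimately show ?thesis using K0(2)[OF ep z] K0(2)[OF ep zh] by linarith
  qed
  have K00: "K0 ep >= 0" using K0(2)[OF ep z] norm_ge_zero order_trans by blast
  have K20: "K2 ep >= 0" using K2(2)[OF ep z] norm_ge_zero order_trans by blast
  show ?thesis
  proof (cases "K0 ep = 0")
   case True
   \<comment> \<open>A step proportional to \<open>sqrt K0\<close> would be 0 here; arbitrarily
     small steps \<open>h\<close> show instead that the derivative vanishes.\<close>
   have "cmod (pdiff e (u ep) z) <= 0 + d" if "d > 0" for d
   proof -
    define h where "h = min et (d / (K2 ep + 1))"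
    have h: "0 < h" "h <= et" "h * K2 ep <= d"
    proof -
     show "0 < h" "h <= et" using et(1) that K20 by (auto simp: h_def)
     have "h * K2 ep <= d / (K2 ep + 1) * (K2 ep + 1)"
     using that K20 by (intro mult_mono) (auto simp: h_def)
     then show "h * K2 ep <= d" using K20 by simp
    qed
    have "h * cmod (pdiff e (u ep) z) <= h * (h * K2 ep)"
     using *[OF h(1,2)] True by (simp add: power2_eq_square mult.assoc)
    then show ?thesis using h by simp
   qed
   then have "cmod (pdiff e (u ep) z) <= 0" by (rule field_le_epsilon)
   then show ?thesis using True by (simp add: K_def s_def)
  next
   case False
   have s0: "s ep > 0" using False by (simp add: s_def)
   have ss: "K0 ep = s ep * s ep" using K00 by (simp add: s_def)
   \<comment> \<open>The denominator ensures \<open>h <= et\<close> without a case distinction, and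
     it makes \<open>K0 / h\<close> a polynomial in \<open>s\<close>, up to the factor
     \<open>1 / et\<close>.\<close>
   define h where "h = et * s ep / (1 + s ep)"
   have h: "0 < h" "h <= et" "h <= et * s ep" using s0 et(1) by (auto simp: h_def field_simps)
   have "cmod (pdiff e (u ep) z) <= (2 * K0 ep + h\<^sup>2 * K2 ep) / h"
    using *[OF h(1,2)] h(1) by (simp add: pos_le_divide_eq mult.commute)
   also have "\<dots> = 2 * K0 ep / h + h * K2 ep" using h(1) by (simp add: add_divide_distrib power2_eq_square)
   also have "2 * K0 ep / h = (2 / et) * (s ep + s ep * s ep)"
    using s0 et(1) by (simp add: ss h_def field_simps)
   also have "h * K2 ep <= et * s ep * K2 ep" using h(3) K20 by (rule mult_right_mono)
   finally show ?thesis using K20 by (simp add: K_def mult.commute mult.left_commute)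
  qed
 qed
 ultimately show thesis by (rule that)
qed

text \<open>Induction along the multi-index: each derivative of \<open>u\<close> is moderate with
  all its derivatives, so \<open>snet_null_deriv\<close> applies to it in turn.\<close>

lemma snet_null_if_sup:
 fixes Om :: "'a::euclidean_space set"
 assumes nice: "nice_dom Om" and u: "snet A_mod Om u"
  and K0: "K0 : A_null" "!!ep z. 0 < ep ==> ep <= 1 ==> z : Om ==> cmod (u ep z) <= K0 ep"
 shows "snet A_null Om u"
proof -
 have *: "\<exists>K\<in>A_null. \<forall>ep z. 0 < ep --> ep <= 1 --> z : Om --> cmod (pdiffs es (u ep) z) <= K ep"
  if "es : lists Basis" for es
  using that
 proof (induction es)
  case Nil
  show ?case by (rule bexI[OF _ K0(1)]) (simp add: K0(2))
 next
  case (Cons e es)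
  obtain K where K: "K : A_null"
   "\<forall>ep z. 0 < ep --> ep <= 1 --> z : Om --> cmod (pdiffs es (u ep) z) <= K ep"
   using Cons.IH by (elim bexE)
  obtain K' where K': "K' : A_null"
   "!!ep z. 0 < ep ==> ep <= 1 ==> z : Om ==> cmod (pdiff e (pdiffs es (u ep)) z) <= K' ep"
   by (rule snet_null_deriv[OF nice snet_pdiffs[OF u Cons.hyps(2)] Cons.hyps(1) K(1)])
    (simp_all add: K(2))
  show ?case by (rule bexI[OF _ K'(1)]) (simp add: K'(2) pdiffs_Cons)
 qed
 show ?thesis unfolding snet_def
 proof (intro conjI ballI)
  show "smooth_on Om (u ep)" if "ep : {0<..1}" for ep using snet_smooth[OF u] that by simp
  fix es :: "'a list" assume "es : lists Basis"
  from *[OF this] obtain K where K: "K : A_null"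
   "\<forall>ep z. 0 < ep --> ep <= 1 --> z : Om --> cmod (pdiffs es (u ep) z) <= K ep" by (elim bexE)
  show "\<exists>K\<in>A_null. \<forall>ep\<in>{0<..1}. \<forall>z\<in>Om. cmod (pdiffs es (u ep) z) <= K ep"
   by (rule bexI[OF _ K(1)]) (simp add: K(2))
 qed
qed

text \<open>The gradient of \<open>u\<close> is moderate, so \<open>L2_Lipschitz_sup\<close> applies
  with a moderate \<open>M\<close>. Either of its alternatives bounds the sup norm by a root, of
  order 2 or \<open>DIM('a) + 2\<close>, of a moderate factor times the square of the null
  \<open>L2norm\<close>. Derivatives follow by \<open>snet_null_if_sup\<close>.\<close>

lemma L2_null_imp_sup_null:
 fixes Om :: "'a::euclidean_space set"
 assumes nice: "nice_dom Om" and u: "snet A_mod Om u"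
  and null: "(%ep. L2norm Om (u ep)) : A_null"
 shows "snet A_null Om u"
proof -
 obtain ka r0 where ka: "ka > 0" "r0 > 0" "!!z r. z : Om ==> 0 < r ==> r <= r0 ==>
   \<exists>S\<in>sets borel. S \<subseteq> Om \<inter> cball z r \<and> ka * r ^ DIM('a) <= measure lebesgue S"
  using nice unfolding nice_dom_def by (elim conjE exE) (metis greaterThanAtMost_iff)
 \<comment> \<open>The induction over finite sets of directions serves to find one moderate bound
   for all partial derivatives.\<close>
 have "\<exists>K\<in>A_mod. \<forall>e\<in>E. \<forall>ep z. 0 < ep --> ep <= 1 --> z : Om --> cmod (pdiff e (u ep) z) <= K ep \<and> 0 <= K ep"
  if "finite E" "E \<subseteq> Basis" for E
  using that
 proof (induction E)
  case empty then show ?case using A_mod_const[of 0] by (intro bexI[of _ "%_. 0"]) auto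
 next
  case (insert e E)
  then obtain K where K: "K : A_mod"
   "\<forall>e\<in>E. \<forall>ep z. 0 < ep --> ep <= 1 --> z : Om --> cmod (pdiff e (u ep) z) <= K ep \<and> 0 <= K ep" by auto
  obtain K' where K': "K' : A_mod"
   "!!ep z. 0 < ep ==> ep <= 1 ==> z : Om ==> cmod (pdiff e (u ep) z) <= K' ep"
   using snet_bound0[OF snet_pdiff[OF u, of e]] insert.prems by blast
  show ?case
  proof (rule bexI[OF _ A_mod_add[OF A_mod_abs[OF K(1)] A_mod_abs[OF K'(1)]]], intro ballI allI impI conjI)
   fix d :: 'a and ep :: real and z assume *: "d : insert e E" "0 < ep" "ep <= 1" "z : Om"
   have "cmod (pdiff d (u ep) z) <= K ep \<or> cmod (pdiff d (u ep) z) <= K' ep"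
    using * K(2) K'(2)[OF *(2-4)] by auto
   then show "cmod (pdiff d (u ep) z) <= \<bar>K ep\<bar> + \<bar>K' ep\<bar>" by linarith
  qed simp
 qed
 from this[OF finite_Basis order_refl] obtain K where K: "K : A_mod"
  "!!e ep z. e : Basis ==> 0 < ep ==> ep <= 1 ==> z : Om ==> cmod (pdiff e (u ep) z) <= K ep" by blast
 let ?n = "DIM('a)"
 define M where "M ep = ?n * \<bar>K ep\<bar> + 1" for ep
 define N where "N ep = L2norm Om (u ep)" for ep
 define P where "P ep = 4 / ka * (2 * M ep) ^ ?n * (N ep * N ep)" for ep
 define Q where "Q ep = 4 / (ka * r0 ^ ?n) * (N ep * N ep)" for ep
 have N: "N : A_null" "N : A_mod" using null A_null_mod by (auto simp: N_def[abs_def])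
 have Mm: "(%ep. (2 * M ep) ^ k) : A_mod" for k
 proof (induction k)
  case (Suc k)
  have "(%ep. 2 * M ep) : A_mod"
   unfolding M_def by (intro A_mod_mult A_mod_add A_mod_const A_mod_abs K(1))
  from A_mod_mult[OF this Suc] show ?case by simp
 qed (simp add: A_mod_const)
 have P: "P : A_null" "P ep >= 0" for ep
 proof -
  show "P : A_null" unfolding P_def[abs_def]
   by (intro A_mod_null_mult[OF A_mod_mult[OF A_mod_const Mm]] A_mod_null_mult[OF N(2,1)])
  show "P ep >= 0" using ka by (auto simp: P_def M_def)
 qed
 have Q: "Q : A_null" "Q ep >= 0" for ep
 proof -
  show "Q : A_null" unfolding Q_def[abs_def] by (intro A_null_cmult A_mod_null_mult[OF N(2,1)])
  show "Q ep >= 0" using ka(1,2) by (simp add: Q_def)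
 qed
 show ?thesis
 proof (rule snet_null_if_sup[OF nice u])
  have "(%ep. root (?n + 2) (P ep)) : A_null"
   by (rule A_null_root[OF P(1), of "?n + 2"]) (use P in \<open>auto simp del: power_Suc\<close>)
  moreover have "(%ep. sqrt (Q ep)) : A_null"
   by (rule A_null_root[OF Q(1), of 2]) (use Q in auto)
  ultimately show "(%ep. sqrt (Q ep) + root (?n + 2) (P ep)) : A_null" by (rule A_null_add[rotated])
  fix ep :: real and z assume ep: "0 < ep" "ep <= 1" and z: "z : Om"
  have "(cmod (u ep z))\<^sup>2 <= 4 * (L2norm Om (u ep))\<^sup>2 / (ka * r0 ^ ?n) \<or>
   (cmod (u ep z)) ^ (?n + 2) <= 4 * (2 * M ep) ^ ?n * (L2norm Om (u ep))\<^sup>2 / ka"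
  proof (rule L2_Lipschitz_sup[OF ka(3)[OF z] ka(1,2) nice_lmeasurable[OF nice] z])
   have "u ep : Hinf Om" using snet_bsm[OF u ep] by (simp add: Hinf_iff_bsm[OF nice])
   then show "u ep : L2 Om" unfolding Hinf_def by (auto dest: bspec[of _ _ "[]"])
   show "cmod (u ep w - u ep z) <= M ep * dist w z" if "w : Om" for w
   proof -
    have "cmod (u ep w - u ep z) <= ?n * K ep * dist w z"
     by (rule bsm_Lipschitz[OF snet_bsm[OF u ep] nice_open[OF nice] nice_convex[OF nice] K(2)[OF _ ep] that z])
    also have "\<dots> <= M ep * dist w z"
    proof (rule mult_right_mono)
     have "real ?n * K ep <= real ?n * \<bar>K ep\<bar>" by (rule mult_left_mono) simp_all
     then show "real ?n * K ep <= M ep" unfolding M_def by linarith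
    qed simp
    finally show ?thesis .
   qed
  qed (auto simp: M_def)
  then show "cmod (u ep z) <= sqrt (Q ep) + root (?n + 2) (P ep)"
  proof
   assume "(cmod (u ep z))\<^sup>2 <= 4 * (L2norm Om (u ep))\<^sup>2 / (ka * r0 ^ ?n)"
   then have "cmod (u ep z) <= sqrt (Q ep)"
    by (intro real_le_rsqrt) (simp add: Q_def N_def power2_eq_square)
   then show ?thesis using P(2)[of ep] by (simp add: add_increasing2)
  next
   assume "(cmod (u ep z)) ^ (?n + 2) <= 4 * (2 * M ep) ^ ?n * (L2norm Om (u ep))\<^sup>2 / ka"
   then have "cmod (u ep z) ^ (?n + 2) <= P ep" by (simp add: P_def N_def power2_eq_square del: power_Suc)
   then have "root (?n + 2) (cmod (u ep z) ^ (?n + 2)) <= root (?n + 2) (P ep)"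
    by (intro real_root_le_mono) auto
   then have "cmod (u ep z) <= root (?n + 2) (P ep)" by (subst (asm) real_root_power_cancel) auto
   then show ?thesis using Q(2)[of ep] by (simp add: add_increasing)
  qed
 qed
qed

lemma null_iff_snet:
 fixes Om :: "'a::euclidean_space set"
 assumes nice: "nice_dom Om" shows "u : null_nets Om \<longleftrightarrow> snet A_null Om u"
proof
 assume "u : null_nets Om"
 then show "snet A_null Om u"
  by (intro L2_null_imp_sup_null[OF nice]) (auto simp: null_nets_def A_null_def moderate_iff_snet[OF nice])
next
 assume u: "snet A_null Om u"
 from snet_L2norm_null[OF this nice lists.Nil] snet_mono[OF u A_null_mod] show "u : null_nets Om"
  by (simp add: null_nets_def A_null_def moderate_iff_snet[OF nice])
qed

section \<open>Intervals and the space-time rectangle are nice domains\<close>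

lemma L2_nn_integral_le:
 assumes f: "f : L2 Om" and Om: "Om : lmeasurable"
 shows "(\<integral>\<^sup>+z\<in>Om. ennreal (cmod (f z)) \<partial>lborel) <= ennreal (measure lebesgue Om + (L2norm Om f)\<^sup>2)"
proof -
 interpret finite_measure "lebesgue_on Om" by (rule finite_measure_lebesgue_on[OF Om])
 have Om': "Om \<inter> space lebesgue : sets lebesgue" using Om by simp
 have "(\<integral>\<^sup>+z\<in>Om. ennreal (cmod (f z)) \<partial>lborel) = (\<integral>\<^sup>+z. ennreal (cmod (f z)) \<partial>lebesgue_on Om)"
  by (simp add: nn_integral_restrict_space[OF Om'] nn_integral_completion)
 also have "\<dots> <= (\<integral>\<^sup>+z. ennreal (1 + (cmod (f z))\<^sup>2) \<partial>lebesgue_on Om)"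
 proof (intro nn_integral_mono ennreal_leI)
  \<comment> \<open>This pointwise inequality stands in for the Cauchy-Schwarz inequality; it is the
    origin of the shape "1 plus a sum of squares" in \<open>nice_dom\<close>.\<close>
  fix z show "cmod (f z) <= 1 + (cmod (f z))\<^sup>2"
   using zero_le_power2[of "cmod (f z) - 1 / 2"] by (simp add: power2_eq_square algebra_simps)
 qed
 also have "\<dots> = ennreal (LINT z|lebesgue_on Om. 1 + (cmod (f z))\<^sup>2)"
  using f by (intro nn_integral_eq_integral) (auto simp: L2_def)
 also have "(LINT z|lebesgue_on Om. 1 + (cmod (f z))\<^sup>2) = measure lebesgue Om + (L2norm Om f)\<^sup>2"
  using f Om by (simp add: L2_def L2norm_def measure_restrict_space fmeasurable_def)
 finally show ?thesis .
qed

lemma borel_cont_indicator: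
 fixes f :: "'a::euclidean_space => complex"
 assumes "continuous_on Om f" "open Om"
 shows "(%z. ennreal (cmod (f z)) * indicator Om z) : bmeas borel"
proof -
 have "(%z. indicator Om z *\<^sub>R cmod (f z)) : bmeas borel"
  by (rule borel_measurable_continuous_on_indicator) (use assms in \<open>auto intro!: continuous_intros\<close>)
 then have m: "(%z. ennreal (indicator Om z *\<^sub>R cmod (f z))) : bmeas borel" by measurable
 have eq: "(%z. ennreal (indicator Om z *\<^sub>R cmod (f z))) = (%z. ennreal (cmod (f z)) * indicator Om z)"
  by (auto simp: indicator_def)
 show ?thesis unfolding eq[symmetric] by (rule m)
qed

text \<open>\<open>cmod (g x)\<close> is at most \<open>cmod (g y)\<close> plus the integral of
  \<open>cmod g'\<close>, and this is integrated over \<open>y\<close>. Values in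
  \<open>ennreal\<close> allow the inequality to be used before integrability is known.\<close>

lemma sobolev_1d:
 fixes g g' :: "real => complex"
 assumes d: "!!x. x : {0<..<L} ==> (g has_vector_derivative g' x) (at x)"
  and c: "continuous_on {0<..<L} g'" and x: "x : {0<..<L}"
 shows "ennreal (L * cmod (g x)) <= (\<integral>\<^sup>+y\<in>{0<..<L}. ennreal (cmod (g y)) \<partial>lborel)
  + ennreal L * (\<integral>\<^sup>+y\<in>{0<..<L}. ennreal (cmod (g' y)) \<partial>lborel)"
proof -
 define I where "I = (\<integral>\<^sup>+y\<in>{0<..<L}. ennreal (cmod (g' y)) \<partial>lborel)"
 have gc: "continuous_on {0<..<L} g"
  by (intro continuous_at_imp_continuous_on ballI has_vector_derivative_continuous[OF d])
 have L: "L > 0" using x by auto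
 have le: "ennreal (cmod (g q - g p)) <= I" if "p <= q" "p : {0<..<L}" "q : {0<..<L}" for p q
 proof -
  have sub: "{p..q} \<subseteq> {0<..<L}" using that by auto
  have 1: "(g' has_integral (g q - g p)) {p..q}"
   by (rule fundamental_theorem_of_calculus[OF that(1)], rule has_vector_derivative_at_within, rule d)
    (use sub in auto)
  have 2: "((%y. cmod (g' y)) has_integral integral {p..q} (%y. cmod (g' y))) {p..q}"
   by (intro integrable_integral integrable_continuous_real continuous_intros continuous_on_subset[OF c sub])
  have "cmod (g q - g p) <= integral {p..q} (%y. cmod (g' y))"
   using 1 2 by (metis integral_norm_bound_integral has_integral_integrable integral_unique order_refl)
  then have "ennreal (cmod (g q - g p)) <= ennreal (integral {p..q} (%y. cmod (g' y)))"
   by (rule ennreal_leI)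
  also have "\<dots> = (\<integral>\<^sup>+y. ennreal (cmod (g' y)) * indicator {p..q} y \<partial>lborel)"
   by (rule nn_integral_has_integral_lebesgue'[symmetric]) (use 2 in auto)
  also have "\<dots> <= I" unfolding I_def
   by (rule nn_integral_mono) (use sub in \<open>auto simp: indicator_def\<close>)
  finally show ?thesis .
 qed
 have le': "ennreal (cmod (g x)) <= ennreal (cmod (g y)) + I" if y: "y : {0<..<L}" for y
 proof -
  have "ennreal (cmod (g x - g y)) <= I"
   using le[of x y] le[of y x] x y by (cases "x <= y") (auto simp: norm_minus_commute)
  moreover have "ennreal (cmod (g x)) <= ennreal (cmod (g y) + cmod (g x - g y))"
   by (intro ennreal_leI norm_triangle_sub)
  ultimately show ?thesis by (simp add: add_left_mono order_trans)
 qed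
 have "ennreal (L * cmod (g x)) = (\<integral>\<^sup>+y. ennreal (cmod (g x)) * indicator {0<..<L} y \<partial>lborel)"
  using L by (simp add: nn_integral_cmult_indicator ennreal_mult mult.commute)
 also have "\<dots> <= (\<integral>\<^sup>+y. ennreal (cmod (g y)) * indicator {0<..<L} y + I * indicator {0<..<L} y \<partial>lborel)"
  by (rule nn_integral_mono) (use le' in \<open>auto simp: indicator_def\<close>)
 also have "\<dots> = (\<integral>\<^sup>+y\<in>{0<..<L}. ennreal (cmod (g y)) \<partial>lborel) + I * ennreal L"
  using borel_cont_indicator[OF gc] L by (subst nn_integral_add) (auto simp: nn_integral_cmult_indicator)
 finally show ?thesis by (simp add: I_def mult.commute)
qed

lemma pdiff_real_vector_derivative:
 fixes f :: "real => complex"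
 assumes "f differentiable (at x)" shows "(f has_vector_derivative pdiff 1 f x) (at x)"
 using pdiff_has_derivative[OF assms] by (simp add: has_vector_derivative_def)

lemma smooth_on_differentiable:
 assumes "smooth_on Om f" "open Om" "es : lists Basis" "z : Om"
 shows "pdiffs es f differentiable (at z)"
 using assms(1)[unfolded smooth_on_at[OF assms(2)]] assms(3,4) by (elim ballE) auto

lemma smooth_on_continuous:
 assumes "smooth_on Om f" "es : lists Basis"
 shows "continuous_on Om (pdiffs es f)"
 using assms by (auto simp: smooth_on_def intro: differentiable_imp_continuous_on)

lemma nice_U:
 assumes L: "L > 0" shows "nice_dom {0<..<L::real}"
proof -
 have lm: "{0<..<L} : lmeasurable" by simp
 have sob: "cmod (f z) <= (1 + 1 / L) * (1 + L) * (1 + (\<Sum>es\<leftarrow>[[], [1::real]]. (L2norm {0<..<L} (pdiffs es f))\<^sup>2))"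
  if f: "f : Hinf {0<..<L}" and z: "z : {0<..<L}" for f z
 proof -
  have sm: "smooth_on {0<..<L} f" and l2: "f : L2 {0<..<L}" "pdiff 1 f : L2 {0<..<L}"
   using f bspec[of "lists Basis" "%es. pdiffs es f : L2 {0<..<L}" "[]"]
    bspec[of "lists Basis" "%es. pdiffs es f : L2 {0<..<L}" "[1]"]
   by (auto simp: Hinf_def pdiffs_Cons)
  let ?a = "(L2norm {0<..<L} f)\<^sup>2" and ?b = "(L2norm {0<..<L} (pdiff 1 f))\<^sup>2"
  have "ennreal (L * cmod (f z)) <= (\<integral>\<^sup>+y\<in>{0<..<L}. ennreal (cmod (f y)) \<partial>lborel)
    + ennreal L * (\<integral>\<^sup>+y\<in>{0<..<L}. ennreal (cmod (pdiff 1 f y)) \<partial>lborel)"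
  proof (rule sobolev_1d[OF _ _ z])
   show "(f has_vector_derivative pdiff 1 f x) (at x)" if "x : {0<..<L}" for x
    using smooth_on_differentiable[OF sm _ lists.Nil that] by (intro pdiff_real_vector_derivative) simp
   show "continuous_on {0<..<L} (pdiff 1 f)"
    using smooth_on_continuous[OF sm, of "[1]"] by (simp add: pdiffs_Cons)
  qed
  also have "\<dots> <= ennreal (L + ?a) + ennreal L * ennreal (L + ?b)"
   using L2_nn_integral_le[OF l2(1) lm] L2_nn_integral_le[OF l2(2) lm] L
   by (intro add_mono mult_left_mono) auto
  also have "\<dots> = ennreal ((L + ?a) + L * (L + ?b))"
   using L by (simp add: ennreal_mult[symmetric] ennreal_plus[symmetric] del: ennreal_plus)
  finally have "L * cmod (f z) <= (L + ?a) + L * (L + ?b)"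
   using L by (subst (asm) ennreal_le_iff) auto
  also have "\<dots> <= (1 + L) * (1 + L) * (1 + (?a + ?b))"
   using L by (simp add: algebra_simps)
  finally have "cmod (f z) <= (1 + L) * (1 + L) * (1 + (?a + ?b)) / L"
   using L by (simp add: pos_le_divide_eq mult.commute)
  also have "\<dots> = (1 + 1 / L) * (1 + L) * (1 + (?a + ?b))" using L by (simp add: field_simps)
  finally show ?thesis by (simp add: pdiffs_Cons)
 qed
 \<comment> \<open>An interval of length \<open>r\<close> that starts at \<open>z\<close> and points
   away from the nearer endpoint stays inside the domain.\<close>
 have cone: "\<exists>S\<in>sets borel. S \<subseteq> {0<..<L} \<inter> cball z r \<and> (1 / 2) * r ^ DIM(real) <= measure lebesgue S"
  if z: "z : {0<..<L}" and r: "r : {0<..L / 2}" for z r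
 proof (cases "z <= L / 2")
  case True
  then show ?thesis using z r
   by (intro bexI[of _ "{z..<z + r}"]) (auto simp: cball_def dist_real_def)
 next
  case False
  then show ?thesis using z r
   by (intro bexI[of _ "{z - r<..z}"]) (auto simp: cball_def dist_real_def)
 qed
 have dir: "\<exists>\<sigma>\<in>{-1, 1}. \<forall>s\<in>{0..L / 4}. z + (s * \<sigma>) *\<^sub>R e : {0<..<L}"
  if z: "z : {0<..<L}" and e: "e : Basis" for z e :: real
 proof (cases "z <= L / 2")
  case True
  then show ?thesis using z e L by (intro bexI[of _ 1]) auto
 next
  case False
  then show ?thesis using z e L by (intro bexI[of _ "-1"]) auto
 qed
 have B: "set [[], [1::real]] \<subseteq> lists Basis" by simp
 show ?thesis unfolding nice_dom_def
 proof (intro conjI)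
  show "\<exists>C\<ge>0. \<exists>ES. set ES \<subseteq> lists Basis \<and> (\<forall>f\<in>Hinf {0<..<L}. \<forall>z\<in>{0<..<L}.
    cmod (f z) <= C * (1 + (\<Sum>es\<leftarrow>ES. (L2norm {0<..<L} (pdiffs es f))\<^sup>2)))"
  proof (rule exI[of _ "(1 + 1 / L) * (1 + L)"], rule conjI)
   show "0 <= (1 + 1 / L) * (1 + L)" using L by simp
   show "\<exists>ES. set ES \<subseteq> lists Basis \<and> (\<forall>f\<in>Hinf {0<..<L}. \<forall>z\<in>{0<..<L}.
    cmod (f z) <= (1 + 1 / L) * (1 + L) * (1 + (\<Sum>es\<leftarrow>ES. (L2norm {0<..<L} (pdiffs es f))\<^sup>2)))"
    by (rule exI[of _ "[[], [1::real]]"], rule conjI[OF B], rule ballI, rule ballI, rule sob)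
  qed
  show "\<exists>ka>0. \<exists>r0>0. \<forall>z\<in>{0<..<L}. \<forall>r\<in>{0<..r0}.
    \<exists>S\<in>sets borel. S \<subseteq> {0<..<L} \<inter> cball z r \<and> ka * r ^ DIM(real) <= measure lebesgue S"
  proof (rule exI[of _ "(1 / 2)"], rule conjI)
   show "\<exists>r0>0. \<forall>z\<in>{0<..<L}. \<forall>r\<in>{0<..r0}.
    \<exists>S\<in>sets borel. S \<subseteq> {0<..<L} \<inter> cball z r \<and> (1 / 2) * r ^ DIM(real) <= measure lebesgue S"
    by (rule exI[of _ "L / 2"], rule conjI, (use L in simp), rule ballI, rule ballI, rule cone)
  qed simp
  show "\<exists>et>0. \<forall>z\<in>{0<..<L}. \<forall>e\<in>Basis. \<exists>\<sigma>\<in>{- 1, 1}. \<forall>s\<in>{0..et}. z + (s * \<sigma>) *\<^sub>R e : {0<..<L}"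
   by (rule exI[of _ "L / 4"], rule conjI, (use L in simp), rule ballI, rule ballI, rule dir)
 qed auto
qed

lemma open_XT: "open (XT T)" and convex_XT: "convex (XT T)" and bounded_XT: "bounded (XT T)"
 by (auto simp: XT_def intro!: open_Times convex_Times bounded_Times)

lemma Basis_XT: "(Basis :: (real \<times> real) set) = {dirX, dirT}"
 by (auto simp: Basis_prod_def)

lemma pdiff_slice_x:
 fixes f :: "real \<times> real => complex"
 assumes "f differentiable (at (x, t))"
 shows "((%x. f (x, t)) has_vector_derivative dX f (x, t)) (at x)"
proof -
 have "((%x. (x, t)) has_derivative (%s. (s, 0))) (at x)" by (auto intro!: derivative_eq_intros)
 from has_derivative_compose[OF this pdiff_has_derivative[OF assms]]
 show ?thesis by (simp add: has_vector_derivative_def Basis_XT)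
qed

lemma pdiff_slice_t:
 fixes f :: "real \<times> real => complex"
 assumes "f differentiable (at (x, t))"
 shows "((%t. f (x, t)) has_vector_derivative dT f (x, t)) (at t)"
proof -
 have "((%t. (x, t)) has_derivative (%s. (0, s))) (at t)" by (auto intro!: derivative_eq_intros)
 from has_derivative_compose[OF this pdiff_has_derivative[OF assms]]
 show ?thesis by (simp add: has_vector_derivative_def Basis_XT)
qed

lemma nn_integral_XT:
 assumes "h : bmeas borel"
 shows "(\<integral>\<^sup>+ta\<in>{0<..<T}. (\<integral>\<^sup>+s\<in>{0<..<1}. h (s, ta) \<partial>lborel) \<partial>lborel) = (\<integral>\<^sup>+z\<in>XT T. h z \<partial>(lborel :: (real \<times> real) measure))"
proof -
 have XT: "XT T : sets borel" using open_XT by simp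
 have hm: "(%z. h z * indicator (XT T) z) : bmeas (lborel \<Otimes>\<^sub>M lborel)"
  using assms XT by (simp add: lborel_prod)
 have "(\<integral>\<^sup>+z\<in>XT T. h z \<partial>lborel) = (\<integral>\<^sup>+z. h z * indicator (XT T) z \<partial>(lborel \<Otimes>\<^sub>M lborel))"
  by (simp add: lborel_prod)
 also have "\<dots> = (\<integral>\<^sup>+ta. (\<integral>\<^sup>+s. h (s, ta) * indicator (XT T) (s, ta) \<partial>lborel) \<partial>lborel)"
  by (rule lborel_pair.nn_integral_snd[symmetric, OF hm])
 also have "\<dots> = (\<integral>\<^sup>+ta\<in>{0<..<T}. (\<integral>\<^sup>+s\<in>{0<..<1}. h (s, ta) \<partial>lborel) \<partial>lborel)"
  by (intro nn_integral_cong) (auto simp: XT_def indicator_def split: if_splits)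
 finally show ?thesis by simp
qed

text \<open>The Sobolev bound is iterated. \<open>sobolev_1d\<close> in \<open>t\<close> at fixed
  \<open>x\<close> leads to integrals of \<open>f\<close> and its \<open>t\<close>-derivative along
  a line; \<open>sobolev_1d\<close> in \<open>x\<close> followed by Tonelli bounds these by
  integrals over the rectangle. Hence the four multi-indices in \<open>?ES\<close>, the mixed one
  among them.\<close>

lemma nice_XT:
 assumes T: "T > 0" shows "nice_dom (XT T)"
proof -
 have lm: "XT T : lmeasurable" by (simp add: bounded_set_imp_lmeasurable bounded_XT open_XT borel_open)
 let ?I = "%f. \<integral>\<^sup>+z\<in>XT T. ennreal (cmod (f z)) \<partial>lborel"
 let ?ES = "[[], [dirX], [dirT], [dirX, dirT]]"
 have sob: "cmod (f z) <= (1 + 1 / T) * (4 * (1 + measure lebesgue (XT T))) * (1 + (\<Sum>es\<leftarrow>?ES. (L2norm (XT T) (pdiffs es f))\<^sup>2))"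
  if f: "f : Hinf (XT T)" and z: "z : XT T" for f z
 proof -
  have sm: "smooth_on (XT T) f" and l2: "!!es. es : lists Basis ==> pdiffs es f : L2 (XT T)"
   using f by (auto simp: Hinf_def)
  obtain x t where xt: "z = (x, t)" "x : {0<..<1}" "t : {0<..<T}" using z by (auto simp: XT_def)
  have XTI: "(x, t) : XT T" if "x : {0<..<1}" "t : {0<..<T}" for x t using that by (simp add: XT_def)
  have cont: "continuous_on {0<..<1} (%x. pdiffs es f (x, t))" if "es : lists Basis" "t : {0<..<T}" for es t
   by (rule continuous_on_compose2[OF smooth_on_continuous[OF sm that(1)]])
    (use XTI that in \<open>auto intro!: continuous_intros\<close>)
  have contt: "continuous_on {0<..<T} (%t. pdiffs es f (x, t))" if "es : lists Basis" for es
   by (rule continuous_on_compose2[OF smooth_on_continuous[OF sm that(1)]])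
    (use XTI xt in \<open>auto intro!: continuous_intros\<close>)
  have inX: "ennreal (cmod (pdiffs es f (x, ta))) <= (\<integral>\<^sup>+s\<in>{0<..<1}. ennreal (cmod (pdiffs es f (s, ta))) \<partial>lborel)
    + (\<integral>\<^sup>+s\<in>{0<..<1}. ennreal (cmod (pdiffs (dirX # es) f (s, ta))) \<partial>lborel)"
   if es: "es : lists Basis" and ta: "ta : {0<..<T}" for es ta
  proof -
   have es': "dirX # es : lists Basis" using es by (simp add: Basis_XT)
   have "((%s. pdiffs es f (s, ta)) has_vector_derivative pdiffs (dirX # es) f (s, ta)) (at s)"
    if "s : {0<..<1}" for s
    unfolding pdiffs_Cons using smooth_on_differentiable[OF sm open_XT es XTI[OF that ta]]
    by (rule pdiff_slice_x)
   from sobolev_1d[OF this cont[OF es' ta] xt(2)] show ?thesis by simp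
  qed
  have bnd: "?I (pdiffs es f) <= ennreal (measure lebesgue (XT T) + (L2norm (XT T) (pdiffs es f))\<^sup>2)"
   if "es : lists Basis" for es
   by (rule L2_nn_integral_le[OF l2[OF that] lm])
  have meas: "(%z. ennreal (cmod (pdiffs es f z)) * indicator (XT T) z) : bmeas borel"
   if "es : lists Basis" for es
   by (rule borel_cont_indicator[OF smooth_on_continuous[OF sm that] open_XT])
  have int: "(\<integral>\<^sup>+ta\<in>{0<..<T}. ennreal (cmod (pdiffs es f (x, ta))) \<partial>lborel)
    <= ?I (pdiffs es f) + ?I (pdiffs (dirX # es) f)" if es: "es : lists Basis" for es
  proof -
   have es': "dirX # es : lists Basis" using es by (simp add: Basis_XT)
   \<comment> \<open>The indicator of \<open>XT T\<close> makes the integrand Borel on the whole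
     plane, as the derivatives are arbitrary off the rectangle.\<close>
   let ?F = "%es ta. \<integral>\<^sup>+s\<in>{0<..<1}. ennreal (cmod (pdiffs es f (s, ta))) * indicator (XT T) (s, ta) \<partial>lborel"
   have F: "?F es ta = (\<integral>\<^sup>+s\<in>{0<..<1}. ennreal (cmod (pdiffs es f (s, ta))) \<partial>lborel)" if "ta : {0<..<T}" for es ta
    by (rule nn_integral_cong) (use XTI that in \<open>auto simp: indicator_def\<close>)
   have Fm: "?F es : bmeas lborel" if "es : lists Basis" for es
   proof -
    have "(%z. ennreal (cmod (pdiffs es f z)) * indicator (XT T) z * indicator {0<..<1} (fst z)) : bmeas (lborel \<Otimes>\<^sub>M lborel)"
     using meas[OF that] by (simp add: lborel_prod borel_prod[symmetric])
    from measurable_compose[OF measurable_pair_swap' this]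
    have "(%(ta, s). ennreal (cmod (pdiffs es f (s, ta))) * indicator (XT T) (s, ta) * indicator {0<..<1} s)
     : bmeas (lborel \<Otimes>\<^sub>M lborel)" by (simp add: case_prod_unfold)
    from lborel.borel_measurable_nn_integral[OF this] show ?thesis .
   qed
   have "(\<integral>\<^sup>+ta\<in>{0<..<T}. ennreal (cmod (pdiffs es f (x, ta))) \<partial>lborel)
     <= (\<integral>\<^sup>+ta. ?F es ta * indicator {0<..<T} ta + ?F (dirX # es) ta * indicator {0<..<T} ta \<partial>lborel)"
   proof (rule nn_integral_mono)
    fix ta show "ennreal (cmod (pdiffs es f (x, ta))) * indicator {0<..<T} ta
     <= ?F es ta * indicator {0<..<T} ta + ?F (dirX # es) ta * indicator {0<..<T} ta"
    proof (cases "ta : {0<..<T}")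
     case True
     then show ?thesis using inX[OF es True] unfolding F[OF True] by simp
    qed simp
   qed
   also have "\<dots> = (\<integral>\<^sup>+ta\<in>{0<..<T}. ?F es ta \<partial>lborel) + (\<integral>\<^sup>+ta\<in>{0<..<T}. ?F (dirX # es) ta \<partial>lborel)"
    using Fm[OF es] Fm[OF es'] by (intro nn_integral_add) simp_all
   also have "(%es. \<integral>\<^sup>+ta\<in>{0<..<T}. ?F es ta \<partial>lborel) es = ?I (pdiffs es f)"
    unfolding nn_integral_XT[OF meas[OF es]] by (rule nn_integral_cong) (auto simp: indicator_def)
   also have "(%es. \<integral>\<^sup>+ta\<in>{0<..<T}. ?F es ta \<partial>lborel) (dirX # es) = ?I (pdiffs (dirX # es) f)"
    unfolding nn_integral_XT[OF meas[OF es']] by (rule nn_integral_cong) (auto simp: indicator_def)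
   finally show ?thesis by simp
  qed
  let ?n = "%es. (L2norm (XT T) (pdiffs es f))\<^sup>2" and ?m = "measure lebesgue (XT T)"
  have B: "[] : lists Basis" "[dirX] : lists Basis" "[dirT] : lists Basis" "[dirX, dirT] : lists Basis"
   by (simp_all add: Basis_XT)
  have "ennreal (T * cmod (f (x, t))) <= (\<integral>\<^sup>+ta\<in>{0<..<T}. ennreal (cmod (f (x, ta))) \<partial>lborel)
    + ennreal T * (\<integral>\<^sup>+ta\<in>{0<..<T}. ennreal (cmod (pdiffs [dirT] f (x, ta))) \<partial>lborel)"
  proof (rule sobolev_1d[OF _ contt[OF B(3)] xt(3)])
   show "((%t. f (x, t)) has_vector_derivative pdiffs [dirT] f (x, ta)) (at ta)" if "ta : {0<..<T}" for ta
    using smooth_on_differentiable[OF sm open_XT B(1) XTI[OF xt(2) that]]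
    by (simp add: pdiffs_Cons pdiff_slice_t)
  qed
  also have "\<dots> <= (ennreal (?m + ?n []) + ennreal (?m + ?n [dirX]))
    + ennreal T * (ennreal (?m + ?n [dirT]) + ennreal (?m + ?n [dirX, dirT]))"
   using order_trans[OF int[OF B(1)] add_mono[OF bnd[OF B(1)] bnd[OF B(2)]]]
    order_trans[OF int[OF B(3)] add_mono[OF bnd[OF B(3)] bnd[OF B(4)]]]
   by (intro add_mono mult_left_mono) auto
  also have "\<dots> = ennreal ((?m + ?n [] + (?m + ?n [dirX])) + T * (?m + ?n [dirT] + (?m + ?n [dirX, dirT])))"
   using T by (simp add: ennreal_mult[symmetric] ennreal_plus[symmetric] del: ennreal_plus)
  finally have "T * cmod (f (x, t)) <= (?m + ?n [] + (?m + ?n [dirX])) + T * (?m + ?n [dirT] + (?m + ?n [dirX, dirT]))"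
   using T by (subst (asm) ennreal_le_iff) auto
  also have "\<dots> <= (1 + T) * (4 * (1 + ?m)) * (1 + (?n [] + ?n [dirX] + ?n [dirT] + ?n [dirX, dirT]))"
  proof -
   have *: "(m + p + (m + q)) + t * (m + r + (m + s)) <= (1 + t) * (4 * (1 + m)) * (1 + (p + q + r + s))"
    if "t >= 0" "m >= 0" "p >= 0" "q >= 0" "r >= 0" "s >= 0" for m p q r s t :: real
   proof -
    let ?A = "p + q + r + s"
    have "(m + p + (m + q)) + t * (m + r + (m + s)) <= (2 * m + ?A) + t * (2 * m + ?A)"
    proof (rule add_mono)
     show "t * (m + r + (m + s)) <= t * (2 * m + ?A)" using that by (intro mult_left_mono) linarith+
    qed (use that in linarith)
    also have "\<dots> = (1 + t) * (2 * m + ?A)" by (simp add: algebra_simps)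
    also have "\<dots> <= (1 + t) * ((4 * (1 + m)) * (1 + ?A))"
    proof (rule mult_left_mono)
     have lin: "2 * m + a <= 4 + 4 * m + 4 * a + 4 * x" if "0 <= m" "0 <= a" "0 <= x" for a x
     using that by linarith
     have "2 * m + ?A <= 4 + 4 * m + 4 * ?A + 4 * (m * ?A)"
     by (rule lin) (use that in \<open>auto intro!: mult_nonneg_nonneg\<close>)
     also have "\<dots> = (4 * (1 + m)) * (1 + ?A)" by (simp only: algebra_simps)
     finally show "2 * m + ?A <= (4 * (1 + m)) * (1 + ?A)" .
    qed (use that in simp)
    finally show ?thesis by (simp only: mult.assoc)
   qed
   show ?thesis by (rule *) (use T in auto)
  qed
  finally have "cmod (f (x, t)) <= (1 + T) * (4 * (1 + ?m)) * (1 + (?n [] + ?n [dirX] + ?n [dirT] + ?n [dirX, dirT])) / T"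
   using T by (simp add: pos_le_divide_eq mult.commute)
  also have "\<dots> = (1 + 1 / T) * (4 * (1 + ?m)) * (1 + (?n [] + ?n [dirX] + ?n [dirT] + ?n [dirX, dirT]))"
   using T by (simp add: field_simps)
  finally show ?thesis by (simp add: xt add.assoc)
 qed
 define a where "a = min 1 T / 2"
 have a: "a > 0" "a <= 1 / 2" "a <= T / 2" using T by (auto simp: a_def)
 have cone: "\<exists>S\<in>sets borel. S \<subseteq> XT T \<inter> cball z r \<and> (1 / 4) * r ^ DIM(real \<times> real) <= measure lebesgue S"
  if z: "z : XT T" and r: "r : {0<..a}" for z r
 proof -
  obtain x t where xt: "z = (x, t)" "x : {0<..<1}" "t : {0<..<T}" using z by (auto simp: XT_def)
  \<comment> \<open>Lower left corner of a square of side \<open>r / 2\<close> that has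
    \<open>z\<close> as one corner and opens away from the nearer sides; its area is the source of
    the constant \<open>1 / 4\<close>.\<close>
  define p where "p = (if x <= 1 / 2 then x else x - r / 2)"
  define q where "q = (if t <= T / 2 then t else t - r / 2)"
  have pq: "{p<..<p + r / 2} \<subseteq> {0<..<1}" "{q<..<q + r / 2} \<subseteq> {0<..<T}"
   using xt r a by (auto simp: p_def q_def)
  have near: "\<bar>x - x'\<bar> <= r / 2" if "x' : {p<..<p + r / 2}" for x' using that r by (auto simp: p_def split: if_splits)
  have near': "\<bar>t - t'\<bar> <= r / 2" if "t' : {q<..<q + r / 2}" for t' using that r by (auto simp: q_def split: if_splits)
  let ?S = "box (p, q) (p + r / 2, q + r / 2)"
  have S: "?S = {p<..<p + r / 2} \<times> {q<..<q + r / 2}" by (auto simp: box_def Basis_XT)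
  have "?S \<subseteq> XT T" unfolding S XT_def using pq by blast
  moreover have "?S \<subseteq> cball z r"
  proof
   fix w assume "w : ?S"
   then obtain x' t' where w: "w = (x', t')" "x' : {p<..<p + r / 2}" "t' : {q<..<q + r / 2}"
    unfolding S by blast
   have "dist z w <= \<bar>x - x'\<bar> + \<bar>t - t'\<bar>"
    unfolding xt w dist_Pair_Pair dist_real_def using sqrt_sum_squares_le_sum_abs[of "x - x'" "t - t'"] by simp
   with near[OF w(2)] near'[OF w(3)] show "w : cball z r" by simp
  qed
  moreover have "measure lebesgue ?S = (r / 2) * (r / 2)"
  proof -
   have "measure lborel ?S = (\<Prod>b\<in>Basis. ((p + r / 2, q + r / 2) - (p, q)) \<bullet> b)"
    by (rule measure_lborel_box) (use r in \<open>auto simp: Basis_XT\<close>)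
   then show ?thesis by (simp add: Basis_XT)
  qed
  ultimately show ?thesis
   by (intro bexI[of _ ?S]) (auto simp: power2_eq_square)
 qed
 have dir: "\<exists>\<sigma>\<in>{-1, 1}. \<forall>s\<in>{0..a / 2}. z + (s * \<sigma>) *\<^sub>R e : XT T"
  if z: "z : XT T" and e: "e : Basis" for z e
 proof -
  obtain x t where xt: "z = (x, t)" "0 < x" "x < 1" "0 < t" "t < T" using z by (auto simp: XT_def)
  define \<sigma> :: real where "\<sigma> = (if e = dirX then (if x <= 1 / 2 then 1 else -1) else (if t <= T / 2 then 1 else -1))"
  have "z + (s * \<sigma>) *\<^sub>R e : XT T" if "s : {0..a / 2}" for s
   using e xt a that by (auto simp: Basis_XT \<sigma>_def XT_def)
  then show ?thesis by (intro bexI[of _ \<sigma>]) (auto simp: \<sigma>_def)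
 qed
 have B: "set ?ES \<subseteq> lists Basis" by (simp add: Basis_XT)
 show ?thesis unfolding nice_dom_def
 proof (intro conjI)
  show "\<exists>C\<ge>0. \<exists>ES. set ES \<subseteq> lists Basis \<and> (\<forall>f\<in>Hinf (XT T). \<forall>z\<in>(XT T).
    cmod (f z) <= C * (1 + (\<Sum>es\<leftarrow>ES. (L2norm (XT T) (pdiffs es f))\<^sup>2)))"
  proof (rule exI[of _ "(1 + 1 / T) * (4 * (1 + measure lebesgue (XT T)))"], rule conjI)
   show "0 <= (1 + 1 / T) * (4 * (1 + measure lebesgue (XT T)))" using T a by simp
   show "\<exists>ES. set ES \<subseteq> lists Basis \<and> (\<forall>f\<in>Hinf (XT T). \<forall>z\<in>(XT T).
    cmod (f z) <= (1 + 1 / T) * (4 * (1 + measure lebesgue (XT T))) * (1 + (\<Sum>es\<leftarrow>ES. (L2norm (XT T) (pdiffs es f))\<^sup>2)))"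
    by (rule exI[of _ "?ES"], rule conjI[OF B], rule ballI, rule ballI, rule sob)
  qed
  show "\<exists>ka>0. \<exists>r0>0. \<forall>z\<in>(XT T). \<forall>r\<in>{0<..r0}.
    \<exists>S\<in>sets borel. S \<subseteq> (XT T) \<inter> cball z r \<and> ka * r ^ DIM(real \<times> real) <= measure lebesgue S"
  proof (rule exI[of _ "(1 / 4)"], rule conjI)
   show "\<exists>r0>0. \<forall>z\<in>(XT T). \<forall>r\<in>{0<..r0}.
    \<exists>S\<in>sets borel. S \<subseteq> (XT T) \<inter> cball z r \<and> (1 / 4) * r ^ DIM(real \<times> real) <= measure lebesgue S"
    by (rule exI[of _ "a"], rule conjI, (use T a in simp), rule ballI, rule ballI, rule cone)
  qed simp
  show "\<exists>et>0. \<forall>z\<in>(XT T). \<forall>e\<in>Basis. \<exists>\<sigma>\<in>{- 1, 1}. \<forall>s\<in>{0..et}. z + (s * \<sigma>) *\<^sub>R e : (XT T)"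
   by (rule exI[of _ "a / 2"], rule conjI, (use T a in simp), rule ballI, rule ballI, rule dir)
 qed (use open_XT convex_XT bounded_XT in auto)
qed

section \<open>Boundary values and traces\<close>

lemma nice_at_within_nontrivial:
 fixes Om :: "'a::euclidean_space set"
 assumes "open Om" "z : closure Om"
 shows "at z within Om \<noteq> bot"
proof -
 have "z islimpt Om"
 proof (cases "z : Om")
  case True
  then show ?thesis using interior_limit_point[of z Om] assms(1) by (simp add: interior_open)
 next
  case False
  then show ?thesis using assms(2) by (simp add: closure_def)
 qed
 then show ?thesis by (simp add: trivial_limit_within)
qed

text \<open>
 \<^term>\<open>bdval\<close> is a \<open>Lim\<close>, hence a definite description; it is pinned down by exhibiting a continuous extension.
\<close>

lemma bdval_unique:
 fixes Om :: "'a::euclidean_space set"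
 assumes "open Om" "continuous_on (closure Om) G" "!!w. w : Om ==> f w = G w" "z : closure Om"
 shows "bdval Om f z = G z"
proof -
 have "(G \<longlongrightarrow> G z) (at z within closure Om)" using assms by (simp add: continuous_on_def)
 then have "(G \<longlongrightarrow> G z) (at z within Om)" by (rule tendsto_within_subset) (rule closure_subset)
 then have "(f \<longlongrightarrow> G z) (at z within Om)"
  by (rule Lim_transform_eventually) (use assms(3) in \<open>auto simp: eventually_at_filter\<close>)
 then show ?thesis unfolding bdval_def
  by (rule tendsto_Lim[OF nice_at_within_nontrivial[OF assms(1,4)]])
qed

text \<open>Bounded derivatives on a convex set give a Lipschitz bound, hence uniform continuity and
  a continuous extension to the closure.\<close>

lemma bsm_extension:
 fixes Om :: "'a::euclidean_space set"
 assumes nice: "nice_dom Om" and f: "bsm Om f"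
 obtains G where "continuous_on (closure Om) G" "!!w. w : Om ==> f w = G w"
proof -
 have "\<exists>K. \<forall>e\<in>E. \<forall>z\<in>Om. cmod (pdiff e f z) <= K" if "finite E" "E \<subseteq> Basis" for E
  using that
 proof (induction E)
  case (insert e E)
  then obtain K where K: "\<forall>e\<in>E. \<forall>z\<in>Om. cmod (pdiff e f z) <= K" by auto
  obtain K' where K': "!!z. z : Om ==> cmod (pdiff e f z) <= K'"
   using snet_bound0[OF snet_pdiff[OF f, of e]] insert.prems by (metis insert_subset zero_less_one order_refl)
  show ?case
   by (rule exI[of _ "max K K'"]) (use K K' in \<open>simp add: le_max_iff_disj\<close>)
 qed simp
 from this[OF finite_Basis order_refl] obtain K where K: "!!e z. e : Basis ==> z : Om ==> cmod (pdiff e f z) <= K" by blast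
 have lip: "cmod (f w - f z) <= real DIM('a) * K * dist w z" if "w : Om" "z : Om" for w z
  by (rule bsm_Lipschitz[OF f nice_open[OF nice] nice_convex[OF nice] K that])
 have "uniformly_continuous_on Om f"
  unfolding uniformly_continuous_on_def
 proof (intro allI impI)
  fix e :: real assume e: "e > 0"
  let ?L = "real DIM('a) * \<bar>K\<bar> + 1"
  have L: "?L > 0" by (simp add: add_nonneg_pos)
  show "\<exists>d>0. \<forall>x\<in>Om. \<forall>x'\<in>Om. dist x' x < d --> dist (f x') (f x) < e"
  proof (intro exI[of _ "e / ?L"] conjI ballI impI)
   fix x x' assume x: "x : Om" "x' : Om" "dist x' x < e / ?L"
   have "dist (f x') (f x) <= real DIM('a) * K * dist x' x" using lip[OF x(2,1)] by (simp add: dist_norm)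
   also have "\<dots> <= ?L * dist x' x"
   proof (rule mult_right_mono)
    have "real DIM('a) * K <= real DIM('a) * \<bar>K\<bar>" by (rule mult_left_mono) simp_all
    then show "real DIM('a) * K <= ?L" by linarith
   qed simp
   also have "\<dots> < e" using x(3) L by (simp add: pos_less_divide_eq mult.commute)
   finally show "dist (f x') (f x) < e" .
  qed (use e L in simp)
 qed
 then show thesis
 proof (rule uniformly_continuous_on_extension_on_closure)
  fix G assume "uniformly_continuous_on (closure Om) G" and G: "!!x. x : Om ==> f x = G x"
  from that[OF uniformly_continuous_imp_continuous[OF this(1)] G] show thesis .
 qed
qed

lemma bdval_inside:
 assumes "nice_dom Om" "bsm Om f" "z : Om" shows "bdval Om f z = f z"
proof -
 obtain G where G: "continuous_on (closure Om) G" "!!w. w : Om ==> f w = G w"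
  using bsm_extension[OF assms(1,2)] by blast
 have "z : closure Om" using assms(3) closure_subset by blast
 from bdval_unique[OF nice_open[OF assms(1)] G this] G(2)[OF assms(3)] show ?thesis by simp
qed

lemma bdval_continuous:
 assumes "nice_dom Om" "bsm Om f" shows "continuous_on (closure Om) (bdval Om f)"
proof -
 obtain G where G: "continuous_on (closure Om) G" "!!w. w : Om ==> f w = G w"
  using bsm_extension[OF assms(1,2)] by blast
 show ?thesis
  by (rule continuous_on_eq[OF G(1)]) (use bdval_unique[OF nice_open[OF assms(1)] G] in simp)
qed

lemma bdval_cong:
 assumes nice: "nice_dom Om" and f: "bsm Om f" and eq: "!!w. w : Om ==> f w = g w" and z: "z : closure Om"
 shows "bdval Om g z = bdval Om f z"
 by (rule bdval_unique[OF nice_open[OF nice] bdval_continuous[OF nice f] _ z])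
  (simp add: bdval_inside[OF nice f] eq)

lemma bdval_diff:
 assumes nice: "nice_dom Om" and "bsm Om f" "bsm Om g" and z: "z : closure Om"
 shows "bdval Om (%w. f w - g w) z = bdval Om f z - bdval Om g z"
 by (rule bdval_unique[OF nice_open[OF nice] _ _ z])
  (auto intro!: continuous_intros bdval_continuous assms simp: bdval_inside assms)

lemma bdval_bound:
 fixes Om :: "'a::euclidean_space set"
 assumes nice: "nice_dom Om" and f: "bsm Om f" and K: "!!w. w : Om ==> cmod (f w) <= K" and z: "z : closure Om"
 shows "cmod (bdval Om f z) <= K"
proof -
 have "continuous_on (closure Om) (%z. cmod (bdval Om f z))"
  by (intro continuous_intros bdval_continuous[OF nice f])
 then show ?thesis
  by (rule continuous_le_on_closure[OF _ z]) (simp add: bdval_inside[OF nice f] K)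
qed

text \<open>Both points are moved towards one interior point \<open>w\<close> by the same fraction
  \<open>d\<close>. Convexity puts them into \<open>Om\<close>, and they still differ by a multiple
  of \<open>e\<close>, namely \<open>(1 - d) * h\<close>; so \<open>quadratic_remainder\<close>
  applies there, and \<open>d\<close> tending to 0 gives the estimate on the closure.\<close>

lemma bdval_quadratic:
 fixes Om :: "'a::euclidean_space set"
 assumes nice: "nice_dom Om" and f: "bsm Om f" and e: "e : Basis"
  and z: "z : closure Om" "z + h *\<^sub>R e : closure Om"
  and K: "!!w. w : Om ==> cmod (pdiff e (pdiff e f) w) <= K"
 shows "cmod (bdval Om f (z + h *\<^sub>R e) - bdval Om f z - h *\<^sub>R bdval Om (pdiff e f) z) <= K * h\<^sup>2"
proof -
 have "Om \<noteq> {}" using z by auto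
 then obtain w where w: "w : Om" by blast
 define Z Z' where "Z d = z - d *\<^sub>R (z - w)" and "Z' d = z + h *\<^sub>R e - d *\<^sub>R (z + h *\<^sub>R e - w)" for d
 have shrink: "p - d *\<^sub>R (p - w) : Om" if "p : closure Om" "0 < d" "d <= 1" for p d
  using mem_interior_closure_convex_shrink[OF nice_convex[OF nice] _ that, of w] w nice_open[OF nice]
  by (simp add: interior_open)
 note f' = snet_pdiff[OF f e]
 have le: "cmod (bdval Om f (Z' d) - bdval Om f (Z d) - ((1 - d) * h) *\<^sub>R bdval Om (pdiff e f) (Z d)) <= K * ((1 - d) * h)\<^sup>2"
  if d: "0 < d" "d <= 1" for d
 proof -
  have 1: "Z d : Om" "Z' d : Om" unfolding Z_def Z'_def using shrink z d by auto
  have 2: "Z' d = Z d + ((1 - d) * h) *\<^sub>R e" by (simp add: Z_def Z'_def algebra_simps)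
  show ?thesis
   using quadratic_remainder[OF f nice_open[OF nice] nice_convex[OF nice] e 1(1) _ K, of "(1 - d) * h"] 1
   by (simp add: bdval_inside[OF nice f] bdval_inside[OF nice f'] 2)
 qed
 have lim: "((%d. bdval Om g (p - d *\<^sub>R (p - w))) \<longlongrightarrow> bdval Om g p) (at_right 0)"
  if g: "bsm Om g" and p: "p : closure Om" for g p
 proof -
  have "((%d. p - d *\<^sub>R (p - w)) \<longlongrightarrow> p) (at_right 0)"
   by (auto intro!: tendsto_eq_intros)
  moreover have "\<forall>\<^sub>F d in at_right 0. p - d *\<^sub>R (p - w) : closure Om"
  proof (rule eventually_mono[OF eventually_at_right_01])
   fix d :: real assume "0 < d \<and> d <= 1"
   then show "p - d *\<^sub>R (p - w) : closure Om" using shrink[OF p] closure_subset[of Om] by blast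
  qed
  ultimately show ?thesis by (rule continuous_on_tendsto_compose[OF bdval_continuous[OF nice g] _ p])
 qed
 have "cmod (bdval Om f (z + h *\<^sub>R e) - bdval Om f z - ((1 - 0) * h) *\<^sub>R bdval Om (pdiff e f) z) <= K * ((1 - 0) * h)\<^sup>2"
 proof (rule tendsto_le[OF trivial_limit_at_right_real])
  show "((%d. K * ((1 - d) * h)\<^sup>2) \<longlongrightarrow> K * ((1 - 0) * h)\<^sup>2) (at_right 0)"
   by (intro tendsto_intros)
  show "((%d. cmod (bdval Om f (Z' d) - bdval Om f (Z d) - ((1 - d) * h) *\<^sub>R bdval Om (pdiff e f) (Z d)))
   \<longlongrightarrow> cmod (bdval Om f (z + h *\<^sub>R e) - bdval Om f z - ((1 - 0) * h) *\<^sub>R bdval Om (pdiff e f) z)) (at_right 0)"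
   unfolding Z_def Z'_def by (intro tendsto_intros lim f f' z)
  show "\<forall>\<^sub>F d in at_right 0. cmod (bdval Om f (Z' d) - bdval Om f (Z d) - ((1 - d) * h) *\<^sub>R bdval Om (pdiff e f) (Z d))
   <= K * ((1 - d) * h)\<^sup>2"
   by (rule eventually_mono[OF eventually_at_right_01]) (simp add: le)
 qed
 then show ?thesis by simp
qed

lemma closure_U: "L > 0 ==> closure {0<..<L::real} = {0..L}"
 by (simp add: closure_greaterThanLessThan)

lemma closure_XT: "T > 0 ==> closure (XT T) = {0..1} \<times> {0..T}"
 by (simp add: XT_def closure_Times closure_greaterThanLessThan)

lemma XT_I: "x : {0<..<1} ==> t : {0<..<T} ==> (x, t) : XT T"
 by (simp add: XT_def)

lemma has_vector_derivative_quadratic: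
 fixes g :: "real => 'b::real_normed_vector"
 assumes "!!y. y : S ==> norm (g y - g x - (y - x) *\<^sub>R d) <= K * (y - x)\<^sup>2"
 shows "(g has_vector_derivative d) (at x within S)"
 unfolding has_vector_derivative_def has_derivative_within
proof
 have "((%y. K * \<bar>y - x\<bar>) \<longlongrightarrow> K * \<bar>x - x\<bar>) (at x within S)" by (intro tendsto_intros)
 then have 0: "((%y. K * \<bar>y - x\<bar>) \<longlongrightarrow> 0) (at x within S)" by simp
 show "((%y. (1 / norm (y - x)) *\<^sub>R (g y - (g x + (y - x) *\<^sub>R d))) \<longlongrightarrow> 0) (at x within S)"
 proof (rule Lim_null_comparison[OF _ 0])
  show "\<forall>\<^sub>F y in at x within S. norm ((1 / norm (y - x)) *\<^sub>R (g y - (g x + (y - x) *\<^sub>R d))) <= K * \<bar>y - x\<bar>"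
   unfolding eventually_at_filter
  proof (rule always_eventually, intro allI impI)
   fix y assume y: "y \<noteq> x" "y : S"
   have "norm ((1 / norm (y - x)) *\<^sub>R (g y - (g x + (y - x) *\<^sub>R d)))
     = norm (g y - g x - (y - x) *\<^sub>R d) / \<bar>y - x\<bar>" by (simp add: diff_diff_eq)
   also have "\<dots> <= (K * (y - x)\<^sup>2) / \<bar>y - x\<bar>" using assms[OF y(2)] by (intro divide_right_mono) auto
   also have "\<dots> = K * \<bar>y - x\<bar> * \<bar>y - x\<bar> / \<bar>y - x\<bar>"
    by (simp only: power2_eq_square abs_mult_self_eq mult.assoc)
   also have "\<dots> = K * \<bar>y - x\<bar>" by (rule nonzero_mult_div_cancel_right) (use y in simp)
   finally show "norm ((1 / norm (y - x)) *\<^sub>R (g y - (g x + (y - x) *\<^sub>R d))) <= K * \<bar>y - x\<bar>" .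
  qed
 qed
qed (rule bounded_linear_scaleR_left)

lemma bsm_bound0:
 assumes "bsm Om f" obtains K where "K >= 0" "!!z. z : Om ==> cmod (f z) <= K"
proof -
 obtain K :: "real => real"
  where K: "!!ep z. 0 < ep ==> ep <= 1 ==> z : Om ==> cmod (f z) <= K ep"
  using snet_bound0[OF assms] by blast
 show thesis
 proof (rule that)
  show "0 <= \<bar>K 1\<bar>" by (rule abs_ge_zero)
  show "cmod (f z) <= \<bar>K 1\<bar>" if "z : Om" for z using K[of 1 z] that by simp
 qed
qed

text \<open>Because the quadratic estimate holds up to the closure, boundary values are
  differentiable along the axes even at corners and end times; the set \<open>S\<close> accounts for
  derivatives that are one-sided there.\<close>

lemma trace_derivative:
 assumes T: "T > 0" and f: "bsm (XT T) f" and e: "e : Basis" and p: "!!y. y : S ==> z + (y - x) *\<^sub>R e : closure (XT T)"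
  and x: "x : S"
 shows "((%y. bdval (XT T) f (z + (y - x) *\<^sub>R e)) has_vector_derivative bdval (XT T) (pdiff e f) z) (at x within S)"
proof -
 obtain K where K: "!!w. w : XT T ==> cmod (pdiff e (pdiff e f) w) <= K"
  using bsm_bound0[OF snet_pdiff[OF snet_pdiff[OF f e] e]] by blast
 have z: "z : closure (XT T)" using p[OF x] by simp
 show ?thesis
 proof (rule has_vector_derivative_quadratic)
  fix y assume "y : S"
  from bdval_quadratic[OF nice_XT[OF T] f e z p[OF this] K]
  show "cmod (bdval (XT T) f (z + (y - x) *\<^sub>R e) - bdval (XT T) f (z + (x - x) *\<^sub>R e)
    - (y - x) *\<^sub>R bdval (XT T) (pdiff e f) z) <= K * (y - x)\<^sup>2" by simp
 qed
qed

lemma trace_t_x_derivative: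
 assumes T: "T > 0" and f: "bsm (XT T) f" and x: "x : {0..1}" and s: "s : {0..T}"
 shows "(trace_t T s f has_vector_derivative trace_t T s (dX f) x) (at x within {0..1})"
proof -
 have B: "dirX : Basis" by (simp add: Basis_XT)
 have c: "(x, s) + (y - x) *\<^sub>R dirX : closure (XT T)" if "y : {0..1}" for y
  using that s by (simp add: closure_XT[OF T])
 have eq: "(%y. bdval (XT T) f ((x, s) + (y - x) *\<^sub>R dirX)) = trace_t T s f"
  by (rule ext) (simp add: trace_t_def)
 have "(trace_t T s f has_vector_derivative bdval (XT T) (dX f) (x, s)) (at x within {0..1})"
  using trace_derivative[OF T f B c x] unfolding eq .
 then show ?thesis by (simp only: trace_t_def)
qed

lemma trace_x_t_derivative:
 assumes T: "T > 0" and f: "bsm (XT T) f" and a: "a : {0..1}" and t: "t : {0..T}"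
 shows "(trace_x T a f has_vector_derivative trace_x T a (dT f) t) (at t within {0..T})"
proof -
 have B: "dirT : Basis" by (simp add: Basis_XT)
 have c: "(a, t) + (y - t) *\<^sub>R dirT : closure (XT T)" if "y : {0..T}" for y
  using that a by (simp add: closure_XT[OF T])
 have eq: "(%y. bdval (XT T) f ((a, t) + (y - t) *\<^sub>R dirT)) = trace_x T a f"
  by (rule ext) (simp add: trace_x_def)
 have "(trace_x T a f has_vector_derivative bdval (XT T) (dT f) (a, t)) (at t within {0..T})"
  using trace_derivative[OF T f B c t] unfolding eq .
 then show ?thesis by (simp only: trace_x_def)
qed

lemma pdiff_real_eq: "(f has_vector_derivative d) (at x) ==> pdiff (1::real) f x = d"
 by (drule has_vector_derivative_def[THEN iffD1], drule pdiff_eq[of _ _ _ 1]) simp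

text \<open>The tangential derivative of a trace is the trace of the derivative, so the set of all
  traces of nets is an invariant for \<open>snet_coinduct\<close>.\<close>

lemma snet_trace_t:
 assumes T: "T > 0" and u: "snet A (XT T) u" and s: "s : {0..T}"
 shows "snet A {0<..<1} (%ep. trace_t T s (u ep))"
proof (rule snet_coinduct[where P = "%v. \<exists>u. snet A (XT T) u \<and> v = (%ep. trace_t T s (u ep))"])
 fix v :: "real net" assume "\<exists>u. snet A (XT T) u \<and> v = (%ep. trace_t T s (u ep))"
 then obtain u where u: "snet A (XT T) u" and v: "v = (%ep. trace_t T s (u ep))" by blast
 have d: "(v ep has_vector_derivative trace_t T s (dX (u ep)) x) (at x)"
  if "0 < ep" "ep <= 1" "x : {0<..<1}" for ep x
  using trace_t_x_derivative[OF T snet_bsm[OF u that(1,2)] _ s, of x] that(3)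
  by (simp add: v at_within_Icc_at)
 then show "v ep differentiable (at x)" if "0 < ep" "ep <= 1" "x : {0<..<1}" for ep x
  using that differentiableI_vector by blast
 obtain K where K: "K : A" "!!ep z. 0 < ep ==> ep <= 1 ==> z : XT T ==> cmod (u ep z) <= K ep"
  using snet_bound0[OF u] by blast
 have "cmod (v ep x) <= K ep" if "0 < ep" "ep <= 1" "x : {0<..<1}" for ep x
  unfolding v trace_t_def
  by (rule bdval_bound[OF nice_XT[OF T] snet_bsm[OF u that(1,2)] K(2)[OF that(1,2)]])
   (use that s in \<open>auto simp: closure_XT[OF T]\<close>)
 then show "\<exists>K\<in>A. \<forall>ep\<in>{0<..1}. \<forall>x\<in>{0<..<1}. cmod (v ep x) <= K ep"
  by (intro bexI[OF _ K(1)]) simp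
 show "\<exists>w. (\<exists>u. snet A (XT T) u \<and> w = (%ep. trace_t T s (u ep))) \<and>
   (\<forall>ep\<in>{0<..1}. \<forall>x\<in>{0<..<1}. pdiff e (v ep) x = w ep x)" if "e : Basis" for e
 proof (intro exI conjI)
  show "snet A (XT T) (%ep. dX (u ep))" by (rule snet_pdiff[OF u]) (simp add: Basis_XT)
  show "\<forall>ep\<in>{0<..1}. \<forall>x\<in>{0<..<1}. pdiff e (v ep) x = trace_t T s (dX (u ep)) x"
   using pdiff_real_eq[OF d] that by simp
 qed simp
qed (use u in auto)

lemma snet_trace_x:
 assumes T: "T > 0" and u: "snet A (XT T) u" and a: "a : {0..1}"
 shows "snet A {0<..<T} (%ep. trace_x T a (u ep))"
proof (rule snet_coinduct[where P = "%v. \<exists>u. snet A (XT T) u \<and> v = (%ep. trace_x T a (u ep))"])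
 fix v :: "real net" assume "\<exists>u. snet A (XT T) u \<and> v = (%ep. trace_x T a (u ep))"
 then obtain u where u: "snet A (XT T) u" and v: "v = (%ep. trace_x T a (u ep))" by blast
 have d: "(v ep has_vector_derivative trace_x T a (dT (u ep)) t) (at t)"
  if "0 < ep" "ep <= 1" "t : {0<..<T}" for ep t
  using trace_x_t_derivative[OF T snet_bsm[OF u that(1,2)] a, of t] that(3)
  by (simp add: v at_within_Icc_at)
 then show "v ep differentiable (at t)" if "0 < ep" "ep <= 1" "t : {0<..<T}" for ep t
  using that differentiableI_vector by blast
 obtain K where K: "K : A" "!!ep z. 0 < ep ==> ep <= 1 ==> z : XT T ==> cmod (u ep z) <= K ep"
  using snet_bound0[OF u] by blast
 have "cmod (v ep t) <= K ep" if "0 < ep" "ep <= 1" "t : {0<..<T}" for ep t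
  unfolding v trace_x_def
  by (rule bdval_bound[OF nice_XT[OF T] snet_bsm[OF u that(1,2)] K(2)[OF that(1,2)]])
   (use that a in \<open>auto simp: closure_XT[OF T]\<close>)
 then show "\<exists>K\<in>A. \<forall>ep\<in>{0<..1}. \<forall>t\<in>{0<..<T}. cmod (v ep t) <= K ep"
  by (intro bexI[OF _ K(1)]) simp
 show "\<exists>w. (\<exists>u. snet A (XT T) u \<and> w = (%ep. trace_x T a (u ep))) \<and>
   (\<forall>ep\<in>{0<..1}. \<forall>t\<in>{0<..<T}. pdiff e (v ep) t = w ep t)" if "e : Basis" for e
 proof (intro exI conjI)
  show "snet A (XT T) (%ep. dT (u ep))" by (rule snet_pdiff[OF u]) (simp add: Basis_XT)
  show "\<forall>ep\<in>{0<..1}. \<forall>t\<in>{0<..<T}. pdiff e (v ep) t = trace_x T a (dT (u ep)) t"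
   using pdiff_real_eq[OF d] that by simp
 qed simp
qed (use u in auto)

lemma pdiff_comp_linear:
 assumes \<pi>: "bounded_linear (\<pi> :: real \<times> real => real)" and f: "f differentiable (at (\<pi> z))"
 shows "((%z. f (\<pi> z)) has_derivative (%v. \<pi> v *\<^sub>R pdiff 1 f (\<pi> z))) (at z)"
 using has_derivative_compose[OF bounded_linear.has_derivative[OF \<pi> has_derivative_ident] pdiff_has_derivative[OF f]]
 by simp

text \<open>\<pi> is a coordinate projection. A derivative of a lifted net is again a lifted net or
  zero, and the factor \<open>k\<close> in \<open>{0, 1}\<close> lets the invariant cover both
  cases.\<close>

lemma snet_lift:
 assumes \<pi>: "bounded_linear (\<pi> :: real \<times> real => real)" and I: "open I"
  and XI: "!!z. z : XT T ==> \<pi> z : I" and B: "!!e. e : Basis ==> \<pi> e : {0, 1}"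
  and u: "snet A I u"
 shows "snet A (XT T) (%ep z. u ep (\<pi> z))"
proof (rule snet_coinduct[OF open_XT, where P = "%v. \<exists>u k. snet A I u \<and> k : {0, 1} \<and> v = (%ep z. k *\<^sub>R u ep (\<pi> z))"])
 fix v :: "(real \<times> real) net" assume "\<exists>u k. snet A I u \<and> k : {0, 1} \<and> v = (%ep z. k *\<^sub>R u ep (\<pi> z))"
 then obtain u and k :: real where u: "snet A I u" and k: "k : {0, 1}" and v: "v = (%ep z. k *\<^sub>R u ep (\<pi> z))" by blast
 have d: "(v ep has_derivative (%w. k *\<^sub>R \<pi> w *\<^sub>R pdiff 1 (u ep) (\<pi> z))) (at z)"
  if "0 < ep" "ep <= 1" "z : XT T" for ep z
  unfolding v
  by (intro has_derivative_scaleR_right pdiff_comp_linear[OF \<pi>] snet_differentiable[OF u I that(1,2) XI[OF that(3)]])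
 then show "v ep differentiable (at z)" if "0 < ep" "ep <= 1" "z : XT T" for ep z
  using that differentiableI by blast
 obtain K where K: "K : A" "!!ep z. 0 < ep ==> ep <= 1 ==> z : I ==> cmod (u ep z) <= K ep"
  using snet_bound0[OF u] by blast
 have "cmod (v ep z) <= K ep" if "0 < ep" "ep <= 1" "z : XT T" for ep z
  using K(2)[OF that(1,2) XI[OF that(3)]] k order_trans[OF norm_ge_zero] by (auto simp: v)
 then show "\<exists>K\<in>A. \<forall>ep\<in>{0<..1}. \<forall>z\<in>XT T. cmod (v ep z) <= K ep"
  by (intro bexI[OF _ K(1)]) simp
 show "\<exists>w. (\<exists>u k. snet A I u \<and> k : {0, 1} \<and> w = (%ep z. k *\<^sub>R u ep (\<pi> z))) \<and>
   (\<forall>ep\<in>{0<..1}. \<forall>z\<in>XT T. pdiff e (v ep) z = w ep z)" if "e : Basis" for e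
 proof (intro exI conjI)
  show "snet A I (%ep. pdiff 1 (u ep))" by (rule snet_pdiff[OF u]) simp
  show "k * \<pi> e : {0, 1}" using k B[OF that] by auto
  show "\<forall>ep\<in>{0<..1}. \<forall>z\<in>XT T. pdiff e (v ep) z = (k * \<pi> e) *\<^sub>R pdiff 1 (u ep) (\<pi> z)"
   using pdiff_eq[OF d] by simp
 qed simp
next
 show "\<exists>u' k. snet A I u' \<and> k : {0, 1} \<and> (%ep z. u ep (\<pi> z)) = (%ep z. k *\<^sub>R u' ep (\<pi> z))"
  using u by (intro exI[of _ u] exI[of _ "1::real"]) simp
qed

lemma snet_lift_x: "snet A U01 u ==> snet A (XT T) (%ep z. u ep (fst z))"
 by (rule snet_lift[OF bounded_linear_fst]) (auto simp: XT_def Basis_XT)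

lemma snet_lift_t: "snet A {0<..<T} u ==> snet A (XT T) (%ep z. u ep (snd z))"
 by (rule snet_lift[OF bounded_linear_snd]) (auto simp: XT_def Basis_XT)

section \<open>Smooth steps and the du Bois-Reymond lemma\<close>

lemma power_exp_neg_le: "y ^ n * exp (- y) <= fact n" if "y >= 0" for y :: real
proof -
 have "(\<Sum>i\<in>{n}. y ^ i /\<^sub>R fact i) <= (\<Sum>i. y ^ i /\<^sub>R fact i)"
  by (rule sum_le_suminf[OF sums_summable[OF exp_converges]]) (use that in auto)
 then have "y ^ n / fact n <= exp y" by (simp add: exp_def divide_inverse mult.commute)
 then have "y ^ n <= exp y * fact n" by (simp add: pos_divide_le_eq)
 then have "y ^ n * exp (- y) <= (exp y * fact n) * exp (- y)" by (rule mult_right_mono) simp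
 also have "\<dots> = fact n" by (simp add: exp_minus)
 finally show ?thesis .
qed

text \<open>The classical flat functions. The polynomial is a parameter because differentiation
  sends \<open>p\<close> to \<open>X^2 * (p - p')\<close>, which makes the family closed under
  derivatives.\<close>

definition flat :: "real poly => real => real" where
 "flat p x = (if x > 0 then poly p (1 / x) * exp (- (1 / x)) else 0)"

lemma flat_bounded: "\<exists>K. \<forall>x. \<bar>flat p x\<bar> <= K"
proof (intro exI allI)
 fix x :: real
 show "\<bar>flat p x\<bar> <= (\<Sum>i\<le>degree p. \<bar>coeff p i\<bar> * fact i)"
 proof (cases "x > 0")
  case True
  let ?y = "1 / x"
  have "flat p x = (\<Sum>i\<le>degree p. coeff p i * (?y ^ i * exp (- ?y)))"
   using True by (simp add: flat_def poly_altdef sum_distrib_right mult.assoc)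
  also have "\<bar>\<dots>\<bar> <= (\<Sum>i\<le>degree p. \<bar>coeff p i * (?y ^ i * exp (- ?y))\<bar>)" by (rule sum_abs)
  also have "\<dots> <= (\<Sum>i\<le>degree p. \<bar>coeff p i\<bar> * fact i)"
  proof (rule sum_mono)
   fix i
   have "\<bar>?y ^ i * exp (- ?y)\<bar> <= fact i" using power_exp_neg_le[of ?y i] True by simp
   then show "\<bar>coeff p i * (?y ^ i * exp (- ?y))\<bar> <= \<bar>coeff p i\<bar> * fact i"
    unfolding abs_mult[of "coeff p i"] by (rule mult_left_mono) simp
  qed
  finally show ?thesis .
 qed (simp add: flat_def sum_nonneg)
qed

lemma flat_derivative:
 "(flat p has_real_derivative flat (monom 1 2 * (p - pderiv p)) x) (at x)"
proof -
 consider "x > 0" | "x < 0" | "x = 0" by linarith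
 then show ?thesis
 proof cases
  case 1
  have "((%x. poly p (1 / x) * exp (- (1 / x))) has_real_derivative flat (monom 1 2 * (p - pderiv p)) x) (at x)"
   by (rule DERIV_cong, rule DERIV_mult, rule DERIV_chain2[OF poly_DERIV])
    (use 1 in \<open>auto intro!: derivative_eq_intros simp: flat_def poly_monom field_simps power2_eq_square\<close>)
  then show ?thesis
   by (rule has_field_derivative_transform_within_open[where S = "{0<..}"]) (use 1 in \<open>auto simp: flat_def\<close>)
 next
  case 2
  have "((%x. 0) has_real_derivative flat (monom 1 2 * (p - pderiv p)) x) (at x)"
   using 2 by (simp add: flat_def)
  then show ?thesis
   by (rule has_field_derivative_transform_within_open[where S = "{..<0}"]) (use 2 in \<open>auto simp: flat_def\<close>)
 next
  case 3
  \<comment> \<open>Splitting \<open>y^2\<close> off \<open>flat p y\<close> leaves the bounded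
    function \<open>flat (monom 1 2 * p)\<close>, so the remainder at 0 is quadratic and the
    derivative there is 0.\<close>
  obtain K where K: "!!x. \<bar>flat (monom 1 2 * p) x\<bar> <= K" using flat_bounded by blast
  have "(flat p has_vector_derivative 0) (at 0 within UNIV)"
  proof (rule has_vector_derivative_quadratic)
   fix y :: real
   have "flat p y = y\<^sup>2 * flat (monom 1 2 * p) y" by (simp add: flat_def poly_monom power_divide)
   then have "\<bar>flat p y\<bar> = y\<^sup>2 * \<bar>flat (monom 1 2 * p) y\<bar>" by (simp add: abs_mult)
   also have "\<dots> <= y\<^sup>2 * K" by (intro mult_left_mono K) simp
   finally show "norm (flat p y - flat p 0 - (y - 0) *\<^sub>R 0) <= K * (y - 0)\<^sup>2"
    by (simp add: flat_def mult.commute)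
  qed
  moreover have "flat (monom 1 2 * (p - pderiv p)) x = 0" using 3 by (simp add: flat_def)
  ultimately show ?thesis using 3 by (simp add: has_real_derivative_iff_has_vector_derivative)
 qed
qed

lemma bsm_coinduct:
 assumes "P f"
  and diff: "!!g x. P g ==> \<exists>g'. P g' \<and> (\<forall>x. (g has_vector_derivative g' x) (at x))"
  and bound: "!!g. P g ==> \<exists>K. \<forall>x. cmod (g x) <= K"
 shows "bsm (UNIV :: real set) f"
proof (rule snet_coinduct[OF open_UNIV, where P = "%v. \<exists>g. P g \<and> v = (%ep. g)"])
 fix v :: "real net" assume "\<exists>g. P g \<and> v = (%ep. g)"
 then obtain g where g: "P g" "v = (%ep. g)" by blast
 obtain g' where g': "P g'" "!!x. (g has_vector_derivative g' x) (at x)" using diff[OF g(1)] by blast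
 obtain K where K: "!!x. cmod (g x) <= K" using bound[OF g(1)] by blast
 show "v ep differentiable (at x)" for ep x using g'(2)[of x] g(2) differentiableI_vector by blast
 show "\<exists>K\<in>UNIV. \<forall>ep\<in>{0<..1}. \<forall>x\<in>UNIV. cmod (v ep x) <= K ep"
  by (rule bexI[of _ "%_. K"]) (simp_all add: g K)
 show "\<exists>w. (\<exists>g. P g \<and> w = (%ep. g)) \<and> (\<forall>ep\<in>{0<..1}. \<forall>x\<in>UNIV. pdiff e (v ep) x = w ep x)" if "e : Basis" for e
  by (rule exI[of _ "%ep. g'"]) (use g'(1) pdiff_real_eq[OF g'(2)] that in \<open>auto simp: g\<close>)
qed (use assms(1) in blast)

lemma bsm_real_derivative:
 fixes f :: "real => complex"
 assumes "bsm UNIV f" shows "(f has_vector_derivative pdiff 1 f x) (at x)"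
 by (rule pdiff_real_vector_derivative) (use snet_differentiable[OF assms open_UNIV, of 1 x] in simp)

lemma bsm_flat: "bsm UNIV (%x. complex_of_real (flat p x))"
proof (rule bsm_coinduct[where P = "%g. \<exists>p. g = (%x. complex_of_real (flat p x))"])
 fix g assume "\<exists>p. g = (%x. complex_of_real (flat p x))"
 then obtain p where g: "g = (%x. complex_of_real (flat p x))" by blast
 show "\<exists>g'. (\<exists>p. g' = (%x. complex_of_real (flat p x))) \<and> (\<forall>x. (g has_vector_derivative g' x) (at x))"
  unfolding g using has_vector_derivative_of_real[OF flat_derivative] by blast
 show "\<exists>K. \<forall>x. cmod (g x) <= K" unfolding g using flat_bounded[of p] by simp
qed blast

lemma bsm_affine:
 assumes f: "bsm UNIV f" shows "bsm UNIV (%x::real. f (a * x + b))"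
proof (rule bsm_coinduct[where P = "%g. \<exists>f k. bsm UNIV f \<and> g = (%x. k *\<^sub>R f (a * x + b))"])
 fix g assume "\<exists>f k. bsm UNIV f \<and> g = (%x. k *\<^sub>R f (a * x + b))"
 then obtain f k where f: "bsm UNIV f" and g: "g = (%x. k *\<^sub>R f (a * x + b))" by blast
 have "((%x. k *\<^sub>R f (a * x + b)) has_vector_derivative (k * a) *\<^sub>R pdiff 1 f (a * x + b)) (at x)" for x
 proof -
  have "((%x. a * x + b) has_vector_derivative a) (at x)"
   by (auto intro!: derivative_eq_intros simp: has_real_derivative_iff_has_vector_derivative[symmetric])
  from vector_diff_chain_at[OF this bsm_real_derivative[OF f]]
  have "((%x. f (a * x + b)) has_vector_derivative a *\<^sub>R pdiff 1 f (a * x + b)) (at x)" by (simp add: o_def)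
  from has_vector_derivative_scaleR[OF DERIV_const[of k] this] show ?thesis by simp
 qed
 moreover have "bsm UNIV (pdiff 1 f)" by (rule snet_pdiff[OF f]) simp
 ultimately show "\<exists>g'. (\<exists>f k. bsm UNIV f \<and> g' = (%x. k *\<^sub>R f (a * x + b))) \<and> (\<forall>x. (g has_vector_derivative g' x) (at x))"
  unfolding g by blast
 obtain K where K: "K >= 0" "!!x. x : UNIV ==> cmod (f x) <= K" using bsm_bound0[OF f] by blast
 show "\<exists>K. \<forall>x. cmod (g x) <= K" unfolding g
  by (intro exI[of _ "\<bar>k\<bar> * K"]) (auto intro!: mult_left_mono K)
next
 show "\<exists>f' k. bsm UNIV f' \<and> (%x. f (a * x + b)) = (%x. k *\<^sub>R f' (a * x + b))"
  using f by (intro exI[of _ f] exI[of _ 1]) simp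
qed

lemma bsm_mult: "open Om ==> bsm Om f ==> bsm Om g ==> bsm Om (%x. f x * g x)"
 by (rule snet_mult) auto

lemma bsm_add: "open Om ==> bsm Om f ==> bsm Om g ==> bsm Om (%x. f x + g x)"
 by (rule snet_add) auto

lemma bsm_const: "bsm Om (%x. k)"
proof -
 have *: "pdiffs es (%x. k) = (%x. if es = [] then k else 0)" for es :: "'a list"
  by (induction es) (auto simp: pdiffs_Cons)
 show ?thesis unfolding snet_def smooth_on_def *
  by (auto intro!: bexI[of _ "%_. cmod k"])
qed

lemma bsm_diff: "open Om ==> bsm Om f ==> bsm Om g ==> bsm Om (%x. f x - g x)"
 using bsm_add[of Om f "%x. (-1) * g x"] bsm_mult[OF _ bsm_const[of _ "-1"], of Om g] by simp

text \<open>\<open>S\<close> is the normalised primitive of the bump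
  \<open>exp (- (1 / x)) * exp (- (1 / (1 - x)))\<close> on the unit interval. The density \<rho> is
  recorded as well: \<open>S\<close> yields smooth cut-offs, \<rho> the mollifier that belongs to
  them.\<close>

lemma smooth_step:
 obtains S \<rho> :: "real => real" where
  "bsm UNIV (%x. complex_of_real (S x))" "!!x. (S has_real_derivative \<rho> x) (at x)"
  "continuous_on UNIV \<rho>" "!!x. \<rho> x >= 0" "!!x. x \<notin> {0<..<1} ==> \<rho> x = 0"
  "!!x. x <= 0 ==> S x = 0" "!!x. x >= 1 ==> S x = 1" "!!x. 0 <= S x \<and> S x <= 1"
proof -
 define r where "r x = flat 1 x * flat 1 (1 - x)" for x
 have r: "bsm UNIV (%x. complex_of_real (r x))"
  using bsm_mult[OF open_UNIV bsm_flat[of 1] bsm_affine[OF bsm_flat[of 1], of "-1" 1]]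
  by (simp add: r_def)
 have r_nonneg: "r x >= 0" and r_out: "x \<notin> {0<..<1} ==> r x = 0" and r_pos: "x : {0<..<1} ==> r x > 0" for x
  by (auto simp: r_def flat_def)
 have "continuous_on UNIV (%x. Re (complex_of_real (r x)))"
  by (intro continuous_intros snet_continuous_on[OF r]) (auto simp: zero_less_one)
 then have rc: "continuous_on X r" for X by (auto intro: continuous_on_subset)
 have ri: "r integrable_on {a..b}" for a b by (intro integrable_continuous_real rc)
 define I where "I = integral {0..1} r"
 have I: "I > 0"
 proof -
  have "I \<noteq> 0"
  proof
   assume "I = 0"
   then have "(r has_integral 0) {0..1}" using ri[of 0 1] by (simp add: I_def has_integral_iff)
   then have "r (1 / 2) = 0"
    using has_integral_0_cbox_imp_0[of 0 1 r "1 / 2"] rc r_nonneg by (simp add: box_real)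
   then show False using r_pos[of "1 / 2"] by simp
  qed
  moreover have "I >= 0" unfolding I_def using r_nonneg ri by (simp add: integral_nonneg)
  ultimately show ?thesis by simp
 qed
 define S where "S x = integral {0..x} r / I" for x
 have zero: "integral {a..b} r = 0" if "{a<..<b} \<inter> {0<..<1} = {}" for a b
 proof -
  have "r x = 0" if "x : {a..b} - {a, b}" for x
  proof (rule r_out)
   have "x : {a<..<b}" using that by auto
   then show "x \<notin> {0<..<1}" using \<open>_ = {}\<close> by blast
  qed
  then have "integral {a..b} r = integral {a..b} (%x. 0)" by (intro integral_spike[of "{a, b}"]) auto
  then show ?thesis by simp
 qed
 \<comment> \<open>For negative \<open>x\<close> the integral over \<open>{0..x}\<close> is 0 by
   convention, which is the right value since \<open>r\<close> vanishes there. Starting at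
   \<open>- c\<close> instead makes the fundamental theorem available at every
   \<open>x\<close>.\<close>
 have Seq: "S x = integral {-c..x} r / I" if "c >= 0" "-c <= x" for c x
 proof (cases "x >= 0")
  case True
  have "integral {-c..0} r + integral {0..x} r = integral {-c..x} r"
   by (rule hk_combine) (use that True ri in auto)
  moreover have "integral {-c..0} r = 0" by (rule zero) auto
  ultimately show ?thesis by (simp add: S_def)
 next
  case False
  then have "integral {-c..x} r = 0" by (intro zero) auto
  then show ?thesis using False by (simp add: S_def)
 qed
 have dS: "(S has_real_derivative r x / I) (at x)" for x
 proof -
  define c where "c = \<bar>x\<bar> + 1"
  have x: "x : {-c<..<c}" by (auto simp: c_def)
  have "((%x. integral {-c..x} r) has_vector_derivative r x) (at x within {-c..c})"
   by (rule integral_has_vector_derivative[OF rc]) (use x in auto)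
  then have "((%x. integral {-c..x} r) has_real_derivative r x) (at x)"
   using x by (simp add: has_real_derivative_iff_has_vector_derivative at_within_Icc_at)
  then have "((%x. integral {-c..x} r / I) has_real_derivative r x / I) (at x)"
   by (rule DERIV_cdivide)
  then show ?thesis
   by (rule has_field_derivative_transform_within_open[where S = "{-c<..<c}"])
    (use x Seq[of c] in \<open>auto simp: c_def\<close>)
 qed
 have S0: "S x = 0" if "x <= 0" for x using zero[of 0 x] that by (simp add: S_def)
 have S1: "S x = 1" if "x >= 1" for x
 proof -
  have "integral {0..1} r + integral {1..x} r = integral {0..x} r"
   by (rule hk_combine) (use that ri in auto)
  moreover have "integral {1..x} r = 0" by (rule zero) auto
  ultimately show ?thesis using I by (simp add: S_def I_def)
 qed
 have mono: "S x <= S y" if "x <= y" for x y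
  by (rule DERIV_nonneg_imp_nondecreasing[OF that]) (use dS r_nonneg I in \<open>auto intro!: exI[of _ "r _ / I"]\<close>)
 have S01: "0 <= S x \<and> S x <= 1" for x
  using mono[of "min x 0" x] mono[of x "max x 1"] S0[of "min x 0"] S1[of "max x 1"] by simp
 have rI: "bsm UNIV (%x. complex_of_real (r x / I))"
  using bsm_mult[OF open_UNIV bsm_const[of UNIV "complex_of_real (1 / I)"] r] by simp
 have "bsm UNIV (%x. complex_of_real (S x))"
 proof (rule bsm_coinduct[where P = "%g. g = (%x. complex_of_real (S x)) \<or> bsm UNIV g"])
  fix g assume g: "g = (%x. complex_of_real (S x)) \<or> bsm UNIV g"
  from g show "\<exists>g'. (g' = (%x. complex_of_real (S x)) \<or> bsm UNIV g') \<and> (\<forall>x. (g has_vector_derivative g' x) (at x))"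
  proof
   assume "g = (%x. complex_of_real (S x))"
   then show ?thesis using has_vector_derivative_of_real[OF dS] rI by blast
  next
   assume "bsm UNIV g"
   then show ?thesis using bsm_real_derivative[of g] snet_pdiff[of UNIV UNIV "%_. g" 1] by auto
  qed
  from g show "\<exists>K. \<forall>x. cmod (g x) <= K"
  proof
   assume "g = (%x. complex_of_real (S x))"
   then show ?thesis using S01 by (intro exI[of _ 1]) simp
  next
   assume "bsm UNIV g"
   then show ?thesis by (metis bsm_bound0 UNIV_I)
  qed
 qed simp
 then show thesis
  by (rule that[where S = S and \<rho> = "%x. r x / I"])
   (use dS S0 S1 S01 I r_nonneg r_out in \<open>auto intro!: continuous_intros rc\<close>)
qed

lemma test_funI:
 assumes "smooth_on UNIV ph" "compact K" "K \<subseteq> Om" "!!z. z \<notin> K ==> ph z = 0"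
 shows "ph : test_fun Om"
 using assms unfolding test_fun_def by blast

lemma test_fun_smooth: "ph : test_fun Om ==> smooth_on UNIV ph"
 by (simp add: test_fun_def)

lemma test_fun_continuous:
 assumes "ph : test_fun Om" shows "continuous_on X ph"
 using continuous_on_subset[OF smooth_on_continuous[OF test_fun_smooth[OF assms] lists.Nil]] by simp

text \<open>Rests on the completeness of Lebesgue measure. Weak notions fix functions only up to
  null sets, so measurability is carried over from a good representative.\<close>

lemma measurable_lebesgue_on_AE:
 fixes k K :: "'a::euclidean_space => complex"
 assumes K: "K : bmeas (lebesgue_on S)" and S: "S : sets lebesgue"
  and ae: "AE t in lebesgue_on S. k t = K t"
 shows "k : bmeas (lebesgue_on S)"
proof -
 have "AE t in lebesgue. t : S --> k t = K t" using ae S by (simp add: AE_restrict_space_iff)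
 then have "AE t in lebesgue. indicator S t *\<^sub>R K t = indicator S t *\<^sub>R k t"
  by eventually_elim (auto simp: indicator_def)
 moreover have "(%t. indicator S t *\<^sub>R K t) : bmeas lebesgue"
  using K S by (simp add: borel_measurable_restrict_space_iff scaleR_conv_of_real)
 ultimately have "(%t. indicator S t *\<^sub>R k t) : bmeas lebesgue" by (rule borel_measurable_AE[rotated])
 then show ?thesis using S by (simp add: borel_measurable_restrict_space_iff scaleR_conv_of_real)
qed

lemma integrable_lebesgue_on_subset:
 fixes f :: "'a::euclidean_space => 'b::{banach, second_countable_topology}"
 assumes f: "integrable (lebesgue_on S) f" and "A \<subseteq> S" "A : sets lebesgue" "S : sets lebesgue"
 shows "integrable (lebesgue_on A) f"
proof -
 have "integrable lebesgue (%x. indicator S x *\<^sub>R f x)" using f assms by (simp add: integrable_restrict_space)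
 from integrable_mult_indicator[OF _ this, of A] assms(3)
 have "integrable lebesgue (%x. indicator A x *\<^sub>R indicator S x *\<^sub>R f x)" by simp
 moreover have "(%x. indicator A x *\<^sub>R indicator S x *\<^sub>R f x) = (%x. indicator A x *\<^sub>R f x)"
 proof
  fix x show "indicator A x *\<^sub>R indicator S x *\<^sub>R f x = indicator A x *\<^sub>R f x"
   using assms(2) by (cases "x : A") auto
 qed
 ultimately show ?thesis using assms(3) by (simp add: integrable_restrict_space)
qed

text \<open>The mollifier is one-sided, living on \<open>[t0, t0 + d]\<close>, so \<open>d\<close>
  has to stay below \<open>b - t0\<close>; its mass is 1 because \<open>S\<close> rises from 0 to
  1.\<close>

lemma mollifier_tendsto:
 fixes K :: "real => complex" and S \<rho> :: "real => real"
 assumes dS: "!!x. (S has_real_derivative \<rho> x) (at x)" and \<rho>c: "continuous_on UNIV \<rho>" and \<rho>0: "!!x. \<rho> x >= 0"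
  and out: "!!x. x \<notin> {0<..<1} ==> \<rho> x = 0" and S: "S 0 = 0" "S 1 = 1"
  and K: "continuous_on {a<..<b} K" and t0: "t0 : {a<..<b}"
 shows "((%d. LINT t|lebesgue_on {a<..<b}. complex_of_real (\<rho> ((t - t0) / d) / d) * K t) \<longlongrightarrow> K t0) (at_right 0)"
proof (rule tendstoI)
 fix e :: real assume e: "e > 0"
 obtain r where r: "r > 0" "!!t. t : {a<..<b} ==> dist t t0 < r ==> dist (K t) (K t0) < e / 2"
  using K t0 e unfolding continuous_on_iff by (meson half_gt_zero)
 have "\<forall>\<^sub>F d in at_right 0. d : {0<..<min r (b - t0)}"
  by (rule eventually_at_right_real) (use r t0 in auto)
 then show "\<forall>\<^sub>F d in at_right 0. dist (LINT t|lebesgue_on {a<..<b}. complex_of_real (\<rho> ((t - t0) / d) / d) * K t) (K t0) < e"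
 proof eventually_elim
  case (elim d)
  then have d: "0 < d" "d < r" "t0 + d < b" by auto
  define R where "R t = \<rho> ((t - t0) / d) / d" for t
  have sub: "{t0..t0 + d} \<subseteq> {a<..<b}" using t0 d by auto
  have Rc: "continuous_on X R" for X
   unfolding R_def[abs_def] by (rule continuous_on_subset[of UNIV])
    (use d(1) in \<open>auto intro!: continuous_intros continuous_on_compose2[OF \<rho>c]\<close>)
  have R0: "R t = 0" if "t \<notin> {t0..t0 + d}" for t
   using out[of "(t - t0) / d"] that d(1) by (auto simp: R_def field_simps)
  have Ri: "(R has_integral 1) {t0..t0 + d}"
  proof -
   have "((%t. S ((t - t0) / d)) has_real_derivative R t) (at t within {t0..t0 + d})" for t
    unfolding R_def
    by (rule DERIV_cong[OF DERIV_chain2[OF dS]]) (use d in \<open>auto intro!: derivative_eq_intros simp: field_simps\<close>)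
   then have "(R has_integral (S ((t0 + d - t0) / d) - S ((t0 - t0) / d))) {t0..t0 + d}"
    using d by (intro fundamental_theorem_of_calculus) (auto simp: has_real_derivative_iff_has_vector_derivative)
   then show ?thesis using d S by simp
  qed
  have "(LINT t|lebesgue_on {a<..<b}. complex_of_real (R t) * K t) = (LINT t|lebesgue_on {t0..t0 + d}. complex_of_real (R t) * K t)"
  proof -
   have "(LINT t|lebesgue_on {a<..<b}. complex_of_real (R t) * K t)
    = (LINT t|lebesgue. indicator {a<..<b} t *\<^sub>R (complex_of_real (R t) * K t))"
    by (simp add: integral_restrict_space)
   also have "\<dots> = (LINT t|lebesgue. indicator {t0..t0 + d} t *\<^sub>R (complex_of_real (R t) * K t))"
    by (rule bochner_cong) (use R0 sub in \<open>auto simp: indicator_def\<close>)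
   finally show ?thesis by (simp add: integral_restrict_space)
  qed
  also have "\<dots> = integral {t0..t0 + d} (%t. complex_of_real (R t) * K t)"
   by (rule lebesgue_integral_eq_integral)
    (auto intro!: continuous_imp_integrable_real continuous_intros Rc continuous_on_subset[OF K sub])
  finally have eq: "(LINT t|lebesgue_on {a<..<b}. complex_of_real (R t) * K t) = integral {t0..t0 + d} (%t. complex_of_real (R t) * K t)" .
  have Rc': "((%t. complex_of_real (R t) * K t0) has_integral (complex_of_real 1 * K t0)) {t0..t0 + d}"
   by (intro has_integral_mult_left has_integral_of_real Ri)
  have iK: "integral {t0..t0 + d} (%t. complex_of_real (R t) * K t0) = K t0"
   using integral_unique[OF Rc'] by (simp only: of_real_1 mult_1_left)
  have "integral {t0..t0 + d} (%t. complex_of_real (R t) * K t - complex_of_real (R t) * K t0)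
    = integral {t0..t0 + d} (%t. complex_of_real (R t) * K t) - integral {t0..t0 + d} (%t. complex_of_real (R t) * K t0)"
   by (rule integral_diff)
    (auto intro!: integrable_continuous_real continuous_intros Rc continuous_on_subset[OF K sub])
  then have "integral {t0..t0 + d} (%t. complex_of_real (R t) * K t) - K t0
    = integral {t0..t0 + d} (%t. complex_of_real (R t) * K t - complex_of_real (R t) * K t0)"
   unfolding iK by simp
  also have "cmod \<dots> <= integral {t0..t0 + d} (%t. R t * (e / 2))"
  proof (rule integral_norm_bound_integral)
   show "cmod (complex_of_real (R t) * K t - complex_of_real (R t) * K t0) <= R t * (e / 2)" if "t : {t0..t0 + d}" for t
   proof -
    have "cmod (K t - K t0) <= e / 2" using r(2)[of t] that sub d by (auto simp: dist_norm)
    moreover have "R t >= 0" using \<rho>0 d by (simp add: R_def)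
    ultimately have "\<bar>R t\<bar> * cmod (K t - K t0) <= R t * (e / 2)" by (simp only: abs_of_nonneg mult_left_mono)
    then show ?thesis by (simp only: right_diff_distrib[symmetric] norm_mult norm_of_real)
   qed
  qed (auto intro!: integrable_continuous_real continuous_intros Rc continuous_on_subset[OF K sub])
  also have "integral {t0..t0 + d} (%t. R t * (e / 2)) = 1 * (e / 2)"
   by (rule integral_unique) (rule has_integral_mult_left[OF Ri])
  also have "\<dots> < e" using e by simp
  finally show ?case unfolding eq[symmetric] by (simp only: dist_norm R_def)
 qed
qed

text \<open>The test function is a smoothed indicator of \<open>[t1, t2]\<close>, a difference of
  two smooth steps. Its derivative is a difference of mollifiers at \<open>t1\<close> and
  \<open>t2\<close>, which in the limit evaluate the continuous representative \<open>K\<close> at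
  these points.\<close>

lemma du_bois_reymond:
 fixes k l K :: "real => complex"
 assumes test: "!!ph. ph : test_fun {a<..<b} ==>
   (LINT t|lebesgue_on {a<..<b}. pdiff 1 ph t * k t) = - (LINT t|lebesgue_on {a<..<b}. ph t * l t)"
  and ae: "AE t in lebesgue_on {a<..<b}. k t = K t" and K: "continuous_on {a..b} K"
  and l: "integrable (lebesgue_on {a<..<b}) l" and t: "a < t1" "t1 < t2" "t2 < b"
 shows "(LINT t|lebesgue_on {a<..<b}. indicator {t1..t2} t *\<^sub>R l t) = K t2 - K t1"
proof -
 obtain S \<rho> :: "real => real" where S: "bsm UNIV (%x. complex_of_real (S x))"
  and dS: "!!x. (S has_real_derivative \<rho> x) (at x)"
  and \<rho>: "continuous_on UNIV \<rho>" "!!x. \<rho> x >= 0" "!!x. x \<notin> {0<..<1} ==> \<rho> x = 0"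
  and S0: "!!x. x <= 0 ==> S x = 0" and S1: "!!x. x >= 1 ==> S x = 1" and S01: "!!x. 0 <= S x \<and> S x <= 1"
  by (rule smooth_step) blast
 define ph where "ph d t = complex_of_real (S ((t - t1) / d)) - complex_of_real (S ((t - t2) / d))" for d t
 define R where "R s d t = complex_of_real (\<rho> ((t - s) / d) / d)" for s d t
 have ph_test: "ph d : test_fun {a<..<b}" if d: "0 < d" "t2 + d < b" for d
 proof (rule test_funI)
  have "bsm UNIV (%t. complex_of_real (S ((1 / d) * t + (- s / d))))" for s by (rule bsm_affine[OF S])
  then have "bsm UNIV (ph d)" unfolding ph_def[abs_def]
   by (intro bsm_diff) (simp_all add: diff_divide_distrib)
  then show "smooth_on UNIV (ph d)" using snet_smooth[of UNIV UNIV "%_. ph d" 1] by simp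
  show "{t1..t2 + d} \<subseteq> {a<..<b}" using t d by auto
  show "ph d t = 0" if "t \<notin> {t1..t2 + d}" for t
  proof (cases "t < t1")
   case True
   then show ?thesis using t d by (simp add: ph_def S0 divide_le_0_iff)
  next
   case False
   then have "t > t2 + d" using that by auto
   then show ?thesis using t d by (simp add: ph_def S1)
  qed
 qed simp
 have dph: "pdiff 1 (ph d) t = R t1 d t - R t2 d t" if "d > 0" for d t
 proof -
  have "((%t. complex_of_real (S ((t - s) / d))) has_vector_derivative R s d t) (at t)" for s
   unfolding R_def
   by (rule has_vector_derivative_of_real, rule DERIV_cong[OF DERIV_chain2[OF dS]])
    (use that in \<open>auto intro!: derivative_eq_intros\<close>)
  then show ?thesis unfolding ph_def[abs_def] by (intro pdiff_real_eq has_vector_derivative_diff)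
 qed
 \<comment> \<open>At most half of \<open>b - t2\<close>, so that the support
   \<open>[t1, t2 + d n]\<close> stays inside the interval.\<close>
 define d where "d n = (b - t2) * (1 / (real n + 2))" for n
 have d: "0 < d n" "t2 + d n < b" for n
 proof -
  show "0 < d n" using t by (simp add: d_def)
  have "(b - t2) * (1 / (real n + 2)) < (b - t2) * 1" using t by (intro mult_strict_left_mono) auto
  then show "t2 + d n < b" by (simp add: d_def)
 qed
 have "d \<longlonglongrightarrow> 0" unfolding d_def[abs_def] by real_asymp
 then have dlim: "filterlim d (at_right 0) sequentially"
  using d by (simp add: filterlim_at less_imp_neq[OF d(1), symmetric])
 have Kb: "continuous_on {a<..<b} K" by (rule continuous_on_subset[OF K]) auto
 have 1: "(%n. LINT t|lebesgue_on {a<..<b}. R s (d n) t * K t) \<longlonglongrightarrow> K s" if "s : {a<..<b}" for s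
  unfolding R_def
  by (rule filterlim_compose[OF mollifier_tendsto[OF dS \<rho> _ _ Kb that] dlim]) (use S0 S1 in auto)
 have RK: "integrable (lebesgue_on {a<..<b}) (%t. R s (d n) t * K t)" for s n
 proof -
  have "continuous_on {a..b} (%t. R s (d n) t)"
   unfolding R_def[abs_def] by (rule continuous_on_subset[of UNIV])
    (use d(1)[of n] in \<open>auto intro!: continuous_intros continuous_on_compose2[OF \<rho>(1)]\<close>)
  then have "continuous_on {a..b} (%t. R s (d n) t * K t)" by (intro continuous_intros K)
  then have "integrable (lebesgue_on {a..b}) (%t. R s (d n) t * K t)" by (rule continuous_imp_integrable_real)
  then show ?thesis by (rule integrable_lebesgue_on_subset) auto
 qed
 have km: "k : bmeas (lebesgue_on {a<..<b})"
  by (rule measurable_lebesgue_on_AE[OF continuous_imp_measurable_on_sets_lebesgue[OF Kb] _ ae]) auto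
 have 2: "(LINT t|lebesgue_on {a<..<b}. pdiff 1 (ph (d n)) t * k t)
   = (LINT t|lebesgue_on {a<..<b}. R t1 (d n) t * K t) - (LINT t|lebesgue_on {a<..<b}. R t2 (d n) t * K t)" for n
 proof -
  have "(LINT t|lebesgue_on {a<..<b}. pdiff 1 (ph (d n)) t * k t)
    = (LINT t|lebesgue_on {a<..<b}. R t1 (d n) t * K t - R t2 (d n) t * K t)"
  proof (rule integral_cong_AE)
   show "AE t in lebesgue_on {a<..<b}. pdiff 1 (ph (d n)) t * k t = R t1 (d n) t * K t - R t2 (d n) t * K t"
    using ae by eventually_elim (simp add: dph[OF d(1)] left_diff_distrib)
   then show "(%t. pdiff 1 (ph (d n)) t * k t) : bmeas (lebesgue_on {a<..<b})"
    by (rule measurable_lebesgue_on_AE[rotated 2])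
     (auto intro!: borel_measurable_diff borel_measurable_integrable[OF RK])
  qed (auto intro!: borel_measurable_diff borel_measurable_integrable[OF RK])
  then show ?thesis by (simp add: RK)
 qed
 have 3: "(%n. LINT t|lebesgue_on {a<..<b}. ph (d n) t * l t) \<longlonglongrightarrow> (LINT t|lebesgue_on {a<..<b}. indicator {t1..t2} t *\<^sub>R l t)"
 proof (rule integral_dominated_convergence[where w = "%t. cmod (l t)"])
  show "integrable (lebesgue_on {a<..<b}) (%t. cmod (l t))" using l by (rule integrable_norm)
  show "(%t. indicator {t1..t2} t *\<^sub>R l t) : bmeas (lebesgue_on {a<..<b})"
  proof (rule borel_measurable_scaleR[OF _ borel_measurable_integrable[OF l]])
   show "indicator {t1..t2} : bmeas (lebesgue_on {a<..<b})"
    by (rule measurable_restrict_space1) (rule borel_measurable_indicator, simp)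
  qed
  show "(%t. ph (d n) t * l t) : bmeas (lebesgue_on {a<..<b})" for n
  proof (rule borel_measurable_times[OF _ borel_measurable_integrable[OF l]])
   have "continuous_on {a<..<b} (ph (d n))"
    by (rule test_fun_continuous[OF ph_test[OF d]])
   then show "ph (d n) : bmeas (lebesgue_on {a<..<b})"
    by (rule continuous_imp_measurable_on_sets_lebesgue) simp
  qed
  show "AE t in lebesgue_on {a<..<b}. norm (ph (d n) t * l t) <= cmod (l t)" for n
  proof (rule AE_I2)
   fix t
   have "\<bar>S ((t - t1) / d n) - S ((t - t2) / d n)\<bar> <= 1" using S01[of "(t - t1) / d n"] S01[of "(t - t2) / d n"] by auto
   then have "cmod (ph (d n) t) <= 1" unfolding ph_def of_real_diff[symmetric] norm_of_real .
   then show "norm (ph (d n) t * l t) <= cmod (l t)" by (simp add: norm_mult mult_left_le_one_le)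
  qed
  \<comment> \<open>At \<open>t = t1\<close> the step still has the value 0 while the indicator is
    already 1, so this one point is discarded.\<close>
  have "AE t in lebesgue. t \<noteq> t1" by (rule AE_completion[OF AE_lborel_singleton])
  then have "AE t in lebesgue_on {a<..<b}. t \<noteq> t1"
   unfolding AE_restrict_space_iff[of "{a<..<b}" lebesgue, simplified] by (rule eventually_mono) simp
  then show "AE t in lebesgue_on {a<..<b}. (%n. ph (d n) t * l t) \<longlonglongrightarrow> indicator {t1..t2} t *\<^sub>R l t"
  proof eventually_elim
   case (elim t)
   have step: "\<forall>\<^sub>F n in sequentially. S ((t - s) / d n) = (if t > s then 1 else 0)" for s
   proof (cases "t > s")
    case True
    then have "\<forall>\<^sub>F n in sequentially. d n < t - s"
     using order_tendstoD(2)[OF \<open>d \<longlonglongrightarrow> 0\<close>, of "t - s"] by simp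
    then show ?thesis
    proof eventually_elim
     case (elim n)
     then have "(t - s) / d n >= 1" using d(1)[of n] by simp
     then show ?case using S1 True by simp
    qed
   next
    case False
    then have "S ((t - s) / d n) = 0" for n using d(1)[of n] by (intro S0) (simp add: divide_le_0_iff)
    then show ?thesis using False by simp
   qed
   have "\<forall>\<^sub>F n in sequentially. ph (d n) t * l t = indicator {t1..t2} t *\<^sub>R l t"
    using step[of t1] step[of t2]
    by eventually_elim (use elim t in \<open>auto simp: ph_def indicator_def\<close>)
   then show ?case by (rule tendsto_eventually)
  qed
 qed
 have "(%n. LINT t|lebesgue_on {a<..<b}. ph (d n) t * l t) \<longlonglongrightarrow> K t2 - K t1"
 proof -
  have "(%n. - ((LINT t|lebesgue_on {a<..<b}. R t1 (d n) t * K t) - (LINT t|lebesgue_on {a<..<b}. R t2 (d n) t * K t)))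
    \<longlonglongrightarrow> - (K t1 - K t2)"
   by (intro tendsto_intros 1) (use t in auto)
  then show ?thesis unfolding 2[symmetric] test[OF ph_test[OF d]] by simp
 qed
 from LIMSEQ_unique[OF 3 this] show ?thesis .
qed

text \<open>Reaches the endpoints of the interval, hence the initial time: the integral of
  \<open>l\<close> from \<open>a\<close> to \<open>s\<close> minus \<open>K s\<close> is constant on
  the open interval and continuous on the closed one.\<close>

lemma du_bois_reymond_has_integral:
 fixes k l K :: "real => complex"
 assumes test: "!!ph. ph : test_fun {a<..<b} ==>
   (LINT t|lebesgue_on {a<..<b}. pdiff 1 ph t * k t) = - (LINT t|lebesgue_on {a<..<b}. ph t * l t)"
  and ae: "AE t in lebesgue_on {a<..<b}. k t = K t" and K: "continuous_on {a..b} K"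
  and l: "integrable (lebesgue_on {a<..<b}) l" and t: "a <= t1" "t1 <= t2" "t2 <= b"
 shows "(l has_integral (K t2 - K t1)) {t1..t2}"
proof -
 have li: "(l has_integral (LINT t|lebesgue_on {a<..<b}. l t)) {a<..<b}"
  by (rule has_integral_integral_lebesgue_on[OF l]) simp
 have lab: "l integrable_on {a..b}"
  using li by (metis box_real(1) cbox_interval has_integral_integrable integrable_on_open_interval)
 have inner: "(l has_integral (K s2 - K s1)) {s1..s2}" if s: "a < s1" "s1 < s2" "s2 < b" for s1 s2
 proof -
  have sub: "{s1..s2} \<subseteq> {a<..<b}" using s by auto
  have "(LINT t|lebesgue_on {a<..<b}. indicator {s1..s2} t *\<^sub>R l t) = (LINT t|lebesgue_on {s1..s2}. l t)"
   using sub by (simp add: integral_restrict_space) (rule bochner_cong, auto simp: indicator_def)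
  moreover have "integrable (lebesgue_on {s1..s2}) l"
   by (rule integrable_lebesgue_on_subset[OF l]) (use sub in auto)
  ultimately show ?thesis
   using du_bois_reymond[OF test ae K l s] has_integral_integral_lebesgue_on[of "{s1..s2}" l] by simp
 qed
 show ?thesis
 proof (cases "t1 = t2")
  case False
  then have t12: "t1 < t2" using t by simp
  have ab: "a < b" using t t12 by simp
  define G where "G s = integral {a..s} l - K s" for s
  have Gc: "continuous_on {a..b} G"
   unfolding G_def[abs_def] by (intro continuous_intros indefinite_integral_continuous_1 lab K)
  have int: "integral {a..s1} l + integral {s1..s2} l = integral {a..s2} l" if "a <= s1" "s1 <= s2" "s2 <= b" for s1 s2
   by (rule hk_combine)
    (use that in \<open>auto intro: integrable_subinterval_real[OF lab]\<close>)
  have mono: "G s2 = G s1" if "s1 : {a<..<b}" "s2 : {a<..<b}" "s1 < s2" for s1 s2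
   using int[of s1 s2] inner[of s1 s2] that by (simp add: G_def integral_unique algebra_simps)
  then have const: "G s = G ((a + b) / 2)" if "s : {a<..<b}" for s
  proof -
   have m: "(a + b) / 2 : {a<..<b}" using ab by (simp add: field_simps)
   show ?thesis
   proof (cases s "(a + b) / 2" rule: linorder_cases)
    case less
    from mono[OF that m less] show ?thesis by simp
   next
    case greater
    from mono[OF m that greater] show ?thesis .
   qed (simp only:)
  qed
  have cl: "closure {a<..<b} = {a..b}" using ab by (rule closure_greaterThanLessThan)
  have c: "G s = G ((a + b) / 2)" if "s : {a..b}" for s
   by (rule continuous_constant_on_closure[of "{a<..<b}" G, unfolded cl, OF Gc const that])
  have "G t2 = G t1" by (rule trans[OF c c[symmetric]]) (use t in auto)
  then have "integral {a..t2} l = integral {a..t1} l - K t1 + K t2" by (simp add: G_def algebra_simps)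
  moreover have "integral {t1..t2} l = integral {a..t2} l - integral {a..t1} l"
   using int[of t1 t2] t by (simp add: eq_diff_eq add.commute)
  ultimately have "integral {t1..t2} l = K t2 - K t1" by simp
  moreover have "l integrable_on {t1..t2}" by (rule integrable_subinterval_real[OF lab]) (use t in auto)
  ultimately show ?thesis by (simp add: has_integral_iff)
 qed (simp add: has_integral_refl)
qed

text \<open>The previous result with \<open>k = K = 0\<close> makes all integrals over intervals
  vanish. Induction over Borel sets extends this from intervals to Borel sets, splitting a Lebesgue
  set into a Borel part and a null part extends it further, and \<open>density_zero\<close>
  concludes.\<close>

lemma AE_zero_of_test:
 fixes l :: "real => complex"
 assumes l: "integrable (lebesgue_on {a<..<b}) l"
  and test: "!!ph. ph : test_fun {a<..<b} ==> (LINT t|lebesgue_on {a<..<b}. ph t * l t) = 0"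
 shows "AE t in lebesgue_on {a<..<b}. l t = 0"
proof (cases "a < b")
 case True
 have hi: "(l has_integral (0 - 0)) {t1..t2}" if "a <= t1" "t1 <= t2" "t2 <= b" for t1 t2
  by (rule du_bois_reymond_has_integral[where k = "%_. 0" and K = "%_. 0", OF _ _ _ l that])
   (use test in auto)
 define F where "F t = indicator {a<..<b} t *\<^sub>R l t" for t
 have F: "integrable lebesgue F"
  using l by (simp add: F_def[abs_def] integrable_restrict_space)
 have box: "(LINT t|lebesgue. indicator {p..q} t *\<^sub>R F t) = 0" for p q
 proof -
  let ?p = "max p a" and ?q = "min q b"
  have "(LINT t|lebesgue. indicator {p..q} t *\<^sub>R F t) = (LINT t|lebesgue. indicator {?p..?q} t *\<^sub>R F t)"
   by (rule bochner_cong) (auto simp: F_def indicator_def)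
  also have "\<dots> = (LINT t|lebesgue_on {?p..?q}. F t)" by (simp add: integral_restrict_space)
  also have "\<dots> = integral {?p..?q} F"
  proof (rule lebesgue_integral_eq_integral)
   show "integrable (lebesgue_on {?p..?q}) F"
    using integrable_mult_indicator[of "{?p..?q}" lebesgue F] F by (simp add: integrable_restrict_space)
  qed simp
  also have "\<dots> = integral {?p..?q} l"
   by (rule integral_spike[of "{a, b}"]) (auto simp: F_def indicator_def)
  also have "\<dots> = 0"
  proof (cases "?p <= ?q")
   case True
   then show ?thesis using hi[of ?p ?q] by (simp add: integral_unique)
  qed simp
  finally show ?thesis .
 qed
 have all: "(LINT t|lebesgue. F t) = 0"
 proof -
  have "(LINT t|lebesgue. F t) = (LINT t|lebesgue. indicator {a..b} t *\<^sub>R F t)"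
   by (rule bochner_cong) (auto simp: F_def indicator_def)
  then show ?thesis using box by simp
 qed
 have borel: "(LINT t|lebesgue. indicator B t *\<^sub>R F t) = 0" if "B : sets borel" for B
  using that
 proof (induction B rule: borel_set_induct)
  case (compl B)
  have iB: "integrable lebesgue (%t. indicator B t *\<^sub>R F t)" using compl F by (intro integrable_mult_indicator) auto
  have "(LINT t|lebesgue. indicator (- B) t *\<^sub>R F t) = (LINT t|lebesgue. F t - indicator B t *\<^sub>R F t)"
   by (rule bochner_cong) (auto simp: indicator_def)
  then show ?case using compl iB F all by simp
 next
  case (union f)
  have "(LINT t:(\<Union>i. f i)|lebesgue. F t) = (\<Sum>i. (LINT t:f i|lebesgue. F t))"
  proof (rule lebesgue_integral_countable_add)
   show "set_integrable lebesgue (\<Union>i. f i) F" unfolding set_integrable_def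
    using union F by (intro integrable_mult_indicator) auto
  qed (use union in \<open>auto simp: disjoint_family_on_def\<close>)
  then show ?case using union by (simp add: set_lebesgue_integral_def)
 qed (use box in auto)
 interpret finite_measure "lebesgue_on {a<..<b}" by (rule finite_measure_lebesgue_on) simp
 show ?thesis
 proof (rule density_zero[OF l])
  fix A :: "real set" assume "A : sets (lebesgue_on {a<..<b})"
  then have A: "A : sets lebesgue" "A \<subseteq> {a<..<b}" by (auto simp: sets_restrict_space_iff)
  obtain N where N: "N : null_sets lborel" "null_part lborel A \<subseteq> N" using null_part[OF A(1)] by blast
  have "AE t in lebesgue. t \<notin> N" by (rule AE_completion) (use N in \<open>simp add: AE_not_in\<close>)
  then have ae: "AE t in lebesgue. indicator A t *\<^sub>R F t = indicator (main_part lborel A) t *\<^sub>R F t"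
  proof eventually_elim
   case (elim t)
   have "A = main_part lborel A \<union> null_part lborel A" using A by simp
   then have "t : A \<longleftrightarrow> t : main_part lborel A" using elim N by blast
   then show ?case by (simp add: indicator_def)
  qed
  have mp: "main_part lborel A : sets borel" using main_part_sets[OF A(1)] by simp
  have "set_lebesgue_integral (lebesgue_on {a<..<b}) A l = (LINT t|lebesgue. indicator A t *\<^sub>R F t)"
   unfolding set_lebesgue_integral_def F_def
   by (simp add: integral_restrict_space) (rule bochner_cong, auto simp: indicator_def)
  also have "\<dots> = (LINT t|lebesgue. indicator (main_part lborel A) t *\<^sub>R F t)"
   by (rule integral_cong_AE[OF _ _ ae])
    (use A mp F in \<open>auto intro!: borel_measurable_integrable integrable_mult_indicator\<close>)
  finally show "set_lebesgue_integral (lebesgue_on {a<..<b}) A l = 0" using borel[OF mp] by simp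
 qed
next
 case False
 then show ?thesis
  unfolding AE_restrict_space_iff[of "{a<..<b}" lebesgue, simplified] by (intro AE_I2) (use False in auto)
qed

section \<open>Square integrable functions on the unit interval as a real inner product
  space\<close>

lemma L2D:
 assumes "f : L2 Om"
 shows "f : bmeas (lebesgue_on Om)" "integrable (lebesgue_on Om) (%z. (cmod (f z))\<^sup>2)"
 using assms by (simp_all add: L2_def)

lemma L2_add:
 assumes f: "f : L2 Om" and g: "g : L2 Om" shows "(%z. f z + g z) : L2 Om"
 unfolding L2_def mem_Collect_eq
proof
 show m: "(%z. f z + g z) : bmeas (lebesgue_on Om)" using L2D[OF f] L2D[OF g] by (intro borel_measurable_add)
 show "integrable (lebesgue_on Om) (%z. (cmod (f z + g z))\<^sup>2)"
 proof (rule Bochner_Integration.integrable_bound)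
  show "integrable (lebesgue_on Om) (%z. 2 * (cmod (f z))\<^sup>2 + 2 * (cmod (g z))\<^sup>2)"
   using L2D[OF f] L2D[OF g] by (intro Bochner_Integration.integrable_add integrable_mult_right)
  show "(%z. (cmod (f z + g z))\<^sup>2) : bmeas (lebesgue_on Om)" using m by measurable
  show "AE z in lebesgue_on Om. norm ((cmod (f z + g z))\<^sup>2) <= norm (2 * (cmod (f z))\<^sup>2 + 2 * (cmod (g z))\<^sup>2)"
  proof (rule AE_I2)
   fix z
   have "(cmod (f z + g z))\<^sup>2 <= (cmod (f z) + cmod (g z))\<^sup>2" by (intro power_mono norm_triangle_ineq) simp
   also have "\<dots> <= 2 * (cmod (f z))\<^sup>2 + 2 * (cmod (g z))\<^sup>2"
    using zero_le_power2[of "cmod (f z) - cmod (g z)"] by (simp add: power2_eq_square algebra_simps)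
   finally show "norm ((cmod (f z + g z))\<^sup>2) <= norm (2 * (cmod (f z))\<^sup>2 + 2 * (cmod (g z))\<^sup>2)" by simp
  qed
 qed
qed

lemma L2_mult_bounded:
 assumes f: "f : L2 Om" and m: "m : bmeas (lebesgue_on Om)" and M: "!!z. z : Om ==> cmod (m z) <= M"
 shows "(%z. m z * f z) : L2 Om" "M >= 0 ==> L2norm Om (%z. m z * f z) <= M * L2norm Om f"
proof -
 have mm: "(%z. m z * f z) : bmeas (lebesgue_on Om)" using L2D[OF f] m by (intro borel_measurable_times)
 have le: "(cmod (m z * f z))\<^sup>2 <= M\<^sup>2 * (cmod (f z))\<^sup>2" if "z : Om" for z
  unfolding norm_mult power_mult_distrib using M[OF that] by (intro mult_right_mono power_mono) auto
 have i: "integrable (lebesgue_on Om) (%z. (cmod (m z * f z))\<^sup>2)"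
 proof (rule Bochner_Integration.integrable_bound)
  show "integrable (lebesgue_on Om) (%z. M\<^sup>2 * (cmod (f z))\<^sup>2)" using L2D[OF f] by (intro integrable_mult_right)
  show "(%z. (cmod (m z * f z))\<^sup>2) : bmeas (lebesgue_on Om)" using mm by measurable
  show "AE z in lebesgue_on Om. norm ((cmod (m z * f z))\<^sup>2) <= norm (M\<^sup>2 * (cmod (f z))\<^sup>2)"
   by (rule AE_I2) (use le in simp)
 qed
 show "(%z. m z * f z) : L2 Om" using mm i by (simp add: L2_def)
 assume M0: "M >= 0"
 have "(LINT z|lebesgue_on Om. (cmod (m z * f z))\<^sup>2) <= (LINT z|lebesgue_on Om. M\<^sup>2 * (cmod (f z))\<^sup>2)"
  using L2D[OF f] by (intro integral_mono i integrable_mult_right) (use le in simp_all)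
 also have "\<dots> = M\<^sup>2 * (LINT z|lebesgue_on Om. (cmod (f z))\<^sup>2)" by simp
 finally have "L2norm Om (%z. m z * f z) <= sqrt (M\<^sup>2 * (LINT z|lebesgue_on Om. (cmod (f z))\<^sup>2))"
  unfolding L2norm_def by (rule real_sqrt_le_mono)
 then show "L2norm Om (%z. m z * f z) <= M * L2norm Om f" using M0 by (simp add: real_sqrt_mult L2norm_def)
qed

lemma L2_cmult: "f : L2 Om ==> (%z. k * f z) : L2 Om"
 by (rule L2_mult_bounded(1)[where M = "cmod k"]) auto

lemma L2_uminus: "f : L2 Om ==> (%z. - f z) : L2 Om"
 using L2_cmult[of f Om "-1"] by simp

lemma L2_diff: "f : L2 Om ==> g : L2 Om ==> (%z. f z - g z) : L2 Om"
 using L2_add[of f Om "%z. (-1) * g z"] L2_cmult[of g Om "-1"] by simp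

lemma L2_zero: "(%z. 0) : L2 Om"
 by (simp add: L2_def)

lemma L2_product_integrable:
 assumes f: "f : L2 Om" and g: "g : L2 Om"
 shows "integrable (lebesgue_on Om) (%z. f z * cnj (g z))"
proof (rule Bochner_Integration.integrable_bound)
 show "integrable (lebesgue_on Om) (%z. (cmod (f z))\<^sup>2 + (cmod (g z))\<^sup>2)"
  using L2D[OF f] L2D[OF g] by (intro Bochner_Integration.integrable_add)
 show "(%z. f z * cnj (g z)) : bmeas (lebesgue_on Om)"
  using L2D[OF f] L2D[OF g] by (intro borel_measurable_times measurable_compose[OF _ borel_measurable_continuous_onI[OF continuous_on_cnj[OF continuous_on_id]]])
 show "AE z in lebesgue_on Om. norm (f z * cnj (g z)) <= norm ((cmod (f z))\<^sup>2 + (cmod (g z))\<^sup>2)"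
 proof (rule AE_I2)
  fix z
  have "cmod (f z) * cmod (g z) <= (cmod (f z))\<^sup>2 + (cmod (g z))\<^sup>2"
  proof -
   have "0 <= (cmod (f z))\<^sup>2 + (cmod (g z))\<^sup>2 - 2 * (cmod (f z) * cmod (g z))"
    using zero_le_power2[of "cmod (f z) - cmod (g z)"] by (simp add: power2_diff)
   moreover have "0 <= cmod (f z) * cmod (g z)" by simp
   ultimately show ?thesis by linarith
  qed
  then show "norm (f z * cnj (g z)) <= norm ((cmod (f z))\<^sup>2 + (cmod (g z))\<^sup>2)" by (simp add: norm_mult)
 qed
qed

text \<open>
 \<open>L\<^sup>2((0, 1))\<close> modulo equality almost everywhere, as a real inner product space with the real part of
 \<^const>\<open>L2ip\<close>.
\<close>

definition L2eq :: "(real => complex) => (real => complex) => bool" where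
 "L2eq f g \<longleftrightarrow> f : L2 U01 \<and> g : L2 U01 \<and> (AE x in lebU. f x = g x)"

quotient_type l2 = "real => complex" / partial: L2eq
proof (rule part_equivpI)
 show "\<exists>f. L2eq f f" using L2_zero by (auto simp: L2eq_def)
 show "symp L2eq" unfolding L2eq_def by (rule sympI) (auto elim: eventually_mono)
 show "transp L2eq" unfolding L2eq_def
  by (rule transpI) (auto elim: eventually_elim2)
qed

lemma L2ip_cong:
 assumes "L2eq f f'" "L2eq g g'" shows "L2ip f g = L2ip f' g'"
 unfolding L2ip_def
proof (rule integral_cong_AE)
 show "(%x. f x * cnj (g x)) : bmeas (lebU)" "(%x. f' x * cnj (g' x)) : bmeas (lebU)"
  using assms by (auto simp: L2eq_def intro!: borel_measurable_integrable L2_product_integrable)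
 have "AE x in lebU. f x = f' x" "AE x in lebU. g x = g' x" using assms by (auto simp: L2eq_def)
 then show "AE x in lebU. f x * cnj (g x) = f' x * cnj (g' x)" by eventually_elim simp
qed

lemma L2ip_self: "Re (L2ip f f) = (LINT x|lebU. (cmod (f x))\<^sup>2)"
proof -
 have "L2ip f f = (LINT x|lebU. complex_of_real ((cmod (f x))\<^sup>2))"
  unfolding L2ip_def by (simp add: complex_norm_square[symmetric])
 then show ?thesis by (simp only: integral_complex_of_real Re_complex_of_real)
qed

instantiation l2 :: real_inner
begin

lift_definition zero_l2 :: l2 is "%x. 0" by (simp add: L2eq_def L2_zero)
lift_definition plus_l2 :: "l2 => l2 => l2" is "%f g x. f x + g x"
 by (auto simp: L2eq_def L2_add elim: eventually_elim2)
lift_definition minus_l2 :: "l2 => l2 => l2" is "%f g x. f x - g x"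
 by (auto simp: L2eq_def L2_diff elim: eventually_elim2)
lift_definition uminus_l2 :: "l2 => l2" is "%f x. - f x"
 by (auto simp: L2eq_def L2_uminus elim: eventually_mono)
lift_definition scaleR_l2 :: "real => l2 => l2" is "%r f x. of_real r * f x"
 by (auto simp: L2eq_def L2_cmult elim: eventually_mono)
lift_definition inner_l2 :: "l2 => l2 => real" is "%f g. Re (L2ip f g)"
 using L2ip_cong by simp
definition norm_l2 :: "l2 => real" where "norm_l2 f = sqrt (inner f f)"
definition dist_l2 :: "l2 => l2 => real" where "dist_l2 f g = norm (f - g)"
definition sgn_l2 :: "l2 => l2" where "sgn_l2 f = inverse (norm f) *\<^sub>R f"
definition uniformity_l2 :: "(l2 \<times> l2) filter" where
 "uniformity_l2 = (INF e\<in>{0 <..}. principal {(x, y). dist x y < e})"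
definition open_l2 :: "l2 set => bool" where
 "open_l2 U = (\<forall>x\<in>U. \<forall>\<^sub>F (x', y) in uniformity. x' = x --> y : U)"

instance
proof
 have D: "L2eq f g \<longleftrightarrow> (AE x in lebU. f x = g x)" if "f : L2 U01" "g : L2 U01" for f g
  using that by (simp add: L2eq_def)
 have mem: "L2eq f f \<longleftrightarrow> f : L2 U01" for f by (simp add: L2eq_def)
 have add: "L2ip (%x. f x + g x) h = L2ip f h + L2ip g h" if "L2eq f f" "L2eq g g" "L2eq h h" for f g h
  unfolding L2ip_def distrib_right using that by (intro Bochner_Integration.integral_add L2_product_integrable) (auto simp: mem)
 have scale: "L2ip (%x. of_real r * f x) h = of_real r * L2ip f h" for f h r
  unfolding L2ip_def mult.assoc by (rule integral_mult_right_zero)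
 note self = L2ip_self
 fix a b c :: l2 and r s :: real
 show "a + b + c = a + (b + c)" by transfer (auto simp: L2eq_def L2_add add.assoc)
 show "a + b = b + a" by transfer (auto simp: L2eq_def L2_add add.commute)
 show "0 + a = a" by transfer (auto simp: L2eq_def)
 show "- a + a = 0" by transfer (auto simp: L2eq_def L2_zero L2_add L2_uminus)
 show "a - b = a + - b" by transfer (auto simp: L2eq_def L2_diff L2_add L2_uminus)
 show "r *\<^sub>R (a + b) = r *\<^sub>R a + r *\<^sub>R b" by transfer (auto simp: L2eq_def L2_add L2_cmult distrib_left)
 show "(r + s) *\<^sub>R a = r *\<^sub>R a + s *\<^sub>R a" by transfer (auto simp: L2eq_def L2_add L2_cmult distrib_right)
 show "r *\<^sub>R s *\<^sub>R a = (r * s) *\<^sub>R a" by transfer (auto simp: L2eq_def L2_cmult mult.assoc)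
 show "1 *\<^sub>R a = a" by transfer (auto simp: L2eq_def)
 show "dist a b = norm (a - b)" by (rule dist_l2_def)
 show "sgn a = inverse (norm a) *\<^sub>R a" by (rule sgn_l2_def)
 show "(uniformity :: (l2 \<times> l2) filter) = (INF e\<in>{0 <..}. principal {(x, y). dist x y < e})" by (rule uniformity_l2_def)
 show "open U \<longleftrightarrow> (\<forall>x\<in>U. \<forall>\<^sub>F (x', y) in uniformity. x' = x --> y : U)" for U :: "l2 set" by (rule open_l2_def)
 show "norm a = sqrt (inner a a)" by (rule norm_l2_def)
 show "inner a b = inner b a"
 proof transfer
  fix f g
  have "L2ip g f = (LINT x|lebU. cnj (f x * cnj (g x)))" by (simp add: L2ip_def mult.commute)
  also have "\<dots> = cnj (L2ip f g)" unfolding L2ip_def by (simp del: complex_cnj_mult)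
  finally show "Re (L2ip f g) = Re (L2ip g f)" by simp
 qed
 show "inner (a + b) c = inner a c + inner b c" by transfer (simp add: add)
 show "inner (r *\<^sub>R a) b = r * inner a b" by transfer (simp add: scale)
 show "0 <= inner a a" by transfer (simp add: self)
 show "inner a a = 0 \<longleftrightarrow> a = 0"
 proof transfer
  fix f assume "L2eq f f"
  then have f: "f : L2 U01" by (simp add: mem)
  have "(LINT x|lebU. (cmod (f x))\<^sup>2) = 0 \<longleftrightarrow> (AE x in lebU. (cmod (f x))\<^sup>2 = 0)"
   using L2D[OF f] by (intro integral_nonneg_eq_0_iff_AE) auto
  then show "Re (L2ip f f) = 0 \<longleftrightarrow> L2eq f (%x. 0)" using f by (simp add: self D L2_zero)
 qed
qed

end

text \<open>The class of \<open>f\<close> in \<open>l2\<close>. It turns equality almost everywhere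
  into equality, which matters because \<open>wd\<close> and the values of weak solutions are
  determined only up to null sets. The value 0 outside \<open>L2 U01\<close> is a dummy.\<close>

definition J :: "(real => complex) => l2" where
 "J f = (if f : L2 U01 then abs_l2 f else 0)"

lemma J_L2: "f : L2 U01 ==> J f = abs_l2 f" by (simp add: J_def)

lemma L2eq_refl: "f : L2 U01 ==> L2eq f f" by (simp add: L2eq_def)

lemma J_add: "f : L2 U01 ==> g : L2 U01 ==> J (%x. f x + g x) = J f + J g"
 by (simp add: J_L2 L2_add plus_l2.abs_eq L2eq_refl)

lemma J_diff: "f : L2 U01 ==> g : L2 U01 ==> J (%x. f x - g x) = J f - J g"
 by (simp add: J_L2 L2_diff minus_l2.abs_eq L2eq_refl)

lemma J_scaleR: "f : L2 U01 ==> J (%x. of_real r * f x) = r *\<^sub>R J f"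
 by (simp add: J_L2 L2_cmult scaleR_l2.abs_eq L2eq_refl)

lemma J_inner: "f : L2 U01 ==> g : L2 U01 ==> inner (J f) (J g) = Re (L2ip f g)"
 by (simp add: J_L2 inner_l2.abs_eq L2eq_refl)

lemma J_cong: "f : L2 U01 ==> g : L2 U01 ==> AE x in lebU. f x = g x ==> J f = J g"
 using Quotient3_rel_abs[OF Quotient3_l2, of f g] by (simp add: J_L2 L2eq_def)

lemma J_norm: "f : L2 U01 ==> norm (J f) = L2norm U01 f"
 by (simp add: norm_eq_sqrt_inner J_inner L2norm_def L2ip_self)

lemma J_norm_diff: "f : L2 U01 ==> g : L2 U01 ==> norm (J f - J g) = L2norm U01 (%x. f x - g x)"
 by (simp add: J_diff[symmetric] J_norm L2_diff)

lemma L2ip_add_left: "f : L2 U01 ==> g : L2 U01 ==> h : L2 U01 ==> L2ip (%x. f x + g x) h = L2ip f h + L2ip g h"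
 unfolding L2ip_def distrib_right by (intro Bochner_Integration.integral_add L2_product_integrable)

lemma L2ip_diff_left: "f : L2 U01 ==> g : L2 U01 ==> h : L2 U01 ==> L2ip (%x. f x - g x) h = L2ip f h - L2ip g h"
 unfolding L2ip_def left_diff_distrib by (intro Bochner_Integration.integral_diff L2_product_integrable)

lemma L2ip_cmult_left: "L2ip (%x. k * f x) h = k * L2ip f h"
 unfolding L2ip_def mult.assoc by (rule integral_mult_right_zero)

lemma L2ip_bound:
 assumes f: "f : L2 U01" and h: "h : L2 U01"
 shows "cmod (L2ip f h) <= L2norm U01 f * L2norm U01 h"
proof (cases "L2ip f h = 0")
 case False
 \<comment> \<open>Rotating \<open>f\<close> by a factor of modulus 1 makes the pairing real and
   nonnegative, which reduces the claim to the real Cauchy-Schwarz inequality of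
   \<open>l2\<close>.\<close>
 define k where "k = cnj (L2ip f h) / cmod (L2ip f h)"
 have k: "cmod k = 1" using False by (simp add: k_def norm_divide)
 have "L2ip (%x. k * f x) h = k * L2ip f h" by (rule L2ip_cmult_left)
 also have "\<dots> = complex_of_real (cmod (L2ip f h))"
  using False by (simp add: k_def complex_norm_square[symmetric] mult.commute[of "cnj _"] power2_eq_square)
 finally have "cmod (L2ip f h) = inner (J (%x. k * f x)) (J h)" using f h by (simp add: J_inner L2_cmult)
 also have "\<dots> <= norm (J (%x. k * f x)) * norm (J h)" by (rule norm_cauchy_schwarz)
 also have "norm (J (%x. k * f x)) = L2norm U01 f" using f k by (simp add: J_norm L2_cmult L2norm_def norm_mult)
 finally show ?thesis using h by (simp add: J_norm)
qed simp

lemma L2norm_zero_AE: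
 assumes "f : L2 U01" "L2norm U01 f = 0" shows "AE x in lebU. f x = 0"
proof -
 have "AE x in lebU. (cmod (f x))\<^sup>2 = 0"
  using assms L2D[OF assms(1)] integral_nonneg_eq_0_iff_AE[of "lebU" "%x. (cmod (f x))\<^sup>2"] by (simp add: L2norm_def)
 then show ?thesis by simp
qed

section \<open>Test functions and Sobolev spaces on the unit interval\<close>

lemma nice_U01: "nice_dom U01" using nice_U[of 1] by simp

lemma test_fun_pdiffs:
 assumes "ph : test_fun Om" "es : lists Basis" shows "pdiffs es ph : test_fun Om"
proof -
 obtain K where K: "compact K" "K \<subseteq> Om" "!!z. z \<notin> K ==> ph z = 0" using assms(1) by (auto simp: test_fun_def)
 have app: "fs @ es : lists Basis" if "fs : lists Basis" for fs using that assms(2) by simp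
 show ?thesis
 proof (rule test_funI[OF _ K(1,2)])
  show "smooth_on UNIV (pdiffs es ph)"
   using test_fun_smooth[OF assms(1)] app unfolding smooth_on_def pdiffs_append[symmetric] by (intro ballI) (rule bspec)
  show "pdiffs es ph z = 0" if "z \<notin> K" for z
  proof -
   have "open (- K)" using compact_imp_closed[OF K(1)] by (simp add: open_Compl)
   then have "pdiffs es ph z = pdiffs es (%_. 0) z" by (rule pdiffs_cong) (use that K(3) in auto)
   also have "pdiffs es (%_. 0) = (%_. 0::complex)" by (induction es) (simp_all add: pdiffs_Cons)
   finally show ?thesis .
  qed
 qed
qed

lemma test_fun_bounded:
 assumes "ph : test_fun Om" shows "\<exists>B. \<forall>z. cmod (ph z) <= B"
proof -
 obtain K where K: "compact K" "!!z. z \<notin> K ==> ph z = 0" using assms by (auto simp: test_fun_def)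
 have "compact (ph ` K)" by (rule compact_continuous_image[OF test_fun_continuous[OF assms] K(1)])
 then have "bounded (ph ` K)" by (rule compact_imp_bounded)
 then obtain B where "\<forall>y\<in>ph ` K. norm y <= B" by (auto simp: bounded_iff)
 then have B: "cmod (ph z) <= B" if "z : K" for z using that by simp
 have "cmod (ph z) <= \<bar>B\<bar>" for z using B[of z] K(2)[of z] by (cases "z : K") auto
 then show ?thesis by blast
qed

lemma smooth_on_subset: "smooth_on Om f ==> X \<subseteq> Om ==> smooth_on X f"
 unfolding smooth_on_def by (auto intro: differentiable_on_subset)

lemma test_fun_bsm:
 assumes "ph : test_fun Om" shows "bsm X ph"
 unfolding snet_def
proof (intro conjI ballI)
 show "smooth_on X ph" by (rule smooth_on_subset[OF test_fun_smooth[OF assms]]) simp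
 fix es :: "'a list" assume "es : lists Basis"
 then obtain B where B: "!!z. cmod (pdiffs es ph z) <= B" using test_fun_bounded[OF test_fun_pdiffs[OF assms]] by blast
 show "\<exists>K\<in>UNIV. \<forall>ep\<in>{0<..1::real}. \<forall>z\<in>X. cmod (pdiffs es ph z) <= K ep"
  by (rule bexI[of _ "%_. B"]) (simp_all add: B)
qed

lemma bsm_L2: "bsm U01 f ==> f : L2 U01"
proof -
 assume "bsm U01 f"
 then have "\<forall>es\<in>lists Basis. pdiffs es f : L2 U01" using Hinf_iff_bsm[OF nice_U01, of f] by (simp add: Hinf_def)
 from bspec[OF this lists.Nil] show ?thesis by simp
qed

lemma test_fun_L2: "ph : test_fun U01 ==> ph : L2 U01"
 by (rule bsm_L2[OF test_fun_bsm])

lemma pdiff_cnj: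
 assumes "f differentiable (at z)" shows "pdiff e (%x. cnj (f x)) z = cnj (pdiff e f z)"
  and "(%x. cnj (f x)) differentiable (at z)"
proof -
 have h: "((%x. cnj (f x)) has_derivative (%v. cnj (frechet_derivative f (at z) v))) (at z)"
  using assms unfolding frechet_derivative_works by (rule has_derivative_cnj)
 show "pdiff e (%x. cnj (f x)) z = cnj (pdiff e f z)" using pdiff_eq[OF h, of e] by (simp add: pdiff_def[of e f])
 show "(%x. cnj (f x)) differentiable (at z)" using h by (rule differentiableI)
qed

lemma test_fun_cnj:
 assumes "ph : test_fun Om"
 shows "(%x. cnj (ph x)) : test_fun Om" "es : lists Basis ==> pdiffs es (%x. cnj (ph x)) = (%x. cnj (pdiffs es ph x))"
proof -
 have d: "pdiffs es ph differentiable (at z)" if "es : lists Basis" for es z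
  by (rule smooth_on_differentiable[OF test_fun_smooth[OF assms] open_UNIV that UNIV_I])
 have *: "pdiffs es (%x. cnj (ph x)) = (%x. cnj (pdiffs es ph x))" if "es : lists Basis" for es
  using that
 proof (induction es)
  case (Cons e es)
  show ?case unfolding pdiffs_Cons Cons.IH by (rule ext) (rule pdiff_cnj(1)[OF d[OF Cons.hyps(2)]])
 qed simp
 then show "es : lists Basis ==> pdiffs es (%x. cnj (ph x)) = (%x. cnj (pdiffs es ph x))" by blast
 obtain K where K: "compact K" "K \<subseteq> Om" "!!z. z \<notin> K ==> ph z = 0" using assms by (auto simp: test_fun_def)
 show "(%x. cnj (ph x)) : test_fun Om"
 proof (rule test_funI[OF _ K(1,2)])
  show "smooth_on UNIV (%x. cnj (ph x))" unfolding smooth_on_at[OF open_UNIV]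
   by (intro ballI) (simp add: * pdiff_cnj(2) d)
 qed (use K in simp)
qed

lemma L2_times_test_integrable:
 assumes "f : L2 U01" "ph : test_fun U01" shows "integrable (lebU) (%x. f x * ph x)"
 using L2_product_integrable[OF assms(1) test_fun_L2[OF test_fun_cnj(1)[OF assms(2)]]] by simp

lemma L2_integrable: "f : L2 U01 ==> integrable (lebU) f"
 using L2_product_integrable[of f U01 "%_. 1"] bsm_L2[OF bsm_const[of U01 1]] by simp

lemma funpow_pdiff: "(pdiff e ^^ k) f = pdiffs (replicate k e) f"
 by (induction k) (simp_all add: pdiffs_Cons)

lemma replicate_Basis: "replicate k (1::real) : lists Basis" by (auto simp: in_lists_conv_set)

lemma test_fun_deriv: "ph : test_fun Om ==> (pdiff (1::real) ^^ k) ph : test_fun Om"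
 unfolding funpow_pdiff by (rule test_fun_pdiffs[OF _ replicate_Basis])

lemma weak_deriv_unique:
 assumes "z1 : L2 U01" "z2 : L2 U01" "weak_deriv k v z1" "weak_deriv k v z2"
 shows "AE x in lebU. z1 x = z2 x"
proof -
 have "AE x in lebU. z1 x - z2 x = 0"
 proof (rule AE_zero_of_test[OF L2_integrable[OF L2_diff[OF assms(1,2)]]])
  fix ph assume ph: "ph : test_fun U01"
  have "(- 1) ^ k * (LINT x|lebU. z1 x * ph x) = (- 1) ^ k * (LINT x|lebU. z2 x * ph x)"
   using bspec[OF assms(3)[unfolded weak_deriv_def] ph] bspec[OF assms(4)[unfolded weak_deriv_def] ph] by simp
  then have "(LINT x|lebU. z1 x * ph x) = (LINT x|lebU. z2 x * ph x)" by simp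
  then show "(LINT x|lebU. ph x * (z1 x - z2 x)) = 0"
   using L2_times_test_integrable[OF assms(1) ph] L2_times_test_integrable[OF assms(2) ph]
   by (simp add: right_diff_distrib mult.commute)
 qed
 then show ?thesis by simp
qed

text \<open>\<open>wd\<close> is a choice; its class under \<open>J\<close> is what does not depend
  on that choice, and it can be computed from any weak derivative at hand.\<close>

lemma wd_eq:
 assumes "z : L2 U01" "weak_deriv k v z"
 shows "wd k v : L2 U01" "weak_deriv k v (wd k v)" "J (wd k v) = J z"
proof -
 have *: "wd k v : L2 U01 \<and> weak_deriv k v (wd k v)"
  unfolding wd_def by (rule someI[of "%z. z : L2 U01 \<and> weak_deriv k v z" z]) (use assms in simp)
 then show "wd k v : L2 U01" "weak_deriv k v (wd k v)" by auto
 show "J (wd k v) = J z" using * assms by (intro J_cong weak_deriv_unique) auto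
qed

lemma H2_L2: "v : H2 ==> v : L2 U01" by (simp add: H2_def)

lemma H2_wd: "v : H2 ==> k <= 2 ==> wd k v : L2 U01" "v : H2 ==> k <= 2 ==> weak_deriv k v (wd k v)"
proof -
 have *: "wd k v : L2 U01 \<and> weak_deriv k v (wd k v)" if v: "v : H2" and k: "k <= 2"
 proof -
  have "\<forall>k\<le>2. \<exists>z\<in>L2 U01. weak_deriv k v z" using v by (simp add: H2_def)
  with k obtain z where "z : L2 U01" "weak_deriv k v z" by (elim allE impE bexE)
  then show ?thesis using wd_eq(1,2) by simp
 qed
 then show "v : H2 ==> k <= 2 ==> wd k v : L2 U01" "v : H2 ==> k <= 2 ==> weak_deriv k v (wd k v)" by simp_all
qed

lemma wd_0: "v : L2 U01 ==> J (wd 0 v) = J v"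
 by (rule wd_eq(3)) (simp_all add: weak_deriv_def)

lemma weak_deriv_diff:
 assumes "v : L2 U01" "v' : L2 U01" "z : L2 U01" "z' : L2 U01" "weak_deriv k v z" "weak_deriv k v' z'"
 shows "weak_deriv k (%x. v x - v' x) (%x. z x - z' x)"
 unfolding weak_deriv_def
proof
 fix ph assume ph: "ph : test_fun U01"
 note ph' = test_fun_deriv[OF ph, of k]
 have "(LINT x|lebU. (v x - v' x) * (pdiff 1 ^^ k) ph x)
   = (LINT x|lebU. v x * (pdiff 1 ^^ k) ph x) - (LINT x|lebU. v' x * (pdiff 1 ^^ k) ph x)"
  unfolding left_diff_distrib by (intro Bochner_Integration.integral_diff L2_times_test_integrable assms ph')
 also have "\<dots> = (- 1) ^ k * ((LINT x|lebU. z x * ph x) - (LINT x|lebU. z' x * ph x))"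
  using assms(5,6) ph unfolding weak_deriv_def by (simp add: right_diff_distrib)
 also have "(LINT x|lebU. z x * ph x) - (LINT x|lebU. z' x * ph x) = (LINT x|lebU. (z x - z' x) * ph x)"
  unfolding left_diff_distrib by (intro Bochner_Integration.integral_diff[symmetric] L2_times_test_integrable assms ph)
 finally show "(LINT x|lebU. (v x - v' x) * (pdiff 1 ^^ k) ph x) = (- 1) ^ k * (LINT x|lebU. (z x - z' x) * ph x)" .
qed

lemma H2_diff:
 assumes "v : H2" "v' : H2"
 shows "(%x. v x - v' x) : H2" "k <= 2 ==> J (wd k (%x. v x - v' x)) = J (wd k v) - J (wd k v')"
proof -
 have *: "weak_deriv k (%x. v x - v' x) (%x. wd k v x - wd k v' x)" "(%x. wd k v x - wd k v' x) : L2 U01" if "k <= 2" for k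
 proof -
  note 1 = H2_wd[OF assms(1) that] and 2 = H2_wd[OF assms(2) that]
  show "weak_deriv k (%x. v x - v' x) (%x. wd k v x - wd k v' x)"
   by (rule weak_deriv_diff[OF H2_L2[OF assms(1)] H2_L2[OF assms(2)] 1(1) 2(1) 1(2) 2(2)])
  show "(%x. wd k v x - wd k v' x) : L2 U01" by (rule L2_diff[OF 1(1) 2(1)])
 qed
 have "\<forall>k\<le>2. \<exists>z\<in>L2 U01. weak_deriv k (%x. v x - v' x) z"
 proof (intro allI impI)
  fix k :: nat assume "k <= 2"
  then show "\<exists>z\<in>L2 U01. weak_deriv k (%x. v x - v' x) z"
   by (intro bexI[where x = "%x. wd k v x - wd k v' x"] *)
 qed
 then show "(%x. v x - v' x) : H2"
  unfolding H2_def using L2_diff[OF H2_L2[OF assms(1)] H2_L2[OF assms(2)]] by simp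
 assume k: "k <= 2"
 show "J (wd k (%x. v x - v' x)) = J (wd k v) - J (wd k v')"
  using wd_eq(3)[OF *(2,1)[OF k]] H2_wd(1)[OF assms(1) k] H2_wd(1)[OF assms(2) k] by (simp add: J_diff)
qed

lemma H2norm_J:
 assumes "v : H2" shows "H2norm v = sqrt (\<Sum>k\<le>2. (norm (J (wd k v)))\<^sup>2)"
 unfolding H2norm_def by (intro arg_cong[of _ _ sqrt] sum.cong refl) (simp add: J_norm H2_wd(1)[OF assms])

lemma norm_wd_le_H2norm:
 assumes "v : H2" "k <= 2" shows "norm (J (wd k v)) <= H2norm v"
proof -
 have "(norm (J (wd k v)))\<^sup>2 <= (\<Sum>k\<le>2. (norm (J (wd k v)))\<^sup>2)"
  by (rule member_le_sum) (use assms in auto)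
 then show ?thesis using H2norm_J[OF assms(1)] by (simp add: real_le_rsqrt)
qed

lemma norm_le_H2norm: "v : H2 ==> norm (J v) <= H2norm v"
 using norm_wd_le_H2norm[of v 0] wd_0[OF H2_L2, of v] by simp

text \<open>Translates \<open>H2norm\<close> convergence into convergence of three families in
  \<open>l2\<close>, where the usual limit rules apply. This sidesteps \<open>wd\<close> of a
  difference, which is a fresh choice and need not be the pointwise difference.\<close>

lemma H2norm_diff_tendsto:
 assumes "!!n. f n : H2" "v : H2"
 shows "((%n. H2norm (%x. f n x - v x)) \<longlongrightarrow> 0) F \<longleftrightarrow> (\<forall>k\<le>2. ((%n. J (wd k (f n))) \<longlongrightarrow> J (wd k v)) F)"
proof
 have d: "(%x. f n x - v x) : H2" for n by (rule H2_diff(1)[OF assms(1) assms(2)])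
 { assume "((%n. H2norm (%x. f n x - v x)) \<longlongrightarrow> 0) F"
  then have "((%n. J (wd k (f n)) - J (wd k v)) \<longlongrightarrow> 0) F" if "k <= 2" for k
   by (rule Lim_null_comparison[rotated])
    (use norm_wd_le_H2norm[OF d that] H2_diff(2)[OF assms(1,2) that] in simp)
  then show "\<forall>k\<le>2. ((%n. J (wd k (f n))) \<longlongrightarrow> J (wd k v)) F" by (simp add: LIM_zero_iff) }
 assume *: "\<forall>k\<le>2. ((%n. J (wd k (f n))) \<longlongrightarrow> J (wd k v)) F"
 have "((%n. sqrt (\<Sum>k\<le>2. (norm (J (wd k (f n)) - J (wd k v)))\<^sup>2)) \<longlongrightarrow> sqrt (\<Sum>k\<le>(2::nat). (norm (J (wd k v) - J (wd k v)))\<^sup>2)) F"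
  by (intro tendsto_intros) (use * in auto)
 moreover have "H2norm (%x. f n x - v x) = sqrt (\<Sum>k\<le>2. (norm (J (wd k (f n)) - J (wd k v)))\<^sup>2)" for n
  unfolding H2norm_J[OF d] by (intro arg_cong[of _ _ sqrt] sum.cong refl) (simp add: H2_diff(2)[OF assms(1,2)])
 ultimately show "((%n. H2norm (%x. f n x - v x)) \<longlongrightarrow> 0) F" by simp
qed

lemma integration_by_parts_test:
 assumes g: "bsm U01 g" and ph: "ph : test_fun U01"
 shows "(LINT x|lebU. g x * pdiff 1 ph x) = - (LINT x|lebU. pdiff 1 g x * ph x)"
proof -
 obtain K where K: "compact K" "K \<subseteq> U01" "!!z. z \<notin> K ==> ph z = 0" using ph by (auto simp: test_fun_def)
 note ph' = test_fun_deriv[OF ph, of 1, simplified]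
 have p: "bsm U01 ph" "bsm U01 (pdiff 1 ph)" "bsm U01 (pdiff 1 g)"
  using test_fun_bsm[OF ph] test_fun_bsm[OF ph'] snet_pdiff[OF g, of 1] by auto
 have ex: "\<exists>a b. 0 < a \<and> a <= b \<and> b < 1 \<and> K \<subseteq> {a..b}"
 proof (cases "K = {}")
  case False
  have "Inf K : K" "Sup K : K" using False K(1)
   by (auto intro!: closed_contains_Inf closed_contains_Sup compact_imp_closed bounded_imp_bdd_below bounded_imp_bdd_above compact_imp_bounded)
  moreover have "K \<subseteq> {Inf K..Sup K}" using K(1)
   by (auto intro!: cInf_lower cSup_upper bounded_imp_bdd_below bounded_imp_bdd_above compact_imp_bounded)
  ultimately show ?thesis using K(2) by (intro exI[of _ "Inf K"] exI[of _ "Sup K"]) force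
 qed (auto intro!: exI[of _ "1/2"])
 then obtain a b where ab: "0 < a" "a <= b" "b < 1" "K \<subseteq> {a..b}" by blast
 \<comment> \<open>The interval is enlarged slightly past the support of \<open>ph\<close>: the
   product vanishes at \<open>a'\<close> and \<open>b'\<close>, and both points stay inside
   \<open>U01\<close>, where \<open>g\<close> is differentiable.\<close>
 define a' b' where "a' = a / 2" and "b' = (1 + b) / 2"
 have ab': "0 < a'" "a' < a" "b < b'" "b' < 1" using ab by (auto simp: a'_def b'_def)
 have sub: "{a'..b'} \<subseteq> U01" using ab' by auto
 define D where "D x = g x * pdiff 1 ph x + pdiff 1 g x * ph x" for x
 have Db: "bsm U01 D" unfolding D_def[abs_def] by (intro bsm_add bsm_mult g p) simp_all
 have Dc: "continuous_on U01 D" using snet_continuous_on[OF Db, of 1] by simp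
 have D0: "D x = 0" if "x \<notin> {a'..b'}" for x
 proof -
  have "x : - K" using that ab ab' by auto
  moreover have "open (- K)" using compact_imp_closed[OF K(1)] by (simp add: open_Compl)
  ultimately have "pdiff 1 ph x = pdiff 1 (%_. 0) x" using K(3) by (intro pdiff_cong[of "- K"]) simp_all
  then show ?thesis using K(3)[of x] \<open>x : - K\<close> by (simp add: D_def)
 qed
 have "(D has_integral (g b' * ph b' - g a' * ph a')) {a'..b'}"
 proof (rule fundamental_theorem_of_calculus)
  show "a' <= b'" using ab ab' by simp
  show "((%x. g x * ph x) has_vector_derivative D x) (at x within {a'..b'})" if "x : {a'..b'}" for x
  proof -
   have "x : U01" using sub that by blast
   then have "(g has_vector_derivative pdiff 1 g x) (at x)" "(ph has_vector_derivative pdiff 1 ph x) (at x)"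
    using snet_differentiable[OF g, of 1 x] snet_differentiable[OF p(1), of 1 x] by (auto intro!: pdiff_real_vector_derivative)
   from has_vector_derivative_mult[OF this] show ?thesis
    unfolding D_def by (rule has_vector_derivative_at_within)
  qed
 qed
 moreover have "a' \<notin> {a..b}" "b' \<notin> {a..b}" using ab' by auto
 then have "ph a' = 0" "ph b' = 0" using K(3) ab(4) by blast+
 ultimately have "(D has_integral 0) {a'..b'}" by simp
 moreover have "(LINT x|lebU. D x) = integral {a'..b'} D"
 proof -
  have "(LINT x|lebU. D x) = (LINT x|lebesgue. indicator U01 x *\<^sub>R D x)" by (simp add: integral_restrict_space)
  also have "\<dots> = (LINT x|lebesgue. indicator {a'..b'} x *\<^sub>R D x)"
   by (rule bochner_cong) (use D0 sub in \<open>auto simp: indicator_def\<close>)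
  also have "\<dots> = (LINT x|lebesgue_on {a'..b'}. D x)" by (simp add: integral_restrict_space)
  also have "\<dots> = integral {a'..b'} D"
   by (rule lebesgue_integral_eq_integral[OF continuous_imp_integrable_real[OF continuous_on_subset[OF Dc sub]]]) simp
  finally show ?thesis .
 qed
 ultimately have 0: "(LINT x|lebU. D x) = 0" by (simp add: integral_unique)
 have "integrable (lebU) (%x. g x * pdiff 1 ph x)" "integrable (lebU) (%x. pdiff 1 g x * ph x)"
  by (rule L2_times_test_integrable[OF bsm_L2[OF g] ph'], rule L2_times_test_integrable[OF bsm_L2[OF p(3)] ph])
 with 0 show ?thesis unfolding D_def by (simp add: add_eq_0_iff)
qed

lemma bsm_weak_deriv:
 assumes g: "bsm U01 g" shows "weak_deriv k g ((pdiff 1 ^^ k) g)"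
 unfolding weak_deriv_def
proof
 fix ph assume ph: "ph : test_fun U01"
 show "(LINT x|lebU. g x * (pdiff 1 ^^ k) ph x) = (- 1) ^ k * (LINT x|lebU. (pdiff 1 ^^ k) g x * ph x)"
  using ph
 proof (induction k arbitrary: ph)
  case (Suc k)
  have gk: "bsm U01 ((pdiff 1 ^^ k) g)" unfolding funpow_pdiff by (rule snet_pdiffs[OF g replicate_Basis])
  have "(pdiff 1 ^^ Suc k) ph = (pdiff 1 ^^ k) (pdiff 1 ph)" by (simp add: funpow_swap1)
  then have "(LINT x|lebU. g x * (pdiff 1 ^^ Suc k) ph x) = (- 1) ^ k * (LINT x|lebU. (pdiff 1 ^^ k) g x * pdiff 1 ph x)"
   using Suc.IH[OF test_fun_deriv[OF Suc.prems, of 1, simplified]] by simp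
  also have "\<dots> = (- 1) ^ Suc k * (LINT x|lebU. (pdiff 1 ^^ Suc k) g x * ph x)"
   using integration_by_parts_test[OF gk Suc.prems] by simp
  finally show ?case .
 qed simp
qed

lemma bsm_H2:
 assumes g: "bsm U01 g" shows "g : H2" "J (wd k g) = J ((pdiff 1 ^^ k) g)"
proof -
 have *: "(pdiff 1 ^^ k) g : L2 U01" for k unfolding funpow_pdiff by (rule bsm_L2[OF snet_pdiffs[OF g replicate_Basis]])
 show "g : H2" using bsm_L2[OF g] * bsm_weak_deriv[OF g] by (auto simp: H2_def)
 show "J (wd k g) = J ((pdiff 1 ^^ k) g)" by (rule wd_eq(3)[OF * bsm_weak_deriv[OF g]])
qed

lemma H20_H2: "v : H20 ==> v : H2" by (simp add: H20_def)

lemma H20_approx: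
 assumes "v : H20"
 obtains ph where "!!n. ph n : test_fun U01" "!!k. k <= 2 ==> (%n. J (wd k (ph n))) \<longlonglongrightarrow> J (wd k v)"
proof -
 obtain ph where ph: "!!n. ph n : test_fun U01" "(%n. H2norm (%x. ph n x - v x)) \<longlonglongrightarrow> 0"
  using assms unfolding H20_def by auto
 have H: "ph n : H2" for n by (rule bsm_H2(1)[OF test_fun_bsm[OF ph(1)]])
 have "\<forall>k\<le>2. (%n. J (wd k (ph n))) \<longlonglongrightarrow> J (wd k v)"
  using ph(2) unfolding H2norm_diff_tendsto[of ph v sequentially, OF H H20_H2[OF assms]] .
 then have "(%n. J (wd k (ph n))) \<longlonglongrightarrow> J (wd k v)" if "k <= 2" for k using that by simp
 from that[OF ph(1) this] show thesis .
qed

lemma H20_I: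
 assumes "v : H2" "!!n. ph n : test_fun U01" "!!k. k <= 2 ==> (%n. J (wd k (ph n))) \<longlonglongrightarrow> J (wd k v)"
 shows "v : H20"
proof -
 have H: "ph n : H2" for n by (rule bsm_H2(1)[OF test_fun_bsm[OF assms(2)]])
 have "(%n. H2norm (%x. ph n x - v x)) \<longlonglongrightarrow> 0"
  unfolding H2norm_diff_tendsto[of ph v sequentially, OF H assms(1)] using assms(3) by simp
 then show ?thesis unfolding H20_def using assms(1,2) by (intro CollectI conjI exI[of _ ph]) simp_all
qed

lemma H20_diff:
 assumes "v : H20" "v' : H20" shows "(%x. v x - v' x) : H20"
proof -
 obtain ph where ph: "!!n. ph n : test_fun U01" "!!k. k <= 2 ==> (%n. J (wd k (ph n))) \<longlonglongrightarrow> J (wd k v)"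
  using H20_approx[OF assms(1)] by blast
 obtain ph' where ph': "!!n. ph' n : test_fun U01" "!!k. k <= 2 ==> (%n. J (wd k (ph' n))) \<longlonglongrightarrow> J (wd k v')"
  using H20_approx[OF assms(2)] by blast
 have H: "ph n : H2" "ph' n : H2" for n using bsm_H2(1)[OF test_fun_bsm[OF ph(1)]] bsm_H2(1)[OF test_fun_bsm[OF ph'(1)]] by auto
 show ?thesis
 proof (rule H20_I[where ph = "%n x. ph n x - ph' n x"])
  show "(%x. v x - v' x) : H2" by (rule H2_diff(1)[OF H20_H2[OF assms(1)] H20_H2[OF assms(2)]])
  show "(%x. ph n x - ph' n x) : test_fun U01" for n
  proof -
   obtain K K' where K: "compact K" "K \<subseteq> U01" "!!z. z \<notin> K ==> ph n z = 0" "compact K'" "K' \<subseteq> U01" "!!z. z \<notin> K' ==> ph' n z = 0"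
    using ph(1)[of n] ph'(1)[of n] unfolding test_fun_def by blast
   show ?thesis
   proof (rule test_funI[of _ "K \<union> K'"])
    have "bsm UNIV (%x. ph n x - ph' n x)" by (intro bsm_diff test_fun_bsm[OF ph(1)] test_fun_bsm[OF ph'(1)]) simp
    then show "smooth_on UNIV (%x. ph n x - ph' n x)" using snet_smooth[of UNIV UNIV _ 1] by simp
   qed (use K in auto)
  qed
  show "(%n. J (wd k (%x. ph n x - ph' n x))) \<longlonglongrightarrow> J (wd k (%x. v x - v' x))" if "k <= 2" for k
   unfolding H2_diff(2)[OF H that] H2_diff(2)[OF H20_H2[OF assms(1)] H20_H2[OF assms(2)] that]
   by (intro tendsto_diff ph(2) ph'(2) that)
 qed
qed

text \<open>For test functions this is integration by parts twice. Both sides are continuous in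
  \<open>J (wd 0 v)\<close> and \<open>J (wd 2 v)\<close>, so the identity passes to
  \<open>H20\<close> along an approximating sequence; all boundary terms are killed on the side of
  \<open>v\<close>.\<close>

lemma L2ip_bsm_H20:
 assumes g: "bsm U01 g" and v: "v : H20"
 shows "Re (L2ip (pdiff 1 (pdiff 1 g)) v) = Re (L2ip g (wd 2 v))"
proof -
 obtain ph where ph: "!!n. ph n : test_fun U01" "!!k. k <= 2 ==> (%n. J (wd k (ph n))) \<longlonglongrightarrow> J (wd k v)"
  using H20_approx[OF v] by blast
 have g'': "bsm U01 (pdiff 1 (pdiff 1 g))" by (intro snet_pdiff g) simp_all
 have eq: "inner (J (pdiff 1 (pdiff 1 g))) (J (wd 0 (ph n))) = inner (J g) (J (wd 2 (ph n)))" for n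
 proof -
  \<comment> \<open>\<open>weak_deriv\<close> pairs without conjugation and \<open>L2ip\<close> with
    it, hence the conjugated test function.\<close>
  note c = test_fun_cnj[OF ph(1)[of n]]
  have two: "(pdiff 1 ^^ 2) f = pdiffs [1, 1] f" for f :: "real => complex" by (simp add: numeral_2_eq_2 pdiffs_Cons)
  have c2: "(pdiff 1 ^^ 2) (%x. cnj (ph n x)) = (%x. cnj ((pdiff 1 ^^ 2) (ph n) x))"
   unfolding two by (rule c(2)) simp
  have two': "(pdiff 1 ^^ 2) g = pdiff 1 (pdiff 1 g)" by (simp add: numeral_2_eq_2)
  have "(LINT x|lebU. g x * (pdiff 1 ^^ 2) (%x. cnj (ph n x)) x) = (- 1) ^ 2 * (LINT x|lebU. (pdiff 1 ^^ 2) g x * cnj (ph n x))"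
   by (rule bspec[OF bsm_weak_deriv[OF g, of 2, unfolded weak_deriv_def] c(1)])
  then have "L2ip g ((pdiff 1 ^^ 2) (ph n)) = L2ip (pdiff 1 (pdiff 1 g)) (ph n)"
   unfolding c2 by (simp add: L2ip_def two')
  moreover have "J (wd 2 (ph n)) = J ((pdiff 1 ^^ 2) (ph n))" by (rule bsm_H2(2)[OF test_fun_bsm[OF ph(1)]])
  moreover have "J (wd 0 (ph n)) = J (ph n)" by (rule wd_0[OF test_fun_L2[OF ph(1)]])
  ultimately show ?thesis
   using bsm_L2[OF g] bsm_L2[OF g''] test_fun_L2[OF ph(1)] test_fun_L2[OF test_fun_deriv[OF ph(1)]] by (simp add: J_inner)
 qed
 have 1: "(%n. inner (J (pdiff 1 (pdiff 1 g))) (J (wd 0 (ph n)))) \<longlonglongrightarrow> inner (J (pdiff 1 (pdiff 1 g))) (J (wd 0 v))"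
  by (intro tendsto_intros ph(2)) simp
 have 2: "(%n. inner (J (pdiff 1 (pdiff 1 g))) (J (wd 0 (ph n)))) \<longlonglongrightarrow> inner (J g) (J (wd 2 v))"
  unfolding eq by (intro tendsto_intros ph(2)) simp
 have vH: "v : H2" by (rule H20_H2[OF v])
 show ?thesis
  using LIMSEQ_unique[OF 1 2] wd_0[OF H2_L2[OF vH]] H2_L2[OF vH] H2_wd(1)[OF vH, of 2] bsm_L2[OF g] bsm_L2[OF g'']
  by (simp add: J_inner)
qed

text \<open>\<open>Om\<close> and the complement of \<open>K\<close> are open and cover the whole
  space; \<open>F\<close> is smooth on the first and zero on the second.\<close>

lemma zero_extension_test_fun:
 assumes op: "open Om" and F: "bsm Om F" and K: "compact K" "K \<subseteq> Om" "!!z. z \<notin> K ==> F z = 0"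
 shows "F : test_fun Om"
proof (rule test_funI[OF _ K])
 show "smooth_on UNIV F" unfolding smooth_on_at[OF open_UNIV]
 proof (intro ballI)
  fix es :: "'a list" and z assume es: "es : lists Basis"
  show "pdiffs es F differentiable (at z)"
  proof (cases "z : Om")
   case True
   show ?thesis using snet_differentiable[OF snet_pdiffs[OF F es] op _ _ True, of 1] by simp
  next
   case False
   have o: "open (- K)" using compact_imp_closed[OF K(1)] by (simp add: open_Compl)
   have z: "z : - K" using False K(2) by blast
   show ?thesis
   proof (rule differentiable_cong_open[OF o z])
    fix y assume "y : - K"
    then have "pdiffs es F y = pdiffs es (%_. 0) y" using K(3) by (intro pdiffs_cong[OF o]) auto
    also have "pdiffs es (%_. 0) = (%_. 0::complex)" by (induction es) (simp_all add: pdiffs_Cons)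
    finally show "pdiffs es F y = 0" .
   qed simp
  qed
 qed
qed

lemma L2norm_tendsto_zero:
 assumes m: "!!n. h n : bmeas (lebU)" and C: "!!n x. x : U01 ==> cmod (h n x) <= C"
  and ev: "!!x. x : U01 ==> \<forall>\<^sub>F n in sequentially. h n x = 0"
 shows "(%n. L2norm U01 (h n)) \<longlonglongrightarrow> 0"
proof -
 interpret finite_measure "lebU" by (rule nice_finite[OF nice_U01])
 have "(%n. LINT x|lebU. (cmod (h n x))\<^sup>2) \<longlonglongrightarrow> (LINT x|lebU. 0::real)"
 proof (rule integral_dominated_convergence[where w = "%_. C\<^sup>2"])
  show "(%x. (cmod (h n x))\<^sup>2) : bmeas (lebU)" for n using m[of n] by measurable
  show "AE x in lebU. (%n. (cmod (h n x))\<^sup>2) \<longlonglongrightarrow> 0"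
  proof (rule AE_I2)
   fix x assume "x : space (lebU)"
   then have "\<forall>\<^sub>F n in sequentially. (cmod (h n x))\<^sup>2 = 0" using eventually_mono[OF ev[of x]] by simp
   then show "(%n. (cmod (h n x))\<^sup>2) \<longlonglongrightarrow> 0" by (rule tendsto_eventually)
  qed
  show "AE x in lebU. norm ((cmod (h n x))\<^sup>2) <= C\<^sup>2" for n
   by (rule AE_I2) (use C in \<open>auto intro!: power_mono\<close>)
 qed auto
 then have "(%n. sqrt (LINT x|lebU. (cmod (h n x))\<^sup>2)) \<longlonglongrightarrow> sqrt 0"
  by (intro tendsto_real_sqrt) simp
 then show ?thesis by (simp add: L2norm_def)
qed

lemma snet_subset:
 assumes "snet A Om u" "X \<subseteq> Om" shows "snet A X u"
 using assms smooth_on_subset[OF _ assms(2)] unfolding snet_def by (meson subsetD)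

lemma affine_derivative:
 fixes f :: "real => complex"
 assumes "bsm UNIV f"
 shows "((%x. f (a * x + b)) has_vector_derivative a *\<^sub>R pdiff 1 f (a * x + b)) (at x)"
proof -
 have "((%x. a * x + b) has_vector_derivative a) (at x)"
  by (auto intro!: derivative_eq_intros simp: has_real_derivative_iff_has_vector_derivative[symmetric])
 from vector_diff_chain_at[OF this bsm_real_derivative[OF assms]] show ?thesis by (simp add: o_def)
qed

text \<open>With a smooth step \<open>s\<close> and \<open>N = n + 3\<close>, the cut-off is
  \<open>s (N * x - 1) * s (N - 1 - N * x)\<close>: it switches on between distance
  \<open>1 / N\<close> and \<open>2 / N\<close> from the endpoints, and each derivative costs a
  factor \<open>N\<close>. Since \<open>N >= 3\<close>, the interval carrying the support is
  nonempty.\<close>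

lemma bsm_cutoff:
 obtains \<theta> :: "nat => real => complex" and B where
  "!!n. bsm UNIV (\<theta> n)" "!!n x. x \<notin> {1 / (real n + 3)..1 - 1 / (real n + 3)} ==> \<theta> n x = 0"
  "!!n x. x : {2 / (real n + 3)..1 - 2 / (real n + 3)} ==> \<theta> n x = 1" "!!n x. cmod (\<theta> n x) <= 1"
  "!!n x. cmod (pdiff 1 (\<theta> n) x) <= (real n + 3) * B" "!!n x. cmod (pdiff 1 (pdiff 1 (\<theta> n)) x) <= (real n + 3)\<^sup>2 * B"
proof -
 obtain S \<rho> :: "real => real" where S: "bsm UNIV (%x. complex_of_real (S x))"
  and S0: "!!x. x <= 0 ==> S x = 0" and S1: "!!x. x >= 1 ==> S x = 1" and S01: "!!x. 0 <= S x \<and> S x <= 1"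
  by (rule smooth_step) blast
 define s where "s x = complex_of_real (S x)" for x
 define s1 where "s1 = pdiff 1 s"
 define s2 where "s2 = pdiff 1 s1"
 have sb: "bsm UNIV s" using S by (simp add: s_def[abs_def])
 have s1b: "bsm UNIV s1" unfolding s1_def by (rule snet_pdiff[OF sb]) simp
 have s2b: "bsm UNIV s2" unfolding s2_def by (rule snet_pdiff[OF s1b]) simp
 obtain B1 where B1: "B1 >= 0" "!!z. z : UNIV ==> cmod (s1 z) <= B1" using bsm_bound0[OF s1b] by blast
 obtain B2 where B2: "B2 >= 0" "!!z. z : UNIV ==> cmod (s2 z) <= B2" using bsm_bound0[OF s2b] by blast
 have s_le: "cmod (s x) <= 1" for x using S01 by (simp add: s_def)
 define B where "B = 2 * B1 + 2 * B2 + 2 * B1\<^sup>2"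
 define N where "N n = real n + 3" for n
 have N: "N n > 0" for n by (simp add: N_def)
 define P where "P n x = s (N n * x + (- 1))" for n x
 define Q where "Q n x = s ((- N n) * x + (N n - 1))" for n x
 define \<theta> where "\<theta> n x = P n x * Q n x" for n x
 have dP: "(P n has_vector_derivative N n *\<^sub>R s1 (N n * x + (- 1))) (at x)" for n x
  unfolding P_def[abs_def] s1_def by (rule affine_derivative[OF sb])
 have dQ: "(Q n has_vector_derivative (- N n) *\<^sub>R s1 ((- N n) * x + (N n - 1))) (at x)" for n x
  unfolding Q_def[abs_def] s1_def by (rule affine_derivative[OF sb])
 have dP1: "((%x. N n *\<^sub>R s1 (N n * x + (- 1))) has_vector_derivative N n *\<^sub>R N n *\<^sub>R s2 (N n * x + (- 1))) (at x)" for n x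
  unfolding s2_def by (rule bounded_linear.has_vector_derivative[OF bounded_linear_scaleR_right affine_derivative[OF s1b]])
 have dQ1: "((%x. (- N n) *\<^sub>R s1 ((- N n) * x + (N n - 1))) has_vector_derivative (- N n) *\<^sub>R (- N n) *\<^sub>R s2 ((- N n) * x + (N n - 1))) (at x)" for n x
  unfolding s2_def by (rule bounded_linear.has_vector_derivative[OF bounded_linear_scaleR_right affine_derivative[OF s1b]])
 have d1: "pdiff 1 (\<theta> n) = (%x. P n x * ((- N n) *\<^sub>R s1 ((- N n) * x + (N n - 1))) + (N n *\<^sub>R s1 (N n * x + (- 1))) * Q n x)" for n
  unfolding \<theta>_def[abs_def] by (rule ext, rule pdiff_real_eq, rule has_vector_derivative_mult[OF dP dQ])
 have d2: "pdiff 1 (pdiff 1 (\<theta> n)) x =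
   (P n x * ((- N n) *\<^sub>R (- N n) *\<^sub>R s2 ((- N n) * x + (N n - 1))) + (N n *\<^sub>R s1 (N n * x + (- 1))) * ((- N n) *\<^sub>R s1 ((- N n) * x + (N n - 1))))
   + ((N n *\<^sub>R s1 (N n * x + (- 1))) * ((- N n) *\<^sub>R s1 ((- N n) * x + (N n - 1))) + (N n *\<^sub>R N n *\<^sub>R s2 (N n * x + (- 1))) * Q n x)" for n x
  unfolding d1
  by (rule pdiff_real_eq, rule has_vector_derivative_add[OF has_vector_derivative_mult[OF dP dQ1] has_vector_derivative_mult[OF dP1 dQ]])
 have PQ: "cmod (P n x) <= 1" "cmod (Q n x) <= 1" for n x by (simp_all add: P_def Q_def s_le)
 have u1: "cmod ((N n *\<^sub>R s1 y)) <= N n * B1" "cmod (((- N n) *\<^sub>R s1 y)) <= N n * B1" for n y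
  using N[of n] B1(2)[of y] by (simp_all add: mult_left_mono)
 have u2: "cmod ((N n *\<^sub>R N n *\<^sub>R s2 y)) <= N n * N n * B2" "cmod (((- N n) *\<^sub>R (- N n) *\<^sub>R s2 y)) <= N n * N n * B2" for n y
  using N[of n] B2(2)[of y] by (simp_all add: mult_left_mono)
 have m: "cmod (p * q) <= a * b" if "cmod p <= a" "cmod q <= b" for p q a b
  unfolding norm_mult by (rule mult_mono) (use that norm_ge_zero order_trans in \<open>auto intro: order_trans[OF norm_ge_zero]\<close>)
 show thesis
 proof (rule that[of \<theta> B])
  fix n :: nat and x :: real
  show "bsm UNIV (\<theta> n)" unfolding \<theta>_def[abs_def] P_def Q_def by (intro bsm_mult bsm_affine sb) simp
  show "cmod (\<theta> n x) <= 1" using m[OF PQ(1)[of n x] PQ(2)[of n x]] by (simp add: \<theta>_def)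
  show "\<theta> n x = 0" if "x \<notin> {1 / (real n + 3)..1 - 1 / (real n + 3)}"
  proof -
   have "x < 1 / N n \<or> x > 1 - 1 / N n" using that by (auto simp: N_def)
   then have "N n * x + - 1 <= 0 \<or> - N n * x + (N n - 1) <= 0" using N[of n] by (auto simp: field_simps)
   then show ?thesis using S0 by (auto simp: \<theta>_def P_def Q_def s_def)
  qed
  show "\<theta> n x = 1" if "x : {2 / (real n + 3)..1 - 2 / (real n + 3)}"
  proof -
   have "2 / N n <= x" "x <= 1 - 2 / N n" using that by (auto simp: N_def)
   then have "N n * x + - 1 >= 1" "- N n * x + (N n - 1) >= 1" using N[of n] by (auto simp: field_simps)
   then show ?thesis using S1 by (simp add: \<theta>_def P_def Q_def s_def)
  qed
  have "cmod (pdiff 1 (\<theta> n) x) <= 1 * (N n * B1) + (N n * B1) * 1"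
   unfolding d1 by (intro norm_triangle_mono m PQ u1)
  also have "\<dots> = N n * (2 * B1)" by simp
  also have "\<dots> <= N n * B" using N[of n] B1 B2 by (intro mult_left_mono) (auto simp: B_def)
  finally show "cmod (pdiff 1 (\<theta> n) x) <= (real n + 3) * B" by (simp add: N_def add.commute)
  have "cmod (pdiff 1 (pdiff 1 (\<theta> n)) x) <= (1 * (N n * N n * B2) + (N n * B1) * (N n * B1)) + ((N n * B1) * (N n * B1) + (N n * N n * B2) * 1)"
   unfolding d2 by (intro norm_triangle_mono m PQ u1 u2)
  also have "\<dots> = (N n)\<^sup>2 * (2 * B2 + 2 * B1\<^sup>2)" by (simp add: power2_eq_square algebra_simps)
  also have "\<dots> <= (N n)\<^sup>2 * B" using B1 by (intro mult_left_mono) (auto simp: B_def)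
  finally show "cmod (pdiff 1 (pdiff 1 (\<theta> n)) x) <= (real n + 3)\<^sup>2 * B" by (simp add: N_def add.commute)
 qed
qed

text \<open>
 Cutting off at distance \<open>1/n\<close> from the boundary converges in \<open>H\<^sup>2\<close>: the second derivative of the
 cut-off function stays bounded, because \<open>f\<close> vanishes to second order, and it differs from that of
 \<open>f\<close> only on a set of measure \<open>O(1/n)\<close>.
\<close>

lemma bsm_H20_I:
 assumes f: "bsm U01 f" and M: "!!x. x : U01 ==> cmod (f x) <= M * (min x (1 - x))\<^sup>2"
  and M': "!!x. x : U01 ==> cmod (pdiff 1 f x) <= M * min x (1 - x)"
 shows "f : H20"
proof -
 obtain \<theta> :: "nat => real => complex" and B where \<theta>: "!!n. bsm UNIV (\<theta> n)"
  and \<theta>0: "!!n x. x \<notin> {1 / (real n + 3)..1 - 1 / (real n + 3)} ==> \<theta> n x = 0"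
  and \<theta>1: "!!n x. x : {2 / (real n + 3)..1 - 2 / (real n + 3)} ==> \<theta> n x = 1"
  and b0: "!!n x. cmod (\<theta> n x) <= 1" and b1: "!!n x. cmod (pdiff 1 (\<theta> n) x) <= (real n + 3) * B"
  and b2: "!!n x. cmod (pdiff 1 (pdiff 1 (\<theta> n)) x) <= (real n + 3)\<^sup>2 * B"
  by (rule bsm_cutoff) blast
 have \<theta>U: "bsm U01 (\<theta> n)" for n
  by (rule snet_subset[OF \<theta>]) simp
 have f1: "bsm U01 (pdiff 1 f)" and f2: "bsm U01 (pdiff 1 (pdiff 1 f))" by (intro snet_pdiff f; simp)+
 have \<theta>'U: "bsm U01 (pdiff 1 (\<theta> n))" for n by (rule snet_pdiff[OF \<theta>U]) simp
 define ph where "ph n x = f x * \<theta> n x" for n x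
 have phU: "bsm U01 (ph n)" for n unfolding ph_def[abs_def] by (intro bsm_mult f \<theta>U) simp
 have ph_test: "ph n : test_fun U01" for n
 proof (rule zero_extension_test_fun[OF _ phU])
  have "0 < 1 / (real n + 3)" by simp
  then show "{1 / (real n + 3)..1 - 1 / (real n + 3)} \<subseteq> U01" unfolding subset_iff atLeastAtMost_iff greaterThanLessThan_iff by linarith
  show "ph n z = 0" if "z \<notin> {1 / (real n + 3)..1 - 1 / (real n + 3)}" for z using \<theta>0[OF that] by (simp add: ph_def)
 qed auto
 have dd: "(g has_vector_derivative pdiff 1 g x) (at x)" if "bsm U01 g" "x : U01" for g x
  using snet_differentiable[OF that(1), of 1 x] that(2) by (intro pdiff_real_vector_derivative) simp
 have d1: "pdiff 1 (ph n) x = f x * pdiff 1 (\<theta> n) x + pdiff 1 f x * \<theta> n x" if "x : U01" for n x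
  unfolding ph_def[abs_def] by (rule pdiff_real_eq, rule has_vector_derivative_mult[OF dd[OF f that] dd[OF \<theta>U that]])
 have d2: "pdiff 1 (pdiff 1 (ph n)) x = (f x * pdiff 1 (pdiff 1 (\<theta> n)) x + pdiff 1 f x * pdiff 1 (\<theta> n) x)
   + (pdiff 1 f x * pdiff 1 (\<theta> n) x + pdiff 1 (pdiff 1 f) x * \<theta> n x)" if x: "x : U01" for n x
 proof -
  have "pdiff 1 (pdiff 1 (ph n)) x = pdiff 1 (%x. f x * pdiff 1 (\<theta> n) x + pdiff 1 f x * \<theta> n x) x"
   by (rule pdiff_cong[OF _ x d1]) simp_all
  also have "\<dots> = (f x * pdiff 1 (pdiff 1 (\<theta> n)) x + pdiff 1 f x * pdiff 1 (\<theta> n) x)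
   + (pdiff 1 f x * pdiff 1 (\<theta> n) x + pdiff 1 (pdiff 1 f) x * \<theta> n x)"
   by (rule pdiff_real_eq, rule has_vector_derivative_add[OF
     has_vector_derivative_mult[OF dd[OF f x] dd[OF \<theta>'U x]] has_vector_derivative_mult[OF dd[OF f1 x] dd[OF \<theta>U x]]])
  finally show ?thesis .
 qed
 obtain F0 where F0: "F0 >= 0" "!!x. x : U01 ==> cmod (f x) <= F0" using bsm_bound0[OF f] by blast
 obtain F1 where F1: "F1 >= 0" "!!x. x : U01 ==> cmod (pdiff 1 f x) <= F1" using bsm_bound0[OF f1] by blast
 obtain F2 where F2: "F2 >= 0" "!!x. x : U01 ==> cmod (pdiff 1 (pdiff 1 f) x) <= F2" using bsm_bound0[OF f2] by blast
 have B0: "B >= 0" using order_trans[OF norm_ge_zero b1[of 0 0]] by simp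
 have M0: "M >= 0"
 proof -
  have "0 <= M * min (1 / 2) (1 - 1 / 2)" using order_trans[OF norm_ge_zero M'[of "1 / 2"]] by simp
  then show ?thesis by simp
 qed
 define C where "C = 2 * (F0 + F1 + F2) + 12 * (M * B)"
 define h where "h k n x = (pdiff 1 ^^ k) (ph n) x - (pdiff 1 ^^ k) f x" for k :: nat and n and x
 have two: "(pdiff 1 ^^ 2) g = pdiff 1 (pdiff 1 g)" for g :: "real => complex" by (simp add: numeral_2_eq_2)
 have inner0: "h k n x = 0" if x: "2 / (real n + 3) < min x (1 - x)" for k n x
 proof -
  have "(pdiff 1 ^^ k) (ph n) x = (pdiff 1 ^^ k) f x"
   unfolding funpow_pdiff
  proof (rule pdiffs_cong[of "{2 / (real n + 3)<..<1 - 2 / (real n + 3)}"])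
   show "ph n y = f y" if "y : {2 / (real n + 3)<..<1 - 2 / (real n + 3)}" for y
    using \<theta>1[of y n] that by (simp add: ph_def)
  qed (use x in auto)
  then show ?thesis by (simp add: h_def)
 qed
 have m: "cmod (p * q) <= a * b" if "cmod p <= a" "cmod q <= b" for p q a b
  unfolding norm_mult by (rule mult_mono) (use that in \<open>auto intro: order_trans[OF norm_ge_zero]\<close>)
 have hb: "cmod (h k n x) <= C" if k: "k <= 2" and x: "x : U01" for k n x
 proof (cases "2 / (real n + 3) < min x (1 - x)")
  case True
  then show ?thesis using inner0[OF True, of k] B0 M0 F0 F1 F2 by (simp add: C_def)
 next
  case False
  define d where "d = min x (1 - x)"
  define N where "N = real n + 3"
  have N: "N >= 1" by (simp add: N_def)
  \<comment> \<open>On the boundary strip the distance \<open>d\<close> is at most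
    \<open>2 / N\<close>, so the decay \<open>d^2\<close> and \<open>d\<close> of \<open>f\<close>
    and its derivative compensates the growth \<open>N^2\<close> and \<open>N\<close> of the
    derivatives of the cut-off.\<close>
  have "d <= 2 / N" using False unfolding d_def N_def by linarith
  then have d: "0 <= d" "N * d <= 2" using x N by (auto simp: d_def field_simps)
  have fd: "cmod (f x) <= M * d\<^sup>2" "cmod (pdiff 1 f x) <= M * d" using M[OF x] M'[OF x] by (simp_all add: d_def)
  have c1: "cmod (pdiff 1 (\<theta> n) x) <= N * B" and c2: "cmod (pdiff 1 (pdiff 1 (\<theta> n)) x) <= N\<^sup>2 * B"
   using b1[of n x] b2[of n x] by (simp_all add: N_def add.commute)
  have Nd2: "(N * d) * (N * d) <= 2 * 2" using d N by (intro mult_mono) auto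
  have t2: "cmod (f x * pdiff 1 (pdiff 1 (\<theta> n)) x) <= 4 * M * B"
  proof -
   have "cmod (f x * pdiff 1 (pdiff 1 (\<theta> n)) x) <= M * d\<^sup>2 * (N\<^sup>2 * B)" by (rule m[OF fd(1) c2])
   also have "\<dots> = (M * B) * ((N * d) * (N * d))" by (simp add: power2_eq_square)
   also have "\<dots> <= (M * B) * (2 * 2)" using Nd2 M0 B0 by (intro mult_left_mono) auto
   finally show ?thesis by simp
  qed
  have t1: "cmod (pdiff 1 f x * pdiff 1 (\<theta> n) x) <= 2 * M * B"
  proof -
   have "cmod (pdiff 1 f x * pdiff 1 (\<theta> n) x) <= M * d * (N * B)" by (rule m[OF fd(2) c1])
   also have "\<dots> = (M * B) * (N * d)" by simp
   also have "\<dots> <= (M * B) * 2" using d M0 B0 by (intro mult_left_mono) auto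
   finally show ?thesis by simp
  qed
  have t0: "cmod (f x * pdiff 1 (\<theta> n) x) <= 4 * M * B"
  proof -
   have "cmod (f x * pdiff 1 (\<theta> n) x) <= M * d\<^sup>2 * (N * B)" by (rule m[OF fd(1) c1])
   also have "\<dots> = (M * B) * (N * d * d)" by (simp add: power2_eq_square)
   also have "\<dots> <= (M * B) * (N * d * (N * d))"
    using M0 B0 d N by (intro mult_left_mono) (auto simp: mult_le_cancel_right1)
   also have "\<dots> <= (M * B) * (2 * 2)" using Nd2 M0 B0 by (intro mult_left_mono) auto
   finally show ?thesis by simp
  qed
  have s: "cmod (p * \<theta> n x) <= q" if "cmod p <= q" for p q using m[OF that b0[of n x]] by simp
  have MB: "M * B >= 0" using M0 B0 by simp
  consider "k = 0" | "k = 1" | "k = 2" using k by linarith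
  then show ?thesis
  proof cases
   case 1
   have "cmod (h k n x) <= F0 + F0"
   proof -
    have e: "h k n x = f x * \<theta> n x - f x" by (simp add: h_def 1 ph_def)
    show ?thesis unfolding e by (intro order_trans[OF norm_triangle_ineq4] add_mono s F0(2) x)
   qed
   then show ?thesis using F0 F1 F2 MB by (simp add: C_def mult_ac)
  next
   case 2
   have "cmod (h k n x) <= (4 * M * B + F1) + F1"
   proof -
    have e: "h k n x = (f x * pdiff 1 (\<theta> n) x + pdiff 1 f x * \<theta> n x) - pdiff 1 f x" by (simp add: h_def 2 d1[OF x])
    show ?thesis unfolding e by (intro order_trans[OF norm_triangle_ineq4] add_mono norm_triangle_mono t0 s F1(2) x)
   qed
   then show ?thesis using F0 F1 F2 MB by (simp add: C_def mult_ac)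
  next
   case 3
   have "cmod (h k n x) <= ((4 * M * B + 2 * M * B) + (2 * M * B + F2)) + F2"
    unfolding h_def 3 two d2[OF x] by (intro order_trans[OF norm_triangle_ineq4] add_mono norm_triangle_mono t1 t2 s F2(2) x)
   then show ?thesis using F0 F1 F2 MB by (simp add: C_def mult_ac)
  qed
 qed
 have L: "(pdiff 1 ^^ k) g : L2 U01" if "bsm U01 g" for k and g :: "real => complex"
  unfolding funpow_pdiff by (rule bsm_L2[OF snet_pdiffs[OF that replicate_Basis]])
 show ?thesis
 proof (rule H20_I[OF bsm_H2(1)[OF f] ph_test])
  fix k :: nat assume k: "k <= 2"
  \<comment> \<open>Dominated convergence with the constant bound \<open>C\<close>: every fixed
    point eventually lies where the cut-off is 1.\<close>
  have "(%n. L2norm U01 (h k n)) \<longlonglongrightarrow> 0"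
  proof (rule L2norm_tendsto_zero[OF _ hb[OF k]])
   show "h k n : bmeas (lebU)" for n
    unfolding h_def[abs_def] by (intro borel_measurable_diff L2D(1)[OF L] phU f)
   show "\<forall>\<^sub>F n in sequentially. h k n x = 0" if "x : U01" for x
   proof -
    have "(%n. 2 / (real n + 3)) \<longlonglongrightarrow> 0" by real_asymp
    from order_tendstoD(2)[OF this, of "min x (1 - x)"] that
    have "\<forall>\<^sub>F n in sequentially. 2 / (real n + 3) < min x (1 - x)" by simp
    then show ?thesis by eventually_elim (rule inner0, simp add: add.commute)
   qed
  qed
  moreover have "L2norm U01 (h k n) = norm (J (wd k (ph n)) - J (wd k f))" for n
   unfolding bsm_H2(2)[OF phU] bsm_H2(2)[OF f] h_def[abs_def] by (rule J_norm_diff[symmetric, OF L[OF phU] L[OF f]])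
  ultimately have "(%n. norm (J (wd k (ph n)) - J (wd k f))) \<longlonglongrightarrow> 0" by simp
  then show "(%n. J (wd k (ph n))) \<longlonglongrightarrow> J (wd k f)"
   by (rule LIM_zero_cancel[OF tendsto_norm_zero_cancel])
 qed
qed

section \<open>Time slices of functions on the rectangle\<close>

lemma lebesgue_AE_borel:
 fixes g :: "'a::euclidean_space => complex"
 assumes "g : bmeas (lebesgue_on S)" "S : sets borel"
 obtains g0 where "g0 : bmeas borel" "AE z in lborel. z : S --> g z = g0 z"
proof -
 have m: "(%z. indicator S z *\<^sub>R g z) : bmeas lebesgue"
  using borel_measurable_if_I[OF assms(1)] assms(2) by (simp add: indicator_scaleR_eq_if)
 note m' = m[unfolded borel_measurable_complex_iff]
 obtain p where p: "p : bmeas lborel" "AE z in lborel. Re (indicator S z *\<^sub>R g z) = p z"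
  using completion_ex_borel_measurable_real[OF conjunct1[OF m']] by blast
 obtain q where q: "q : bmeas lborel" "AE z in lborel. Im (indicator S z *\<^sub>R g z) = q z"
  using completion_ex_borel_measurable_real[OF conjunct2[OF m']] by blast
 show thesis
 proof (rule that[of "%z. Complex (p z) (q z)"])
  have "(%z. complex_of_real (p z) + \<i> * complex_of_real (q z)) : bmeas borel"
   using p(1) q(1) by measurable
  then show "(%z. Complex (p z) (q z)) : bmeas borel" by (simp add: complex_eq_iff Complex_eq)
  show "AE z in lborel. z : S --> g z = Complex (p z) (q z)"
   using p(2) q(2) by eventually_elim (auto simp: complex_eq_iff)
 qed
qed

lemma AE_lebesgue_on_open:
 fixes S :: "'a::euclidean_space set"
 assumes "S : sets borel" "AE z in lborel. z : S --> P z"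
 shows "AE z in lebesgue_on S. P z"
 using assms AE_completion[OF assms(2)] by (subst AE_restrict_space_iff) auto

lemma AE_lborel_negligible:
 fixes P :: "'a::euclidean_space => bool"
 assumes "AE z in lborel. P z"
 obtains N where "negligible N" "!!z. z \<notin> N ==> P z"
proof -
 obtain N where N: "{z : space lborel. \<not> P z} \<subseteq> N" "emeasure lborel N = 0" "N : sets lborel" by (rule AE_E[OF assms])
 have "N : null_sets lebesgue" using N by (auto simp: null_sets_def)
 then show thesis using N(1) by (intro that[of N]) (auto simp: negligible_iff_null_sets)
qed

lemma AE_slices:
 assumes "AE z in lborel. P z"
 shows "AE t in lborel. AE x in lborel. P (x :: real, t :: real)"
proof -
 obtain N where N: "{z : space lborel. \<not> P z} \<subseteq> N" "emeasure lborel N = 0" "N : sets lborel"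
  by (rule AE_E[OF assms])
 have "AE z in lborel. z \<notin> N" using N by (intro AE_not_in) (auto simp: null_sets_def)
 then have "AE z in lborel \<Otimes>\<^sub>M lborel. z \<notin> N" unfolding lborel_prod .
 from lborel_pair.AE_pair[OF this] have "AE x in lborel. AE t in lborel. (x, t) \<notin> N" by simp
 moreover have "{x : space (lborel \<Otimes>\<^sub>M lborel). (fst x, snd x) \<notin> N} : sets (lborel \<Otimes>\<^sub>M lborel)"
 proof -
  have "- N : sets borel" using N(3) by auto
  then show ?thesis unfolding lborel_prod by (simp add: Compl_eq)
 qed
 ultimately have "AE t in lborel. AE x in lborel. (x, t) \<notin> N" by (subst lborel_pair.AE_commute[symmetric])
 then show ?thesis
 proof (rule eventually_mono)
  fix t assume "AE x in lborel. (x, t) \<notin> N"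
  then show "AE x in lborel. P (x, t)" by eventually_elim (use N(1) in auto)
 qed
qed

text \<open>\<open>g\<close> is only Lebesgue measurable, so single slices may be arbitrary and
  everything holds off one null set \<open>N\<close> of times. A Borel representative
  \<open>g0\<close> makes the theorems on product measures applicable. The first norm bound is
  Cauchy-Schwarz in time; the second integrates a uniform bound on the slices.\<close>

lemma L2_slices:
 assumes T: "T > 0" and g: "g : L2 (XT T)"
 obtains N where "negligible N" "!!t. t : {0<..<T} - N ==> (%x. g (x, t)) : L2 U01"
  "(%t. L2norm U01 (%x. g (x, t))) integrable_on {0..T}"
  "integral {0..T} (%t. L2norm U01 (%x. g (x, t))) <= sqrt T * L2norm (XT T) g"
  "!!M. M >= 0 ==> (!!t. t : {0<..<T} - N ==> L2norm U01 (%x. g (x, t)) <= M) ==> L2norm (XT T) g <= sqrt T * M"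
proof -
 have XTb: "XT T : sets borel" by (intro borel_open open_XT)
 obtain g0 where g0: "g0 : bmeas borel" "AE z in lborel. z : XT T --> g z = g0 z"
  by (rule lebesgue_AE_borel[OF L2D(1)[OF g] XTb])
 define h where "h z = indicator (XT T) z * (cmod (g0 z))\<^sup>2" for z
 have hm: "h : bmeas borel" unfolding h_def[abs_def] using g0(1) XTb by measurable
 have "integrable lebesgue (%z. indicator (XT T) z *\<^sub>R (cmod (g z))\<^sup>2)"
  using L2D(2)[OF g] by (subst (asm) integrable_restrict_space) (use XTb in auto)
 moreover have aeh: "AE z in lebesgue. indicator (XT T) z *\<^sub>R (cmod (g z))\<^sup>2 = h z"
  using AE_completion[OF g0(2)] by eventually_elim (auto simp: h_def indicator_def)
 ultimately have hleb: "integrable lebesgue h"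
  using hm by (subst integrable_cong_AE[symmetric]) (auto simp: borel_measurable_integrable intro: measurable_completion)
 have hi: "integrable lborel h" using hleb hm by (simp add: integrable_completion)
 have hI: "(LINT z|lborel. h z) = (L2norm (XT T) g)\<^sup>2"
 proof -
  have "(LINT z|lborel. h z) = (LINT z|lebesgue. h z)" using hm by (simp add: integral_completion)
  also have "\<dots> = (LINT z|lebesgue. indicator (XT T) z *\<^sub>R (cmod (g z))\<^sup>2)"
   using aeh \<open>integrable lebesgue (%z. indicator (XT T) z *\<^sub>R (cmod (g z))\<^sup>2)\<close> hleb
   by (intro integral_cong_AE) (auto simp: borel_measurable_integrable eq_commute)
  also have "\<dots> = (LINT z|lebesgue_on (XT T). (cmod (g z))\<^sup>2)"
   using XTb by (subst integral_restrict_space) auto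
  finally show ?thesis by (simp add: L2norm_def)
 qed
 define hs where "hs z = h (snd z, fst z)" for z
 have hp: "integrable (lborel \<Otimes>\<^sub>M lborel) h" using hi by (simp add: lborel_prod)
 have hsp: "integrable (lborel \<Otimes>\<^sub>M lborel) (%(t, x). h (x, t))"
  by (rule lborel_pair.integrable_product_swap[OF hp])
 have intx: "AE t in lborel. integrable lborel (%x. h (x, t))" using lborel_pair.AE_integrable_fst'[OF hsp] by simp
 have intt: "integrable lborel (%t. LINT x|lborel. h (x, t))" using lborel_pair.integrable_fst'[OF hsp] by simp
 have intI: "(LINT t|lborel. LINT x|lborel. h (x, t)) = (L2norm (XT T) g)\<^sup>2"
  using lborel_pair.integral_fst'[OF hsp] lborel_pair.integral_product_swap[of h] borel_measurable_integrable[OF hp] hI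
  by (simp add: lborel_prod)
 have aes: "AE t in lborel. AE x in lborel. (x, t) : XT T --> g (x, t) = g0 (x, t)"
  by (rule AE_slices[OF g0(2)])
 have "AE t in lborel. integrable lborel (%x. h (x, t)) \<and> (AE x in lborel. (x, t) : XT T --> g (x, t) = g0 (x, t))"
  using intx aes by eventually_elim simp
 then obtain N where N: "negligible N"
  "!!t. t \<notin> N ==> integrable lborel (%x. h (x, t)) \<and> (AE x in lborel. (x, t) : XT T --> g (x, t) = g0 (x, t))"
  by (rule AE_lborel_negligible) blast
 have sl: "(%x. g (x, t)) : L2 U01" "(L2norm U01 (%x. g (x, t)))\<^sup>2 = (LINT x|lborel. h (x, t))"
  if t: "t : {0<..<T} - N" for t
 proof -
  have ae: "AE x in lebU. g (x, t) = g0 (x, t)"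
   by (rule AE_lebesgue_on_open) (use N(2)[of t] t in \<open>auto simp: XT_def\<close>)
  have b: "(%x. g0 (x, t)) : bmeas borel" using g0(1) by (intro measurable_compose[OF _ g0(1)]) (simp add: borel_prod[symmetric])
  then have b': "(%x. g0 (x, t)) : bmeas (lebU)"
   by (intro measurable_restrict_space1 measurable_completion) simp
  have m: "(%x. g (x, t)) : bmeas (lebU)" by (rule measurable_lebesgue_on_AE[OF b' _ ae]) simp
  have hx: "h (x, t) = indicator U01 x *\<^sub>R (cmod (g0 (x, t)))\<^sup>2" for x using t by (auto simp: h_def XT_def indicator_def)
  have i0: "integrable (lebU) (%x. (cmod (g0 (x, t)))\<^sup>2)"
   using N(2)[of t] t b by (subst integrable_restrict_space) (auto simp: hx integrable_completion)
  have "integrable (lebU) (%x. (cmod (g (x, t)))\<^sup>2)"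
   by (rule integrable_cong_AE_imp[OF i0]) (use ae m in \<open>auto elim: eventually_mono\<close>)
  then show "(%x. g (x, t)) : L2 U01" using m by (simp add: L2_def)
  have "(L2norm U01 (%x. g (x, t)))\<^sup>2 = (LINT x|lebU. (cmod (g (x, t)))\<^sup>2)"
   unfolding L2norm_def by (intro real_sqrt_pow2 integral_nonneg_AE AE_I2) simp
  also have "\<dots> = (LINT x|lebU. (cmod (g0 (x, t)))\<^sup>2)"
   by (rule integral_cong_AE) (use ae m b' in \<open>auto elim: eventually_mono\<close>)
  also have "\<dots> = (LINT x|lborel. h (x, t))"
   using b by (subst integral_restrict_space) (auto simp: hx integral_completion)
  finally show "(L2norm U01 (%x. g (x, t)))\<^sup>2 = (LINT x|lborel. h (x, t))" .
 qed
 define et where "et t = (LINT x|lborel. h (x, t))" for t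
 have h0: "et t >= 0" for t unfolding et_def by (intro integral_nonneg_AE AE_I2) (simp add: h_def)
 have etm: "et : bmeas borel" using borel_measurable_integrable[OF intt] by (simp add: et_def[abs_def])
 have eti: "integrable (lebesgue_on {0..T}) et"
 proof -
  have "integrable lborel et" using intt unfolding et_def[abs_def] .
  then have "integrable lebesgue et" using etm by (subst integrable_completion) simp_all
  then have "integrable lebesgue (%t. indicator {0..T} t *\<^sub>R et t)" by (intro integrable_mult_indicator) simp_all
  then show ?thesis by (subst integrable_restrict_space) simp_all
 qed
 have one: "integrable (lebesgue_on {0..T}) (%_. 1::real)" by simp
 have setm: "(%t. sqrt (et t)) : bmeas (lebesgue_on {0..T})"
  using borel_measurable_integrable[OF eti] by measurable
 \<comment> \<open>\<open>sqrt s <= 1 + s\<close> for \<open>s >= 0\<close> dominates the slice norm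
   by an integrable function.\<close>
 have set: "integrable (lebesgue_on {0..T}) (%t. sqrt (et t))"
 proof (rule Bochner_Integration.integrable_bound[OF Bochner_Integration.integrable_add[OF one eti] setm], rule AE_I2)
  fix t
  have "sqrt (et t) <= 1 + et t" using h0[of t] by (intro real_le_lsqrt) (auto simp: power2_eq_square algebra_simps)
  then show "norm (sqrt (et t)) <= norm (1 + et t)" using h0[of t] by simp
 qed
 have hi: "((%t. sqrt (et t)) has_integral (LINT t|lebesgue_on {0..T}. sqrt (et t))) {0..T}"
  by (rule has_integral_integral_lebesgue_on[OF set]) simp
 have g\<gamma>: "((%t. L2norm U01 (%x. g (x, t))) has_integral (LINT t|lebesgue_on {0..T}. sqrt (et t))) {0..T}"
 proof (rule has_integral_spike[OF _ _ hi])
  show "negligible (N \<union> {0, T})" using N(1) by (auto intro: negligible_Un)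
  show "L2norm U01 (%x. g (x, t)) = sqrt (et t)" if "t : {0..T} - (N \<union> {0, T})" for t
   using sl(2)[of t, symmetric] that by (simp add: et_def)
 qed
 have cs: "(LINT t|lebesgue_on {0..T}. sqrt (et t)) <= sqrt T * L2norm (XT T) g"
 proof -
  define A where "A = (LINT t|lebesgue_on {0..T}. sqrt (et t))"
  have A0: "A >= 0" unfolding A_def by (intro integral_nonneg_AE AE_I2) (simp add: h0)
  \<comment> \<open>Cauchy-Schwarz in the form that the variance of \<open>sqrt (et t)\<close> about
    its mean \<open>A / T\<close> is nonnegative.\<close>
  have "(LINT t|lebesgue_on {0..T}. (sqrt (et t) - A / T)\<^sup>2) >= 0" by (intro integral_nonneg_AE AE_I2) simp
  also have "(LINT t|lebesgue_on {0..T}. (sqrt (et t) - A / T)\<^sup>2) = (LINT t|lebesgue_on {0..T}. et t - 2 * (A / T) * sqrt (et t) + (A / T)\<^sup>2)"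
   by (intro bochner_cong) (auto simp: power2_diff h0)
  also have "\<dots> = (LINT t|lebesgue_on {0..T}. et t) - 2 * (A / T) * A + (A / T)\<^sup>2 * T"
   using eti set T by (simp add: A_def[symmetric] measure_restrict_space)
  also have "\<dots> = (LINT t|lebesgue_on {0..T}. et t) - A\<^sup>2 / T" using T by (simp add: power2_eq_square field_simps)
  finally have "A\<^sup>2 <= T * (LINT t|lebesgue_on {0..T}. et t)" using T by (simp add: field_simps)
  also have "(LINT t|lebesgue_on {0..T}. et t) <= (L2norm (XT T) g)\<^sup>2"
  proof -
   have "(LINT t|lebesgue_on {0..T}. et t) = (LINT t|lebesgue. indicator {0..T} t *\<^sub>R et t)"
    by (subst integral_restrict_space) auto
   also have "\<dots> = (LINT t|lborel. indicator {0..T} t *\<^sub>R et t)" using etm by (intro integral_completion) simp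
   also have "\<dots> <= (LINT t|lborel. et t)"
    using intt h0 etm by (intro integral_mono integrable_mult_indicator) (auto simp: et_def[abs_def, symmetric] indicator_def)
   finally show ?thesis using intI by (simp add: et_def)
  qed
  finally have "A\<^sup>2 <= T * (L2norm (XT T) g)\<^sup>2" using T by simp
  then have "A <= sqrt (T * (L2norm (XT T) g)\<^sup>2)" by (rule real_le_rsqrt)
  then show ?thesis by (simp add: A_def real_sqrt_mult)
 qed
 have upper: "L2norm (XT T) g <= sqrt T * M"
  if M: "M >= 0" "!!t. t : {0<..<T} - N ==> L2norm U01 (%x. g (x, t)) <= M" for M
 proof -
  have etl: "integrable lebesgue et"
   using intt etm by (subst integrable_completion) (simp_all add: et_def[abs_def])
  have ind: "integrable lebesgue (%t. indicator {0<..<T} t *\<^sub>R M\<^sup>2)"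
   using T by (intro integrable_scaleR_left integrable_real_indicator) (auto simp: emeasure_lborel_Ioo)
  have "(L2norm (XT T) g)\<^sup>2 = (LINT t|lebesgue. et t)"
   using intI etm by (subst integral_completion) (simp_all add: et_def[abs_def])
  also have "\<dots> <= (LINT t|lebesgue. indicator {0<..<T} t *\<^sub>R M\<^sup>2)"
  proof (rule integral_mono_AE[OF etl ind])
   have "AE t in lebesgue. t \<notin> N" using N(1) by (intro AE_not_in) (simp add: negligible_iff_null_sets)
   then show "AE t in lebesgue. et t <= indicator {0<..<T} t *\<^sub>R M\<^sup>2"
   proof (rule eventually_mono)
    fix t assume tN: "t \<notin> N"
    show "et t <= indicator {0<..<T} t *\<^sub>R M\<^sup>2"
    proof (cases "t : {0<..<T}")
     case True
     have "et t = (L2norm U01 (%x. g (x, t)))\<^sup>2" using sl(2)[of t] True tN by (simp add: et_def)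
     also have "\<dots> <= M\<^sup>2" using M(2)[of t] True tN by (intro power_mono) auto
     finally show ?thesis using True by simp
    next
     case False
     then have "h (x, t) = 0" for x by (simp add: h_def XT_def)
     then show ?thesis using False by (simp add: et_def)
    qed
   qed
  qed
  also have "\<dots> = T * M\<^sup>2" using T by simp
  finally have "L2norm (XT T) g <= sqrt (T * M\<^sup>2)" by (rule real_le_rsqrt)
  then show ?thesis using M(1) by (simp add: real_sqrt_mult)
 qed
 show thesis
  by (rule that[OF N(1) sl(1) _ _ upper]) (use g\<gamma> cs in \<open>auto simp: has_integral_iff\<close>)
qed

lemma J_mult_bounded:
 assumes "f : L2 U01" "f' : L2 U01" "m : bmeas (lebU)" "!!x. x : U01 ==> cmod (m x) <= M" "M >= 0"
 shows "norm (J (%x. m x * f x) - J (%x. m x * f' x)) <= M * norm (J f - J f')"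
proof -
 have "L2norm U01 (%x. m x * f x - m x * f' x) = L2norm U01 (%x. m x * (f x - f' x))" by (simp add: algebra_simps)
 also have "\<dots> <= M * L2norm U01 (%x. f x - f' x)" by (rule L2_mult_bounded(2)[OF L2_diff assms(3,4,5)]) (use assms in auto)
 also have "L2norm U01 (%x. f x - f' x) = norm (J f - J f')" by (rule J_norm_diff[OF assms(1,2), symmetric])
 also have "L2norm U01 (%x. m x * f x - m x * f' x) = norm (J (%x. m x * f x) - J (%x. m x * f' x))"
  by (rule J_norm_diff[OF L2_mult_bounded(1)[OF assms(1,3,4)] L2_mult_bounded(1)[OF assms(2,3,4)], symmetric])
 finally show ?thesis .
qed

section \<open>Mild solutions and their energy estimate\<close>

locale plate =
 fixes T :: real and b :: "real \<times> real => complex" and c :: "real => complex" and c0 c1 Cb :: real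
 assumes T: "0 < T" and b_smooth: "bsm (XT T) b" and b_le: "!!z. z : XT T ==> cmod (b z) <= Cb" and Cb: "0 <= Cb"
  and c_smooth: "bsm U01 c" and c0: "0 < c0" and c_real: "!!x. x : U01 ==> c x : \<real>"
  and c_ge: "!!x. x : U01 ==> c0 <= Re (c x)" and c_le: "!!x. x : U01 ==> Re (c x) <= c1"
begin

text \<open>The force minus the two spatial terms of the weak equation, where \<open>w\<close>
  stands for the second \<open>x\<close>-derivative of the solution. Only real parts are kept, to
  match the inner product of \<open>l2\<close>.\<close>

definition rhs :: "(real \<times> real => complex) => (real => complex) => (real => complex) => real => real" where
 "rhs g w v s = Re (L2ip (%x. g (x, s)) v) - Re (L2ip (%x. b (x, s) * w x) v) - Re (L2ip (%x. c x * w x) (wd 2 v))"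

text \<open>The equation integrated in time against each fixed \<open>v\<close>, the common ground
  of smooth clamped functions and weak solutions. The velocity \<open>y\<close> is continuous in
  \<open>l2\<close> but need not take values in \<open>H20\<close>, and no second time derivative
  occurs.\<close>

definition mild :: "(real \<times> real => complex) => (real => real => complex) => (real => real => complex) => bool" where
 "mild g z y \<longleftrightarrow>
   (\<forall>t\<in>{0..T}. z t : H20 \<and> y t : L2 U01) \<and>
   continuous_on {0..T} (%t. J (y t)) \<and> continuous_on {0..T} (%t. J (wd 2 (z t))) \<and>
   (\<forall>t\<in>{0..T}. ((%t. J (z t)) has_vector_derivative J (y t)) (at t within {0..T})) \<and>
   (\<forall>v\<in>H20. \<forall>t1 t2. 0 <= t1 --> t1 <= t2 --> t2 <= T -->
    ((%s. rhs g (wd 2 (z s)) v s) has_integral inner (J (y t2) - J (y t1)) (J v)) {t1..t2})"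

lemma c_measurable: "c : bmeas (lebU)"
 using L2D(1)[OF bsm_L2[OF c_smooth]] .

lemma c_norm_le: "x : U01 ==> cmod (c x) <= c1"
 using c_real[of x] c_ge[of x] c_le[of x] c0 by (auto elim!: Reals_cases)

lemma b_slice:
 assumes "s : {0<..<T}"
 shows "(%x. b (x, s)) : bmeas (lebU)" "!!x. x : U01 ==> cmod (b (x, s)) <= Cb"
proof -
 have "continuous_on (XT T) b" using snet_continuous_on[OF b_smooth open_XT, of 1] by simp
 then have "continuous_on U01 (%x. b (x, s))"
  by (rule continuous_on_compose2) (use assms in \<open>auto simp: XT_def intro!: continuous_intros\<close>)
 then show "(%x. b (x, s)) : bmeas (lebU)"
  by (rule continuous_imp_measurable_on_sets_lebesgue) simp
 show "cmod (b (x, s)) <= Cb" if "x : U01" for x by (rule b_le[OF XT_I[OF that assms]])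
qed

lemma L2_coefficients:
 assumes "w : L2 U01"
 shows "(%x. c x * w x) : L2 U01" "s : {0<..<T} ==> (%x. b (x, s) * w x) : L2 U01"
 using L2_mult_bounded(1)[OF assms c_measurable c_norm_le] L2_mult_bounded(1)[OF assms b_slice] by auto

lemma H20_L2: "v : H20 ==> v : L2 U01" and H20_wd: "v : H20 ==> wd 2 v : L2 U01"
 using H2_L2[OF H20_H2] H2_wd(1)[OF H20_H2, of v 2] by auto

lemma L2ip_J: "f : L2 U01 ==> g : L2 U01 ==> f' : L2 U01 ==> J f = J f' ==> Re (L2ip f g) = Re (L2ip f' g)"
 by (simp add: J_inner[symmetric])

text \<open>\<open>wd 2\<close> of a difference is another arbitrary choice, so manipulations inside
  \<open>rhs\<close> have to pass through equality of classes.\<close>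

lemma rhs_J_cong:
 assumes s: "s : {0<..<T}" and w: "w : L2 U01" "w' : L2 U01" "J w = J w'" and v: "v : H20"
 shows "rhs g w v s = rhs g w' v s"
proof -
 note L = L2_coefficients(1)[OF w(1)] L2_coefficients(1)[OF w(2)] L2_coefficients(2)[OF w(1) s] L2_coefficients(2)[OF w(2) s]
 have J: "J (%x. c x * w x) = J (%x. c x * w' x)" "J (%x. b (x, s) * w x) = J (%x. b (x, s) * w' x)"
  using J_mult_bounded[OF w(1,2) c_measurable c_norm_le] J_mult_bounded[OF w(1,2) b_slice[OF s] Cb] c0 c_ge[of "1/2"] c_le[of "1/2"]
  by (simp_all add: w(3))
 show ?thesis
  unfolding rhs_def L2ip_J[OF L(1) H20_wd[OF v] L(2) J(1)] L2ip_J[OF L(3) H20_L2[OF v] L(4) J(2)] ..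
qed

lemma rhs_diff:
 assumes s: "s : {0<..<T}" and w: "w : L2 U01" "w' : L2 U01" and v: "v : H20"
  and g: "(%x. g (x, s)) : L2 U01" "(%x. g' (x, s)) : L2 U01"
 shows "rhs (%z. g z - g' z) (%x. w x - w' x) v s = rhs g w v s - rhs g' w' v s"
proof -
 note L = L2_coefficients(1)[OF w(1)] L2_coefficients(1)[OF w(2)] L2_coefficients(2)[OF w(1) s] L2_coefficients(2)[OF w(2) s]
 show ?thesis
  unfolding rhs_def right_diff_distrib
   L2ip_diff_left[OF g H20_L2[OF v]] L2ip_diff_left[OF L(1,2) H20_wd[OF v]] L2ip_diff_left[OF L(3,4) H20_L2[OF v]]
  by simp
qed

text \<open>\<open>N\<close> collects the times at which a slice of \<open>g\<close> or
  \<open>g'\<close> may fail to be square integrable. Together with the end times, where nothing is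
  known of \<open>b\<close>, it is negligible and invisible to the time integral.\<close>

lemma mild_diff:
 assumes m: "mild g z y" "mild g' z' y'" and N: "negligible N"
  and g: "!!s. s : {0<..<T} - N ==> (%x. g (x, s)) : L2 U01" "!!s. s : {0<..<T} - N ==> (%x. g' (x, s)) : L2 U01"
 shows "mild (%p. g p - g' p) (%t x. z t x - z' t x) (%t x. y t x - y' t x)"
proof -
 have H: "z t : H20" "z' t : H20" "y t : L2 U01" "y' t : L2 U01" if "t : {0..T}" for t using m that by (auto simp: mild_def)
 have jw: "J (wd 2 (%x. z t x - z' t x)) = J (wd 2 (z t)) - J (wd 2 (z' t))" if "t : {0..T}" for t
  using H[OF that] by (intro H2_diff(2) H20_H2) auto
 have jz: "J (%x. z t x - z' t x) = J (z t) - J (z' t)" "J (%x. y t x - y' t x) = J (y t) - J (y' t)" if "t : {0..T}" for t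
  using H[OF that] by (auto intro!: J_diff H20_L2)
 show ?thesis unfolding mild_def
 proof (intro conjI ballI allI impI)
  fix t assume t: "t : {0..T}"
  show "(%x. z t x - z' t x) : H20" "(%x. y t x - y' t x) : L2 U01" using H[OF t] by (auto intro: H20_diff L2_diff)
  have D: "((%t. J (z t) - J (z' t)) has_vector_derivative (J (y t) - J (y' t))) (at t within {0..T})"
   using m t by (intro has_vector_derivative_diff) (auto simp: mild_def)
  show "((%t. J (%x. z t x - z' t x)) has_vector_derivative J (%x. y t x - y' t x)) (at t within {0..T})"
   unfolding jz(2)[OF t] by (rule has_vector_derivative_transform[OF t _ D]) (rule jz(1))
 next
  have c: "continuous_on {0..T} (%t. J (y t) - J (y' t))" "continuous_on {0..T} (%t. J (wd 2 (z t)) - J (wd 2 (z' t)))"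
   using m by (auto simp: mild_def intro!: continuous_on_diff)
  show "continuous_on {0..T} (%t. J (%x. y t x - y' t x))" by (rule continuous_on_eq[OF c(1)]) (simp add: jz)
  show "continuous_on {0..T} (%t. J (wd 2 (%x. z t x - z' t x)))" by (rule continuous_on_eq[OF c(2)]) (simp add: jw)
 next
  fix v and t1 t2 :: real
  assume v: "v : H20" and t: "0 <= t1" "t1 <= t2" "t2 <= T"
  have i: "((%s. rhs g (wd 2 (z s)) v s) has_integral inner (J (y t2) - J (y t1)) (J v)) {t1..t2}"
   "((%s. rhs g' (wd 2 (z' s)) v s) has_integral inner (J (y' t2) - J (y' t1)) (J v)) {t1..t2}"
   using m v t by (simp_all add: mild_def)
  have "((%s. rhs (%p. g p - g' p) (wd 2 (%x. z s x - z' s x)) v s) has_integral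
   inner (J (y t2) - J (y t1)) (J v) - inner (J (y' t2) - J (y' t1)) (J v)) {t1..t2}"
  proof (rule has_integral_spike[OF _ _ has_integral_diff[OF i]])
   show "negligible (N \<union> {0, T})" using N by (auto intro: negligible_Un)
   fix s assume "s : {t1..t2} - (N \<union> {0, T})"
   then have s: "s : {0<..<T}" "s : {0<..<T} - N" "s : {0..T}" using t by auto
   note w = H20_wd[OF H(1)[OF s(3)]] H20_wd[OF H(2)[OF s(3)]]
   have "rhs (%p. g p - g' p) (wd 2 (%x. z s x - z' s x)) v s = rhs (%p. g p - g' p) (%x. wd 2 (z s) x - wd 2 (z' s) x) v s"
    using w H[OF s(3)] by (intro rhs_J_cong[OF s(1) _ _ _ v] H20_wd H20_diff L2_diff) (simp_all add: jw[OF s(3)] J_diff)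
   also have "\<dots> = rhs g (wd 2 (z s)) v s - rhs g' (wd 2 (z' s)) v s"
    by (rule rhs_diff[OF s(1) w v g(1)[OF s(2)] g(2)[OF s(2)]])
   finally show "rhs (%p. g p - g' p) (wd 2 (%x. z s x - z' s x)) v s = rhs g (wd 2 (z s)) v s - rhs g' (wd 2 (z' s)) v s" .
  qed
  then show "((%s. rhs (%p. g p - g' p) (wd 2 (%x. z s x - z' s x)) v s) has_integral
   inner (J (%x. y t2 x - y' t2 x) - J (%x. y t1 x - y' t1 x)) (J v)) {t1..t2}"
   using t by (simp add: jz inner_diff_left algebra_simps)
 qed
qed

text \<open>
 The square root of \<open>c\<close> turns the elliptic part into the norm of \<open>Z\<close>, to which the abstract energy
 estimate applies; \<open>b\<close> is treated as a perturbation of the right-hand side.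
\<close>

lemma mild_energy_aux:
 defines "m \<equiv> %x. complex_of_real (sqrt (Re (c x)))"
 assumes mi: "mild g z y" and N: "negligible N"
  and g: "!!s. s : {0<..<T} - N ==> (%x. g (x, s)) : L2 U01"
  and \<gamma>: "!!s. s : {0<..<T} - N ==> L2norm U01 (%x. g (x, s)) <= \<gamma> s"
  and \<gamma>0: "!!s. s : {0..T} ==> \<gamma> s >= 0" and \<gamma>i: "\<gamma> integrable_on {0..T}" and t: "t : {0..T}"
 shows "(norm (J (y t)))\<^sup>2 + (norm (J (%x. m x * wd 2 (z t) x)))\<^sup>2
  <= exp (2 * (4 * (Cb / sqrt c0) + 1) * T) *
    (4 * ((norm (J (y 0)))\<^sup>2 + (norm (J (%x. m x * wd 2 (z 0) x)))\<^sup>2) + 16 * (integral {0..T} \<gamma>)\<^sup>2)"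
  and "norm (J (wd 2 (z t))) <= norm (J (%x. m x * wd 2 (z t) x)) / sqrt c0"
  and "norm (J (%x. m x * wd 2 (z t) x)) <= sqrt c1 * norm (J (wd 2 (z t)))"
proof -
 have H: "z t : H20" "y t : L2 U01" if "t : {0..T}" for t using mi that by (auto simp: mild_def)
 have mm: "m : bmeas (lebU)" unfolding m_def using c_measurable by measurable
 have c1: "c1 > 0" using c0 c_ge[of "1/2"] c_le[of "1/2"] by simp
 have ml: "cmod (m x) <= sqrt c1" if "x : U01" for x using c_le[OF that] c_ge[OF that] c0 by (simp add: m_def)
 have mL: "(%x. m x * f x) : L2 U01" if "f : L2 U01" for f by (rule L2_mult_bounded(1)[OF that mm ml])
 have mJ: "norm (J (%x. m x * f x) - J (%x. m x * f' x)) <= sqrt c1 * norm (J f - J f')" if "f : L2 U01" "f' : L2 U01" for f f'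
  using c1 by (intro J_mult_bounded[OF that mm ml]) auto
 have m1: "cmod (1 / m x) <= 1 / sqrt c0" if "x : U01" for x
  using c_ge[OF that] c0 by (simp add: m_def norm_divide frac_le)
 have mlow: "norm (J f) <= norm (J (%x. m x * f x)) / sqrt c0" if f: "f : L2 U01" for f
 proof -
  have mm': "(%x. 1 / m x) : bmeas (lebU)" using mm by measurable
  have "L2norm U01 (%x. 1 / m x * (m x * f x)) <= 1 / sqrt c0 * L2norm U01 (%x. m x * f x)"
   by (rule L2_mult_bounded(2)[OF mL[OF f] mm' m1]) (use c0 in auto)
  moreover have "L2norm U01 (%x. 1 / m x * (m x * f x)) = L2norm U01 f"
  proof -
   have "m x \<noteq> 0" if "x : U01" for x using c_ge[OF that] c0 by (simp add: m_def)
   then show ?thesis unfolding L2norm_def by (intro arg_cong[where f = sqrt] bochner_cong) auto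
  qed
  ultimately show ?thesis using f mL[OF f] by (simp add: J_norm)
 qed
 show "norm (J (wd 2 (z t))) <= norm (J (%x. m x * wd 2 (z t) x)) / sqrt c0"
  by (rule mlow[OF H20_wd[OF H(1)[OF t]]])
 show "norm (J (%x. m x * wd 2 (z t) x)) <= sqrt c1 * norm (J (wd 2 (z t)))"
  using mJ[OF H20_wd[OF H(1)[OF t]] L2_zero] J_diff[OF L2_zero L2_zero] by simp
 define Z where "Z t = J (%x. m x * wd 2 (z t) x)" for t
 \<comment> \<open>Test functions together with their weighted second derivatives; the abstract
   estimate sees \<open>H20\<close> only through this set.\<close>
 define D where "D = {(J v, J (%x. m x * wd 2 v x)) | v. v : H20}"
 define B where "B t = integral {0..t} \<gamma>" for t
 \<comment> \<open>Combines the bound \<open>Cb\<close> on \<open>b\<close> with the bound of the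
   second derivative by \<open>norm Z / sqrt c0\<close>.\<close>
 define C where "C = Cb / sqrt c0"
 have C: "C >= 0" using Cb c0 by (simp add: C_def)
 have Zc: "continuous_on {0..T} Z"
 proof -
  have wc: "continuous_on {0..T} (%t. J (wd 2 (z t)))" using mi by (simp add: mild_def)
  show ?thesis unfolding continuous_on_def
  proof
   fix s assume s: "s : {0..T}"
   have "((%t. sqrt c1 * norm (J (wd 2 (z t)) - J (wd 2 (z s)))) \<longlongrightarrow> sqrt c1 * norm (J (wd 2 (z s)) - J (wd 2 (z s)))) (at s within {0..T})"
    using wc s by (intro tendsto_intros) (simp add: continuous_on_def)
   then have l: "((%t. sqrt c1 * norm (J (wd 2 (z t)) - J (wd 2 (z s)))) \<longlongrightarrow> 0) (at s within {0..T})" by simp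
   have "((%t. Z t - Z s) \<longlongrightarrow> 0) (at s within {0..T})"
   proof (rule Lim_null_comparison[OF _ l])
    show "\<forall>\<^sub>F t in at s within {0..T}. norm (Z t - Z s) <= sqrt c1 * norm (J (wd 2 (z t)) - J (wd 2 (z s)))"
     unfolding Z_def eventually_at_filter by (rule always_eventually) (use s in \<open>auto intro!: mJ H20_wd H\<close>)
   qed
   then show "(Z \<longlongrightarrow> Z s) (at s within {0..T})" by (simp add: LIM_zero_iff)
  qed
 qed
 have D: "(J (z s) - J (z t), Z s - Z t) : D" if s: "s : {0..T}" and t: "t : {0..T}" for s t
 proof -
  have h: "(%x. z s x - z t x) : H20" by (intro H20_diff H s t)
  have w: "wd 2 (z s) : L2 U01" "wd 2 (z t) : L2 U01" "wd 2 (%x. z s x - z t x) : L2 U01" by (intro H20_wd H s t h)+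
  have jw: "J (wd 2 (%x. z s x - z t x)) = J (%x. wd 2 (z s) x - wd 2 (z t) x)"
   using w by (simp add: J_diff H2_diff(2)[OF H20_H2[OF H(1)[OF s]] H20_H2[OF H(1)[OF t]]])
  have "J (%x. m x * wd 2 (%x. z s x - z t x) x) = J (%x. m x * (wd 2 (z s) x - wd 2 (z t) x))"
   using mJ[OF w(3) L2_diff[OF w(1,2)]] by (simp add: jw)
  also have "\<dots> = Z s - Z t" unfolding Z_def right_diff_distrib by (rule J_diff[OF mL[OF w(1)] mL[OF w(2)]])
  finally have 2: "Z s - Z t = J (%x. m x * wd 2 (%x. z s x - z t x) x)" by simp
  have 1: "J (z s) - J (z t) = J (%x. z s x - z t x)" by (intro J_diff[symmetric] H20_L2 H s t)
  show ?thesis unfolding D_def 1 2 using h by blast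
 qed
 have eq: "inner (J (y t2) - J (y t1)) v + integral {t1..t2} (%s. inner (Z s) V)
    <= norm v * (B t2 - B t1 + C * integral {t1..t2} (%s. norm (Z s)))"
  if vV: "(v, V) : D" and t: "0 <= t1" "t1 <= t2" "t2 <= T" for v V t1 t2
 proof -
  obtain v' where v': "v' : H20" and v: "v = J v'" and V: "V = J (%x. m x * wd 2 v' x)" using vV unfolding D_def by blast
  note vL = H20_L2[OF v'] H20_wd[OF v']
  have sub: "{t1..t2} \<subseteq> {0..T}" using t by auto
  have i1: "((%s. rhs g (wd 2 (z s)) v' s) has_integral inner (J (y t2) - J (y t1)) v) {t1..t2}"
   using mi v' t by (simp add: mild_def v)
  have i2: "((%s. inner (Z s) V) has_integral integral {t1..t2} (%s. inner (Z s) V)) {t1..t2}"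
   by (intro integrable_integral integrable_continuous_interval continuous_intros continuous_on_subset[OF Zc sub])
  have i3: "((%s. norm (Z s)) has_integral integral {t1..t2} (%s. norm (Z s))) {t1..t2}"
   by (intro integrable_integral integrable_continuous_interval continuous_intros continuous_on_subset[OF Zc sub])
  have i4: "(\<gamma> has_integral (B t2 - B t1)) {t1..t2}"
  proof -
   have "integral {0..t1} \<gamma> + integral {t1..t2} \<gamma> = integral {0..t2} \<gamma>"
    using t by (intro hk_combine integrable_subinterval_real[OF \<gamma>i]) auto
   then show ?thesis using integrable_subinterval_real[OF \<gamma>i sub] by (simp add: B_def has_integral_iff)
  qed
  define F where "F s = rhs g (wd 2 (z s)) v' s + inner (Z s) V" for s
  define G where "G s = norm v * (\<gamma> s + C * norm (Z s))" for s
  have iF: "(F has_integral (inner (J (y t2) - J (y t1)) v + integral {t1..t2} (%s. inner (Z s) V))) {t1..t2}"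
   unfolding F_def by (rule has_integral_add[OF i1 i2])
  have iG: "(G has_integral (norm v * (B t2 - B t1 + C * integral {t1..t2} (%s. norm (Z s))))) {t1..t2}"
   unfolding G_def by (intro has_integral_mult_right has_integral_add i3 i4)
  have FG: "F s <= G s" if "s : {t1..t2} - (N \<union> {0, T})" for s
  proof -
   have s: "s : {0<..<T}" "s : {0<..<T} - N" "s : {0..T}" using t that by auto
   note w = H20_wd[OF H(1)[OF s(3)]]
   have "inner (Z s) V = Re (L2ip (%x. m x * wd 2 (z s) x) (%x. m x * wd 2 v' x))"
    unfolding Z_def V by (rule J_inner[OF mL[OF w] mL[OF vL(2)]])
   \<comment> \<open>\<open>m\<close> is real, so \<open>m * cnj m = c\<close>; the elliptic form
     becomes the inner product of \<open>Z s\<close> and \<open>V\<close> and cancels the last term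
     of \<open>rhs\<close>.\<close>
   also have "L2ip (%x. m x * wd 2 (z s) x) (%x. m x * wd 2 v' x) = L2ip (%x. c x * wd 2 (z s) x) (wd 2 v')"
    unfolding L2ip_def
   proof (rule bochner_cong[OF refl])
    fix x assume "x : space (lebU)"
    then have x: "x : U01" by simp
    have "m x * cnj (m x) = complex_of_real (sqrt (Re (c x)) * sqrt (Re (c x)))" 
     unfolding m_def complex_cnj_complex_of_real of_real_mult ..
    also have "\<dots> = complex_of_real (Re (c x))" using c_ge[OF x] c0 by simp
    also have "\<dots> = c x" using c_real[OF x] by simp
    finally have "m x * cnj (m x) = c x" .
    then show "m x * wd 2 (z s) x * cnj (m x * wd 2 v' x) = c x * wd 2 (z s) x * cnj (wd 2 v' x)"
     by (metis (no_types, opaque_lifting) complex_cnj_mult mult.assoc mult.left_commute)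
   qed
   finally have "F s = Re (L2ip (%x. g (x, s)) v') - Re (L2ip (%x. b (x, s) * wd 2 (z s) x) v')"
    by (simp add: F_def rhs_def)
   also have "\<dots> <= cmod (L2ip (%x. g (x, s)) v') + cmod (L2ip (%x. b (x, s) * wd 2 (z s) x) v')"
    using complex_Re_le_cmod[of "L2ip (%x. g (x, s)) v'"] abs_Re_le_cmod[of "L2ip (%x. b (x, s) * wd 2 (z s) x) v'"] by linarith
   also have "\<dots> <= L2norm U01 (%x. g (x, s)) * norm v + L2norm U01 (%x. b (x, s) * wd 2 (z s) x) * norm v"
    unfolding v J_norm[OF vL(1)] by (intro add_mono L2ip_bound g s L2_coefficients w vL)
   also have "\<dots> <= \<gamma> s * norm v + (C * norm (Z s)) * norm v"
   proof (intro add_mono mult_right_mono \<gamma> s norm_ge_zero)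
    have "L2norm U01 (%x. b (x, s) * wd 2 (z s) x) <= Cb * norm (J (wd 2 (z s)))"
     unfolding J_norm[OF w] by (rule L2_mult_bounded(2)[OF w b_slice[OF s(1)] Cb])
    also have "\<dots> <= Cb * (norm (Z s) / sqrt c0)" unfolding Z_def by (intro mult_left_mono mlow w Cb)
    finally show "L2norm U01 (%x. b (x, s) * wd 2 (z s) x) <= C * norm (Z s)" by (simp add: C_def)
   qed
   finally show ?thesis by (simp add: G_def algebra_simps)
  qed
  have ng: "negligible (N \<union> {0, T})" using N by (auto intro: negligible_Un)
  \<comment> \<open>\<open>has_integral_le\<close> asks for the inequality at every point, so
    \<open>F\<close> is replaced by \<open>G\<close> on the exceptional null set.\<close>
  have iF': "((%s. if s : N \<union> {0, T} then G s else F s) has_integral (inner (J (y t2) - J (y t1)) v + integral {t1..t2} (%s. inner (Z s) V))) {t1..t2}"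
   by (rule has_integral_spike[OF ng _ iF]) auto
  show ?thesis by (rule has_integral_le[OF iF' iG]) (use FG in auto)
 qed
 have "(norm (J (y t)))\<^sup>2 + (norm (Z t))\<^sup>2
  <= exp (2 * (4 * C + 1) * T) * (4 * ((norm (J (y 0)))\<^sup>2 + (norm (Z 0))\<^sup>2) + 16 * (B T - B 0)\<^sup>2)"
 proof (rule energy_estimate[where z = "%t. J (z t)" and D = D])
  show "continuous_on {0..T} B" unfolding B_def by (rule indefinite_integral_continuous_1[OF \<gamma>i])
  show "B s <= B t" if "0 <= s" "s <= t" "t <= T" for s t
  proof -
   have "integral {0..s} \<gamma> + integral {s..t} \<gamma> = integral {0..t} \<gamma>"
    using that by (intro hk_combine integrable_subinterval_real[OF \<gamma>i]) auto
   moreover have "integral {s..t} \<gamma> >= 0"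
    using that by (intro integral_nonneg integrable_subinterval_real[OF \<gamma>i] \<gamma>0) auto
   ultimately show ?thesis by (simp add: B_def)
  qed
  show "((%t. J (z t)) has_vector_derivative J (y t)) (at t within {0..T})" if "t : {0..T}" for t
   using mi that by (simp add: mild_def)
  show "continuous_on {0..T} (%t. J (y t))" using mi by (simp add: mild_def)
 qed (use T Zc C D eq t in auto)
 then show "(norm (J (y t)))\<^sup>2 + (norm (J (%x. m x * wd 2 (z t) x)))\<^sup>2
  <= exp (2 * (4 * (Cb / sqrt c0) + 1) * T) *
    (4 * ((norm (J (y 0)))\<^sup>2 + (norm (J (%x. m x * wd 2 (z 0) x)))\<^sup>2) + 16 * (integral {0..T} \<gamma>)\<^sup>2)"
  by (simp add: Z_def C_def B_def)
qed

text \<open>The energy bounds the velocity uniformly in time, and the displacement is recovered by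
  integrating the velocity, which brings in the factor \<open>T\<close>. The constant depends on the
  coefficients and \<open>T\<close> alone, hence is fixed before \<open>g\<close>, \<open>z\<close>
  and \<open>y\<close>.\<close>

lemma mild_energy:
 obtains K where "K >= 0" "!!g z y N \<gamma> t. mild g z y ==> negligible N ==>
  (!!s. s : {0<..<T} - N ==> (%x. g (x, s)) : L2 U01) ==>
  (!!s. s : {0<..<T} - N ==> L2norm U01 (%x. g (x, s)) <= \<gamma> s) ==>
  (!!s. s : {0..T} ==> \<gamma> s >= 0) ==> \<gamma> integrable_on {0..T} ==> t : {0..T} ==>
  norm (J (z t)) <= norm (J (z 0)) + K * (norm (J (y 0)) + norm (J (wd 2 (z 0))) + integral {0..T} \<gamma>)"
proof -
 have c1: "c1 > 0" using c0 c_ge[of "1/2"] c_le[of "1/2"] by simp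
 define e where "e = exp (2 * (4 * (Cb / sqrt c0) + 1) * T)"
 \<comment> \<open>\<open>e\<close> is the exponential of the energy estimate;
   \<open>16 * (1 + c1)\<close> majorises its constants 4, \<open>4 * c1\<close> and 16 once all
   data are bounded by their sum \<open>E\<close>.\<close>
 define K where "K = sqrt (e * (16 * (1 + c1)))"
 have e: "e > 0" by (simp add: e_def)
 have K: "K >= 0" using e c1 by (simp add: K_def)
 show thesis
 proof (rule that[of "K * T"])
  show "K * T >= 0" using K T by simp
  fix g z y N \<gamma> t
  assume mi: "mild g z y" and N: "negligible N"
   and g: "!!s. s : {0<..<T} - N ==> (%x. g (x, s)) : L2 U01"
   and \<gamma>: "!!s. s : {0<..<T} - N ==> L2norm U01 (%x. g (x, s)) <= \<gamma> s"
   and \<gamma>0: "!!s. s : {0..T} ==> \<gamma> s >= 0" and \<gamma>i: "\<gamma> integrable_on {0..T}" and t: "t : {0..T}"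
  define \<beta> where "\<beta> = integral {0..T} \<gamma>"
  have \<beta>: "\<beta> >= 0" unfolding \<beta>_def by (intro integral_nonneg \<gamma>i \<gamma>0)
  define E where "E = norm (J (y 0)) + norm (J (wd 2 (z 0))) + \<beta>"
  have E: "E >= 0" using \<beta> by (simp add: E_def)
  have y: "norm (J (y s)) <= K * E" if s: "s : {0..T}" for s
  proof -
   note en = mild_energy_aux[OF mi N g \<gamma> \<gamma>0 \<gamma>i s]
   have Z0: "norm (J (%x. complex_of_real (sqrt (Re (c x))) * wd 2 (z 0) x)) <= sqrt c1 * norm (J (wd 2 (z 0)))"
    by (rule mild_energy_aux(3)[OF mi N g \<gamma> \<gamma>0 \<gamma>i]) (use T in auto)
   have "(norm (J (y s)))\<^sup>2 <= e * (4 * ((norm (J (y 0)))\<^sup>2 + (norm (J (%x. complex_of_real (sqrt (Re (c x))) * wd 2 (z 0) x)))\<^sup>2) + 16 * \<beta>\<^sup>2)"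
    using en(1) zero_le_power2[of "norm (J (%x. complex_of_real (sqrt (Re (c x))) * wd 2 (z s) x))"] unfolding e_def \<beta>_def by linarith
   also have "\<dots> <= e * (4 * ((norm (J (y 0)))\<^sup>2 + (sqrt c1 * norm (J (wd 2 (z 0))))\<^sup>2) + 16 * \<beta>\<^sup>2)"
    using e Z0 by (intro mult_left_mono add_right_mono add_left_mono power_mono) auto
   also have "(sqrt c1 * norm (J (wd 2 (z 0))))\<^sup>2 = c1 * (norm (J (wd 2 (z 0))))\<^sup>2" using c1 by (simp add: power_mult_distrib)
   also have "e * (4 * ((norm (J (y 0)))\<^sup>2 + c1 * (norm (J (wd 2 (z 0))))\<^sup>2) + 16 * \<beta>\<^sup>2) <= e * (16 * (1 + c1) * E\<^sup>2)"
   proof (rule mult_left_mono)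
    define p q where "p = norm (J (y 0))" and "q = norm (J (wd 2 (z 0)))"
    have pq: "p >= 0" "q >= 0" by (simp_all add: p_def q_def)
    have "p\<^sup>2 <= E\<^sup>2" "q\<^sup>2 <= E\<^sup>2" using pq \<beta> unfolding E_def p_def[symmetric] q_def[symmetric] by (intro power_mono; simp)+
    then have "c1 * q\<^sup>2 <= c1 * E\<^sup>2" using c1 by simp
    have "p\<^sup>2 + \<beta>\<^sup>2 <= E\<^sup>2"
    proof -
     have "(p + \<beta>)\<^sup>2 <= E\<^sup>2" using pq \<beta> unfolding E_def p_def[symmetric] q_def[symmetric] by (intro power_mono; simp)
     moreover have "(p + \<beta>)\<^sup>2 = p\<^sup>2 + \<beta>\<^sup>2 + 2 * p * \<beta>" by (simp add: power2_sum)
     moreover have "0 <= 2 * p * \<beta>" using pq \<beta> by simp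
     ultimately show ?thesis by linarith
    qed
    moreover have "0 <= c1 * E\<^sup>2" using c1 by simp
    ultimately have "4 * (p\<^sup>2 + c1 * q\<^sup>2) + 16 * \<beta>\<^sup>2 <= 16 * (E\<^sup>2 + c1 * E\<^sup>2)"
     using \<open>c1 * q\<^sup>2 <= c1 * E\<^sup>2\<close> zero_le_power2[of p] zero_le_power2[of \<beta>] zero_le_power2[of E] unfolding distrib_left by linarith
    then show "4 * ((norm (J (y 0)))\<^sup>2 + c1 * (norm (J (wd 2 (z 0))))\<^sup>2) + 16 * \<beta>\<^sup>2 <= 16 * (1 + c1) * E\<^sup>2"
     unfolding p_def[symmetric] q_def[symmetric] by (simp add: algebra_simps)
   qed (use e in auto)
   finally have "(norm (J (y s)))\<^sup>2 <= (e * (16 * (1 + c1))) * E\<^sup>2" by (simp add: mult.assoc)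
   then have "norm (J (y s)) <= sqrt ((e * (16 * (1 + c1))) * E\<^sup>2)" by (rule real_le_rsqrt)
   also have "\<dots> = K * E" using E by (simp add: K_def real_sqrt_mult)
   finally show ?thesis .
  qed
  have "norm (J (z t) - J (z 0)) <= K * E * \<bar>t - 0\<bar>"
   by (rule vector_derivative_norm_bound[where a = 0 and b = T and g' = "%t. J (y t)"]) (use mi t T y in \<open>auto simp: mild_def\<close>)
  also have "\<dots> <= K * E * T" using K E t by (intro mult_left_mono) auto
  finally have "norm (J (z t)) <= norm (J (z 0)) + K * T * E"
   using norm_triangle_sub[of "J (z t)" "J (z 0)"] by (simp add: mult_ac)
  then show "norm (J (z t)) <= norm (J (z 0)) + K * T * (norm (J (y 0)) + norm (J (wd 2 (z 0))) + integral {0..T} \<gamma>)"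
   by (simp add: E_def \<beta>_def)
 qed
qed

end

section \<open>Clamped smooth functions are mild solutions\<close>

lemma U01_closure_XT: "x : U01 ==> s : {0..T} ==> T > 0 ==> (x, s) : closure (XT T)"
 by (simp add: closure_XT)

lemma trace_t_pdiff:
 assumes T: "T > 0" and f: "bsm (XT T) f" and x: "x : U01" and s: "s : {0..T}"
 shows "pdiff 1 (trace_t T s f) x = trace_t T s (dX f) x"
proof (rule pdiff_real_eq)
 have "at x within {0..1} = at x" using x by (intro at_within_interior) simp
 then show "(trace_t T s f has_vector_derivative trace_t T s (dX f) x) (at x)"
  using trace_t_x_derivative[OF T f, of x s] x s by simp
qed

lemma trace_t_bsm: "T > 0 ==> bsm (XT T) f ==> s : {0..T} ==> bsm U01 (trace_t T s f)"
 by (rule snet_trace_t)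

lemma trace_t_L2: "T > 0 ==> bsm (XT T) f ==> s : {0..T} ==> trace_t T s f : L2 U01"
 by (intro bsm_L2 trace_t_bsm)

lemma bsm_pdiff: "bsm (XT T) f ==> bsm (XT T) (dX f)" "bsm (XT T) f ==> bsm (XT T) (dT f)"
 by (rule snet_pdiff; simp add: Basis_XT)+

text \<open>The quadratic remainder in \<open>t\<close> is uniform in \<open>x\<close>, and
  \<open>U01\<close> has measure 1, so the same constant bounds the remainder in the norm of
  \<open>l2\<close>.\<close>

lemma J_trace_t_derivative:
 assumes T: "T > 0" and f: "bsm (XT T) f" and t: "t : {0..T}"
 shows "((%s. J (trace_t T s f)) has_vector_derivative J (trace_t T t (dT f))) (at t within {0..T})"
proof -
 note f1 = bsm_pdiff(2)[OF f]
 obtain K where K: "K >= 0" "!!z. z : XT T ==> cmod (dT (dT f) z) <= K"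
  using bsm_bound0[OF bsm_pdiff(2)[OF f1]] by blast
 have [simp]: "measure lebesgue U01 = 1" by simp
 show ?thesis
 proof (rule has_vector_derivative_quadratic[where K = K])
  fix s assume s: "s : {0..T}"
  note L = trace_t_L2[OF T f s] trace_t_L2[OF T f t] trace_t_L2[OF T f1 t]
  define d where "d x = trace_t T s f x - trace_t T t f x - of_real (s - t) * trace_t T t (dT f) x" for x
  have dL: "d : L2 U01" unfolding d_def by (intro L2_diff L2_cmult L)
  have "J d = J (%x. trace_t T s f x - trace_t T t f x) - J (%x. of_real (s - t) * trace_t T t (dT f) x)"
   unfolding d_def by (rule J_diff[OF L2_diff[OF L(1,2)] L2_cmult[OF L(3)]])
  then have "J (trace_t T s f) - J (trace_t T t f) - (s - t) *\<^sub>R J (trace_t T t (dT f)) = J d"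
   unfolding J_diff[OF L(1,2)] J_scaleR[OF L(3)] by simp
  moreover have "norm (J d) <= K * (s - t)\<^sup>2"
  proof -
   have "L2norm U01 d <= sqrt (measure lebesgue U01) * \<bar>K * (s - t)\<^sup>2\<bar>"
   proof (rule bounded_L2(2)[OF nice_lmeasurable[OF nice_U01] L2D(1)[OF dL]])
    fix x assume x: "x : U01"
    have "cmod (bdval (XT T) f ((x, t) + (s - t) *\<^sub>R dirT) - bdval (XT T) f (x, t) - (s - t) *\<^sub>R bdval (XT T) (dT f) (x, t)) <= K * (s - t)\<^sup>2"
     by (rule bdval_quadratic[OF nice_XT[OF T] f]) (use K T x s t in \<open>auto simp: Basis_XT closure_XT\<close>)
    then show "cmod (d x) <= K * (s - t)\<^sup>2" by (simp add: d_def trace_t_def scaleR_conv_of_real)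
   qed
   then show ?thesis using K by (simp add: J_norm[OF dL])
  qed
  ultimately show "norm (J (trace_t T s f) - J (trace_t T t f) - (s - t) *\<^sub>R J (trace_t T t (dT f))) <= K * (s - t)\<^sup>2" by simp
 qed
qed

lemma J_trace_t_continuous:
 assumes "T > 0" "bsm (XT T) f" shows "continuous_on {0..T} (%t. J (trace_t T t f))"
 by (rule continuous_on_vector_derivative[OF J_trace_t_derivative[OF assms]])

lemma trace_x_closed:
 assumes T: "T > 0" and f: "bsm (XT T) f" and a: "a : {0..1}" and z: "!!t. t : {0<..<T} ==> trace_x T a f t = 0" and t: "t : {0..T}"
 shows "trace_x T a f t = 0"
proof -
 have "continuous_on {0..T} (trace_x T a f)"
  by (rule continuous_on_vector_derivative[OF trace_x_t_derivative[OF T f a]])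
 then have "continuous_on (closure {0<..<T}) (trace_x T a f)" by (simp add: closure_U[OF T])
 from continuous_constant_on_closure[OF this z] t show ?thesis by (simp add: closure_U[OF T])
qed

text \<open>The boundary conditions hold exactly, not just up to null nets. They are imposed on the
  open time interval, as in \<open>smooth_solution\<close>; \<open>trace_x_closed\<close> extends
  them to the corners by continuity.\<close>

definition clamped :: "real => (real \<times> real => complex) => bool" where
 "clamped T v \<longleftrightarrow> bsm (XT T) v \<and> (\<forall>a\<in>{0, 1}. \<forall>t\<in>{0<..<T}. trace_x T a v t = 0 \<and> trace_x T a (dX v) t = 0)"

text \<open>Value and slope vanish at both ends, so expanding from either endpoint gives decay of
  second order for the trace and of first order for its derivative, which is what
  \<open>bsm_H20_I\<close> asks for.\<close>

lemma clamped_trace_H20: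
 assumes T: "T > 0" and v: "clamped T v" and t: "t : {0..T}"
 shows "trace_t T t v : H20" "J (wd 2 (trace_t T t v)) = J (trace_t T t (dX (dX v)))"
proof -
 have vb: "bsm (XT T) v" using v by (simp add: clamped_def)
 note v1 = bsm_pdiff(1)[OF vb] note v2 = bsm_pdiff(1)[OF v1]
 obtain K where K: "K >= 0" "!!z. z : XT T ==> cmod (dX (dX v) z) <= K" using bsm_bound0[OF v2] by blast
 have z: "bdval (XT T) v (a, t) = 0" "bdval (XT T) (dX v) (a, t) = 0" if "a : {0, 1}" for a
  using trace_x_closed[OF T vb _ _ t, of a] trace_x_closed[OF T v1 _ _ t, of a] v that unfolding clamped_def trace_x_def by auto
 have q: "cmod (trace_t T t v x) <= K * (x - a)\<^sup>2" if a: "a : {0, 1}" and x: "x : U01" for a x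
 proof -
  have "cmod (bdval (XT T) v ((a, t) + (x - a) *\<^sub>R dirX) - bdval (XT T) v (a, t) - (x - a) *\<^sub>R bdval (XT T) (dX v) (a, t)) <= K * (x - a)\<^sup>2"
   by (rule bdval_quadratic[OF nice_XT[OF T] vb]) (use K T x a t in \<open>auto simp: Basis_XT closure_XT\<close>)
  then show ?thesis by (simp add: z[OF a] trace_t_def)
 qed
 have l: "cmod (trace_t T t (dX v) x) <= K * \<bar>x - a\<bar>" if a: "a : {0, 1}" and x: "x : U01" for a x
 proof -
  have "cmod (trace_t T t (dX v) x - trace_t T t (dX v) a) <= K * \<bar>x - a\<bar>"
  proof (rule vector_derivative_norm_bound[where a = 0 and b = 1])
   show "(trace_t T t (dX v) has_vector_derivative trace_t T t (dX (dX v)) s) (at s within {0..1})"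
    if "s : {0..1}" for s by (rule trace_t_x_derivative[OF T v1 that t])
   show "cmod (trace_t T t (dX (dX v)) s) <= K" if "s : {0..1}" for s
    unfolding trace_t_def by (rule bdval_bound[OF nice_XT[OF T] v2 K(2)]) (use that t T in \<open>auto simp: closure_XT\<close>)
  qed (use a x in auto)
  then show ?thesis by (simp add: trace_t_def z[OF a])
 qed
 note tb = trace_t_bsm[OF T vb t]
 show "trace_t T t v : H20"
 proof (rule bsm_H20_I[OF tb, where M = K])
  fix x :: real assume x: "x : U01"
  show "cmod (trace_t T t v x) <= K * (min x (1 - x))\<^sup>2"
   using q[of 0 x] q[of 1 x] x by (simp add: min_def power2_commute)
  show "cmod (pdiff 1 (trace_t T t v) x) <= K * min x (1 - x)"
   unfolding trace_t_pdiff[OF T vb x t] using l[of 0 x] l[of 1 x] x by (simp add: min_def)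
 qed
 have "J (wd 2 (trace_t T t v)) = J ((pdiff 1 ^^ 2) (trace_t T t v))" by (rule bsm_H2(2)[OF tb])
 also have "\<dots> = J (trace_t T t (dX (dX v)))"
 proof (rule J_cong)
  have two: "(pdiff 1 ^^ 2) (trace_t T t v) = pdiff 1 (pdiff 1 (trace_t T t v))" by (simp add: numeral_2_eq_2)
  show "(pdiff 1 ^^ 2) (trace_t T t v) : L2 U01" unfolding two by (intro bsm_L2 snet_pdiff tb; simp)
  show "trace_t T t (dX (dX v)) : L2 U01" by (rule trace_t_L2[OF T v2 t])
  show "AE x in lebU. (pdiff 1 ^^ 2) (trace_t T t v) x = trace_t T t (dX (dX v)) x"
  proof (rule AE_I2)
   fix x assume "x : space (lebU)"
   then have x: "x : U01" by simp
   have "pdiff 1 (pdiff 1 (trace_t T t v)) x = pdiff 1 (trace_t T t (dX v)) x"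
    by (rule pdiff_cong[OF _ x trace_t_pdiff[OF T vb _ t]]) auto
   then show "(pdiff 1 ^^ 2) (trace_t T t v) x = trace_t T t (dX (dX v)) x"
    by (simp add: two trace_t_pdiff[OF T v1 x t])
  qed
 qed
 finally show "J (wd 2 (trace_t T t v)) = J (trace_t T t (dX (dX v)))" .
qed

lemma bsm_slice:
 assumes T: "T > 0" and F: "bsm (XT T) F" and s: "s : {0<..<T}"
 shows "bsm U01 (%x. F (x, s))" "!!x. x : U01 ==> trace_t T s F x = F (x, s)"
  "!!x. x : U01 ==> pdiff 1 (%x. F (x, s)) x = dX F (x, s)"
proof -
 show tr: "trace_t T s F x = F (x, s)" if "x : U01" for x
  unfolding trace_t_def by (rule bdval_inside[OF nice_XT[OF T] F XT_I[OF that s]])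
 have "bsm U01 (trace_t T s F)" using s by (intro trace_t_bsm[OF T F]) auto
 then show "bsm U01 (%x. F (x, s))" by (rule snet_cong[rotated]) (simp_all add: tr)
 show "pdiff 1 (%x. F (x, s)) x = dX F (x, s)" if "x : U01" for x
  by (rule pdiff_real_eq[OF pdiff_slice_x[OF snet_differentiable[OF F open_XT, of 1]]]) (use XT_I[OF that s] in auto)
qed

definition plate_op :: "(real \<times> real => complex) => (real => complex) => (real \<times> real => complex) => real \<times> real => complex" where
 "plate_op b c v z = dT (dT v) z + dX (dX (%y. c (fst y) * dX (dX v) y)) z
   + b z * dX (dX v) z"

context plate
begin

lemma plate_op_bsm: "bsm (XT T) v ==> bsm (XT T) (plate_op b c v)"
 unfolding plate_op_def[abs_def]
 by (intro bsm_add bsm_mult bsm_pdiff snet_lift_x[OF c_smooth] b_smooth open_XT)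

text \<open>At a fixed time the moment \<open>q = c * v_xx\<close> is paired with \<open>ph\<close>
  in \<open>H20\<close>, which absorbs both integrations by parts. What remains of
  \<open>rhs\<close> is the pairing with the second time derivative, and its time integral is given
  by the fundamental theorem of calculus.\<close>

theorem clamped_mild:
 assumes v: "clamped T v"
 shows "mild (plate_op b c v) (%t. trace_t T t v) (%t. trace_t T t (dT v))"
proof -
 have vb: "bsm (XT T) v" using v by (simp add: clamped_def)
 note v1 = bsm_pdiff(1)[OF vb] note v2 = bsm_pdiff(1)[OF v1]
 note y1 = bsm_pdiff(2)[OF vb] note y2 = bsm_pdiff(2)[OF y1]
 define F where "F y = c (fst y) * dX (dX v) y" for y
 have Fb: "bsm (XT T) F" unfolding F_def[abs_def] by (intro bsm_mult snet_lift_x[OF c_smooth] v2 open_XT)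
 note F1 = bsm_pdiff(1)[OF Fb] note F2 = bsm_pdiff(1)[OF F1]
 show ?thesis unfolding mild_def
 proof (intro conjI ballI allI impI)
  fix t assume t: "t : {0..T}"
  show "trace_t T t v : H20" by (rule clamped_trace_H20(1)[OF T v t])
  show "trace_t T t (dT v) : L2 U01" by (rule trace_t_L2[OF T y1 t])
  show "((%t. J (trace_t T t v)) has_vector_derivative J (trace_t T t (dT v))) (at t within {0..T})"
   by (rule J_trace_t_derivative[OF T vb t])
 next
  show "continuous_on {0..T} (%t. J (trace_t T t (dT v)))" by (rule J_trace_t_continuous[OF T y1])
  show "continuous_on {0..T} (%t. J (wd 2 (trace_t T t v)))"
   by (rule continuous_on_eq[OF J_trace_t_continuous[OF T v2]]) (simp add: clamped_trace_H20(2)[OF T v])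
 next
  fix ph and t1 t2 :: real assume ph: "ph : H20" and t: "0 <= t1" "t1 <= t2" "t2 <= T"
  have "((%s. inner (J (trace_t T s (dT (dT v)))) (J ph)) has_integral
   inner (J (trace_t T t2 (dT v))) (J ph) - inner (J (trace_t T t1 (dT v))) (J ph)) {t1..t2}"
  proof (rule fundamental_theorem_of_calculus[OF t(2)])
   fix s assume s: "s : {t1..t2}"
   have "((%s. J (trace_t T s (dT v))) has_vector_derivative J (trace_t T s (dT (dT v)))) (at s within {t1..t2})"
    by (rule has_vector_derivative_within_subset[OF J_trace_t_derivative[OF T y1]]) (use s t in auto)
   then show "((%s. inner (J (trace_t T s (dT v))) (J ph)) has_vector_derivative inner (J (trace_t T s (dT (dT v)))) (J ph)) (at s within {t1..t2})"
    by (rule bounded_linear.has_vector_derivative[OF bounded_linear_inner_left])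
  qed
  then have "((%s. rhs (plate_op b c v) (wd 2 (trace_t T s v)) ph s) has_integral
   inner (J (trace_t T t2 (dT v))) (J ph) - inner (J (trace_t T t1 (dT v))) (J ph)) {t1..t2}"
  proof (rule has_integral_spike[where S = "{0, T}", rotated 2])
   show "negligible {0, T}" by simp
   fix s assume "s : {t1..t2} - {0, T}"
   then have s: "s : {0<..<T}" "s : {0..T}" using t by auto
   define q where "q x = F (x, s)" for x
   have qb: "bsm U01 q" unfolding q_def[abs_def] by (rule bsm_slice(1)[OF T Fb s(1)])
   have q2: "pdiff 1 (pdiff 1 q) x = dX (dX F) (x, s)" if x: "x : U01" for x
   proof -
    have "pdiff 1 (pdiff 1 q) x = pdiff 1 (%x. dX F (x, s)) x"
     unfolding q_def[abs_def] by (rule pdiff_cong[OF _ x bsm_slice(3)[OF T Fb s(1)]]) auto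
    then show ?thesis by (simp add: bsm_slice(3)[OF T F1 s(1) x])
   qed
   define w where "w x = dX (dX v) (x, s)" for x
   have wL: "w : L2 U01" unfolding w_def[abs_def] by (rule bsm_L2[OF bsm_slice(1)[OF T v2 s(1)]])
   have yL: "(%x. dT (dT v) (x, s)) : L2 U01" by (rule bsm_L2[OF bsm_slice(1)[OF T y2 s(1)]])
   have qL: "pdiff 1 (pdiff 1 q) : L2 U01" by (intro bsm_L2 snet_pdiff qb; simp)
   have phL: "ph : L2 U01" by (rule H20_L2[OF ph])
   have J1: "J (wd 2 (trace_t T s v)) = J w"
    unfolding clamped_trace_H20(2)[OF T v s(2)]
    by (rule J_cong[OF trace_t_L2[OF T v2 s(2)] wL], rule AE_I2) (simp add: w_def bsm_slice(2)[OF T v2 s(1)])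
   have J2: "J (trace_t T s (dT (dT v))) = J (%x. dT (dT v) (x, s))"
    by (rule J_cong[OF trace_t_L2[OF T y2 s(2)] yL], rule AE_I2) (simp add: bsm_slice(2)[OF T y2 s(1)])
   have "rhs (plate_op b c v) (wd 2 (trace_t T s v)) ph s = rhs (plate_op b c v) w ph s"
    by (rule rhs_J_cong[OF s(1) H20_wd[OF clamped_trace_H20(1)[OF T v s(2)]] wL J1 ph])
   also have "\<dots> = Re (L2ip (%x. dT (dT v) (x, s)) ph)"
   proof -
    have "L2ip (%x. plate_op b c v (x, s)) ph = L2ip (%x. (dT (dT v) (x, s) + pdiff 1 (pdiff 1 q) x) + b (x, s) * w x) ph"
     unfolding L2ip_def
     by (intro bochner_cong) (auto simp: plate_op_def q2 w_def F_def[abs_def, symmetric])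
    also have "\<dots> = L2ip (%x. dT (dT v) (x, s)) ph + L2ip (pdiff 1 (pdiff 1 q)) ph + L2ip (%x. b (x, s) * w x) ph"
     unfolding L2ip_add_left[OF L2_add[OF yL qL] L2_coefficients(2)[OF wL s(1)] phL] L2ip_add_left[OF yL qL phL] ..
    finally show ?thesis
     using L2ip_bsm_H20[OF qb ph] by (simp add: rhs_def q_def[abs_def] F_def w_def)
   qed
   also have "\<dots> = inner (J (trace_t T s (dT (dT v)))) (J ph)"
    unfolding J2 by (rule J_inner[OF yL phL, symmetric])
   finally show "rhs (plate_op b c v) (wd 2 (trace_t T s v)) ph s = inner (J (trace_t T s (dT (dT v)))) (J ph)" .
  qed
  then show "((%s. rhs (plate_op b c v) (wd 2 (trace_t T s v)) ph s) has_integral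
   inner (J (trace_t T t2 (dT v)) - J (trace_t T t1 (dT v))) (J ph)) {t1..t2}"
   by (simp add: inner_diff_left)
 qed
qed

end

section \<open>Weak solutions are mild solutions\<close>

lemma H20_scaleR:
 assumes v: "v : H20" shows "(%x. of_real r * v x) : H20"
proof -
 have vH: "v : H2" by (rule H20_H2[OF v])
 have wk: "weak_deriv k (%x. of_real r * f x) (%x. of_real r * z x)" if "weak_deriv k f z" for k f z
  using that by (simp add: weak_deriv_def mult.assoc mult.left_commute)
 have sc: "(%x. of_real r * f x) : H2" "k <= 2 ==> J (wd k (%x. of_real r * f x)) = r *\<^sub>R J (wd k f)" if f: "f : H2" for f k
 proof -
  show "(%x. of_real r * f x) : H2"
   using L2_cmult[OF H2_L2[OF f]] L2_cmult[OF H2_wd(1)[OF f]] wk[OF H2_wd(2)[OF f]] unfolding H2_def by blast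
  show "J (wd k (%x. of_real r * f x)) = r *\<^sub>R J (wd k f)" if "k <= 2"
   unfolding wd_eq(3)[OF L2_cmult[OF H2_wd(1)[OF f that]] wk[OF H2_wd(2)[OF f that]]] by (rule J_scaleR[OF H2_wd(1)[OF f that]])
 qed
 obtain ph where ph: "!!n. ph n : test_fun U01" "!!k. k <= 2 ==> (%n. J (wd k (ph n))) \<longlonglongrightarrow> J (wd k v)"
  using H20_approx[OF v] by blast
 have H: "ph n : H2" for n by (rule bsm_H2(1)[OF test_fun_bsm[OF ph(1)]])
 show ?thesis
 proof (rule H20_I[where ph = "%n x. of_real r * ph n x", OF sc(1)[OF vH]])
  show "(%x. of_real r * ph n x) : test_fun U01" for n
  proof -
   obtain K where K: "compact K" "K \<subseteq> U01" "!!z. z \<notin> K ==> ph n z = 0" using ph(1)[of n] unfolding test_fun_def by blast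
   have "bsm UNIV (%x. of_real r * ph n x)" by (intro bsm_mult bsm_const test_fun_bsm[OF ph(1)]) simp
   then have "smooth_on UNIV (%x. of_real r * ph n x)" using snet_smooth[of UNIV UNIV _ 1] by simp
   then show ?thesis by (rule test_funI[OF _ K(1,2)]) (simp add: K(3))
  qed
  show "(%n. J (wd k (%x. of_real r * ph n x))) \<longlonglongrightarrow> J (wd k (%x. of_real r * v x))" if "k <= 2" for k
   unfolding sc(2)[OF H that] sc(2)[OF vH that] by (intro tendsto_scaleR tendsto_const ph(2) that)
 qed
qed

lemma continuous_on_dominated:
 assumes "continuous_on S G" "!!s t. s : S ==> t : S ==> dist (F s) (F t) <= C * dist (G s) (G t)"
 shows "continuous_on S F"
 unfolding continuous_on_def
proof
 fix t assume t: "t : S"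
 have "((%s. C * dist (G s) (G t)) \<longlongrightarrow> C * dist (G t) (G t)) (at t within S)"
  using assms(1) t by (intro tendsto_intros) (simp add: continuous_on_def)
 then have l: "((%s. C * dist (G s) (G t)) \<longlongrightarrow> 0) (at t within S)" by simp
 have "((%s. dist (F s) (F t)) \<longlongrightarrow> 0) (at t within S)"
  by (rule Lim_null_comparison[OF _ l]) (use assms(2) t in \<open>auto simp: eventually_at_filter\<close>)
 then show "(F \<longlongrightarrow> F t) (at t within S)" by (rule tendsto_dist_iff[THEN iffD2])
qed

lemma L2ip_continuous_on:
 assumes "continuous_on S (%t. J (f t))" "!!t. t : S ==> f t : L2 U01" and v: "v : L2 U01"
 shows "continuous_on S (%t. L2ip (f t) v)"
proof (rule continuous_on_dominated[OF assms(1), where C = "L2norm U01 v"])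
 fix s t assume st: "s : S" "t : S"
 have "cmod (L2ip (%x. f s x - f t x) v) <= L2norm U01 (%x. f s x - f t x) * L2norm U01 v"
  by (intro L2ip_bound L2_diff assms st)
 then show "dist (L2ip (f s) v) (L2ip (f t) v) <= L2norm U01 v * dist (J (f s)) (J (f t))"
  using assms(2)[OF st(1)] assms(2)[OF st(2)] v by (simp add: dist_norm J_norm_diff L2ip_diff_left mult.commute)
qed

lemma AE_on_negligible:
 fixes S :: "'a::euclidean_space set"
 assumes "AE t in lebesgue_on S. P t" "S : sets lebesgue"
 obtains N where "negligible N" "!!t. t : S - N ==> P t"
proof -
 have "AE t in lebesgue. t : S --> P t" using assms by (subst (asm) AE_restrict_space_iff) auto
 then obtain N where N: "{t : space lebesgue. \<not> (t : S --> P t)} \<subseteq> N" "emeasure lebesgue N = 0" "N : sets lebesgue" by (rule AE_E)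
 then have "negligible N" by (auto simp: negligible_iff_null_sets null_sets_def)
 then show thesis by (rule that) (use N(1) in auto)
qed

lemma negligible_AE_on:
 fixes S :: "'a::euclidean_space set"
 assumes "negligible N" "!!t. t : S - N ==> P t" "S : sets lebesgue"
 shows "AE t in lebesgue_on S. P t"
proof -
 have "AE t in lebesgue. t : S --> P t"
  by (rule AE_I'[of N]) (use assms in \<open>auto simp: negligible_iff_null_sets\<close>)
 then show ?thesis using assms(3) by (subst AE_restrict_space_iff) auto
qed

text \<open>Brings a distributional time derivative into integrated form: \<open>k\<close> and
  \<open>l\<close> are what \<open>time_deriv\<close> speaks about, while \<open>K\<close> and
  \<open>L\<close> agree with them off a null set and have the required regularity.\<close>

lemma weak_time_derivative:
 fixes k l K L :: "real => complex"
 assumes test: "!!ph. ph : test_fun {0<..<T} ==>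
   (LINT t|lebT T. pdiff 1 ph t * k t) = - (LINT t|lebT T. ph t * l t)"
  and N: "negligible N" and k: "!!t. t : {0<..<T} - N ==> k t = K t" and l: "!!t. t : {0<..<T} - N ==> l t = L t"
  and K: "continuous_on {0..T} K" and L: "integrable (lebT T) L" and t: "0 <= t1" "t1 <= t2" "t2 <= T"
 shows "((%t. Re (L t)) has_integral Re (K t2 - K t1)) {t1..t2}"
proof -
 have ael: "AE t in lebT T. l t = L t" by (rule negligible_AE_on[OF N l]) auto
 have lm: "l : bmeas (lebT T)"
  by (rule measurable_lebesgue_on_AE[OF borel_measurable_integrable[OF L] _ ael]) simp
 have li: "integrable (lebT T) l"
  by (rule integrable_cong_AE_imp[OF L lm]) (use ael in \<open>simp add: eq_commute\<close>)
 have "(l has_integral (K t2 - K t1)) {t1..t2}"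
  by (rule du_bois_reymond_has_integral[OF test negligible_AE_on[OF N k] K li t]) auto
 then have "(L has_integral (K t2 - K t1)) {t1..t2}"
  by (rule has_integral_spike[where S = "N \<union> {0, T}", rotated 2]) (use N l t in \<open>auto intro: negligible_Un\<close>)
 from has_integral_linear[OF this bounded_linear_Re] show ?thesis by (simp add: o_def)
qed

text \<open>Borel representatives of \<open>g\<close> and \<open>v\<close> turn the pairing into a
  measurable parameter integral, with which it agrees off a null set of times.\<close>

lemma L2ip_slice_measurable:
 assumes g: "g : L2 (XT T)" and v: "v : L2 U01"
 shows "(%t. L2ip (%x. g (x, t)) v) : bmeas (lebT T)"
proof -
 obtain g0 where g0: "g0 : bmeas borel" "AE z in lborel. z : XT T --> g z = g0 z"
  by (rule lebesgue_AE_borel[OF L2D(1)[OF g] borel_open[OF open_XT]])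
 obtain v0 where v0: "v0 : bmeas borel" "AE x in lborel. x : U01 --> v x = v0 x"
  by (rule lebesgue_AE_borel[OF L2D(1)[OF v]]) auto
 define m where "m t = (LINT x|lborel. indicator U01 x *\<^sub>R (g0 (x, t) * cnj (v0 x)))" for t
 have g0p: "g0 : bmeas (borel \<Otimes>\<^sub>M borel)" using g0(1) by (simp add: borel_prod)
 have sl: "(%x. g0 (x, t)) : bmeas borel" for t
  by (rule measurable_compose[OF _ g0p]) measurable
 have "(%(t, x). indicator U01 x *\<^sub>R (g0 (x, t) * cnj (v0 x))) : bmeas (borel \<Otimes>\<^sub>M lborel)"
 proof -
  have 1: "(%p. g0 (snd p, fst p)) : bmeas (borel \<Otimes>\<^sub>M lborel)"
   by (rule measurable_compose[OF _ g0p]) measurable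
  have 2: "(%p. v0 (snd p)) : bmeas ((borel :: real measure) \<Otimes>\<^sub>M lborel)"
   by (rule measurable_compose[OF _ v0(1)]) measurable
  have 3: "(%p. cnj (v0 (snd p))) : bmeas ((borel :: real measure) \<Otimes>\<^sub>M lborel)"
   by (rule measurable_compose[OF 2]) (intro borel_measurable_continuous_onI continuous_intros)
  have 4: "(%p. indicat_real U01 (snd p)) : bmeas ((borel :: real measure) \<Otimes>\<^sub>M lborel)"
   by (rule measurable_compose[OF measurable_snd]) simp
  show ?thesis unfolding split_beta' by (intro borel_measurable_scaleR borel_measurable_times 1 3 4)
 qed
 then have mm: "m : bmeas borel" unfolding m_def by (rule lborel.borel_measurable_lebesgue_integral)
 have mm': "m : bmeas (lebT T)"
  using mm by (intro measurable_restrict_space1 measurable_completion) simp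
 obtain N0 where N0: "negligible N0" "!!t. t \<notin> N0 ==> AE x in lborel. (x, t) : XT T --> g (x, t) = g0 (x, t)"
  by (rule AE_lborel_negligible[OF AE_slices[OF g0(2)]]) blast
 have eq: "L2ip (%x. g (x, t)) v = m t" if t: "t : {0<..<T} - N0" for t
 proof -
  have ae: "AE x in lebU. g (x, t) * cnj (v x) = g0 (x, t) * cnj (v0 x)"
  proof (rule AE_lebesgue_on_open)
   have "AE x in lborel. (x, t) : XT T --> g (x, t) = g0 (x, t)" using N0(2) t by auto
   then show "AE x in lborel. x : U01 --> g (x, t) * cnj (v x) = g0 (x, t) * cnj (v0 x)"
    using v0(2) by eventually_elim (use t in \<open>auto simp: XT_def\<close>)
  qed simp
  have m0: "(%x. g0 (x, t) * cnj (v0 x)) : bmeas borel"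
   by (intro borel_measurable_times sl measurable_compose[OF v0(1)] borel_measurable_continuous_onI continuous_intros)
  then have m1: "(%x. g0 (x, t) * cnj (v0 x)) : bmeas (lebU)"
   by (intro measurable_restrict_space1 measurable_completion) simp
  have "L2ip (%x. g (x, t)) v = (LINT x|lebU. g0 (x, t) * cnj (v0 x))"
   unfolding L2ip_def
   by (rule integral_cong_AE[OF measurable_lebesgue_on_AE[OF m1 _ ae] m1 ae]) simp
  also have "\<dots> = (LINT x|lebesgue. indicator U01 x *\<^sub>R (g0 (x, t) * cnj (v0 x)))"
   by (subst integral_restrict_space) auto
  also have "\<dots> = m t" unfolding m_def using m0 by (intro integral_completion) simp
  finally show ?thesis .
 qed
 show ?thesis by (rule measurable_lebesgue_on_AE[OF mm' _ negligible_AE_on[OF N0(1) eq]]) auto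
qed

text \<open>
 \<open>J (W t)\<close> is differentiable as soon as this holds weakly against \<open>H\<^sup>2\<^sub>0\<close>, because the
 difference quotients lie in the closure of \<open>J ` H\<^sup>2\<^sub>0\<close>.
\<close>

lemma J_H20_derivative:
 assumes W: "!!t. t : {0..T} ==> W t : H20" and W1c: "continuous_on {0..T} (%t. J (W1 t))"
  and W1: "!!t. t : {0..T} ==> W1 t : L2 U01"
  and N: "negligible N" "!!t. t : {0<..<T} - N ==> \<exists>v\<in>H20. J (W1 t) = J v"
  and int: "!!v t1 t2. v : H20 ==> 0 <= t1 ==> t1 <= t2 ==> t2 <= T ==>
   ((%s. inner (J (W1 s)) (J v)) has_integral inner (J (W t2) - J (W t1)) (J v)) {t1..t2}"
  and T: "0 < T" and t: "t : {0..T}"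
 shows "((%t. J (W t)) has_vector_derivative J (W1 t)) (at t within {0..T})"
proof -
 \<comment> \<open>Every neighbourhood of \<open>t\<close> contains times outside \<open>N\<close>,
   at which \<open>J (W1 s)\<close> comes from an element of \<open>H20\<close>; continuity carries
   the approximation over to \<open>t\<close>.\<close>
 have dense: "\<exists>v\<in>H20. norm (J (W1 t) - J v) < e" if e: "e > 0" for e
 proof -
  obtain d where d: "d > 0" "!!s. s : {0..T} ==> dist s t < d ==> dist (J (W1 s)) (J (W1 t)) < e"
   using W1c t e unfolding continuous_on_iff by metis
  define I where "I = {max 0 (t - d)<..<min T (t + d)}"
  have "max 0 (t - d) < min T (t + d)" using t T d(1) by auto
  moreover have "negligible I \<longleftrightarrow> min T (t + d) <= max 0 (t - d)"
   unfolding I_def using negligible_interval(2)[of "max 0 (t - d)" "min T (t + d)"]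
   by (simp only: box_real greaterThanLessThan_empty_iff)
  ultimately have "\<not> negligible I" by (simp only: not_le)
  then have "\<not> I \<subseteq> N" using N(1) negligible_subset by blast
  then obtain s where s: "s : I" "s \<notin> N" by blast
  then obtain v where "v : H20" "J (W1 s) = J v" using N(2)[of s] by (auto simp: I_def)
  moreover have "dist (J (W1 s)) (J (W1 t)) < e" by (rule d(2)) (use s in \<open>auto simp: I_def dist_real_def\<close>)
  ultimately show ?thesis by (auto simp: dist_norm norm_minus_commute)
 qed
 have bound: "norm (J (W s) - J (W t) - (s - t) *\<^sub>R J (W1 t)) <= \<omega> * \<bar>s - t\<bar>"
  if s: "s : {0..T}" and \<omega>: "!!r. r : {min s t..max s t} ==> norm (J (W1 r) - J (W1 t)) <= \<omega>" for s \<omega>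
 proof -
  define D where "D = J (W s) - J (W t) - (s - t) *\<^sub>R J (W1 t)"
  have \<omega>0: "\<omega> >= 0" using order_trans[OF norm_ge_zero \<omega>[of t]] by simp
  have D1: "inner D (J v) <= \<omega> * \<bar>s - t\<bar> * norm (J v)" if v: "v : H20" for v
  proof -
   define a b where "a = min s t" and "b = max s t"
   have ab: "0 <= a" "a <= b" "b <= T" using s t by (auto simp: a_def b_def)
   have hi: "((%r. inner (J (W1 r)) (J v) - inner (J (W1 t)) (J v)) has_integral
     inner (J (W b) - J (W a)) (J v) - (b - a) *\<^sub>R inner (J (W1 t)) (J v)) {a..b}"
    using has_integral_diff[OF int[OF v ab] has_integral_const_real[of "inner (J (W1 t)) (J v)" a b]] ab by simp
   have hb: "norm (inner (J (W1 r)) (J v) - inner (J (W1 t)) (J v)) <= \<omega> * norm (J v)" if "r : {a..b} - {}" for r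
   proof -
    have "norm (inner (J (W1 r) - J (W1 t)) (J v)) <= norm (J (W1 r) - J (W1 t)) * norm (J v)" using Cauchy_Schwarz_ineq2 by simp
    also have "\<dots> <= \<omega> * norm (J v)" using \<omega>[of r] that by (intro mult_right_mono) (auto simp: a_def b_def)
    finally show ?thesis by (simp add: inner_diff_left)
   qed
   have "norm (inner (J (W b) - J (W a)) (J v) - (b - a) *\<^sub>R inner (J (W1 t)) (J v)) <= \<omega> * norm (J v) * (b - a)"
    using has_integral_bound_real[OF _ finite.emptyI hi hb] \<omega>0 ab by (simp add: content_real)
   moreover have "\<bar>inner D (J v)\<bar> = \<bar>inner (J (W b) - J (W a)) (J v) - (b - a) *\<^sub>R inner (J (W1 t)) (J v)\<bar>"
   proof (cases "s <= t")
    case True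
    then have "inner D (J v) = - (inner (J (W b) - J (W a)) (J v) - (b - a) *\<^sub>R inner (J (W1 t)) (J v))"
     by (simp add: D_def a_def b_def inner_diff_left algebra_simps)
    then show ?thesis by (metis abs_minus_cancel)
   qed (simp add: D_def a_def b_def inner_diff_left)
   moreover have "b - a = \<bar>s - t\<bar>" by (simp add: a_def b_def)
   ultimately show ?thesis by (simp add: mult_ac)
  qed
  have ap: "\<exists>v\<in>H20. norm (D - J v) < e" if e: "e > 0" for e
  proof -
   obtain u where u: "u : H20" "norm (J (W1 t) - J u) < e / (1 + \<bar>s - t\<bar>)" using dense[of "e / (1 + \<bar>s - t\<bar>)"] e by auto
   define v where "v x = (W s x - W t x) - of_real (s - t) * u x" for x
   have v: "v : H20" unfolding v_def by (intro H20_diff H20_scaleR u W s t)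
   have L: "W s : L2 U01" "W t : L2 U01" "u : L2 U01" by (intro H2_L2 H20_H2 W s t u)+
   have "J v = (J (W s) - J (W t)) - (s - t) *\<^sub>R J u"
    unfolding v_def J_diff[OF L2_diff[OF L(1,2)] L2_cmult[OF L(3)]] J_diff[OF L(1,2)] J_scaleR[OF L(3)] ..
   then have "D - J v = - ((s - t) *\<^sub>R (J (W1 t) - J u))" by (simp add: D_def scaleR_diff_right)
   then have "norm (D - J v) = \<bar>s - t\<bar> * norm (J (W1 t) - J u)" by simp
   also have "\<dots> <= \<bar>s - t\<bar> * (e / (1 + \<bar>s - t\<bar>))" using u(2) by (intro mult_left_mono) auto
   also have "\<dots> < e" using e by (simp add: field_simps)
   finally show ?thesis using v by blast
  qed
  define C where "C = \<omega> * \<bar>s - t\<bar>"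
  have C: "C >= 0" using \<omega>0 by (simp add: C_def)
  \<comment> \<open>\<open>D\<close> is tested against its own approximations \<open>J v\<close>,
    the Cauchy-Schwarz inequality read backwards; the errors are made small through
    \<open>e'\<close>.\<close>
  have "(norm D)\<^sup>2 <= C * norm D"
  proof (rule field_le_epsilon)
   fix e :: real assume e: "e > 0"
   define e' where "e' = e / (norm D + C + 1)"
   have p: "norm D + C + 1 > 0" using C norm_ge_zero[of D] by linarith
   then have e': "e' > 0" using e by (simp add: e'_def)
   obtain v where v: "v : H20" "norm (D - J v) < e'" using ap[OF e'] by blast
   have "(norm D)\<^sup>2 = inner D (J v) + inner D (D - J v)" by (simp add: inner_diff_right power2_norm_eq_inner)
   also have "inner D (J v) <= C * norm (J v)" using D1[OF v(1)] by (simp add: C_def)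
   also have "inner D (D - J v) <= norm D * e'"
    using norm_cauchy_schwarz[of D "D - J v"] mult_left_mono[of "norm (D - J v)" e' "norm D"] v(2) by simp
   also have "C * norm (J v) <= C * (norm D + e')"
    using norm_triangle_sub[of "J v" D] v(2) C by (intro mult_left_mono) (auto simp: norm_minus_commute)
   finally have "(norm D)\<^sup>2 <= C * norm D + e' * (norm D + C)" by (simp add: algebra_simps)
   also have "e' * (norm D + C) <= e' * (norm D + C + 1)" using e' by simp
   also have "\<dots> = e" using p by (simp add: e'_def)
   finally show "(norm D)\<^sup>2 <= C * norm D + e" by simp
  qed
  then have "norm D <= C" using C by (cases "D = 0") (auto simp: power2_eq_square)
  then show ?thesis by (simp add: D_def C_def)
 qed
 show ?thesis
  unfolding has_vector_derivative_def has_derivative_within_alt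
 proof (intro conjI allI impI bounded_linear_scaleR_left)
  fix e :: real assume e: "e > 0"
  obtain d where d: "d > 0" "!!s. s : {0..T} ==> dist s t < d ==> dist (J (W1 s)) (J (W1 t)) < e"
   using W1c t e unfolding continuous_on_iff by metis
  show "\<exists>d>0. \<forall>s\<in>{0..T}. norm (s - t) < d --> norm (J (W s) - J (W t) - (s - t) *\<^sub>R J (W1 t)) <= e * norm (s - t)"
  proof (intro exI[of _ d] conjI d ballI impI)
   fix s assume s: "s : {0..T}" "norm (s - t) < d"
   have "norm (J (W1 r) - J (W1 t)) <= e" if "r : {min s t..max s t}" for r
    using d(2)[of r] that s t by (force simp: dist_norm dist_real_def min_def max_def split: if_splits)
   from bound[OF s(1) this] show "norm (J (W s) - J (W t) - (s - t) *\<^sub>R J (W1 t)) <= e * norm (s - t)" by simp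
  qed
 qed
qed

context plate
begin

lemma b_continuous_time:
 obtains L where "L >= 0" "!!x s t. x : U01 ==> s : {0<..<T} ==> t : {0<..<T} ==> cmod (b (x, s) - b (x, t)) <= L * \<bar>s - t\<bar>"
proof -
 obtain A where A: "A >= 0" "!!z. z : XT T ==> cmod (dX b z) <= A"
  using bsm_bound0[OF snet_pdiff[OF b_smooth, of dirX]] by (auto simp: Basis_XT)
 obtain B where B: "B >= 0" "!!z. z : XT T ==> cmod (dT b z) <= B"
  using bsm_bound0[OF snet_pdiff[OF b_smooth, of dirT]] by (auto simp: Basis_XT)
 show thesis
 proof (rule that[of "2 * max A B"])
  show "2 * max A B >= 0" using A by auto
  fix x s t assume x: "x : U01" and s: "s : {0<..<T}" and t: "t : {0<..<T}"
  have "cmod (b (x, s) - b (x, t)) <= real DIM(real \<times> real) * max A B * dist (x, s) (x, t)"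
  proof (rule bsm_Lipschitz[OF b_smooth open_XT convex_XT _ XT_I[OF x s] XT_I[OF x t]])
   fix e z assume e: "e : (Basis :: (real \<times> real) set)" and z: "z : XT T"
   consider "e = dirX" | "e = dirT" using e unfolding Basis_XT by blast
   then show "cmod (pdiff e b z) <= max A B" using A(2)[OF z] B(2)[OF z] by cases auto
  qed
  then show "cmod (b (x, s) - b (x, t)) <= 2 * max A B * \<bar>s - t\<bar>" by (simp add: dist_Pair_Pair dist_real_def)
 qed
qed

text \<open>Restricted to the open interval because \<open>b\<close> is controlled on the open
  rectangle only. The increment splits into the change of \<open>w\<close> and the Lipschitz change
  of \<open>b\<close> in time.\<close>

lemma L2ip_b_continuous_on:
 assumes w: "continuous_on {0..T} (%t. J (w t))" "!!t. t : {0..T} ==> w t : L2 U01" and v: "v : L2 U01"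
 shows "continuous_on {0<..<T} (%t. L2ip (%x. b (x, t) * w t x) v)"
proof (rule L2ip_continuous_on[OF _ _ v])
 show "(%x. b (x, t) * w t x) : L2 U01" if "t : {0<..<T}" for t
  using that w(2)[of t] by (intro L2_coefficients(2)) auto
 have sub: "{0<..<T} \<subseteq> {0..T}" by auto
 obtain L where L: "L >= 0" "!!x s t. x : U01 ==> s : {0<..<T} ==> t : {0<..<T} ==> cmod (b (x, s) - b (x, t)) <= L * \<bar>s - t\<bar>"
  using b_continuous_time by blast
 show "continuous_on {0<..<T} (%t. J (%x. b (x, t) * w t x))"
  unfolding continuous_on_def
 proof
  fix t assume t: "t : {0<..<T}"
  have t': "t : {0..T}" using t by auto
  have wt: "w t : L2 U01" by (rule w(2)[OF t'])
  have wl: "((%s. J (w s)) \<longlongrightarrow> J (w t)) (at t within {0<..<T})"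
   using continuous_on_subset[OF w(1) sub] t by (simp add: continuous_on_def)
  have "((%s. Cb * norm (J (w s) - J (w t)) + L * \<bar>s - t\<bar> * norm (J (w t))) \<longlongrightarrow>
    Cb * norm (J (w t) - J (w t)) + L * \<bar>t - t\<bar> * norm (J (w t))) (at t within {0<..<T})"
   by (intro tendsto_intros wl)
  then have l: "((%s. Cb * norm (J (w s) - J (w t)) + L * \<bar>s - t\<bar> * norm (J (w t))) \<longlongrightarrow> 0) (at t within {0<..<T})" by simp
  have "((%s. J (%x. b (x, s) * w s x) - J (%x. b (x, t) * w t x)) \<longlongrightarrow> 0) (at t within {0<..<T})"
  proof (rule Lim_null_comparison[OF _ l])
   have "norm (J (%x. b (x, s) * w s x) - J (%x. b (x, t) * w t x)) <= Cb * norm (J (w s) - J (w t)) + L * \<bar>s - t\<bar> * norm (J (w t))"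
    if s: "s : {0<..<T}" for s
   proof -
    have ws: "w s : L2 U01" using s by (intro w(2)) auto
    have 1: "norm (J (%x. b (x, s) * w s x) - J (%x. b (x, s) * w t x)) <= Cb * norm (J (w s) - J (w t))"
     by (rule J_mult_bounded[OF ws wt b_slice[OF s] Cb])
    have "norm (J (%x. b (x, s) * w t x) - J (%x. b (x, t) * w t x)) = L2norm U01 (%x. (b (x, s) - b (x, t)) * w t x)"
     unfolding J_norm_diff[OF L2_coefficients(2)[OF wt s] L2_coefficients(2)[OF wt t]] by (simp add: algebra_simps)
    also have "\<dots> <= L * \<bar>s - t\<bar> * norm (J (w t))"
     unfolding J_norm[OF wt]
     by (rule L2_mult_bounded(2)[OF wt borel_measurable_diff[OF b_slice(1)[OF s] b_slice(1)[OF t]] L(2)[OF _ s t]]) (use L(1) in auto)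
    finally show ?thesis using 1 norm_triangle_ineq[of "J (%x. b (x, s) * w s x) - J (%x. b (x, s) * w t x)" "J (%x. b (x, s) * w t x) - J (%x. b (x, t) * w t x)"] by simp
   qed
   then show "\<forall>\<^sub>F s in at t within {0<..<T}. norm (J (%x. b (x, s) * w s x) - J (%x. b (x, t) * w t x)) <= Cb * norm (J (w s) - J (w t)) + L * \<bar>s - t\<bar> * norm (J (w t))"
    by (simp add: eventually_at_filter)
  qed
  then show "((%s. J (%x. b (x, s) * w s x)) \<longlongrightarrow> J (%x. b (x, t) * w t x)) (at t within {0<..<T})" by (rule LIM_zero_cancel)
 qed
qed

text \<open>\<open>initial_value\<close> supplies representatives \<open>W\<close> and
  \<open>W1\<close> that are continuous in time, and both distributional equations are integrated
  for them. That \<open>W1\<close> is the derivative of \<open>W\<close> is at first known only in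
  pairings with \<open>H20\<close>; \<open>J_H20_derivative\<close> upgrades it to a derivative in
  \<open>l2\<close>.\<close>

theorem weak_solution_mild:
 assumes w: "weak_solution T b c f1 f2 g w" and f1: "f1 : H20" and f2: "f2 : L2 U01" and g: "g : L2 (XT T)"
 obtains W W1 where "mild g W W1" "J (W 0) = J f1" "J (wd 2 (W 0)) = J (wd 2 f1)" "J (W1 0) = J f2"
  "AE t in lebT T. w t : L2 U01 \<and> J (w t) = J (W t)"
proof -
 obtain w1 w2 where w0: "w : bochner_L2 T H20 H2norm" and w1: "w1 : bochner_L2 T H20 H2norm"
  and td: "time_deriv T (%t. L2ip (w t)) (%t. L2ip (w1 t))" "time_deriv T (%t. L2ip (w1 t)) w2"
  and eq: "!!v. v : H20 ==> AE t in lebT T.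
     w2 t v + L2ip (%x. c x * wd 2 (w t) x) (wd 2 v) + L2ip (%x. b (x, t) * wd 2 (w t) x) v
     = L2ip (%x. g (x, t)) v"
  and iv: "initial_value T H20 H2norm w f1" "initial_value T (L2 U01) (L2norm U01) w1 f2"
  using w unfolding weak_solution_def by blast
 obtain W where W: "AE t in lebT T. H2norm (%y. W t y - w t y) = 0"
  "!!t. t : {0..T} ==> W t : H20" "!!t. t : {0..T} ==> ((%s. H2norm (%y. W s y - W t y)) \<longlongrightarrow> 0) (at t within {0..T})"
  "H2norm (%y. W 0 y - f1 y) = 0"
  using iv(1) unfolding initial_value_def by blast
 obtain W1 where W1: "AE t in lebT T. L2norm U01 (%y. W1 t y - w1 t y) = 0"
  "!!t. t : {0..T} ==> W1 t : L2 U01" "!!t. t : {0..T} ==> ((%s. L2norm U01 (%y. W1 s y - W1 t y)) \<longlongrightarrow> 0) (at t within {0..T})"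
  "L2norm U01 (%y. W1 0 y - f2 y) = 0"
  using iv(2) unfolding initial_value_def by blast
 have "AE t in lebT T. w t : H20 \<and> w1 t : H20 \<and> H2norm (%y. W t y - w t y) = 0 \<and> L2norm U01 (%y. W1 t y - w1 t y) = 0"
  using W(1) W1(1) w0 w1 unfolding bochner_L2_def by auto
 then obtain N where N: "negligible N" "!!t. t : {0<..<T} - N ==>
   w t : H20 \<and> w1 t : H20 \<and> H2norm (%y. W t y - w t y) = 0 \<and> L2norm U01 (%y. W1 t y - w1 t y) = 0"
  by (rule AE_on_negligible) auto
 have Jle: "norm (J (wd k u) - J (wd k v)) <= H2norm (%x. u x - v x)" if "u : H20" "v : H20" "k <= 2" for u v k
  using norm_wd_le_H2norm[OF H2_diff(1)[OF H20_H2 H20_H2] that(3), of u v] H2_diff(2)[OF H20_H2 H20_H2 that(3), of u v] that by simp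
 have Jle0: "norm (J u - J v) <= H2norm (%x. u x - v x)" if "u : H20" "v : H20" for u v
  using norm_le_H2norm[OF H2_diff(1)[OF H20_H2 H20_H2], of u v] J_diff[OF H20_L2 H20_L2, of u v] that by simp
 have Jw: "J (W t) = J (w t)" "J (wd 2 (W t)) = J (wd 2 (w t))" "J (W1 t) = J (w1 t)" "w t : H20" "w1 t : H20"
  if t: "t : {0<..<T} - N" for t
 proof -
  have t': "t : {0..T}" using t by auto
  note n = N(2)[OF t]
  show "J (W t) = J (w t)" using Jle0[of "W t" "w t"] n W(2)[OF t'] by simp
  show "J (wd 2 (W t)) = J (wd 2 (w t))" using Jle[of "W t" "w t" 2] n W(2)[OF t'] by simp
  show "J (W1 t) = J (w1 t)" using J_norm_diff[of "W1 t" "w1 t"] n W1(2)[OF t'] H20_L2[of "w1 t"] by simp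
  show "w t : H20" "w1 t : H20" using n by auto
 qed
 have T0: "0 : {0..T}" using T by simp
 have init: "J (W 0) = J f1" "J (wd 2 (W 0)) = J (wd 2 f1)" "J (W1 0) = J f2"
  using Jle0[OF W(2)[OF T0] f1] Jle[OF W(2)[OF T0] f1, of 2] W(4) W1(4) J_norm_diff[OF W1(2)[OF T0] f2] by simp_all
 have W2c: "continuous_on {0..T} (%t. J (wd 2 (W t)))" and Wc: "continuous_on {0..T} (%t. J (W t))"
  and W1c: "continuous_on {0..T} (%t. J (W1 t))"
  unfolding continuous_on_def
 proof (safe)
  fix t assume t: "t : {0..T}"
  have "((%s. J (wd 2 (W s)) - J (wd 2 (W t))) \<longlongrightarrow> 0) (at t within {0..T})"
   by (rule Lim_null_comparison[OF _ W(3)[OF t]]) (use W(2) t Jle in \<open>simp add: eventually_at_filter\<close>)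
  then show "((%s. J (wd 2 (W s))) \<longlongrightarrow> J (wd 2 (W t))) (at t within {0..T})" by (rule LIM_zero_cancel)
  have "((%s. J (W s) - J (W t)) \<longlongrightarrow> 0) (at t within {0..T})"
   by (rule Lim_null_comparison[OF _ W(3)[OF t]]) (use W(2) t Jle0 in \<open>simp add: eventually_at_filter\<close>)
  then show "((%s. J (W s)) \<longlongrightarrow> J (W t)) (at t within {0..T})" by (rule LIM_zero_cancel)
  have "((%s. J (W1 s) - J (W1 t)) \<longlongrightarrow> 0) (at t within {0..T})"
   by (rule Lim_null_comparison[OF _ W1(3)[OF t]]) (use W1(2) t in \<open>simp add: eventually_at_filter J_norm_diff\<close>)
  then show "((%s. J (W1 s)) \<longlongrightarrow> J (W1 t)) (at t within {0..T})" by (rule LIM_zero_cancel)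
 qed
 have WL: "W t : L2 U01" "wd 2 (W t) : L2 U01" if "t : {0..T}" for t using W(2)[OF that] by (auto intro: H20_L2 H20_wd)
 have ip: "L2ip u v = L2ip u' v" if "u : L2 U01" "u' : L2 U01" "v : L2 U01" "J u = J u'" for u u' v
 proof -
  have "cmod (L2ip (%x. u x - u' x) v) <= L2norm U01 (%x. u x - u' x) * L2norm U01 v" by (intro L2ip_bound L2_diff that)
  then show ?thesis using J_norm_diff[OF that(1,2)] that by (simp add: L2ip_diff_left)
 qed
 have ci: "integrable (lebT T) f" if "continuous_on {0..T} f" for f :: "real => complex"
  by (rule integrable_lebesgue_on_subset[OF continuous_imp_integrable_real[OF that]]) auto
 have int1: "((%s. Re (L2ip (W1 s) v)) has_integral Re (L2ip (W t2) v - L2ip (W t1) v)) {t1..t2}"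
  if v: "v : H20" and t: "0 <= t1" "t1 <= t2" "t2 <= T" for v t1 t2
 proof (rule weak_time_derivative[OF _ N(1) _ _ _ _ t])
  show "(LINT t|lebT T. pdiff 1 ph t * L2ip (w t) v) = - (LINT t|lebT T. ph t * L2ip (w1 t) v)"
   if "ph : test_fun {0<..<T}" for ph using td(1) v that by (simp add: time_deriv_def)
  show "L2ip (w t) v = L2ip (W t) v" "L2ip (w1 t) v = L2ip (W1 t) v" if "t : {0<..<T} - N" for t
   using that by (auto intro!: ip H20_L2 v Jw(4,5) WL W1(2) simp: Jw(1,3))
  show "continuous_on {0..T} (%t. L2ip (W t) v)" by (intro L2ip_continuous_on Wc WL H20_L2 v)
  show "integrable (lebT T) (%t. L2ip (W1 t) v)" by (intro ci L2ip_continuous_on W1c W1(2) H20_L2 v)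
 qed
 have der: "((%t. J (W t)) has_vector_derivative J (W1 t)) (at t within {0..T})" if t: "t : {0..T}" for t
 proof (rule J_H20_derivative[OF W(2) W1c W1(2) N(1) _ _ T t])
  show "\<exists>v\<in>H20. J (W1 t) = J v" if "t : {0<..<T} - N" for t using Jw(3,5)[OF that] by blast
  fix v t1 t2 assume v: "v : H20" and t: "0 <= t1" "t1 <= t2" "t2 <= T"
  have m: "t1 : {0..T}" "t2 : {0..T}" using t by auto
  have "((%s. inner (J (W1 s)) (J v)) has_integral Re (L2ip (W t2) v - L2ip (W t1) v)) {t1..t2}"
   by (rule has_integral_eq[OF _ int1[OF v t]]) (use t W1(2) H20_L2[OF v] in \<open>simp add: J_inner\<close>)
  then show "((%s. inner (J (W1 s)) (J v)) has_integral inner (J (W t2) - J (W t1)) (J v)) {t1..t2}"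
   using WL(1)[OF m(1)] WL(1)[OF m(2)] H20_L2[OF v] by (simp add: inner_diff_left J_inner)
 qed
 obtain Ng where Ng: "negligible Ng" "!!t. t : {0<..<T} - Ng ==> (%x. g (x, t)) : L2 U01"
  "(%t. L2norm U01 (%x. g (x, t))) integrable_on {0..T}"
  by (rule L2_slices[OF T g]) blast
 \<comment> \<open>The pairing is dominated by the slice norm of \<open>g\<close>, which
   \<open>L2_slices\<close> shows to be integrable in time.\<close>
 have gi: "integrable (lebT T) (%t. L2ip (%x. g (x, t)) v)" if v: "v : L2 U01" for v
 proof -
  have "(%t. L2norm U01 (%x. g (x, t))) absolutely_integrable_on {0..T}"
   using Ng(3) by (intro nonnegative_absolutely_integrable_1) auto
  then have "integrable (lebesgue_on {0..T}) (%t. L2norm U01 (%x. g (x, t)))"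
   by (simp add: set_integrable_def integrable_restrict_space)
  then have "integrable (lebT T) (%t. L2norm U01 (%x. g (x, t)))"
   by (rule integrable_lebesgue_on_subset) auto
  then have i: "integrable (lebT T) (%t. L2norm U01 (%x. g (x, t)) * L2norm U01 v)" by simp
  show ?thesis
   by (rule Bochner_Integration.integrable_bound[OF i L2ip_slice_measurable[OF g v]], rule negligible_AE_on[OF Ng(1)])
    (use L2ip_bound[OF Ng(2) v] in auto)
 qed
 have int2: "((%s. rhs g (wd 2 (W s)) v s) has_integral inner (J (W1 t2) - J (W1 t1)) (J v)) {t1..t2}"
  if v: "v : H20" and t: "0 <= t1" "t1 <= t2" "t2 <= T" for v t1 t2
 proof -
  note vL = H20_L2[OF v] and v2L = H20_wd[OF v]
  define L where "L s = L2ip (%x. g (x, s)) v - L2ip (%x. b (x, s) * wd 2 (W s) x) v - L2ip (%x. c x * wd 2 (W s) x) (wd 2 v)" for s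
  \<comment> \<open>This null set depends on \<open>v\<close>, which is harmless because
    \<open>mild\<close> asks for the integrated identity separately for each
    \<open>v\<close>.\<close>
  obtain Nv where Nv: "negligible Nv" "!!t. t : {0<..<T} - Nv ==>
     w2 t v + L2ip (%x. c x * wd 2 (w t) x) (wd 2 v) + L2ip (%x. b (x, t) * wd 2 (w t) x) v
     = L2ip (%x. g (x, t)) v"
   by (rule AE_on_negligible[OF eq[OF v]]) auto
  have "((%s. Re (L s)) has_integral Re (L2ip (W1 t2) v - L2ip (W1 t1) v)) {t1..t2}"
  proof (rule weak_time_derivative[OF _ negligible_Un[OF N(1) Nv(1)] _ _ _ _ t])
   show "(LINT t|lebT T. pdiff 1 ph t * L2ip (w1 t) v) = - (LINT t|lebT T. ph t * w2 t v)"
    if "ph : test_fun {0<..<T}" for ph using td(2) v that by (simp add: time_deriv_def)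
   show "L2ip (w1 t) v = L2ip (W1 t) v" if "t : {0<..<T} - (N \<union> Nv)" for t
    using that by (auto intro!: ip H20_L2 v Jw(4,5) WL W1(2) simp: Jw(1,3))
   show "w2 s v = L s" if s: "s : {0<..<T} - (N \<union> Nv)" for s
   proof -
    have s': "s : {0<..<T} - N" "s : {0<..<T} - Nv" "s : {0<..<T}" "s : {0..T}" using s by auto
    have wL: "wd 2 (w s) : L2 U01" by (rule H20_wd[OF Jw(4)[OF s'(1)]])
    have jc: "J (%x. c x * wd 2 (w s) x) = J (%x. c x * wd 2 (W s) x)"
     using J_mult_bounded[OF wL WL(2)[OF s'(4)] c_measurable c_norm_le] c0 c_ge[of "1/2"] c_le[of "1/2"] Jw(2)[OF s'(1)] by simp
    have jb: "J (%x. b (x, s) * wd 2 (w s) x) = J (%x. b (x, s) * wd 2 (W s) x)"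
     using J_mult_bounded[OF wL WL(2)[OF s'(4)] b_slice[OF s'(3)] Cb] Jw(2)[OF s'(1)] by simp
    have "L2ip (%x. c x * wd 2 (w s) x) (wd 2 v) = L2ip (%x. c x * wd 2 (W s) x) (wd 2 v)"
     by (intro ip L2_coefficients wL WL s' v2L jc)
    moreover have "L2ip (%x. b (x, s) * wd 2 (w s) x) v = L2ip (%x. b (x, s) * wd 2 (W s) x) v"
     by (intro ip L2_coefficients wL WL s' vL jb)
    ultimately show ?thesis using Nv(2)[OF s'(2)] by (simp add: L_def algebra_simps)
   qed
   show "continuous_on {0..T} (%t. L2ip (W1 t) v)" by (intro L2ip_continuous_on W1c W1(2) vL)
   show "integrable (lebT T) L" unfolding L_def
   proof (rule Bochner_Integration.integrable_diff[OF Bochner_Integration.integrable_diff[OF gi[OF vL]] ci])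
    have "continuous_on {0..T} (%s. J (%x. c x * wd 2 (W s) x))"
     by (rule continuous_on_dominated[OF W2c, where C = c1])
     (use J_mult_bounded[OF WL(2) WL(2) c_measurable c_norm_le] c0 c_ge[of "1/2"] c_le[of "1/2"] in \<open>simp add: dist_norm\<close>)
    then show "continuous_on {0..T} (%s. L2ip (%x. c x * wd 2 (W s) x) (wd 2 v))"
     by (rule L2ip_continuous_on[OF _ _ v2L]) (intro L2_coefficients WL)
    have cb: "continuous_on {0<..<T} (%s. L2ip (%x. b (x, s) * wd 2 (W s) x) v)"
     by (rule L2ip_b_continuous_on[OF W2c WL(2) vL])
    obtain M where M: "!!s. s : {0..T} ==> norm (J (wd 2 (W s))) <= M"
     using compact_imp_bounded[OF compact_continuous_image[OF W2c compact_Icc]] unfolding bounded_iff by blast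
    show "integrable (lebT T) (%s. L2ip (%x. b (x, s) * wd 2 (W s) x) v)"
    proof (rule Bochner_Integration.integrable_bound[of _ "%_. Cb * M * L2norm U01 v"])
     show "(%s. L2ip (%x. b (x, s) * wd 2 (W s) x) v) : bmeas (lebT T)"
     by (rule continuous_imp_measurable_on_sets_lebesgue[OF cb]) simp
     show "AE s in lebT T. norm (L2ip (%x. b (x, s) * wd 2 (W s) x) v) <= norm (Cb * M * L2norm U01 v)"
     proof (rule AE_I2)
     fix s assume "s : space (lebT T)"
     then have s: "s : {0<..<T}" "s : {0..T}" by auto
     have "norm (L2ip (%x. b (x, s) * wd 2 (W s) x) v) <= L2norm U01 (%x. b (x, s) * wd 2 (W s) x) * L2norm U01 v"
     by (intro L2ip_bound L2_coefficients WL s vL)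
     also have "\<dots> <= Cb * norm (J (wd 2 (W s))) * L2norm U01 v"
     unfolding J_norm[OF WL(2)[OF s(2)]]
     by (intro mult_right_mono L2_mult_bounded(2)[OF WL(2)[OF s(2)] b_slice[OF s(1)] Cb]) simp_all
     also have "\<dots> <= Cb * M * L2norm U01 v" by (intro mult_right_mono mult_left_mono M s Cb) simp_all
     finally show "norm (L2ip (%x. b (x, s) * wd 2 (W s) x) v) <= norm (Cb * M * L2norm U01 v)" by simp
     qed
    qed (rule finite_measure.integrable_const[OF nice_finite[OF nice_U[OF T]]])
   qed
  qed
  then show ?thesis
   using t W1(2)[of t1] W1(2)[of t2] vL by (simp add: L_def rhs_def[abs_def] inner_diff_left J_inner)
 qed
 show thesis
 proof (rule that[of W W1])
  show "mild g W W1" unfolding mild_def using W(2) W1(2) W1c W2c der int2 by blast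
  show "AE t in lebT T. w t : L2 U01 \<and> J (w t) = J (W t)"
   by (rule negligible_AE_on[OF N(1)]) (use Jw(1,4) H20_L2 in auto)
 qed (use init in auto)
qed

end

section \<open>Stability, Hermite correction and smooth limits\<close>

lemma snet_const_mod:
 assumes "bsm Om f" shows "snet A_mod Om (%_. f)"
 unfolding snet_def
proof (intro conjI ballI)
 show "smooth_on Om f" using snet_smooth[OF assms, of 1] by simp
 fix es :: "'a list" assume es: "es : lists Basis"
 obtain K :: "real => real" where "!!ep z. 0 < ep ==> ep <= 1 ==> z : Om ==> cmod (pdiffs es f z) <= K ep"
  using snet_bound[OF assms es] by metis
 from this[of 1] show "\<exists>K\<in>A_mod. \<forall>ep\<in>{0<..1}. \<forall>z\<in>Om. cmod (pdiffs es f z) <= K ep"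
  by (intro bexI[OF _ A_mod_const[of "K 1"]]) simp
qed

lemma zero_A_null: "(%_. 0) : A_null"
 by (simp add: A_null_def)

lemma snet_zero: "snet A_null Om (%_ _. 0)"
proof -
 have z: "pdiffs es (%_. 0) = (%_. 0)" for es :: "'a list" by (induction es) (simp_all add: pdiffs_Cons)
 show ?thesis unfolding snet_def smooth_on_def z using zero_A_null by auto
qed

lemma snet_class_add:
 "A : {A_mod, A_null} ==> open Om ==> snet A Om u ==> snet A Om v ==> snet A Om (%ep z. u ep z + v ep z)"
 by (rule snet_add) (auto intro: A_mod_add A_null_add)

lemma snet_class_mult:
 "A : {A_mod, A_null} ==> open Om ==> snet A_mod Om u ==> snet A Om v ==> snet A Om (%ep z. u ep z * v ep z)"
 by (rule snet_mult[where A = A_mod and B = A]) (auto intro: A_mod_add A_null_add A_mod_mult A_mod_null_mult)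

lemma snet_class_diff:
 assumes "A : {A_mod, A_null}" "open Om" "snet A Om u" "snet A Om v"
 shows "snet A Om (%ep z. u ep z - v ep z)"
proof -
 have "snet A Om (%ep z. u ep z + (- 1) * v ep z)"
  by (intro snet_class_add snet_class_mult[OF assms(1,2) snet_const_mod[OF bsm_const]] assms)
 then show ?thesis by simp
qed

lemma snet_XT_pdiff: "snet A (XT T) u ==> snet A (XT T) (%ep. dX (u ep))" "snet A (XT T) u ==> snet A (XT T) (%ep. dT (u ep))"
 by (rule snet_pdiff; simp add: Basis_XT)+

lemma plate_op_snet:
 assumes "A : {A_mod, A_null}" "bsm (XT T) b" "bsm U01 c" "snet A (XT T) v"
 shows "snet A (XT T) (%ep. plate_op b c (v ep))"
 unfolding plate_op_def[abs_def]
 by (intro snet_class_add snet_class_mult[OF assms(1)] snet_XT_pdiff open_XT assms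
   snet_const_mod[OF assms(2)] snet_lift_x[OF snet_const_mod[OF assms(3)]])

lemma pdiff_diff_on:
 assumes "open Om" "bsm Om f" "bsm Om g" "z : Om"
 shows "pdiff e (%y. f y - g y) z = pdiff e f z - pdiff e g z"
 using snet_differentiable[OF assms(2,1), of 1 z] snet_differentiable[OF assms(3,1), of 1 z] assms(4) by (intro pdiff_diff) simp_all

lemma pdiffs_diff_on:
 assumes "open Om" "bsm Om f" "bsm Om g" "es : lists Basis" "z : Om"
 shows "pdiffs es (%y. f y - g y) z = pdiffs es f z - pdiffs es g z"
 using assms(4,5)
proof (induction es arbitrary: z rule: list.induct)
 case (Cons e es)
 then have es: "es : lists Basis" by simp
 have "pdiff e (pdiffs es (%y. f y - g y)) z = pdiff e (%y. pdiffs es f y - pdiffs es g y) z"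
  by (rule pdiff_cong[OF assms(1) Cons.prems(2)]) (rule Cons.IH[OF es])
 also have "\<dots> = pdiff e (pdiffs es f) z - pdiff e (pdiffs es g) z"
  by (rule pdiff_diff_on[OF assms(1) snet_pdiffs[OF assms(2) es] snet_pdiffs[OF assms(3) es] Cons.prems(2)])
 finally show ?case by (simp add: pdiffs_Cons)
qed simp

lemma pdiff2_diff_on:
 assumes "open Om" "bsm Om f" "bsm Om g" "z : Om" "e : Basis"
 shows "pdiff e (pdiff e (%y. f y - g y)) z = pdiff e (pdiff e f) z - pdiff e (pdiff e g) z"
 using pdiffs_diff_on[OF assms(1-3), of "[e, e]" z] assms by (simp add: pdiffs_Cons)

lemma plate_op_diff:
 assumes c: "bsm U01 c" and f: "bsm (XT T) f" and g: "bsm (XT T) g" and z: "z : XT T"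
 shows "plate_op b c (%z. f z - g z) z = plate_op b c f z - plate_op b c g z"
proof -
 have B: "dirX : Basis" "dirT : Basis" by (simp_all add: Basis_XT)
 note x2 = pdiff2_diff_on[OF open_XT f g _ B(1)] and t2 = pdiff2_diff_on[OF open_XT f g _ B(2)]
 note fb = bsm_pdiff(1)[OF bsm_pdiff(1)[OF f]] and gb = bsm_pdiff(1)[OF bsm_pdiff(1)[OF g]]
 have cb: "bsm (XT T) (%y. c (fst y))" by (rule snet_lift_x[OF c])
 have "pdiffs [dirX, dirX] (%y. c (fst y) * dX (dX (%z. f z - g z)) y) z
   = pdiffs [dirX, dirX] (%y. c (fst y) * dX (dX f) y - c (fst y) * dX (dX g) y) z"
  by (rule pdiffs_cong[OF open_XT z]) (simp add: x2 right_diff_distrib)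
 also have "\<dots> = pdiffs [dirX, dirX] (%y. c (fst y) * dX (dX f) y) z
   - pdiffs [dirX, dirX] (%y. c (fst y) * dX (dX g) y) z"
  by (rule pdiffs_diff_on[OF open_XT]) (use B z in \<open>auto intro!: bsm_mult open_XT cb fb gb\<close>)
 finally show ?thesis by (simp add: plate_op_def x2[OF z] t2[OF z] pdiffs_Cons algebra_simps)
qed

lemma bsm_XT_L2: "T > 0 ==> bsm (XT T) f ==> f : L2 (XT T)"
 using Hinf_iff_bsm[OF nice_XT, of T f] bspec[of "lists Basis" "%es. pdiffs es f : L2 (XT T)" "[]"]
 by (simp add: Hinf_def)

lemma J_slice:
 assumes T: "T > 0" and f: "bsm (XT T) f" and t: "t : {0<..<T}"
 shows "J (%x. f (x, t)) = J (trace_t T t f)"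
proof (rule J_cong)
 show "(%x. f (x, t)) : L2 U01" by (rule bsm_L2[OF bsm_slice(1)[OF T f t]])
 show "trace_t T t f : L2 U01" using t by (intro trace_t_L2[OF T f]) auto
 show "AE x in lebU. f (x, t) = trace_t T t f x" by (rule AE_I2) (simp add: bsm_slice(2)[OF T f t])
qed

lemma L2norm_XT_le:
 assumes T: "T > 0" and f: "bsm (XT T) f" and M: "M >= 0" "!!t. t : {0<..<T} ==> norm (J (trace_t T t f)) <= M"
 shows "L2norm (XT T) f <= sqrt T * M"
proof -
 obtain N where N: "!!t. t : {0<..<T} - N ==> (%x. f (x, t)) : L2 U01"
  "!!M. M >= 0 ==> (!!t. t : {0<..<T} - N ==> L2norm U01 (%x. f (x, t)) <= M) ==> L2norm (XT T) f <= sqrt T * M"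
  by (rule L2_slices[OF T bsm_XT_L2[OF T f]]) blast
 show ?thesis
 proof (rule N(2)[OF M(1)])
  fix t assume t: "t : {0<..<T} - N"
  then show "L2norm U01 (%x. f (x, t)) <= M"
   using M(2)[of t] J_norm[OF N(1)[OF t]] J_slice[OF T f, of t] by simp
 qed
qed

text \<open>Stability with one constant for all pairs of mild solutions. As a predicate it can be
  obtained once and serves both the uniqueness and the convergence arguments.\<close>

definition (in plate) compare_const :: "real => bool" where
 "compare_const K \<longleftrightarrow> K >= 0 \<and> (\<forall>g z y g' z' y'. \<forall>t\<in>{0..T}. mild g z y --> mild g' z' y' --> g : L2 (XT T) --> g' : L2 (XT T) -->
   norm (J (z t) - J (z' t)) <= norm (J (z 0) - J (z' 0)) + K * (norm (J (y 0) - J (y' 0)) +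
   norm (J (wd 2 (z 0)) - J (wd 2 (z' 0))) + sqrt T * L2norm (XT T) (%p. g p - g' p)))"

lemma (in plate) compareD:
 assumes "compare_const K"
 shows "K >= 0" "mild g z y ==> mild g' z' y' ==> g : L2 (XT T) ==> g' : L2 (XT T) ==> t : {0..T} ==>
  norm (J (z t) - J (z' t)) <= norm (J (z 0) - J (z' 0)) + K * (norm (J (y 0) - J (y' 0)) +
   norm (J (wd 2 (z 0)) - J (wd 2 (z' 0))) + sqrt T * L2norm (XT T) (%p. g p - g' p))"
 using assms unfolding compare_const_def by blast+

lemma (in plate) mild_compare: "\<exists>K. compare_const K"
proof -
 obtain K where K0: "K >= 0" and K: "!!g z y N \<gamma> t. mild g z y ==> negligible N ==>
  (!!s. s : {0<..<T} - N ==> (%x. g (x, s)) : L2 U01) ==>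
  (!!s. s : {0<..<T} - N ==> L2norm U01 (%x. g (x, s)) <= \<gamma> s) ==>
  (!!s. s : {0..T} ==> \<gamma> s >= 0) ==> \<gamma> integrable_on {0..T} ==> t : {0..T} ==>
  norm (J (z t)) <= norm (J (z 0)) + K * (norm (J (y 0)) + norm (J (wd 2 (z 0))) + integral {0..T} \<gamma>)"
  using mild_energy by blast
 show ?thesis unfolding compare_const_def
 proof (rule exI[of _ K], intro conjI allI ballI impI, rule K0)
  fix g z y g' z' y' t
  assume m: "mild g z y" "mild g' z' y'" and g: "g : L2 (XT T)" "g' : L2 (XT T)" and t: "t : {0..T}"
  define d where "d p = g p - g' p" for p
  have d: "d : L2 (XT T)" unfolding d_def by (rule L2_diff[OF g])
  obtain N1 where N1: "negligible N1" "!!s. s : {0<..<T} - N1 ==> (%x. g (x, s)) : L2 U01" by (rule L2_slices[OF T g(1)]) blast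
  obtain N2 where N2: "negligible N2" "!!s. s : {0<..<T} - N2 ==> (%x. g' (x, s)) : L2 U01" by (rule L2_slices[OF T g(2)]) blast
  obtain N3 where N3: "negligible N3" "(%t. L2norm U01 (%x. d (x, t))) integrable_on {0..T}"
   "integral {0..T} (%t. L2norm U01 (%x. d (x, t))) <= sqrt T * L2norm (XT T) d" by (rule L2_slices[OF T d]) blast
  have md: "mild d (%t x. z t x - z' t x) (%t x. y t x - y' t x)"
   unfolding d_def by (rule mild_diff[OF m negligible_Un[OF N1(1) N2(1)]]) (use N1(2) N2(2) in auto)
  have H: "z t : H20" "z' t : H20" "y t : L2 U01" "y' t : L2 U01" if "t : {0..T}" for t using m that by (auto simp: mild_def)
  have t0: "0 : {0..T}" using T by simp
  have e: "norm (J (%x. z t x - z' t x)) <= norm (J (%x. z 0 x - z' 0 x)) + K * (norm (J (%x. y 0 x - y' 0 x)) +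
    norm (J (wd 2 (%x. z 0 x - z' 0 x))) + integral {0..T} (%t. L2norm U01 (%x. d (x, t))))"
   by (rule K[OF md negligible_Un[OF N1(1) N2(1)] _ _ _ N3(2) t]) (use N1(2) N2(2) in \<open>auto simp: d_def intro: L2_diff\<close>)
  have "norm (J (z t) - J (z' t)) <= norm (J (z 0) - J (z' 0)) + K * (norm (J (y 0) - J (y' 0)) +
   norm (J (wd 2 (z 0)) - J (wd 2 (z' 0))) + integral {0..T} (%t. L2norm U01 (%x. d (x, t))))"
   using e unfolding J_diff[OF H20_L2[OF H(1)[OF t]] H20_L2[OF H(2)[OF t]]]
    J_diff[OF H20_L2[OF H(1)[OF t0]] H20_L2[OF H(2)[OF t0]]] J_diff[OF H(3)[OF t0] H(4)[OF t0]]
    H2_diff(2)[OF H20_H2[OF H(1)[OF t0]] H20_H2[OF H(2)[OF t0]] order_refl] .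
  also have "\<dots> <= norm (J (z 0) - J (z' 0)) + K * (norm (J (y 0) - J (y' 0)) +
   norm (J (wd 2 (z 0)) - J (wd 2 (z' 0))) + sqrt T * L2norm (XT T) d)"
   using K0 N3(3) by (intro add_left_mono mult_left_mono) auto
  finally show "norm (J (z t) - J (z' t)) <= norm (J (z 0) - J (z' 0)) + K * (norm (J (y 0) - J (y' 0)) +
   norm (J (wd 2 (z 0)) - J (wd 2 (z' 0))) + sqrt T * L2norm (XT T) (%p. g p - g' p))" unfolding d_def[abs_def] .
 qed
qed

text \<open>The order of integration, \<open>t\<close> outside and \<open>x\<close> inside, is the
  one of \<open>distr_of\<close>.\<close>

lemma Fubini_XT:
 fixes f :: "real \<times> real => complex"
 assumes f: "continuous_on (XT T) f" and B: "!!z. z : XT T ==> cmod (f z) <= B"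
 shows "integrable (lebT T) (%t. LINT x|lebU. f (x, t))"
  and "(LINT z|lebesgue_on (XT T). f z) = (LINT t|lebT T. LINT x|lebU. f (x, t))"
proof -
 define h where "h z = indicator (XT T) z *\<^sub>R f z" for z
 have XTb: "XT T : sets borel" by (intro borel_open open_XT)
 have hm: "h : bmeas borel" unfolding h_def[abs_def]
  by (rule borel_measurable_continuous_on_indicator[OF XTb f])
 have fin: "emeasure lborel (XT T) < \<infinity>" by (rule emeasure_bounded_finite[OF bounded_XT])
 have hi: "integrable lborel h"
 proof (rule Bochner_Integration.integrable_bound[of _ "%z. indicator (XT T) z *\<^sub>R \<bar>B\<bar>"])
  show "integrable lborel (%z. indicator (XT T) z *\<^sub>R \<bar>B\<bar>)"
   using XTb fin by (intro integrable_scaleR_left integrable_real_indicator) auto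
  show "AE z in lborel. norm (h z) <= norm (indicator (XT T) z *\<^sub>R \<bar>B\<bar>)"
   by (rule AE_I2) (use B in \<open>auto simp: h_def indicator_def intro: order_trans[OF _ abs_ge_self]\<close>)
 qed (use hm in simp)
 have hsp: "integrable (lborel \<Otimes>\<^sub>M lborel) (%(t, x). h (x, t))"
  by (rule lborel_pair.integrable_product_swap) (simp add: lborel_prod hi)
 have sl: "(LINT x|lborel. h (x, t)) = indicator {0<..<T} t *\<^sub>R (LINT x|lebU. f (x, t))" for t
 proof -
  have m: "(%x. h (x, t)) : bmeas borel"
   by (rule measurable_compose[of "%x. (x, t)" _ "borel \<Otimes>\<^sub>M borel"]) (use hm in \<open>simp_all add: borel_prod\<close>)
  have "(LINT x|lborel. h (x, t)) = (LINT x|lebesgue. h (x, t))" using m by (intro integral_completion[symmetric]) simp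
  also have "(LINT x|lebesgue. h (x, t)) = (LINT x|lebesgue. indicator {0<..<T} t *\<^sub>R (indicator U01 x *\<^sub>R f (x, t)))"
   by (intro bochner_cong refl) (auto simp: h_def XT_def indicator_def)
  also have "(LINT x|lebesgue. indicator {0<..<T} t *\<^sub>R (indicator U01 x *\<^sub>R f (x, t))) = indicator {0<..<T} t *\<^sub>R (LINT x|lebU. f (x, t))"
   by (cases "t : {0<..<T}") (simp_all add: integral_restrict_space)
  finally show ?thesis .
 qed
 have i1: "integrable lborel (%t. LINT x|lborel. h (x, t))" using lborel_pair.integrable_fst'[OF hsp] by simp
 then have "integrable lebesgue (%t. LINT x|lborel. h (x, t))"
  using borel_measurable_integrable[OF i1] by (subst integrable_completion) simp_all
 then show "integrable (lebT T) (%t. LINT x|lebU. f (x, t))"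
  unfolding sl by (subst integrable_restrict_space) simp_all
 have "(LINT z|lebesgue_on (XT T). f z) = (LINT z|lebesgue. h z)"
  unfolding h_def using XTb by (subst integral_restrict_space) auto
 also have "\<dots> = (LINT z|lborel. h z)" using hm by (intro integral_completion) simp
 also have "\<dots> = (LINT t|lborel. LINT x|lborel. h (x, t))"
  using lborel_pair.integral_fst'[OF hsp] lborel_pair.integral_product_swap[of h] hm by (simp add: lborel_prod)
 also have "\<dots> = (LINT t|lebesgue. LINT x|lborel. h (x, t))"
  using borel_measurable_integrable[OF i1] by (intro integral_completion[symmetric])
 also have "\<dots> = (LINT t|lebT T. LINT x|lebU. f (x, t))"
  unfolding sl by (subst integral_restrict_space) auto
 finally show "(LINT z|lebesgue_on (XT T). f z) = (LINT t|lebT T. LINT x|lebU. f (x, t))" .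
qed

lemma bsm_of_real: "bsm U01 complex_of_real"
proof (rule snet_coinduct[where P = "%v. v = (%_. complex_of_real) \<or> (\<exists>k. v = (%_ _. k))"])
 have d: "(complex_of_real has_vector_derivative 1) (at x)" for x
  using has_vector_derivative_of_real[OF DERIV_ident] by simp
 fix v :: "real => real => complex" assume v: "v = (%_. complex_of_real) \<or> (\<exists>k. v = (%_ _. k))"
 show "v ep differentiable (at z)" for ep z
  using v
 proof (elim disjE exE)
  assume "v = (%_. complex_of_real)"
  then show ?thesis using d[of z] by (auto simp: has_vector_derivative_def differentiable_def)
 qed simp
 show "\<exists>K\<in>UNIV. \<forall>ep\<in>{0<..1}. \<forall>z\<in>U01. cmod (v ep z) <= K ep"
  using v by (auto intro!: exI[of _ "%_. 1 + cmod (v 1 (1 / 2))"])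
 show "\<exists>w. (w = (%_. complex_of_real) \<or> (\<exists>k. w = (%_ _. k))) \<and> (\<forall>ep\<in>{0<..1}. \<forall>z\<in>U01. pdiff e (v ep) z = w ep z)"
  if e: "e : Basis" for e
  using v
 proof
  assume "v = (%_. complex_of_real)"
  then show ?thesis using e pdiff_real_eq[OF d] by (intro exI[of _ "%_ _. 1"]) auto
 next
  assume "\<exists>k. v = (%_ _. k)"
  then show ?thesis by (intro exI[of _ "%_ _. 0"]) auto
 qed
qed auto

text \<open>Cubic Hermite interpolation in \<open>x\<close> with values \<open>p0\<close>,
  \<open>p1\<close> and slopes \<open>q0\<close>, \<open>q1\<close> at the ends 0 and 1.\<close>

definition hermite :: "(real => complex) => (real => complex) => (real => complex) => (real => complex) => real \<times> real => complex" where
 "hermite p0 p1 q0 q1 z = (let x = complex_of_real (fst z); t = snd z in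
   (2 * x * x * x - 3 * x * x + 1) * p0 t + (3 * x * x - 2 * x * x * x) * p1 t
   + (x * x * x - 2 * x * x + x) * q0 t + (x * x * x - x * x) * q1 t)"

definition hermite_lift :: "real => (real \<times> real => complex) => real \<times> real => complex" where
 "hermite_lift T f = hermite (trace_x T 0 f) (trace_x T 1 f) (trace_x T 0 (dX f)) (trace_x T 1 (dX f))"

text \<open>The correction is linear in the four traces with polynomial coefficients in
  \<open>x\<close>, so null traces give a net that is null with all derivatives.\<close>

lemma hermite_lift_null:
 assumes "!!a. a : {0, 1} ==> snet A_null {0<..<T} (%ep. trace_x T a (u ep))"
  "!!a. a : {0, 1} ==> snet A_null {0<..<T} (%ep. trace_x T a (dX (u ep)))"
 shows "snet A_null (XT T) (%ep. hermite_lift T (u ep))"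
proof -
 have x: "bsm (XT T) (%z. complex_of_real (fst z))" by (rule snet_lift_x[OF bsm_of_real])
 have c: "bsm (XT T) (%_. k)" for k by (rule bsm_const)
 note i = bsm_mult[OF open_XT] bsm_add[OF open_XT] bsm_diff[OF open_XT] x c
 have m: "snet A_null (XT T) (%ep z. k z * p ep (snd z))" if "bsm (XT T) k" "snet A_null {0<..<T} p" for k p
  by (rule snet_class_mult[OF _ open_XT snet_const_mod[OF that(1)] snet_lift_t[OF that(2)]]) simp
 have a: "snet A_null (XT T) (%ep z. u ep z + v ep z)" if "snet A_null (XT T) u" "snet A_null (XT T) v" for u v
  by (rule snet_class_add[OF _ open_XT that]) simp
 show ?thesis unfolding hermite_lift_def hermite_def[abs_def] Let_def
  by (intro a m assms; (intro i | simp))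
qed

lemma clamped_hermite:
 assumes T: "T > 0" and f: "bsm (XT T) f"
 shows "clamped T (%z. f z - hermite_lift T f z)" "bsm (XT T) (hermite_lift T f)"
proof -
 note f1 = bsm_pdiff(1)[OF f]
 define p0 p1 q0 q1 where "p0 = trace_x T 0 f" and "p1 = trace_x T 1 f"
  and "q0 = trace_x T 0 (dX f)" and "q1 = trace_x T 1 (dX f)"
 define r where "r = hermite_lift T f"
 \<comment> \<open>The \<open>x\<close>-derivative of the interpolant in closed form: it is
   continuous on the closed rectangle, so the boundary values of \<open>dX r\<close> can be read off
   from it.\<close>
 define r' where "r' z = (let x = complex_of_real (fst z); t = snd z in
   (6 * x * x - 6 * x) * p0 t + (6 * x - 6 * x * x) * p1 t + (3 * x * x - 4 * x + 1) * q0 t + (3 * x * x - 2 * x) * q1 t)" for z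
 have r: "r = hermite p0 p1 q0 q1" by (simp add: r_def hermite_lift_def p0_def p1_def q0_def q1_def)
 have x: "bsm (XT T) (%z. complex_of_real (fst z))" by (rule snet_lift_x[OF bsm_of_real])
 have c: "bsm (XT T) (%_. k)" for k by (rule bsm_const)
 have pb: "bsm {0<..<T} p0" "bsm {0<..<T} p1" "bsm {0<..<T} q0" "bsm {0<..<T} q1"
  unfolding p0_def p1_def q0_def q1_def by (intro snet_trace_x T f f1; simp)+
 have rb: "bsm (XT T) r" unfolding r hermite_def[abs_def] Let_def
  by (intro bsm_mult bsm_add bsm_diff open_XT x c snet_lift_t pb)
 then show "bsm (XT T) (hermite_lift T f)" by (simp add: r_def)
 have pc: "continuous_on {0..T} p0" "continuous_on {0..T} p1" "continuous_on {0..T} q0" "continuous_on {0..T} q1"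
  unfolding p0_def p1_def q0_def q1_def
  by (rule continuous_on_vector_derivative, rule trace_x_t_derivative[OF T]; simp add: f f1)+
 have pc': "continuous_on ({0..1} \<times> {0..T}) (%z. p (snd z))" if "continuous_on {0..T} p" for p :: "real => complex"
  by (rule continuous_on_compose2[OF that continuous_on_snd[OF continuous_on_id]]) auto
 have rc: "continuous_on (closure (XT T)) r" "continuous_on (closure (XT T)) r'"
  unfolding r hermite_def[abs_def] r'_def[abs_def] Let_def closure_XT[OF T]
  by (intro continuous_intros pc' pc)+
 have rd: "dX r z = r' z" if z: "z : XT T" for z
 proof -
  obtain a t where zt: "z = (a, t)" by (cases z)
  have "((%x. r (x, t)) has_vector_derivative dX r (a, t)) (at a)"
   using snet_differentiable[OF rb open_XT, of 1 z] z by (intro pdiff_slice_x) (simp add: zt)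
  moreover have "((%x. r (x, t)) has_vector_derivative r' (a, t)) (at a)"
  proof -
   define R where "R x = (2 * x * x * x - 3 * x * x + 1) * p0 t + (3 * x * x - 2 * x * x * x) * p1 t
    + (x * x * x - 2 * x * x + x) * q0 t + (x * x * x - x * x) * q1 t" for x :: complex
   have "(R has_field_derivative r' (a, t)) (at (complex_of_real a))"
    unfolding R_def[abs_def] r'_def Let_def by (rule derivative_eq_intros refl | simp add: algebra_simps)+
   from has_vector_derivative_real_field[OF this] show ?thesis by (simp add: r hermite_def R_def Let_def)
  qed
  ultimately show ?thesis unfolding zt by (rule vector_derivative_unique_at)
 qed
 note r1 = bsm_pdiff(1)[OF rb]
 show "clamped T (%z. f z - hermite_lift T f z)"
  unfolding clamped_def r_def[symmetric]
 proof (intro conjI ballI)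
  show db: "bsm (XT T) (%z. f z - r z)" by (rule bsm_diff[OF open_XT f rb])
  fix a t :: real assume a: "a : {0, 1}" and t: "t : {0<..<T}"
  have at: "(a, t) : closure (XT T)" using a t T by (auto simp: closure_XT)
  have "bdval (XT T) r (a, t) = r (a, t)" by (rule bdval_unique[OF open_XT rc(1) _ at]) simp
  then show "trace_x T a (%z. f z - r z) t = 0"
   unfolding trace_x_def bdval_diff[OF nice_XT[OF T] f rb at]
   using a by (auto simp: r hermite_def Let_def p0_def p1_def trace_x_def)
  have "bdval (XT T) (dX r) (a, t) = r' (a, t)" by (rule bdval_unique[OF open_XT rc(2) rd at])
  moreover have "bdval (XT T) (dX (%z. f z - r z)) (a, t) = bdval (XT T) (%z. dX f z - dX r z) (a, t)"
   by (rule bdval_cong[OF nice_XT[OF T] bsm_diff[OF open_XT f1 r1] _ at]) (simp add: pdiff_diff_on[OF open_XT f rb])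
  ultimately show "trace_x T a (dX (%z. f z - r z)) t = 0"
   unfolding trace_x_def using a bdval_diff[OF nice_XT[OF T] f1 r1 at]
   by (auto simp: r'_def Let_def q0_def q1_def trace_x_def)
 qed
qed

lemma A_half:
 "K : A_mod ==> (%ep. K (ep / 2)) : A_mod" "K : A_null ==> (%ep. K (ep / 2)) : A_null"
proof -
 have f: "filterlim (%ep::real. ep / 2) (at_right 0) (at_right 0)" by real_asymp
 have q: "(%ep::real. (ep / 2) powr q) : O[at_right 0](%ep. ep powr q)" for q
 proof (rule bigoI[where c = "(1 / 2) powr q"])
  show "\<forall>\<^sub>F ep::real in at_right 0. norm ((ep / 2) powr q) <= (1 / 2) powr q * norm (ep powr q)"
   using eventually_at_right_01 by eventually_elim (simp add: powr_divide)
 qed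
 have h: "(%ep. K (ep / 2)) : O[at_right 0](%ep. ep powr q)" if "K : O[at_right 0](%ep. ep powr q)" for q and K :: "real => real"
  by (rule landau_o.big_trans[OF landau_o.big.compose[OF that f] q])
 show "K : A_mod ==> (%ep. K (ep / 2)) : A_mod" using h unfolding A_mod_def by blast
 show "K : A_null ==> (%ep. K (ep / 2)) : A_null" using h unfolding A_null_def by blast
qed

lemma snet_half:
 assumes "snet A_mod Om u" shows "snet A_mod Om (%ep. u (ep / 2))"
 unfolding snet_def
proof (intro conjI ballI)
 show "smooth_on Om (u (ep / 2))" if "ep : {0<..1}" for ep
  using that by (intro snet_smooth[OF assms]) auto
 fix es :: "'a list" assume es: "es : lists Basis"
 obtain K where K: "K : A_mod" "!!ep z. 0 < ep ==> ep <= 1 ==> z : Om ==> cmod (pdiffs es (u ep) z) <= K ep"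
  using snet_bound[OF assms es] by metis
 show "\<exists>K\<in>A_mod. \<forall>ep\<in>{0<..1}. \<forall>z\<in>Om. cmod (pdiffs es (u (ep / 2)) z) <= K ep"
  by (rule bexI[OF _ A_half(1)[OF K(1)]]) (auto intro: K(2))
qed

text \<open>Exponent 1 among the null bounds already gives geometric decay along
  \<open>2^-k\<close>.\<close>

lemma A_null_summable:
 assumes "K : A_null" shows "summable (%k. K ((1 / 2) ^ k))"
proof -
 have "\<forall>q\<ge>0. K : O[at_right 0](%ep. ep powr q)" using assms by (simp add: A_null_def)
 then have "K : O[at_right 0](%ep. ep powr 1)" by (metis zero_le_one)
 moreover have "filterlim (%k. (1 / 2) ^ k :: real) (at_right 0) sequentially" by real_asymp
 ultimately have "(%k. K ((1 / 2) ^ k)) : O(%k. ((1 / 2) ^ k) powr 1)" by (rule landau_o.big.compose)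
 then obtain C where "\<forall>\<^sub>F k in sequentially. norm (K ((1 / 2) ^ k)) <= C * norm (((1 / 2 :: real) ^ k) powr 1)"
  by (elim landau_o.bigE)
 then have "\<forall>\<^sub>F k in sequentially. norm (K ((1 / 2) ^ k)) <= C * (1 / 2) ^ k" by simp
 then show ?thesis by (rule summable_comparison_test_ev) (intro summable_mult summable_geometric, simp)
qed

text \<open>The telescoping series of every iterated derivative converges uniformly by the
  Weierstrass test. Uniform convergence of the next derivatives makes each limit differentiable with
  the expected partial derivatives, so the limits form an invariant for
  \<open>snet_coinduct\<close>.\<close>

lemma smooth_limit:
 fixes Om :: "'a::euclidean_space set"
 assumes nice: "nice_dom Om" and h: "!!k. bsm Om (h k)"
  and S: "!!es. es : lists Basis ==> \<exists>S. summable S \<and> (\<forall>k. \<forall>z\<in>Om. cmod (pdiffs es (h (Suc k)) z - pdiffs es (h k) z) <= S k)"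
 obtains f where "bsm Om f" "uniform_limit Om h f sequentially"
proof -
 define F where "F es z = lim (%k. pdiffs es (h k) z)" for es z
 have ul: "uniform_limit Om (%k. pdiffs es (h k)) (F es) sequentially" if es: "es : lists Basis" for es
 proof -
  obtain s where s: "summable s" "!!k z. z : Om ==> norm (pdiffs es (h (Suc k)) z - pdiffs es (h k) z) <= s k"
   using S[OF es] by blast
  have tel: "(\<Sum>i<n. pdiffs es (h (Suc i)) z - pdiffs es (h i) z) = pdiffs es (h n) z - pdiffs es (h 0) z" for n z
   by (rule sum_lessThan_telescope)
  have "uniform_limit Om (%n z. \<Sum>i<n. pdiffs es (h (Suc i)) z - pdiffs es (h i) z)
    (%z. \<Sum>i. pdiffs es (h (Suc i)) z - pdiffs es (h i) z) sequentially"
   by (rule Weierstrass_m_test[OF s(2,1)])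
  moreover have "uniform_limit Om (%n. pdiffs es (h 0)) (pdiffs es (h 0)) sequentially" by (rule uniform_limit_const)
  ultimately have "uniform_limit Om (%n z. (\<Sum>i<n. pdiffs es (h (Suc i)) z - pdiffs es (h i) z) + pdiffs es (h 0) z)
    (%z. (\<Sum>i. pdiffs es (h (Suc i)) z - pdiffs es (h i) z) + pdiffs es (h 0) z) sequentially"
   by (rule uniform_limit_add)
  then have u: "uniform_limit Om (%n. pdiffs es (h n)) (%z. (\<Sum>i. pdiffs es (h (Suc i)) z - pdiffs es (h i) z) + pdiffs es (h 0) z) sequentially"
   unfolding tel by simp
  have "F es z = (\<Sum>i. pdiffs es (h (Suc i)) z - pdiffs es (h i) z) + pdiffs es (h 0) z" if "z : Om" for z
   unfolding F_def by (rule limI[OF tendsto_uniform_limitI[OF u that]])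
  then show ?thesis using u by (metis (no_types, lifting) uniform_limit_cong')
 qed
 have der: "(F es has_derivative (%v. \<Sum>e\<in>Basis. (v \<bullet> e) *\<^sub>R F (e # es) x)) (at x)"
  if es: "es : lists Basis" and x: "x : Om" for es x
 proof -
  have "\<exists>g. \<forall>x\<in>Om. (%n. pdiffs es (h n) x) \<longlonglongrightarrow> g x \<and> (g has_derivative (%v. \<Sum>e\<in>Basis. (v \<bullet> e) *\<^sub>R F (e # es) x)) (at x within Om)"
  proof (rule has_derivative_sequence[OF nice_convex[OF nice]])
   show "(pdiffs es (h n) has_derivative (%v. \<Sum>e\<in>Basis. (v \<bullet> e) *\<^sub>R pdiff e (pdiffs es (h n)) x)) (at x within Om)" if "x : Om" for n x
    by (rule has_derivative_at_withinI, rule pdiff_has_derivative,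
     rule snet_differentiable[OF snet_pdiffs[OF h es] nice_open[OF nice], of 1]) (use that in auto)
   fix ep :: real assume ep: "ep > 0"
   \<comment> \<open>Divided by the dimension because the errors of all partial derivatives add up
     in the total derivative.\<close>
   define \<delta> where "\<delta> = ep / DIM('a)"
   have \<delta>: "\<delta> > 0" using ep by (simp add: \<delta>_def)
   have "\<forall>\<^sub>F n in sequentially. \<forall>e\<in>Basis. \<forall>x\<in>Om. dist (pdiffs (e # es) (h n) x) (F (e # es) x) < \<delta>"
    using ul es \<delta> by (intro eventually_ball_finite) (auto simp: uniform_limit_iff)
   then show "\<forall>\<^sub>F n in sequentially. \<forall>x\<in>Om. \<forall>v. norm ((\<Sum>e\<in>Basis. (v \<bullet> e) *\<^sub>R pdiff e (pdiffs es (h n)) x) - (\<Sum>e\<in>Basis. (v \<bullet> e) *\<^sub>R F (e # es) x)) <= ep * norm v"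
   proof (rule eventually_mono, intro ballI allI)
    fix n x v assume n: "\<forall>e\<in>Basis. \<forall>x\<in>Om. dist (pdiffs (e # es) (h n) x) (F (e # es) x) < \<delta>" and x: "x : Om"
    have "norm ((\<Sum>e\<in>Basis. (v \<bullet> e) *\<^sub>R pdiff e (pdiffs es (h n)) x) - (\<Sum>e\<in>Basis. (v \<bullet> e) *\<^sub>R F (e # es) x))
     = norm (\<Sum>e\<in>Basis. (v \<bullet> e) *\<^sub>R (pdiff e (pdiffs es (h n)) x - F (e # es) x))"
     by (simp add: sum_subtractf scaleR_diff_right)
    also have "\<dots> <= (\<Sum>e\<in>(Basis::'a set). norm v * \<delta>)"
    proof (rule sum_norm_le)
     fix e :: 'a assume e: "e : Basis"
     have "norm (pdiff e (pdiffs es (h n)) x - F (e # es) x) <= \<delta>" using n e x by (auto simp: dist_norm pdiffs_Cons less_imp_le)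
     then show "norm ((v \<bullet> e) *\<^sub>R (pdiff e (pdiffs es (h n)) x - F (e # es) x)) <= norm v * \<delta>"
     using Basis_le_norm[OF e, of v] by (simp add: mult_mono)
    qed
    also have "\<dots> = ep * norm v" by (simp add: \<delta>_def)
    finally show "norm ((\<Sum>e\<in>Basis. (v \<bullet> e) *\<^sub>R pdiff e (pdiffs es (h n)) x) - (\<Sum>e\<in>Basis. (v \<bullet> e) *\<^sub>R F (e # es) x)) <= ep * norm v" .
   qed
  next
   show "x : Om" by (rule x)
   show "(%n. pdiffs es (h n) x) \<longlonglongrightarrow> F es x" by (rule tendsto_uniform_limitI[OF ul[OF es] x])
  qed
  then obtain g where g: "!!x. x : Om ==> (%n. pdiffs es (h n) x) \<longlonglongrightarrow> g x"
   "(g has_derivative (%v. \<Sum>e\<in>Basis. (v \<bullet> e) *\<^sub>R F (e # es) x)) (at x within Om)" using x by blast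
  have gF: "g y = F es y" if "y : Om" for y
   using LIMSEQ_unique[OF g(1)[OF that] tendsto_uniform_limitI[OF ul[OF es] that]] .
  have "(g has_derivative (%v. \<Sum>e\<in>Basis. (v \<bullet> e) *\<^sub>R F (e # es) x)) (at x)"
   using g(2) at_within_open[OF x nice_open[OF nice]] by simp
  then show ?thesis by (rule has_derivative_transform_within_open[OF _ nice_open[OF nice] x gF])
 qed
 have bs: "bsm Om (F [])"
 proof (rule snet_coinduct[OF nice_open[OF nice], where P = "%v. \<exists>es\<in>lists Basis. v = (%_. F es)"])
  show "\<exists>es\<in>lists Basis. (%ep. F []) = (%_. F es)" by (intro bexI[of _ "[]"]) auto
  fix v :: "real => 'a => complex" assume "\<exists>es\<in>lists Basis. v = (%_. F es)"
  then obtain es where es: "es : lists Basis" and v: "v = (%_. F es)" by blast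
  show "v ep differentiable (at z)" if "z : Om" for ep z
   unfolding v differentiable_def using der[OF es that] by blast
  show "\<exists>K\<in>UNIV. \<forall>ep\<in>{0<..1}. \<forall>z\<in>Om. cmod (v ep z) <= K ep"
  proof -
   have "\<forall>\<^sub>F n in sequentially. \<forall>x\<in>Om. dist (pdiffs es (h n) x) (F es x) < 1" using ul[OF es] by (auto simp: uniform_limit_iff)
   then obtain n where n: "!!x. x : Om ==> dist (pdiffs es (h n) x) (F es x) < 1" using eventually_happens by force
   obtain K where K: "!!z. z : Om ==> cmod (pdiffs es (h n) z) <= K" using bsm_bound0[OF snet_pdiffs[OF h es]] by blast
   have "cmod (F es z) <= K + 1" if "z : Om" for z
    using n[OF that] K[OF that] norm_triangle_sub[of "F es z" "pdiffs es (h n) z"] by (simp add: dist_norm norm_minus_commute)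
   then show ?thesis unfolding v by (intro bexI[of _ "%_. K + 1"]) auto
  qed
  show "\<exists>w. (\<exists>es\<in>lists Basis. w = (%_. F es)) \<and> (\<forall>ep\<in>{0<..1}. \<forall>z\<in>Om. pdiff e (v ep) z = w ep z)" if e: "e : Basis" for e
  proof -
   have pd: "pdiff e (F es) z = F (e # es) z" if z: "z : Om" for z
   proof -
    have "pdiff e (F es) z = (\<Sum>b\<in>Basis. (e \<bullet> b) *\<^sub>R F (b # es) z)" by (rule pdiff_eq[OF der[OF es z]])
    also have "\<dots> = (\<Sum>b\<in>Basis. if b = e then F (b # es) z else 0)"
     by (rule sum.cong) (auto simp: inner_Basis e)
    also have "\<dots> = F (e # es) z" using e by simp
    finally show ?thesis .
   qed
   have "e # es : lists Basis" using e es by simp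
   then show ?thesis using pd unfolding v by blast
  qed
 qed
 show thesis by (rule that[OF bs]) (use ul[of "[]"] in simp)
qed

section \<open>From Colombeau classes to nets\<close>

lemma colrel_iff:
 "nice_dom Om ==> (u, v) : colrel Om \<longleftrightarrow> snet A_mod Om u \<and> snet A_mod Om v \<and> snet A_null Om (%ep z. u ep z - v ep z)"
 by (simp add: colrel_def moderate_iff_snet null_iff_snet)

lemma in_cls_iff: "v : cls Om u \<longleftrightarrow> (u, v) : colrel Om"
 by (simp add: cls_def)

lemma colrel_sym_trans:
 assumes nice: "nice_dom Om"
 shows "(u, v) : colrel Om ==> (v, u) : colrel Om" "(u, v) : colrel Om ==> (v, w) : colrel Om ==> (u, w) : colrel Om"
proof -
 assume "(u, v) : colrel Om"
 then have uv: "snet A_mod Om u" "snet A_mod Om v" "snet A_null Om (%ep z. u ep z - v ep z)" using nice by (simp_all add: colrel_iff)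
 from snet_class_diff[OF _ nice_open[OF nice] snet_zero uv(3)] uv show "(v, u) : colrel Om" using nice by (simp add: colrel_iff)
 assume "(v, w) : colrel Om"
 then have vw: "snet A_mod Om w" "snet A_null Om (%ep z. v ep z - w ep z)" using nice by (simp_all add: colrel_iff)
 from snet_class_add[OF _ nice_open[OF nice] uv(3) vw(2)] uv vw show "(u, w) : colrel Om" using nice by (simp add: colrel_iff)
qed

lemma cls_self: "nice_dom Om ==> snet A_mod Om u ==> u : cls Om u"
 by (simp add: in_cls_iff colrel_iff snet_zero)

lemma cls_eqI: "nice_dom Om ==> (u, v) : colrel Om ==> cls Om u = cls Om v"
 unfolding set_eq_iff in_cls_iff using colrel_sym_trans[of Om] by blast

text \<open>A null bound tends to 0 while a constant net does not move. This is how equations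
  between classes become pointwise equations for smooth functions.\<close>

lemma null_const_zero:
 assumes "snet A_null Om (%_. f)" "z : Om" shows "f z = 0"
proof -
 obtain K where K: "K : A_null" "!!ep z. 0 < ep ==> ep <= 1 ==> z : Om ==> cmod (f z) <= K ep" using snet_bound0[OF assms(1)] by metis
 have "cmod (f z) <= 0"
  by (rule tendsto_lowerbound[OF A_null_tendsto[OF K(1)]])
   (use eventually_mono[OF eventually_at_right_01] K(2) assms(2) in \<open>auto simp: trivial_limit_at_right_real\<close>)
 then show ?thesis by simp
qed

text \<open>The ellipticity bounds are given for some representative \<open>ce\<close>, not for
  \<open>cs\<close> itself. But \<open>ce\<close> converges pointwise to \<open>cs\<close>, and
  being real and lying between \<open>c0\<close> and \<open>c1\<close> are closed
  conditions.\<close>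

lemma plate_of_class:
 assumes T: "T > 0" and bs: "bsm (XT T) bs" and cs: "bsm U01 cs" and ce: "ce : cls U01 (%_. cs)" and c0: "0 < c0"
  and b: "!!ep x. 0 < ep ==> ep <= 1 ==> x : U01 ==> ce ep x : \<real> \<and> c0 <= Re (ce ep x) \<and> Re (ce ep x) <= c1"
 obtains Cb where "plate T bs cs c0 c1 Cb"
proof -
 obtain Cb where Cb: "Cb >= 0" "!!z. z : XT T ==> cmod (bs z) <= Cb" using bsm_bound0[OF bs] by blast
 have nul: "snet A_null U01 (%ep z. cs z - ce ep z)" using ce by (simp add: in_cls_iff colrel_iff[OF nice_U01])
 obtain K where K: "K : A_null" "!!ep z. 0 < ep ==> ep <= 1 ==> z : U01 ==> cmod (cs z - ce ep z) <= K ep"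
  using snet_bound0[OF nul] by metis
 have lim: "((%ep. ce ep x) \<longlongrightarrow> cs x) (at_right 0)" if x: "x : U01" for x
 proof -
  have "((%ep. ce ep x - cs x) \<longlongrightarrow> 0) (at_right 0)"
   by (rule Lim_null_comparison[OF _ A_null_tendsto[OF K(1)]], rule eventually_mono[OF eventually_at_right_01])
    (use K(2) x in \<open>simp add: norm_minus_commute\<close>)
  then show ?thesis by (rule LIM_zero_cancel)
 qed
 have ne: "at_right (0::real) \<noteq> bot" by (simp add: trivial_limit_at_right_real)
 have "plate T bs cs c0 c1 Cb"
 proof
  fix x :: real assume x: "x : U01"
  have ev: "\<forall>\<^sub>F ep in at_right 0. ce ep x : \<real> \<and> c0 <= Re (ce ep x) \<and> Re (ce ep x) <= c1"
   by (rule eventually_mono[OF eventually_at_right_01]) (use b x in blast)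
  show "cs x : \<real>"
   by (rule Lim_in_closed_set[OF closed_complex_Reals _ ne lim[OF x]]) (rule eventually_mono[OF ev], simp)
  show "c0 <= Re (cs x)"
   by (rule tendsto_lowerbound[OF tendsto_Re[OF lim[OF x]] _ ne]) (rule eventually_mono[OF ev], simp)
  show "Re (cs x) <= c1"
   by (rule tendsto_upperbound[OF tendsto_Re[OF lim[OF x]] _ ne]) (rule eventually_mono[OF ev], simp)
 qed (use T bs cs Cb c0 in auto)
 then show thesis by (rule that)
qed

text \<open>Operations on classes are unions over representatives, so computing with one
  representative yields a member of the result.\<close>

lemma col_map_memI:
 assumes "nice_dom Om" "u : U" "snet A_mod Om v" "!!ep. v ep = \<Phi> (u ep)"
 shows "v : col_map Om \<Phi> U"
proof -
 have "v = (%ep. \<Phi> (u ep))" by (rule ext) (rule assms(4))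
 then have "v : cls Om (%ep. \<Phi> (u ep))" using cls_self[OF assms(1,3)] by simp
 then show ?thesis unfolding col_map_def by (rule UN_I[OF assms(2)])
qed

lemma col_add_memI:
 assumes "nice_dom Om" "u : U" "v : V" "snet A_mod Om w" "!!ep z. w ep z = u ep z + v ep z"
 shows "w : col_add Om U V"
proof -
 have "w = (%ep z. u ep z + v ep z)" by (intro ext) (rule assms(5))
 then have "w : cls Om (%ep z. u ep z + v ep z)" using cls_self[OF assms(1,4)] by simp
 then show ?thesis unfolding col_add_def by (rule UN_I[OF assms(2) UN_I[OF assms(3)]])
qed

lemma col_mult_memI:
 assumes "nice_dom Om" "u : U" "v : V" "snet A_mod Om w" "!!ep z. w ep z = u ep z * v ep z"
 shows "w : col_mult Om U V"
proof -
 have "w = (%ep z. u ep z * v ep z)" by (intro ext) (rule assms(5))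
 then have "w : cls Om (%ep z. u ep z * v ep z)" using cls_self[OF assms(1,4)] by simp
 then show ?thesis unfolding col_mult_def by (rule UN_I[OF assms(2) UN_I[OF assms(3)]])
qed

text \<open>Every operation is carried out on one representative \<open>u\<close> of
  \<open>U\<close>. The equations between classes thereby become membership of the computed nets in
  \<open>g\<close>, \<open>f1\<close> and \<open>f2\<close>, and nullness of the lateral
  traces.\<close>

lemma generalized_solution_nets:
 assumes T: "T > 0" and bs: "bsm (XT T) bs" and cs: "bsm U01 cs"
  and sol: "generalized_solution T (col_embed (XT T) bs) (col_embed U01 cs) f1 f2 g U"
 obtains u where "snet A_mod (XT T) u" "U = cls (XT T) u" "(%ep. plate_op bs cs (u ep)) : g"
  "(%ep. trace_t T 0 (u ep)) : f1" "(%ep. trace_t T 0 (dT (u ep))) : f2"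
  "!!a. a : {0, 1} ==> snet A_null {0<..<T} (%ep. trace_x T a (u ep))"
  "!!a. a : {0, 1} ==> snet A_null {0<..<T} (%ep. trace_x T a (dX (u ep)))"
proof -
 note nX = nice_XT[OF T] note nI = nice_U[OF T]
 have U: "U : Col (XT T)" and pde: "col_add (XT T) (col_add (XT T) (col_diff (XT T) dirT (col_diff (XT T) dirT U))
    (col_diff (XT T) dirX (col_diff (XT T) dirX (col_mult (XT T) (col_lift_x T (col_embed U01 cs)) (col_diff (XT T) dirX (col_diff (XT T) dirX U))))))
    (col_mult (XT T) (col_embed (XT T) bs) (col_diff (XT T) dirX (col_diff (XT T) dirX U))) = g"
  and ini: "col_map U01 (trace_t T 0) U = f1" "col_map U01 (trace_t T 0) (col_diff (XT T) dirT U) = f2"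
  and lat: "!!a. a : {0, 1} ==> col_map {0<..<T} (trace_x T a) U = col_zero {0<..<T}"
   "!!a. a : {0, 1} ==> col_map {0<..<T} (trace_x T a) (col_diff (XT T) dirX U) = col_zero {0<..<T}"
  using sol unfolding generalized_solution_def Let_def by auto
 obtain u where u: "u : moderate (XT T)" "U = colrel (XT T) `` {u}"
  using U unfolding Col_def by (auto elim: quotientE)
 have um: "snet A_mod (XT T) u" using u(1) by (simp add: moderate_iff_snet[OF nX])
 have Uc: "U = cls (XT T) u" using u(2) by (simp add: cls_def)
 have uU: "u : U" unfolding Uc by (rule cls_self[OF nX um])
 define ux where "ux ep = dX (u ep)" for ep
 define uxx where "uxx ep = dX (ux ep)" for ep
 define ut where "ut ep = dT (u ep)" for ep
 define utt where "utt ep = dT (ut ep)" for ep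
 define C where "C ep z = cs (fst z)" for ep :: real and z :: "real \<times> real"
 define F where "F ep z = C ep z * uxx ep z" for ep z
 define Fx where "Fx ep = dX (F ep)" for ep
 define Fxx where "Fxx ep = dX (Fx ep)" for ep
 define G where "G ep z = bs z * uxx ep z" for ep :: real and z
 define S where "S ep z = utt ep z + Fxx ep z" for ep z
 define P where "P ep z = S ep z + G ep z" for ep z
 have A: "A_mod : {A_mod, A_null}" by simp
 have m: "snet A_mod (XT T) ux" "snet A_mod (XT T) ut" unfolding ux_def[abs_def] ut_def[abs_def] by (rule snet_XT_pdiff[OF um])+
 have m2: "snet A_mod (XT T) uxx" "snet A_mod (XT T) utt" unfolding uxx_def[abs_def] utt_def[abs_def] by (rule snet_XT_pdiff[OF m(1)], rule snet_XT_pdiff[OF m(2)])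
 have Cm: "snet A_mod (XT T) C" unfolding C_def[abs_def] by (rule snet_lift_x[OF snet_const_mod[OF cs]])
 have Fm: "snet A_mod (XT T) F" unfolding F_def[abs_def] by (rule snet_class_mult[OF A open_XT Cm m2(1)])
 have Fxm: "snet A_mod (XT T) Fx" unfolding Fx_def[abs_def] by (rule snet_XT_pdiff[OF Fm])
 have Fxxm: "snet A_mod (XT T) Fxx" unfolding Fxx_def[abs_def] by (rule snet_XT_pdiff[OF Fxm])
 have Gm: "snet A_mod (XT T) G" unfolding G_def[abs_def] by (rule snet_class_mult[OF A open_XT snet_const_mod[OF bs] m2(1)])
 have Sm: "snet A_mod (XT T) S" unfolding S_def[abs_def] by (rule snet_class_add[OF A open_XT m2(2) Fxxm])
 have Pm: "snet A_mod (XT T) P" unfolding P_def[abs_def] by (rule snet_class_add[OF A open_XT Sm Gm])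
 have bm: "(%_. bs) : col_embed (XT T) bs" and cm: "(%_. cs) : col_embed U01 cs"
  unfolding col_embed_def by (rule cls_self[OF nX snet_const_mod[OF bs]], rule cls_self[OF nice_U01 snet_const_mod[OF cs]])
 note xm = col_map_memI[OF nX uU m(1) ux_def] and tm = col_map_memI[OF nX uU m(2) ut_def]
 note xxm = col_map_memI[OF nX xm m2(1) uxx_def] and ttm = col_map_memI[OF nX tm m2(2) utt_def]
 have cl: "C : col_lift_x T (col_embed U01 cs)"
  by (rule col_map_memI[OF nX cm Cm]) (simp add: C_def[abs_def] split_beta')
 note FF = col_mult_memI[OF nX cl xxm Fm F_def]
 note FFx = col_map_memI[OF nX FF Fxm Fx_def]
 note FFxx = col_map_memI[OF nX FFx Fxxm Fxx_def]
 note GG = col_mult_memI[OF nX bm xxm Gm G_def]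
 have "P : g" unfolding pde[symmetric] by (rule col_add_memI[OF nX col_add_memI[OF nX ttm FFxx Sm S_def] GG Pm P_def])
 moreover have "(%ep. plate_op bs cs (u ep)) = P"
  by (simp add: fun_eq_iff plate_op_def P_def S_def G_def Fxx_def Fx_def F_def[abs_def] C_def uxx_def ux_def utt_def ut_def)
 ultimately have P: "(%ep. plate_op bs cs (u ep)) : g" by simp
 have 0: "0 : {0..T}" using T by simp
 have l0: "snet A_null {0<..<T} n" if "n : col_zero {0<..<T}" for n
  using colrel_sym_trans(1)[OF nI, of "%_ _. 0" n] that by (simp add: col_embed_def in_cls_iff colrel_iff[OF nI])
 show thesis
 proof (rule that[OF um Uc P])
  show "(%ep. trace_t T 0 (u ep)) : f1"
   unfolding ini(1)[symmetric] by (rule col_map_memI[OF nice_U01 uU snet_trace_t[OF T um 0] refl])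
  show "(%ep. trace_t T 0 (dT (u ep))) : f2"
   unfolding ini(2)[symmetric] using col_map_memI[OF nice_U01 tm snet_trace_t[OF T m(2) 0] refl] by (simp add: ut_def)
  fix a :: real assume a: "a : {0, 1}"
  then have a': "a : {0..1}" by auto
  show "snet A_null {0<..<T} (%ep. trace_x T a (u ep))"
   by (rule l0, unfold lat(1)[OF a, symmetric], rule col_map_memI[OF nI uU snet_trace_x[OF T um a'] refl])
  have "snet A_null {0<..<T} (%ep. trace_x T a (ux ep))"
   by (rule l0, unfold lat(2)[OF a, symmetric], rule col_map_memI[OF nI xm snet_trace_x[OF T m(1) a'] refl])
  then show "snet A_null {0<..<T} (%ep. trace_x T a (dX (u ep)))" by (simp add: ux_def)
 qed
qed

section \<open>Correction of representatives and the smooth case\<close>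

lemma J_wd_diff:
 assumes f: "bsm U01 f" and g: "bsm U01 g"
 shows "norm (J (wd k f) - J (wd k g)) = L2norm U01 (pdiffs (replicate k 1) (%x. f x - g x))"
proof -
 note r = replicate_Basis[of k]
 have L: "pdiffs (replicate k 1) f : L2 U01" "pdiffs (replicate k 1) g : L2 U01" by (intro bsm_L2 snet_pdiffs f g r)+
 have "norm (J (wd k f) - J (wd k g)) = L2norm U01 (%x. pdiffs (replicate k 1) f x - pdiffs (replicate k 1) g x)"
  unfolding bsm_H2(2)[OF f] bsm_H2(2)[OF g] funpow_pdiff by (rule J_norm_diff[OF L])
 also have "\<dots> = L2norm U01 (pdiffs (replicate k 1) (%x. f x - g x))"
  unfolding L2norm_def using pdiffs_diff_on[OF _ f g r]
  by (intro arg_cong[where f = sqrt] bochner_cong) auto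
 finally show ?thesis .
qed

lemma trace_t_diff:
 assumes T: "T > 0" and f: "bsm (XT T) f" and g: "bsm (XT T) g" and s: "s : {0..T}" and x: "x : U01"
 shows "trace_t T s (%z. f z - g z) x = trace_t T s f x - trace_t T s g x"
  "trace_t T s (dT (%z. f z - g z)) x = trace_t T s (dT f) x - trace_t T s (dT g) x"
proof -
 note z = U01_closure_XT[OF x s T] and b = bsm_pdiff(2)[OF f] bsm_pdiff(2)[OF g]
 show "trace_t T s (%z. f z - g z) x = trace_t T s f x - trace_t T s g x"
  unfolding trace_t_def by (rule bdval_diff[OF nice_XT[OF T] f g z])
 have "trace_t T s (dT (%z. f z - g z)) x = trace_t T s (%z. dT f z - dT g z) x"
  unfolding trace_t_def
  by (rule bdval_cong[OF nice_XT[OF T] bsm_diff[OF open_XT b] _ z]) (simp add: pdiff_diff_on[OF open_XT f g])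
 also have "\<dots> = trace_t T s (dT f) x - trace_t T s (dT g) x"
  unfolding trace_t_def by (rule bdval_diff[OF nice_XT[OF T] b z])
 finally show "trace_t T s (dT (%z. f z - g z)) x = trace_t T s (dT f) x - trace_t T s (dT g) x" .
qed

lemma J_trace_t_diff:
 assumes T: "T > 0" and f: "bsm (XT T) f" and g: "bsm (XT T) g" and s: "s : {0..T}"
 shows "J (trace_t T s (%z. f z - g z)) = J (trace_t T s f) - J (trace_t T s g)"
proof -
 note L = trace_t_L2[OF T f s] trace_t_L2[OF T g s]
 have "J (trace_t T s (%z. f z - g z)) = J (%x. trace_t T s f x - trace_t T s g x)"
  by (rule J_cong[OF trace_t_L2[OF T bsm_diff[OF open_XT f g] s] L2_diff[OF L]], rule AE_I2) (simp add: trace_t_diff(1)[OF T f g s])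
 then show ?thesis by (simp add: J_diff[OF L])
qed

context plate
begin

text \<open>
 The Hermite corrector turns a representative whose lateral traces are merely null into one that
 satisfies the boundary conditions exactly, so that the energy estimate applies to it.
\<close>

lemma clamped_approximation:
 assumes u: "snet A_mod (XT T) u"
  and lat: "!!a. a : {0, 1} ==> snet A_null {0<..<T} (%ep. trace_x T a (u ep))"
   "!!a. a : {0, 1} ==> snet A_null {0<..<T} (%ep. trace_x T a (dX (u ep)))"
  and g: "snet A_mod (XT T) ge" "snet A_null (XT T) (%ep z. plate_op b c (u ep) z - ge ep z)"
  and f1: "snet A_mod U01 f1e" "snet A_null U01 (%ep x. trace_t T 0 (u ep) x - f1e ep x)"
  and f2: "snet A_mod U01 f2e" "snet A_null U01 (%ep x. trace_t T 0 (dT (u ep)) x - f2e ep x)"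
 obtains v ka where "ka : A_null" "snet A_mod (XT T) v" "snet A_null (XT T) (%ep z. u ep z - v ep z)"
  "!!ep. 0 < ep ==> ep <= 1 ==> clamped T (v ep)"
  "!!ep. 0 < ep ==> ep <= 1 ==> norm (J (trace_t T 0 (v ep)) - J (f1e ep)) <= ka ep"
  "!!ep. 0 < ep ==> ep <= 1 ==> norm (J (wd 2 (trace_t T 0 (v ep))) - J (wd 2 (f1e ep))) <= ka ep"
  "!!ep. 0 < ep ==> ep <= 1 ==> norm (J (trace_t T 0 (dT (v ep))) - J (f2e ep)) <= ka ep"
  "!!ep z. 0 < ep ==> ep <= 1 ==> z : XT T ==> cmod (plate_op b c (v ep) z - ge ep z) <= ka ep"
proof -
 have t0: "0 : {0..T}" using T by simp
 have A: "A_null : {A_mod, A_null}" "A_mod : {A_mod, A_null}" by simp_all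
 define r where "r ep = hermite_lift T (u ep)" for ep
 define v where "v ep z = u ep z - r ep z" for ep z
 have rn: "snet A_null (XT T) r" unfolding r_def[abs_def] by (rule hermite_lift_null[OF lat])
 have rm: "snet A_mod (XT T) r" by (rule snet_mono[OF rn A_null_mod])
 have vm: "snet A_mod (XT T) v" unfolding v_def[abs_def] by (rule snet_class_diff[OF A(2) open_XT u rm])
 have ub: "bsm (XT T) (u ep)" and rb: "bsm (XT T) (r ep)" and vb: "bsm (XT T) (v ep)" if "0 < ep" "ep <= 1" for ep
  using snet_bsm[OF u that] snet_bsm[OF rn that] snet_bsm[OF vm that] .
 have n1: "snet A_null U01 (%ep x. trace_t T 0 (v ep) x - f1e ep x)"
  by (rule snet_cong[OF _ snet_class_diff[OF A(1) _ f1(2) snet_trace_t[OF T rn t0]]])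
   (simp_all add: v_def[abs_def] trace_t_diff[OF T ub rb t0])
 have n2: "snet A_null U01 (%ep x. trace_t T 0 (dT (v ep)) x - f2e ep x)"
  by (rule snet_cong[OF _ snet_class_diff[OF A(1) _ f2(2) snet_trace_t[OF T snet_XT_pdiff(2)[OF rn] t0]]])
   (simp_all add: v_def[abs_def] trace_t_diff[OF T ub rb t0])
 have n3: "snet A_null (XT T) (%ep z. plate_op b c (v ep) z - ge ep z)"
  by (rule snet_cong[OF open_XT snet_class_diff[OF A(1) open_XT g(2) plate_op_snet[OF A(1) b_smooth c_smooth rn]]])
   (simp add: v_def[abs_def] plate_op_diff[OF c_smooth ub rb])
 obtain K where K: "K : A_null" "!!ep z. 0 < ep ==> ep <= 1 ==> z : XT T ==> cmod (plate_op b c (v ep) z - ge ep z) <= K ep"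
  using snet_bound0[OF n3] by metis
 define a1 where "a1 ep = L2norm U01 (pdiffs [] (%x. trace_t T 0 (v ep) x - f1e ep x))" for ep
 define a2 where "a2 ep = L2norm U01 (pdiffs (replicate 2 1) (%x. trace_t T 0 (v ep) x - f1e ep x))" for ep
 define a3 where "a3 ep = L2norm U01 (pdiffs [] (%x. trace_t T 0 (dT (v ep)) x - f2e ep x))" for ep
 have a: "a1 : A_null" "a2 : A_null" "a3 : A_null"
  unfolding a1_def[abs_def] a2_def[abs_def] a3_def[abs_def]
  using snet_L2norm_null[OF n1 nice_U01, of "[]"] snet_L2norm_null[OF n1 nice_U01 replicate_Basis[of 2]] snet_L2norm_null[OF n2 nice_U01, of "[]"] by simp_all
 \<comment> \<open>A single null bound for all data errors of the corrected net: displacement, its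
   second derivative, velocity and force.\<close>
 define ka where "ka ep = a1 ep + a2 ep + a3 ep + \<bar>K ep\<bar>" for ep
 have nn: "a1 ep >= 0" "a2 ep >= 0" "a3 ep >= 0" for ep by (simp_all add: a1_def a2_def a3_def)
 show thesis
 proof (rule that[of ka v])
  show "ka : A_null" unfolding ka_def[abs_def] by (intro A_null_add a A_null_abs K(1))
  show "snet A_null (XT T) (%ep z. u ep z - v ep z)" using rn by (simp add: v_def)
  fix ep :: real assume ep: "0 < ep" "ep <= 1"
  show "clamped T (v ep)" unfolding v_def[abs_def] r_def by (rule clamped_hermite(1)[OF T ub[OF ep]])
  have tb: "bsm U01 (trace_t T 0 (v ep))" "bsm U01 (trace_t T 0 (dT (v ep)))"
   by (intro trace_t_bsm T vb ep t0 bsm_pdiff)+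
  have fb: "bsm U01 (f1e ep)" "bsm U01 (f2e ep)" using snet_bsm[OF f1(1) ep] snet_bsm[OF f2(1) ep] .
  have "norm (J (trace_t T 0 (v ep)) - J (f1e ep)) = a1 ep"
   unfolding a1_def by (simp add: J_norm_diff bsm_L2 tb fb)
  then show "norm (J (trace_t T 0 (v ep)) - J (f1e ep)) <= ka ep" using nn[of ep] by (simp add: ka_def)
  have "norm (J (wd 2 (trace_t T 0 (v ep))) - J (wd 2 (f1e ep))) = a2 ep" unfolding a2_def by (rule J_wd_diff[OF tb(1) fb(1)])
  then show "norm (J (wd 2 (trace_t T 0 (v ep))) - J (wd 2 (f1e ep))) <= ka ep" using nn[of ep] by (simp add: ka_def)
  have "norm (J (trace_t T 0 (dT (v ep))) - J (f2e ep)) = a3 ep"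
   unfolding a3_def by (simp add: J_norm_diff bsm_L2 tb fb)
  then show "norm (J (trace_t T 0 (dT (v ep))) - J (f2e ep)) <= ka ep" using nn[of ep] by (simp add: ka_def)
  show "cmod (plate_op b c (v ep) z - ge ep z) <= ka ep" if "z : XT T" for z
   using K(2)[OF ep that] nn[of ep] by (simp add: ka_def)
 qed (rule vm)
qed

lemma clamped_unique:
 assumes h: "clamped T h" "clamped T h'" and g: "!!z. z : XT T ==> plate_op b c h z = plate_op b c h' z"
  and f: "!!x. x : U01 ==> trace_t T 0 h x = trace_t T 0 h' x" "!!x. x : U01 ==> trace_t T 0 (dT h) x = trace_t T 0 (dT h') x"
  and z: "z : XT T"
 shows "h z = h' z"
proof -
 have hb: "bsm (XT T) h" "bsm (XT T) h'" using h by (simp_all add: clamped_def)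
 have t0: "0 : {0..T}" using T by simp
 obtain K where Kc: "compare_const K" using mild_compare by blast
 note K0 = compareD(1)[OF Kc] and K = compareD(2)[OF Kc]
 note tb = trace_t_bsm[OF T hb(1) t0] trace_t_bsm[OF T hb(2) t0]
 note yb = trace_t_bsm[OF T bsm_pdiff(2)[OF hb(1)] t0] trace_t_bsm[OF T bsm_pdiff(2)[OF hb(2)] t0]
 have 1: "J (trace_t T 0 h) = J (trace_t T 0 h')" by (rule J_cong[OF bsm_L2[OF tb(1)] bsm_L2[OF tb(2)]], rule AE_I2) (simp add: f)
 have 2: "J (trace_t T 0 (dT h)) = J (trace_t T 0 (dT h'))"
  by (rule J_cong[OF bsm_L2[OF yb(1)] bsm_L2[OF yb(2)]], rule AE_I2) (simp add: f)
 have 3: "J (wd 2 (trace_t T 0 h)) = J (wd 2 (trace_t T 0 h'))"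
  unfolding bsm_H2(2)[OF tb(1)] bsm_H2(2)[OF tb(2)] funpow_pdiff
  by (rule J_cong, (intro bsm_L2 snet_pdiffs tb replicate_Basis)+, rule AE_I2, rule pdiffs_cong[of U01]) (simp_all add: f)
 have 4: "L2norm (XT T) (%p. plate_op b c h p - plate_op b c h' p) = 0"
 proof -
  have "(LINT p|lebesgue_on (XT T). (cmod (plate_op b c h p - plate_op b c h' p))\<^sup>2) = (LINT p|lebesgue_on (XT T). 0)"
   by (rule bochner_cong) (auto simp: g)
  then show ?thesis by (simp add: L2norm_def)
 qed
 have "norm (J (trace_t T t h) - J (trace_t T t h')) <= 0" if t: "t : {0..T}" for t
  using K[OF clamped_mild[OF h(1)] clamped_mild[OF h(2)] bsm_XT_L2[OF T plate_op_bsm[OF hb(1)]] bsm_XT_L2[OF T plate_op_bsm[OF hb(2)]] t]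
  by (simp add: 1 2 3 4)
 then have "L2norm (XT T) (%z. h z - h' z) <= sqrt T * 0"
  by (intro L2norm_XT_le[OF T bsm_diff[OF open_XT hb]]) (simp_all add: J_trace_t_diff[OF T hb])
 then have "L2norm (XT T) (%z. h z - h' z) = 0" using L2norm_nonneg[of "XT T" "%z. h z - h' z"] by simp
 \<comment> \<open>The difference is regarded as a constant net. Vanishing \<open>L2norm\<close>
   makes it null, hence null in the sup norm, so it vanishes at every point and not only almost
   everywhere.\<close>
 then have "(%ep::real. L2norm (XT T) (%z. h z - h' z)) : A_null" using zero_A_null by simp
 from L2_null_imp_sup_null[OF nice_XT[OF T] snet_const_mod[OF bsm_diff[OF open_XT hb]] this]
 have "h z - h' z = 0" by (rule null_const_zero[OF _ z])
 then show ?thesis by simp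
qed

theorem smooth_case:
 assumes u: "snet A_mod (XT T) u"
  and lat: "!!a. a : {0, 1} ==> snet A_null {0<..<T} (%ep. trace_x T a (u ep))"
   "!!a. a : {0, 1} ==> snet A_null {0<..<T} (%ep. trace_x T a (dX (u ep)))"
  and g: "bsm (XT T) gs" "snet A_null (XT T) (%ep z. plate_op b c (u ep) z - gs z)"
  and f1: "bsm U01 f1s" "snet A_null U01 (%ep x. trace_t T 0 (u ep) x - f1s x)"
  and f2: "bsm U01 f2s" "snet A_null U01 (%ep x. trace_t T 0 (dT (u ep)) x - f2s x)"
 obtains h where "bsm (XT T) h" "smooth_solution T b c f1s f2s gs h"
  "!!h' z. smooth_solution T b c f1s f2s gs h' ==> z : XT T ==> h' z = h z"
  "snet A_null (XT T) (%ep z. u ep z - h z)"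
proof -
 have t0: "0 : {0..T}" using T by simp
 note nX = nice_XT[OF T]
 have A: "A_null : {A_mod, A_null}" "A_mod : {A_mod, A_null}" by simp_all
 obtain v ka where ka: "ka : A_null" and vm: "snet A_mod (XT T) v" and uv: "snet A_null (XT T) (%ep z. u ep z - v ep z)"
  and cl: "!!ep. 0 < ep ==> ep <= 1 ==> clamped T (v ep)"
  and e1: "!!ep. 0 < ep ==> ep <= 1 ==> norm (J (trace_t T 0 (v ep)) - J f1s) <= ka ep"
  and e2: "!!ep. 0 < ep ==> ep <= 1 ==> norm (J (wd 2 (trace_t T 0 (v ep))) - J (wd 2 f1s)) <= ka ep"
  and e3: "!!ep. 0 < ep ==> ep <= 1 ==> norm (J (trace_t T 0 (dT (v ep))) - J f2s) <= ka ep"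
  and e4: "!!ep z. 0 < ep ==> ep <= 1 ==> z : XT T ==> cmod (plate_op b c (v ep) z - gs z) <= ka ep"
  by (rule clamped_approximation[OF u lat snet_const_mod[OF g(1)] g(2) snet_const_mod[OF f1(1)] f1(2) snet_const_mod[OF f2(1)] f2(2)])
   (assumption, assumption, rule that, assumption+)
 obtain K where Kc: "compare_const K" using mild_compare by blast
 note K0 = compareD(1)[OF Kc] and K = compareD(2)[OF Kc]
 define \<mu> where "\<mu> = sqrt (measure lebesgue (XT T))"
 have \<mu>: "\<mu> >= 0" by (simp add: \<mu>_def)
 \<comment> \<open>The stability estimate with data errors at most \<open>s\<close>: 1 for the
   initial displacement, 2 for the velocity and the second derivative, the rest for the force on a
   rectangle of measure \<mu> squared.\<close>
 define C where "C = 1 + K * (2 + sqrt T * \<mu>)"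
 have C: "C >= 0" using K0 \<mu> T by (simp add: C_def)
 have vb: "bsm (XT T) (v ep)" if "0 < ep" "ep <= 1" for ep by (rule snet_bsm[OF vm that])
 have ka0: "ka ep >= 0" if "0 < ep" "ep <= 1" for ep by (rule order_trans[OF norm_ge_zero e1[OF that]])
 have tri: "norm (a - b) <= p + q" if "norm (a - m) <= p" "norm (b - m) <= q" for a b m :: l2 and p q
  using norm_triangle_ineq4[of "a - m" "b - m"] that by simp
 have cmp: "norm (J (trace_t T t (v ep)) - J (trace_t T t (v \<delta>))) <= C * (ka ep + ka \<delta>)"
  if ep: "0 < ep" "ep <= 1" and \<delta>: "0 < \<delta>" "\<delta> <= 1" and t: "t : {0..T}" for ep \<delta> t
 proof -
  define s where "s = ka ep + ka \<delta>"
  have s: "s >= 0" using ka0[OF ep] ka0[OF \<delta>] by (simp add: s_def)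
  have P: "plate_op b c (v ep) : L2 (XT T)" "plate_op b c (v \<delta>) : L2 (XT T)" by (intro bsm_XT_L2 T plate_op_bsm vb ep \<delta>)+
  have "L2norm (XT T) (%p. plate_op b c (v ep) p - plate_op b c (v \<delta>) p) <= sqrt (measure lebesgue (XT T)) * \<bar>s\<bar>"
  proof (rule bounded_L2(2)[OF nice_lmeasurable[OF nX] L2D(1)[OF L2_diff[OF P]]])
   fix z assume z: "z : XT T"
   show "cmod (plate_op b c (v ep) z - plate_op b c (v \<delta>) z) <= s"
    using e4[OF ep z] e4[OF \<delta> z] norm_triangle_ineq4[of "plate_op b c (v ep) z - gs z" "plate_op b c (v \<delta>) z - gs z"] by (simp add: s_def)
  qed
  then have P': "L2norm (XT T) (%p. plate_op b c (v ep) p - plate_op b c (v \<delta>) p) <= \<mu> * s" using s by (simp add: \<mu>_def)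
  have "norm (J (trace_t T t (v ep)) - J (trace_t T t (v \<delta>))) <= norm (J (trace_t T 0 (v ep)) - J (trace_t T 0 (v \<delta>))) +
   K * (norm (J (trace_t T 0 (dT (v ep))) - J (trace_t T 0 (dT (v \<delta>)))) +
   norm (J (wd 2 (trace_t T 0 (v ep))) - J (wd 2 (trace_t T 0 (v \<delta>)))) + sqrt T * L2norm (XT T) (%p. plate_op b c (v ep) p - plate_op b c (v \<delta>) p))"
   by (rule K[OF clamped_mild[OF cl[OF ep]] clamped_mild[OF cl[OF \<delta>]] P t])
  also have "\<dots> <= s + K * (s + s + sqrt T * (\<mu> * s))"
   unfolding s_def[symmetric]
   by (intro add_mono mult_left_mono P'[unfolded s_def, folded s_def] tri[OF e1[OF ep] e1[OF \<delta>], folded s_def]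
     tri[OF e2[OF ep] e2[OF \<delta>], folded s_def] tri[OF e3[OF ep] e3[OF \<delta>], folded s_def] K0) (use T in simp)
  also have "\<dots> = C * s" by (simp add: C_def algebra_simps)
  finally show ?thesis by (simp add: s_def)
 qed
 define w where "w ep z = v ep z - v (ep / 2) z" for ep z
 have wm: "snet A_mod (XT T) w" unfolding w_def[abs_def] by (rule snet_class_diff[OF A(2) open_XT vm snet_half[OF vm]])
 have "(%ep. L2norm (XT T) (w ep)) : A_null"
 proof (rule A_null_le)
  show "(%ep. (sqrt T * C) * (ka ep + ka (ep / 2))) : A_null" by (intro A_null_cmult A_null_add ka A_half(2))
  show "\<forall>\<^sub>F ep in at_right 0. \<bar>L2norm (XT T) (w ep)\<bar> <= (sqrt T * C) * (ka ep + ka (ep / 2))"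
  proof (rule eventually_mono[OF eventually_at_right_01])
   fix ep :: real assume "0 < ep \<and> ep <= 1"
   then have ep: "0 < ep" "ep <= 1" "0 < ep / 2" "ep / 2 <= 1" by auto
   note vv = vb[OF ep(1,2)] vb[OF ep(3,4)]
   have "L2norm (XT T) (w ep) <= sqrt T * (C * (ka ep + ka (ep / 2)))"
    unfolding w_def[abs_def]
   proof (rule L2norm_XT_le[OF T bsm_diff[OF open_XT vv]])
    show "0 <= C * (ka ep + ka (ep / 2))" using C ka0[OF ep(1,2)] ka0[OF ep(3,4)] by simp
    show "norm (J (trace_t T t (%z. v ep z - v (ep / 2) z))) <= C * (ka ep + ka (ep / 2))" if t: "t : {0<..<T}" for t
    proof -
     have t': "t : {0..T}" using t by auto
     show ?thesis unfolding J_trace_t_diff[OF T vv t'] by (rule cmp[OF ep t'])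
    qed
   qed
   then show "\<bar>L2norm (XT T) (w ep)\<bar> <= (sqrt T * C) * (ka ep + ka (ep / 2))" by (simp add: mult.assoc)
  qed
 qed
 then have wn: "snet A_null (XT T) w" by (rule L2_null_imp_sup_null[OF nX wm])
 define et where "et k = (1 / 2 :: real) ^ k" for k
 have et: "0 < et k" "et k <= 1" for k by (simp_all add: et_def power_le_one)
 have etS: "et (Suc k) = et k / 2" for k by (simp add: et_def)
 have etlim: "filterlim et (at_right 0) sequentially" unfolding et_def[abs_def] by real_asymp
 have kalim: "(%k. ka (et k)) \<longlonglongrightarrow> 0" by (rule filterlim_compose[OF A_null_tendsto[OF ka] etlim])
 obtain h where hb: "bsm (XT T) h" and hl: "uniform_limit (XT T) (%k. v (et k)) h sequentially"
 proof (rule smooth_limit[OF nX, of "%k. v (et k)"])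
  show "bsm (XT T) (v (et k))" for k by (rule vb[OF et])
  fix es :: "(real \<times> real) list" assume es: "es : lists Basis"
  obtain S where S: "S : A_null" "!!ep z. 0 < ep ==> ep <= 1 ==> z : XT T ==> cmod (pdiffs es (w ep) z) <= S ep"
   using snet_bound[OF wn es] by metis
  show "\<exists>S. summable S \<and> (\<forall>k. \<forall>z\<in>XT T. cmod (pdiffs es (v (et (Suc k))) z - pdiffs es (v (et k)) z) <= S k)"
  proof (intro exI conjI allI ballI)
   show "summable (%k. S (et k))" unfolding et_def by (rule A_null_summable[OF S(1)])
   fix k z assume z: "z : XT T"
   have "pdiffs es (w (et k)) z = pdiffs es (v (et k)) z - pdiffs es (v (et (Suc k))) z"
    unfolding w_def[abs_def] etS by (rule pdiffs_diff_on[OF open_XT vb[OF et] _ es z]) (use vb[OF et, of "Suc k"] in \<open>simp add: etS\<close>)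
   then show "cmod (pdiffs es (v (et (Suc k))) z - pdiffs es (v (et k)) z) <= S (et k)"
    using S(2)[OF et z, of k] by (simp add: norm_minus_commute)
  qed
 qed
 \<comment> \<open>\<open>cmp\<close> with second parameter \<open>et k\<close>, whose error
   disappears as \<open>k\<close> grows. The approximation by \<open>h\<close>, known so far along a
   sequence, thus holds for all \<open>ep\<close>.\<close>
 have vh: "norm (J (trace_t T t (v ep)) - J (trace_t T t h)) <= C * ka ep" if ep: "0 < ep" "ep <= 1" and t: "t : {0<..<T}" for ep t
 proof -
  have t': "t : {0..T}" using t by auto
  have "(%k. J (trace_t T t (v (et k))) - J (trace_t T t h)) \<longlonglongrightarrow> 0"
   unfolding tendsto_iff
  proof (intro allI impI)
   fix e :: real assume e: "e > 0"
   have "\<forall>\<^sub>F k in sequentially. \<forall>z\<in>XT T. dist (v (et k) z) (h z) < e / 2" 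
    using hl half_gt_zero[OF e] unfolding uniform_limit_iff by blast
   then show "\<forall>\<^sub>F k in sequentially. dist (J (trace_t T t (v (et k))) - J (trace_t T t h)) 0 < e"
   proof (rule eventually_mono)
    fix k assume k: "\<forall>z\<in>XT T. dist (v (et k) z) (h z) < e / 2"
    note tL = trace_t_L2[OF T vb[OF et] t', of k] trace_t_L2[OF T hb t']
    have "L2norm U01 (%x. trace_t T t (v (et k)) x - trace_t T t h x) <= sqrt (measure lebesgue U01) * \<bar>e / 2\<bar>"
     by (rule bounded_L2(2)[OF nice_lmeasurable[OF nice_U01] L2D(1)[OF L2_diff[OF tL]]])
     (use k XT_I[OF _ t] in \<open>force simp: bsm_slice(2)[OF T vb[OF et] t] bsm_slice(2)[OF T hb t] dist_norm less_imp_le\<close>)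
    then have "norm (J (trace_t T t (v (et k))) - J (trace_t T t h)) <= e / 2" using e by (simp add: J_norm_diff[OF tL])
    then show "dist (J (trace_t T t (v (et k))) - J (trace_t T t h)) 0 < e" using e by simp
   qed
  qed
  then have "(%k. J (trace_t T t (v (et k)))) \<longlonglongrightarrow> J (trace_t T t h)" by (rule LIM_zero_cancel)
  then have 1: "(%k. norm (J (trace_t T t (v ep)) - J (trace_t T t (v (et k))))) \<longlonglongrightarrow> norm (J (trace_t T t (v ep)) - J (trace_t T t h))"
   by (intro tendsto_intros)
  have 2: "(%k. C * (ka ep + ka (et k))) \<longlonglongrightarrow> C * (ka ep + 0)" by (intro tendsto_intros kalim)
  have "norm (J (trace_t T t (v ep)) - J (trace_t T t h)) <= C * (ka ep + 0)"
   by (rule LIMSEQ_le[OF 1 2]) (use cmp[OF ep et t'] in blast)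
  then show ?thesis by simp
 qed
 have vhm: "snet A_mod (XT T) (%ep z. v ep z - h z)" by (rule snet_class_diff[OF A(2) open_XT vm snet_const_mod[OF hb]])
 have "(%ep. L2norm (XT T) (%z. v ep z - h z)) : A_null"
 proof (rule A_null_le)
  show "(%ep. (sqrt T * C) * ka ep) : A_null" by (intro A_null_cmult ka)
  show "\<forall>\<^sub>F ep in at_right 0. \<bar>L2norm (XT T) (%z. v ep z - h z)\<bar> <= (sqrt T * C) * ka ep"
  proof (rule eventually_mono[OF eventually_at_right_01])
   fix ep :: real assume "0 < ep \<and> ep <= 1"
   then have ep: "0 < ep" "ep <= 1" by auto
   have "L2norm (XT T) (%z. v ep z - h z) <= sqrt T * (C * ka ep)"
    by (rule L2norm_XT_le[OF T bsm_diff[OF open_XT vb[OF ep] hb]])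
     (use C ka0[OF ep] vh[OF ep] in \<open>simp_all add: J_trace_t_diff[OF T vb[OF ep] hb]\<close>)
   then show "\<bar>L2norm (XT T) (%z. v ep z - h z)\<bar> <= (sqrt T * C) * ka ep" by (simp add: mult.assoc)
  qed
 qed
 then have "snet A_null (XT T) (%ep z. v ep z - h z)" by (rule L2_null_imp_sup_null[OF nX vhm])
 from snet_class_add[OF A(1) open_XT uv this] have uh: "snet A_null (XT T) (%ep z. u ep z - h z)" by simp
 have ub: "bsm (XT T) (u ep)" if "0 < ep" "ep <= 1" for ep by (rule snet_bsm[OF u that])
 \<comment> \<open>The operator is linear and maps the null net \<open>u - h\<close> to a null net.
   Subtracting it leaves the constant net \<open>plate_op b c h - gs\<close>, which is null and
   therefore zero; the initial and lateral conditions are treated in the same way.\<close>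
 have hP: "plate_op b c h z = gs z" if z: "z : XT T" for z
 proof -
  have "snet A_null (XT T) (%ep. plate_op b c (%z. u ep z - h z))" by (rule plate_op_snet[OF A(1) b_smooth c_smooth uh])
  from snet_class_diff[OF A(1) open_XT g(2) this]
  have "snet A_null (XT T) (%ep z. plate_op b c h z - gs z)"
   by (rule snet_cong[OF open_XT]) (simp add: plate_op_diff[OF c_smooth ub hb])
  from null_const_zero[OF this z] show ?thesis by simp
 qed
 have hf1: "trace_t T 0 h x = f1s x" if x: "x : U01" for x
 proof -
  from snet_class_diff[OF A(1) _ f1(2) snet_trace_t[OF T uh t0]]
  have "snet A_null U01 (%ep x. trace_t T 0 h x - f1s x)"
   by (rule snet_cong[rotated]) (simp_all add: trace_t_diff[OF T ub hb t0])
  from null_const_zero[OF this x] show ?thesis by simp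
 qed
 have hf2: "trace_t T 0 (dT h) x = f2s x" if x: "x : U01" for x
 proof -
  from snet_class_diff[OF A(1) _ f2(2) snet_trace_t[OF T snet_XT_pdiff(2)[OF uh] t0]]
  have "snet A_null U01 (%ep x. trace_t T 0 (dT h) x - f2s x)"
   by (rule snet_cong[rotated]) (simp_all add: trace_t_diff[OF T ub hb t0])
  from null_const_zero[OF this x] show ?thesis by simp
 qed
 have hlat: "trace_x T a h t = 0" "trace_x T a (dX h) t = 0" if a: "a : {0, 1}" and t: "t : {0<..<T}" for a t
 proof -
  have a': "a : {0..1}" using a by auto
  have z: "(a, s) : closure (XT T)" if "s : {0<..<T}" for s using a that T by (auto simp: closure_XT)
  note hb1 = bsm_pdiff(1)[OF hb]
  have "trace_x T a (%z. u ep z - h z) s = trace_x T a (u ep) s - trace_x T a h s" if "0 < ep" "ep <= 1" "s : {0<..<T}" for ep s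
   unfolding trace_x_def by (rule bdval_diff[OF nX ub[OF that(1,2)] hb z[OF that(3)]])
  then have "snet A_null {0<..<T} (%ep. trace_x T a h)"
   by (intro snet_cong[OF _ snet_class_diff[OF A(1) _ lat(1)[OF a] snet_trace_x[OF T uh a']]]) simp_all
  then show "trace_x T a h t = 0" by (rule null_const_zero[OF _ t])
  have "trace_x T a (dX (%z. u ep z - h z)) s = trace_x T a (dX (u ep)) s - trace_x T a (dX h) s"
   if ep: "0 < ep" "ep <= 1" and s: "s : {0<..<T}" for ep s
  proof -
   note ub1 = bsm_pdiff(1)[OF ub[OF ep]]
   have "bdval (XT T) (dX (%z. u ep z - h z)) (a, s) = bdval (XT T) (%z. dX (u ep) z - dX h z) (a, s)"
    by (rule bdval_cong[OF nX bsm_diff[OF open_XT ub1 hb1] _ z[OF s]]) (simp add: pdiff_diff_on[OF open_XT ub[OF ep] hb])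
   then show ?thesis unfolding trace_x_def using bdval_diff[OF nX ub1 hb1 z[OF s]] by simp
  qed
  then have "snet A_null {0<..<T} (%ep. trace_x T a (dX h))"
   by (intro snet_cong[OF _ snet_class_diff[OF A(1) _ lat(2)[OF a] snet_trace_x[OF T snet_XT_pdiff(1)[OF uh] a']]]) simp_all
  then show "trace_x T a (dX h) t = 0" by (rule null_const_zero[OF _ t])
 qed
 have sol: "smooth_solution T b c f1s f2s gs h"
  unfolding smooth_solution_def Let_def using hP hf1 hf2 hlat hb by (simp add: Hinf_iff_bsm[OF nX] plate_op_def)
 have hcl: "clamped T h" using hb hlat by (simp add: clamped_def)
 show thesis
 proof (rule that[OF hb sol _ uh])
  fix h' z assume h': "smooth_solution T b c f1s f2s gs h'" and z: "z : XT T"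
  have "clamped T h'" "!!z. z : XT T ==> plate_op b c h' z = gs z"
   "!!x. x : U01 ==> trace_t T 0 h' x = f1s x" "!!x. x : U01 ==> trace_t T 0 (dT h') x = f2s x"
   using h' unfolding smooth_solution_def Let_def clamped_def plate_op_def by (auto simp: Hinf_iff_bsm[OF nX])
  then show "h' z = h z" by (intro clamped_unique[OF _ hcl _ _ _ z]) (simp_all add: hP hf1 hf2)
 qed
qed

end

section \<open>Association with the weak solution\<close>

lemma L2norm_add_squared:
 assumes f: "f : L2 Om" and g: "g : L2 Om"
 shows "(L2norm Om (%z. f z + g z))\<^sup>2 <= 2 * (L2norm Om f)\<^sup>2 + 2 * (L2norm Om g)\<^sup>2"
proof -
 have sq: "(L2norm Om h)\<^sup>2 = (LINT z|lebesgue_on Om. (cmod (h z))\<^sup>2)" for h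
  unfolding L2norm_def by (intro real_sqrt_pow2 integral_nonneg_AE AE_I2) simp
 note i = L2D(2)[OF f] L2D(2)[OF g]
 have "(LINT z|lebesgue_on Om. (cmod (f z + g z))\<^sup>2) <= (LINT z|lebesgue_on Om. 2 * (cmod (f z))\<^sup>2 + 2 * (cmod (g z))\<^sup>2)"
 proof (rule integral_mono[OF L2D(2)[OF L2_add[OF f g]]])
  show "integrable (lebesgue_on Om) (%z. 2 * (cmod (f z))\<^sup>2 + 2 * (cmod (g z))\<^sup>2)"
   using i by (intro Bochner_Integration.integrable_add integrable_mult_right)
  fix z
  have "(cmod (f z + g z))\<^sup>2 <= (cmod (f z) + cmod (g z))\<^sup>2" by (intro power_mono norm_triangle_ineq) simp
  also have "\<dots> <= 2 * (cmod (f z))\<^sup>2 + 2 * (cmod (g z))\<^sup>2"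
   using zero_le_power2[of "cmod (f z) - cmod (g z)"] by (simp add: power2_eq_square algebra_simps)
  finally show "(cmod (f z + g z))\<^sup>2 <= 2 * (cmod (f z))\<^sup>2 + 2 * (cmod (g z))\<^sup>2" .
 qed
 also have "\<dots> = 2 * (LINT z|lebesgue_on Om. (cmod (f z))\<^sup>2) + 2 * (LINT z|lebesgue_on Om. (cmod (g z))\<^sup>2)"
  using i by simp
 finally show ?thesis by (simp add: sq)
qed

lemma L2ip_dist:
 assumes f: "f : L2 U01" and f': "f' : L2 U01" and v: "v : L2 U01"
 shows "cmod (L2ip f v - L2ip f' v) <= norm (J f - J f') * L2norm U01 v"
 using L2ip_bound[OF L2_diff[OF f f'] v] by (simp add: L2ip_diff_left[OF f f' v] J_norm_diff[OF f f'])

context plate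
begin

text \<open>Both solutions are mild with the same data, so the stability estimate identifies the
  classes of their continuous representatives at every time; null sets enter only on returning to
  \<open>w\<close> and \<open>w'\<close>.\<close>

lemma weak_solution_unique:
 assumes w: "weak_solution T b c f1l f2l gl w" "weak_solution T b c f1l f2l gl w'"
  and f1l: "f1l : H20" and f2l: "f2l : L2 U01" and gl: "gl : L2 (XT T)"
 shows "AE t in lebT T. AE x in lebU. w' t x = w t x"
proof -
 obtain K where Kc: "compare_const K" using mild_compare by blast
 note K0 = compareD(1)[OF Kc] and K = compareD(2)[OF Kc]
 obtain W W1 where W: "mild gl W W1" "J (W 0) = J f1l" "J (wd 2 (W 0)) = J (wd 2 f1l)" "J (W1 0) = J f2l"
  "AE t in lebT T. w t : L2 U01 \<and> J (w t) = J (W t)"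
  by (rule weak_solution_mild[OF w(1) f1l f2l gl])
 obtain W' W1' where W': "mild gl W' W1'" "J (W' 0) = J f1l" "J (wd 2 (W' 0)) = J (wd 2 f1l)" "J (W1' 0) = J f2l"
  "AE t in lebT T. w' t : L2 U01 \<and> J (w' t) = J (W' t)"
  by (rule weak_solution_mild[OF w(2) f1l f2l gl])
 have eq: "J (W t) = J (W' t)" if "t : {0..T}" for t
  using K[OF W(1) W'(1) gl gl that] by (simp add: W W' L2norm_def)
 show ?thesis
  using W(5) W'(5) AE_space
 proof eventually_elim
  fix t assume t: "w t : L2 U01 \<and> J (w t) = J (W t)" "w' t : L2 U01 \<and> J (w' t) = J (W' t)" "t : space (lebT T)"
  then have "L2norm U01 (%x. w' t x - w t x) = 0"
   using J_norm_diff[of "w' t" "w t"] eq[of t] by simp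
  from L2norm_zero_AE[OF L2_diff this] t show "AE x in lebU. w' t x = w t x" by simp
 qed
qed

text \<open>The corrected net \<open>v\<close> approaches the continuous representative
  \<open>W\<close> of \<open>w\<close> in \<open>l2\<close>, uniformly in time, by the stability
  estimate. Pairing with \<psi> and integrating over time turns this into convergence of
  distributions, and \<open>u - v\<close> contributes a null term.\<close>

theorem weak_case:
 assumes u: "snet A_mod (XT T) u"
  and lat: "!!a. a : {0, 1} ==> snet A_null {0<..<T} (%ep. trace_x T a (u ep))"
   "!!a. a : {0, 1} ==> snet A_null {0<..<T} (%ep. trace_x T a (dX (u ep)))"
  and g: "snet A_mod (XT T) ge" "snet A_null (XT T) (%ep z. plate_op b c (u ep) z - ge ep z)"
  and f1: "snet A_mod U01 f1e" "snet A_null U01 (%ep x. trace_t T 0 (u ep) x - f1e ep x)"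
  and f2: "snet A_mod U01 f2e" "snet A_null U01 (%ep x. trace_t T 0 (dT (u ep)) x - f2e ep x)"
  and f1l: "f1l : H20" and f2l: "f2l : L2 U01" and gl: "gl : L2 (XT T)"
  and lim: "((%ep. H2norm (%x. f1e ep x - f1l x)) \<longlongrightarrow> 0) (at_right 0)"
   "((%ep. L2norm U01 (%x. f2e ep x - f2l x)) \<longlongrightarrow> 0) (at_right 0)"
   "((%ep. L2norm (XT T) (%z. ge ep z - gl z)) \<longlongrightarrow> 0) (at_right 0)"
  and w: "weak_solution T b c f1l f2l gl w" and \<psi>: "\<psi> : test_fun (XT T)"
 shows "((%ep. LINT z|lebesgue_on (XT T). u ep z * \<psi> z) \<longlongrightarrow> distr_of T w \<psi>) (at_right 0)"
proof -
 have t0: "0 : {0..T}" using T by simp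
 note nX = nice_XT[OF T]
 obtain v ka where ka: "ka : A_null" and vm: "snet A_mod (XT T) v" and uv: "snet A_null (XT T) (%ep z. u ep z - v ep z)"
  and cl: "!!ep. 0 < ep ==> ep <= 1 ==> clamped T (v ep)"
  and e1: "!!ep. 0 < ep ==> ep <= 1 ==> norm (J (trace_t T 0 (v ep)) - J (f1e ep)) <= ka ep"
  and e2: "!!ep. 0 < ep ==> ep <= 1 ==> norm (J (wd 2 (trace_t T 0 (v ep))) - J (wd 2 (f1e ep))) <= ka ep"
  and e3: "!!ep. 0 < ep ==> ep <= 1 ==> norm (J (trace_t T 0 (dT (v ep))) - J (f2e ep)) <= ka ep"
  and e4: "!!ep z. 0 < ep ==> ep <= 1 ==> z : XT T ==> cmod (plate_op b c (v ep) z - ge ep z) <= ka ep"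
  by (rule clamped_approximation[OF u lat g f1 f2]) (assumption, assumption, rule that, assumption+)
 obtain W W1 where W: "mild gl W W1" "J (W 0) = J f1l" "J (wd 2 (W 0)) = J (wd 2 f1l)" "J (W1 0) = J f2l"
  "AE t in lebT T. w t : L2 U01 \<and> J (w t) = J (W t)"
  by (rule weak_solution_mild[OF w f1l f2l gl])
 obtain K where Kc: "compare_const K" using mild_compare by blast
 note K0 = compareD(1)[OF Kc] and K = compareD(2)[OF Kc]
 define \<mu> where "\<mu> = sqrt (measure lebesgue (XT T))"
 define H where "H ep = H2norm (%x. f1e ep x - f1l x)" for ep
 define G where "G ep = L2norm U01 (%x. f2e ep x - f2l x)" for ep
 define R where "R ep = L2norm (XT T) (%z. ge ep z - gl z)" for ep
 \<comment> \<open>All data errors in the shape of the stability estimate: the null errors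
   \<open>ka\<close> of the corrected net plus the assumed convergences \<open>H\<close>,
   \<open>G\<close> and \<open>R\<close>. The root of squares comes from
   \<open>L2norm_add_squared\<close>, which takes the place of the triangle inequality on the
   rectangle.\<close>
 define et where "et ep = (ka ep + H ep) + K * ((ka ep + G ep) + (ka ep + H ep) + sqrt T * sqrt (2 * (\<mu> * \<bar>ka ep\<bar>)\<^sup>2 + 2 * (R ep)\<^sup>2))" for ep
 have HL: "(H \<longlongrightarrow> 0) (at_right 0)" and GL: "(G \<longlongrightarrow> 0) (at_right 0)" and RL: "(R \<longlongrightarrow> 0) (at_right 0)"
  using lim by (simp_all add: H_def[abs_def] G_def[abs_def] R_def[abs_def])
 have "(et \<longlongrightarrow> (0 + 0) + K * ((0 + 0) + (0 + 0) + sqrt T * sqrt (2 * (\<mu> * \<bar>0\<bar>)\<^sup>2 + 2 * 0\<^sup>2))) (at_right 0)"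
  unfolding et_def[abs_def] by (intro tendsto_intros HL GL RL A_null_tendsto[OF ka])
 then have etL: "(et \<longlongrightarrow> 0) (at_right 0)" by simp
 have vb: "bsm (XT T) (v ep)" if "0 < ep" "ep <= 1" for ep by (rule snet_bsm[OF vm that])
 have etb: "norm (J (trace_t T t (v ep)) - J (W t)) <= et ep" if ep: "0 < ep" "ep <= 1" and t: "t : {0..T}" for ep t
 proof -
  have fb: "bsm U01 (f1e ep)" "bsm U01 (f2e ep)" using snet_bsm[OF f1(1) ep] snet_bsm[OF f2(1) ep] .
  note H2s = bsm_H2(1)[OF fb(1)] H20_H2[OF f1l]
  have a1: "norm (J (f1e ep) - J f1l) <= H ep"
   using norm_le_H2norm[OF H2_diff(1)[OF H2s]] by (simp add: H_def J_diff[OF bsm_L2[OF fb(1)] H20_L2[OF f1l]])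
  have a2: "norm (J (wd 2 (f1e ep)) - J (wd 2 f1l)) <= H ep"
   using norm_wd_le_H2norm[OF H2_diff(1)[OF H2s] order_refl] by (simp add: H_def H2_diff(2)[OF H2s])
  have a3: "norm (J (f2e ep) - J f2l) <= G ep" by (simp add: G_def J_norm_diff[OF bsm_L2[OF fb(2)] f2l])
  have tri: "norm (x - z) <= p + q" if "norm (x - y) <= p" "norm (y - z) <= q" for x y z :: l2 and p q
   using norm_triangle_ineq[of "x - y" "y - z"] that by simp
  have gb: "ge ep : L2 (XT T)" by (rule bsm_XT_L2[OF T snet_bsm[OF g(1) ep]])
  have Pb: "plate_op b c (v ep) : L2 (XT T)" by (intro bsm_XT_L2 T plate_op_bsm vb ep)
  have r1: "L2norm (XT T) (%z. plate_op b c (v ep) z - ge ep z) <= \<mu> * \<bar>ka ep\<bar>"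
   unfolding \<mu>_def by (rule bounded_L2(2)[OF nice_lmeasurable[OF nX] L2D(1)[OF L2_diff[OF Pb gb]] e4[OF ep]])
  have "(L2norm (XT T) (%z. plate_op b c (v ep) z - gl z))\<^sup>2 \<le>
    2 * (L2norm (XT T) (%z. plate_op b c (v ep) z - ge ep z))\<^sup>2 + 2 * (R ep)\<^sup>2"
   using L2norm_add_squared[OF L2_diff[OF Pb gb] L2_diff[OF gb gl]] by (simp add: R_def)
  also have "\<dots> <= 2 * (\<mu> * \<bar>ka ep\<bar>)\<^sup>2 + 2 * (R ep)\<^sup>2" using power_mono[OF r1 L2norm_nonneg, of 2] by simp
  finally have r: "L2norm (XT T) (%z. plate_op b c (v ep) z - gl z) <= sqrt (2 * (\<mu> * \<bar>ka ep\<bar>)\<^sup>2 + 2 * (R ep)\<^sup>2)"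
   by (rule real_le_rsqrt)
  have "norm (J (trace_t T t (v ep)) - J (W t)) <= norm (J (trace_t T 0 (v ep)) - J (W 0)) +
   K * (norm (J (trace_t T 0 (dT (v ep))) - J (W1 0)) +
   norm (J (wd 2 (trace_t T 0 (v ep))) - J (wd 2 (W 0))) + sqrt T * L2norm (XT T) (%p. plate_op b c (v ep) p - gl p))"
   by (rule K[OF clamped_mild[OF cl[OF ep]] W(1) Pb gl t])
  also have "\<dots> <= et ep" unfolding et_def W(2-4)
   by (intro add_mono mult_left_mono tri[OF e1[OF ep] a1] tri[OF e2[OF ep] a2] tri[OF e3[OF ep] a3] r K0) (use T in simp)
  finally show ?thesis .
 qed
 obtain B where B: "!!z. cmod (\<psi> z) <= B" using test_fun_bounded[OF \<psi>] by blast
 have B0: "B >= 0" by (rule order_trans[OF norm_ge_zero B[of "(0, 0)"]])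
 \<comment> \<open>\<open>L2ip\<close> conjugates its second argument, whereas distributions act
   without conjugation.\<close>
 define \<psi>c where "\<psi>c t x = cnj (\<psi> (x, t))" for t x
 have \<psi>cont: "continuous_on UNIV \<psi>" by (rule test_fun_continuous[OF \<psi>])
 have \<psi>L: "\<psi>c t : L2 U01" "L2norm U01 (\<psi>c t) <= B" for t
 proof -
  have "continuous_on U01 (%x. \<psi> (x, t))"
   by (rule continuous_on_compose2[OF \<psi>cont]) (auto intro!: continuous_intros)
  then have "continuous_on U01 (\<psi>c t)" unfolding \<psi>c_def[abs_def] by (intro continuous_intros)
  then have m: "\<psi>c t : bmeas (lebU)" by (rule continuous_imp_measurable_on_sets_lebesgue) simp
  have b: "cmod (\<psi>c t x) <= B" for x using B[of "(x, t)"] by (simp add: \<psi>c_def)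
  show "\<psi>c t : L2 U01" by (rule bounded_L2(1)[OF nice_lmeasurable[OF nice_U01] m b])
  show "L2norm U01 (\<psi>c t) <= B" using bounded_L2(2)[OF nice_lmeasurable[OF nice_U01] m b] B0 by simp
 qed
 define F where "F ep t = (LINT x|lebU. v ep (x, t) * \<psi> (x, t))" for ep t
 define Gt where "Gt t = L2ip (W t) (\<psi>c t)" for t
 have WL: "W t : L2 U01" if "t : {0..T}" for t using W(1) that by (auto simp: mild_def intro: H20_L2)
 have FG: "cmod (F ep t - Gt t) <= et ep * B" if ep: "0 < ep" "ep <= 1" and t: "t : {0<..<T}" for ep t
 proof -
  have t': "t : {0..T}" using t by auto
  have "F ep t = L2ip (trace_t T t (v ep)) (\<psi>c t)"
   unfolding F_def L2ip_def by (intro bochner_cong) (simp_all add: \<psi>c_def bsm_slice(2)[OF T vb[OF ep] t])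
  then have "cmod (F ep t - Gt t) <= norm (J (trace_t T t (v ep)) - J (W t)) * L2norm U01 (\<psi>c t)"
   unfolding Gt_def using L2ip_dist[OF trace_t_L2[OF T vb[OF ep] t'] WL[OF t'] \<psi>L(1)] by simp
  also have "\<dots> <= et ep * B"
   by (rule mult_mono[OF etb[OF ep t'] \<psi>L(2) order_trans[OF norm_ge_zero etb[OF ep t']] L2norm_nonneg])
  finally show ?thesis .
 qed
 have Fi: "integrable (lebT T) (F ep)" "(LINT z|lebesgue_on (XT T). v ep z * \<psi> z) = (LINT t|lebT T. F ep t)"
  "integrable (lebesgue_on (XT T)) (%z. v ep z * \<psi> z)" if ep: "0 < ep" "ep <= 1" for ep
 proof -
  obtain Bv where Bv: "Bv >= 0" "!!z. z : XT T ==> cmod (v ep z) <= Bv" using bsm_bound0[OF vb[OF ep]] by blast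
  have c: "continuous_on (XT T) (%z. v ep z * \<psi> z)"
   by (intro continuous_on_mult snet_continuous_on[OF vm open_XT ep] continuous_on_subset[OF \<psi>cont]) simp
  have bd: "cmod (v ep z * \<psi> z) <= Bv * B" if "z : XT T" for z
   unfolding norm_mult by (intro mult_mono Bv that B) simp_all
  show "integrable (lebT T) (F ep)" "(LINT z|lebesgue_on (XT T). v ep z * \<psi> z) = (LINT t|lebT T. F ep t)"
   unfolding F_def[abs_def] using Fubini_XT[OF c bd] by simp_all
  have XTl: "XT T : sets lebesgue" using open_XT[of T] by auto
  show "integrable (lebesgue_on (XT T)) (%z. v ep z * \<psi> z)"
   by (rule finite_measure.integrable_const_bound[OF nice_finite[OF nX] _ continuous_imp_measurable_on_sets_lebesgue[OF c XTl], of "Bv * B"])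
    (rule AE_I2, use bd in simp)
 qed
 have half: "filterlim (%k. (1 / 2) ^ k :: real) (at_right 0) sequentially" by real_asymp
 have half01: "0 < (1 / 2 :: real) ^ k" "(1 / 2 :: real) ^ k <= 1" for k by (simp_all add: power_le_one)
 \<comment> \<open>The representatives \<open>W t\<close> are arbitrary in \<open>x\<close> for each
   \<open>t\<close>; measurability of the pairing in \<open>t\<close> comes from its being the
   pointwise limit of the measurable functions \<open>F\<close>, taken along a sequence of
   parameters.\<close>
 have Gm: "Gt : bmeas (lebT T)"
 proof (rule borel_measurable_LIMSEQ_metric)
  show "F ((1 / 2) ^ k) : bmeas (lebT T)" for k
   by (rule borel_measurable_integrable[OF Fi(1)[OF half01]])
  fix t assume "t : space (lebT T)"
  then have t: "t : {0<..<T}" by simp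
  have "(%k. et ((1 / 2) ^ k) * B) \<longlonglongrightarrow> 0 * B" by (intro tendsto_intros filterlim_compose[OF etL half])
  then have l: "(%k. et ((1 / 2) ^ k) * B) \<longlonglongrightarrow> 0" by simp
  have "(%k. F ((1 / 2) ^ k) t - Gt t) \<longlonglongrightarrow> 0"
   by (rule Lim_null_comparison[OF _ l]) (rule always_eventually, rule allI, rule FG[OF half01 t])
  then show "(%k. F ((1 / 2) ^ k) t) \<longlonglongrightarrow> Gt t" by (rule LIM_zero_cancel)
 qed
 interpret FT: finite_measure "lebT T" by (rule nice_finite[OF nice_U[OF T]])
 have Gi: "integrable (lebT T) Gt"
 \<comment> \<open>Any fixed parameter serves for the majorant; \<open>ep = 1\<close> is taken, with
   the error bound \<open>et 1 * B\<close>.\<close>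
 proof (rule Bochner_Integration.integrable_bound[OF Bochner_Integration.integrable_add[OF integrable_norm[OF Fi(1)[OF zero_less_one order_refl]] FT.integrable_const[of "et 1 * B"]] Gm], rule AE_I2)
  fix t assume "t : space (lebT T)"
  then have t: "t : {0<..<T}" by simp
  have "norm (Gt t) <= norm (F 1 t) + cmod (F 1 t - Gt t)" using norm_triangle_sub[of "Gt t" "F 1 t"] by (simp add: norm_minus_commute)
  then show "norm (Gt t) <= norm (norm (F 1 t) + et 1 * B)" using FG[OF zero_less_one order_refl t] by simp
 qed
 have d: "distr_of T w \<psi> = (LINT t|lebT T. Gt t)"
 proof -
  have ae: "AE t in lebT T. (LINT x|lebU. w t x * \<psi> (x, t)) = Gt t"
   using W(5) AE_space
  proof eventually_elim
   fix t assume t: "w t : L2 U01 \<and> J (w t) = J (W t)" "t : space (lebT T)"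
   then have "W t : L2 U01" by (intro WL) auto
   then have "cmod (L2ip (w t) (\<psi>c t) - L2ip (W t) (\<psi>c t)) <= 0" using L2ip_dist[of "w t" "W t" "\<psi>c t"] t \<psi>L(1) by simp
   then show "(LINT x|lebU. w t x * \<psi> (x, t)) = Gt t" by (simp add: Gt_def L2ip_def \<psi>c_def)
  qed
  show ?thesis unfolding distr_of_def
   by (rule integral_cong_AE[OF measurable_lebesgue_on_AE[OF Gm _ ae] Gm ae]) simp
 qed
 obtain Ku where Ku: "Ku : A_null" "!!ep z. 0 < ep ==> ep <= 1 ==> z : XT T ==> cmod (u ep z - v ep z) <= Ku ep"
  using snet_bound0[OF uv] by metis
 define \<Lambda> where "\<Lambda> ep = Ku ep * B * measure lebesgue (XT T) + et ep * B * T" for ep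
 have "(\<Lambda> \<longlongrightarrow> 0 * B * measure lebesgue (XT T) + 0 * B * T) (at_right 0)"
  unfolding \<Lambda>_def[abs_def] by (intro tendsto_intros etL A_null_tendsto[OF Ku(1)])
 then have \<Lambda>: "(\<Lambda> \<longlongrightarrow> 0) (at_right 0)" by simp
 interpret FX: finite_measure "lebesgue_on (XT T)" by (rule nice_finite[OF nX])
 have XTl: "XT T : sets lebesgue" using open_XT[of T] by auto
 have "((%ep. (LINT z|lebesgue_on (XT T). u ep z * \<psi> z) - distr_of T w \<psi>) \<longlongrightarrow> 0) (at_right 0)"
 proof (rule Lim_null_comparison[OF _ \<Lambda>], rule eventually_mono[OF eventually_at_right_01])
  fix ep :: real assume "0 < ep \<and> ep <= 1"
  then have ep: "0 < ep" "ep <= 1" by auto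
  have \<psi>m: "\<psi> : bmeas (lebesgue_on (XT T))"
   by (rule continuous_imp_measurable_on_sets_lebesgue[OF continuous_on_subset[OF \<psi>cont] XTl]) simp
  have dm: "(%z. (u ep z - v ep z) * \<psi> z) : bmeas (lebesgue_on (XT T))"
   by (intro borel_measurable_times borel_measurable_diff \<psi>m snet_measurable[OF u nX ep] snet_measurable[OF vm nX ep])
  have db: "cmod ((u ep z - v ep z) * \<psi> z) <= Ku ep * B" if z: "z : XT T" for z
   unfolding norm_mult by (rule mult_mono[OF Ku(2)[OF ep z] B order_trans[OF norm_ge_zero Ku(2)[OF ep z]]]) simp
  have di: "integrable (lebesgue_on (XT T)) (%z. (u ep z - v ep z) * \<psi> z)"
   by (rule FX.integrable_const_bound[OF _ dm, of "Ku ep * B"]) (rule AE_I2, use db in simp)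
  have "(LINT z|lebesgue_on (XT T). u ep z * \<psi> z) = (LINT z|lebesgue_on (XT T). (u ep z - v ep z) * \<psi> z + v ep z * \<psi> z)"
   by (simp add: algebra_simps)
  also have "\<dots> = (LINT z|lebesgue_on (XT T). (u ep z - v ep z) * \<psi> z) + (LINT t|lebT T. F ep t)"
   unfolding Fi(2)[OF ep, symmetric] by (rule Bochner_Integration.integral_add[OF di Fi(3)[OF ep]])
  finally have "(LINT z|lebesgue_on (XT T). u ep z * \<psi> z) - distr_of T w \<psi>
    = (LINT z|lebesgue_on (XT T). (u ep z - v ep z) * \<psi> z) + (LINT t|lebT T. F ep t - Gt t)"
   by (simp add: d Bochner_Integration.integral_diff[OF Fi(1)[OF ep] Gi])
  moreover have "cmod (LINT z|lebesgue_on (XT T). (u ep z - v ep z) * \<psi> z) <= Ku ep * B * measure lebesgue (XT T)"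
  proof -
   have "cmod (LINT z|lebesgue_on (XT T). (u ep z - v ep z) * \<psi> z) <= (LINT z|lebesgue_on (XT T). cmod ((u ep z - v ep z) * \<psi> z))"
    by (rule integral_norm_bound)
   also have "\<dots> <= (LINT z|lebesgue_on (XT T). Ku ep * B)"
    by (rule integral_mono[OF integrable_norm[OF di] FX.integrable_const]) (use db in simp)
   also have "\<dots> = Ku ep * B * measure lebesgue (XT T)" using XTl by (simp add: measure_restrict_space)
   finally show ?thesis .
  qed
  moreover have "cmod (LINT t|lebT T. F ep t - Gt t) <= et ep * B * T"
  proof -
   note fi = Bochner_Integration.integrable_diff[OF Fi(1)[OF ep] Gi]
   have "cmod (LINT t|lebT T. F ep t - Gt t) <= (LINT t|lebT T. cmod (F ep t - Gt t))"
    by (rule integral_norm_bound)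
   also have "\<dots> <= (LINT t|lebT T. et ep * B)"
    by (rule integral_mono[OF integrable_norm[OF fi] FT.integrable_const]) (use FG[OF ep] in simp)
   also have "\<dots> = et ep * B * T" using T by (simp add: measure_restrict_space)
   finally show ?thesis .
  qed
  ultimately show "norm ((LINT z|lebesgue_on (XT T). u ep z * \<psi> z) - distr_of T w \<psi>) <= \<Lambda> ep"
   unfolding \<Lambda>_def using norm_triangle_ineq[of "LINT z|lebesgue_on (XT T). (u ep z - v ep z) * \<psi> z" "LINT t|lebT T. F ep t - Gt t"] by simp
 qed
 then show ?thesis by (rule LIM_zero_cancel)
qed

end

section \<open>Both claims for classes\<close>

lemma cls_null:
 "nice_dom Om ==> n : cls Om m ==> snet A_null Om (%ep z. n ep z - m ep z)"
 using colrel_sym_trans(1)[of Om m n] by (simp add: in_cls_iff colrel_iff)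

theorem proposition3p3:
  fixes T :: real
    and b g u :: "(real \<times> real) net set"
    and c f1 f2 :: "real net set"
    and bs :: "real \<times> real \<Rightarrow> complex"
    and cs :: "real \<Rightarrow> complex"
  assumes "T > 0"
    and "b \<in> Col (XT T)" and "Linf_log_type T b"
    and "c \<in> Col U01"
    and "\<exists>ce\<in>c. \<exists>c0 c1. 0 < c0 \<and> c0 < c1 \<and>
           (\<forall>\<epsilon>\<in>{0<..1}. \<forall>x\<in>U01. ce \<epsilon> x \<in> \<real> \<and> c0 \<le> Re (ce \<epsilon> x) \<and> Re (ce \<epsilon> x) \<le> c1)"
    and "f1 \<in> Col U01" and "f2 \<in> Col U01"
    and "vanishes_at 0 f1" and "vanishes_at 1 f1"
    and "g \<in> Col (XT T)"
    and "bs \<in> Hinf (XT T)" and "b = col_embed (XT T) bs"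
    and "cs \<in> Hinf U01" and "c = col_embed U01 cs"
    and "generalized_solution T b c f1 f2 g u"
  shows
    "(\<forall>f1s\<in>Hinf U01. \<forall>f2s\<in>Hinf U01. \<forall>gs\<in>Hinf (XT T).
        f1 = col_embed U01 f1s \<and> f2 = col_embed U01 f2s \<and> g = col_embed (XT T) gs \<longrightarrow>
        (\<exists>h. smooth_solution T bs cs f1s f2s gs h \<and>
             (\<forall>h'. smooth_solution T bs cs f1s f2s gs h' \<longrightarrow> (\<forall>z\<in>XT T. h' z = h z)) \<and>
             u = col_embed (XT T) h)) \<and>
     (\<forall>f1e\<in>moderate U01. \<forall>f2e\<in>moderate U01. \<forall>ge\<in>moderate (XT T).
      \<forall>f1l\<in>H20. \<forall>f2l\<in>L2 U01. \<forall>gl\<in>L2 (XT T).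
        f1 = cls U01 f1e \<and> f2 = cls U01 f2e \<and> g = cls (XT T) ge \<and>
        (\<forall>\<^sub>F \<epsilon> in at_right 0. f1e \<epsilon> \<in> H20) \<and>
        ((\<lambda>\<epsilon>. H2norm (\<lambda>x. f1e \<epsilon> x - f1l x)) \<longlongrightarrow> 0) (at_right 0) \<and>
        ((\<lambda>\<epsilon>. L2norm U01 (\<lambda>x. f2e \<epsilon> x - f2l x)) \<longlongrightarrow> 0) (at_right 0) \<and>
        ((\<lambda>\<epsilon>. L2norm (XT T) (\<lambda>z. ge \<epsilon> z - gl z)) \<longlongrightarrow> 0) (at_right 0) \<longrightarrow>
        (\<forall>w. weak_solution T bs cs f1l f2l gl w \<longrightarrow>
             (\<forall>w'. weak_solution T bs cs f1l f2l gl w' \<longrightarrow>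
                (AE t in lebesgue_on {0<..<T}. AE x in lebesgue_on U01. w' t x = w t x)) \<and>
             associated T u (distr_of T w)))"
proof -
 note T = \<open>T > 0\<close>
 note nX = nice_XT[OF T]
 have bs: "bsm (XT T) bs" using assms(11) by (simp add: Hinf_iff_bsm[OF nX])
 have cs: "bsm U01 cs" using assms(13) by (simp add: Hinf_iff_bsm[OF nice_U01])
 obtain ce c0 c1 where ce: "ce : c" "0 < c0"
  "\<forall>ep\<in>{0<..1}. \<forall>x\<in>U01. ce ep x : \<real> \<and> c0 <= Re (ce ep x) \<and> Re (ce ep x) <= c1"
  using assms(5) by blast
 have ce1: "ce : cls U01 (%_. cs)" using ce(1) assms(14) by (simp add: col_embed_def)
 obtain Cb where pl: "plate T bs cs c0 c1 Cb"
  by (rule plate_of_class[OF T bs cs ce1 ce(2)]) (use ce(3) in auto)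
 interpret plate T bs cs c0 c1 Cb by (rule pl)
 have sol: "generalized_solution T (col_embed (XT T) bs) (col_embed U01 cs) f1 f2 g u"
  using assms(15) unfolding assms(12,14) .
 obtain v where vm: "snet A_mod (XT T) v" and uv: "u = cls (XT T) v" and P: "(%ep. plate_op bs cs (v ep)) : g"
  and i1: "(%ep. trace_t T 0 (v ep)) : f1" and i2: "(%ep. trace_t T 0 (dT (v ep))) : f2"
  and lat: "!!a. a : {0, 1} ==> snet A_null {0<..<T} (%ep. trace_x T a (v ep))"
   "!!a. a : {0, 1} ==> snet A_null {0<..<T} (%ep. trace_x T a (dX (v ep)))"
  by (rule generalized_solution_nets[OF T bs cs sol]) (rule that, assumption+)
 show ?thesis
 proof (intro conjI ballI impI allI)
  fix f1s f2s gs
  assume s: "f1s : Hinf U01" "f2s : Hinf U01" "gs : Hinf (XT T)"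
   and e: "f1 = col_embed U01 f1s \<and> f2 = col_embed U01 f2s \<and> g = col_embed (XT T) gs"
  have sb: "bsm U01 f1s" "bsm U01 f2s" "bsm (XT T) gs" using s by (simp_all add: Hinf_iff_bsm[OF nX] Hinf_iff_bsm[OF nice_U01])
  have n: "snet A_null (XT T) (%ep z. plate_op bs cs (v ep) z - gs z)"
   "snet A_null U01 (%ep x. trace_t T 0 (v ep) x - f1s x)" "snet A_null U01 (%ep x. trace_t T 0 (dT (v ep)) x - f2s x)"
   using cls_null[OF nX, of _ "%_. gs"] cls_null[OF nice_U01, of _ "%_. f1s"] cls_null[OF nice_U01, of _ "%_. f2s"] P i1 i2 e
   by (simp_all add: col_embed_def)
  show "\<exists>h. smooth_solution T bs cs f1s f2s gs h \<and>
   (\<forall>h'. smooth_solution T bs cs f1s f2s gs h' --> (\<forall>z\<in>XT T. h' z = h z)) \<and> u = col_embed (XT T) h"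
  proof (rule smooth_case[OF vm lat sb(3) n(1) sb(1) n(2) sb(2) n(3)])
   fix h
   assume h: "bsm (XT T) h" "smooth_solution T bs cs f1s f2s gs h"
    "!!h' z. smooth_solution T bs cs f1s f2s gs h' ==> z : XT T ==> h' z = h z"
    "snet A_null (XT T) (%ep z. v ep z - h z)"
   have "u = col_embed (XT T) h"
    unfolding uv col_embed_def by (rule cls_eqI[OF nX]) (simp add: colrel_iff[OF nX] vm snet_const_mod[OF h(1)] h(4))
   then show ?thesis using h(2,3) by blast
  qed
 next
  fix f1e f2e ge f1l f2l gl w
  assume m: "f1e : moderate U01" "f2e : moderate U01" "ge : moderate (XT T)"
   and l: "f1l : H20" "f2l : L2 U01" "gl : L2 (XT T)"
   and e: "f1 = cls U01 f1e \<and> f2 = cls U01 f2e \<and> g = cls (XT T) ge \<and>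
    (\<forall>\<^sub>F ep in at_right 0. f1e ep : H20) \<and>
    ((%ep. H2norm (%x. f1e ep x - f1l x)) \<longlongrightarrow> 0) (at_right 0) \<and>
    ((%ep. L2norm U01 (%x. f2e ep x - f2l x)) \<longlongrightarrow> 0) (at_right 0) \<and>
    ((%ep. L2norm (XT T) (%z. ge ep z - gl z)) \<longlongrightarrow> 0) (at_right 0)"
   and w: "weak_solution T bs cs f1l f2l gl w"
  have mm: "snet A_mod U01 f1e" "snet A_mod U01 f2e" "snet A_mod (XT T) ge"
   using m by (simp_all add: moderate_iff_snet[OF nX] moderate_iff_snet[OF nice_U01])
  have n: "snet A_null (XT T) (%ep z. plate_op bs cs (v ep) z - ge ep z)"
   "snet A_null U01 (%ep x. trace_t T 0 (v ep) x - f1e ep x)" "snet A_null U01 (%ep x. trace_t T 0 (dT (v ep)) x - f2e ep x)"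
   using cls_null[OF nX, of _ ge] cls_null[OF nice_U01, of _ f1e] cls_null[OF nice_U01, of _ f2e] P i1 i2 e by simp_all
  show "AE t in lebT T. AE x in lebU. w' t x = w t x"
   if "weak_solution T bs cs f1l f2l gl w'" for w'
   by (rule weak_solution_unique[OF w that l])
  have e': "((%ep. H2norm (%x. f1e ep x - f1l x)) \<longlongrightarrow> 0) (at_right 0)"
   "((%ep. L2norm U01 (%x. f2e ep x - f2l x)) \<longlongrightarrow> 0) (at_right 0)"
   "((%ep. L2norm (XT T) (%z. ge ep z - gl z)) \<longlongrightarrow> 0) (at_right 0)"
   using e by blast+
  show "associated T u (distr_of T w)"
   unfolding associated_def
  proof (rule bexI)
   show "v : u" unfolding uv by (rule cls_self[OF nX vm])
   show "\<forall>\<psi>\<in>test_fun (XT T). ((%ep. LINT z|lebesgue_on (XT T). v ep z * \<psi> z) \<longlongrightarrow> distr_of T w \<psi>) (at_right 0)"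
    by (rule ballI) (rule weak_case[OF vm lat mm(3) n(1) mm(1) n(2) mm(2) n(3) l e' w])
  qed
 qed
qed

end
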